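(* Let $\mathbf J$ be an arbitrary non-empty subset of $\mathring{\mathbf I}$. (1) For each $x\in W_{\mathbf J}$ and $\mathbf K\subsetneq\mathbf J$, $$\Phi^\infty_{\mathbf J}(x.Z^{\mathbf K}_{\mathbf J})=\nabla_{\mathbf J}(\mathbf K,\overline{x}^{\mathbf K},z_x),$$ with a unique element $z_x\in W_{\mathbf K}$ such that $\Phi_{\mathbf J}((\overline{x}^{\mathbf K})^{-1}x)\cap\Delta_{\mathbf K+}=\Phi_{\mathbf K}(z_x)$. (2) Both $\Phi^\infty_{\mathbf J}\colon W^\infty_{\mathbf J}\to\mathfrak B^\infty_{\mathbf J}$ and $\chi_{\mathbf J}\colon\boldsymbol{\mathcal P}_{\mathbf J}\to W^\infty_{\mathbf J}$ are bijective, and $\Phi^\infty_{\mathbf J}\circ\chi_{\mathbf J}=\nabla_{\mathbf J}$ as mappings $\boldsymbol{\mathcal P}_{\mathbf J}\to\mathfrak B^\infty_{\mathbf J}$. (3) There is the orbit decomposition $$W^\infty_{\mathbf J}=\coprod_{\mathbf K\subsetneq\mathbf J}W_{\mathbf J}.Z^{\mathbf K}_{\mathbf J}.$$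
   Context: Setting. Let $l\ge1$, $\mathbf I=\{0,1,\dots,l\}$, $\mathring{\mathbf I}=\{1,\dots,l\}$, and let $A=(a_{ij})_{i,j\in\mathbf I}$ be a generalized Cartan matrix of untwisted affine type $X_l^{(1)}$ ($X=A,B,\dots,G$) such that $(a_{ij})_{i,j\in\mathring{\mathbf I}}$ is the Cartan matrix of finite type $X_l$. Let $\mathfrak g$ be the associated affine Kac-Moody Lie algebra with Cartan subalgebra $\mathfrak h$ over $\mathbb R$ (of dimension $l+2$), $\Delta\subset\mathfrak h^*\setminus\{0\}$ its root system, $\Pi=\{\alpha_i\mid i\in\mathbf I\}$ the root basis, $\Delta_\pm$ the positive/negative roots, $W=\langle s_i\mid i\in\mathbf I\rangle\subset GL(\mathfrak h^* )$ the Weyl group. Put $\mathring\Pi=\{\alpha_i\mid i\in\mathring{\mathbf I}\}$, $\mathring W=\langle s_i\mid i\in\mathring{\mathbf I}\rangle$, $\mathring\Delta=\mathring W(\mathring\Pi)$ (finite root system of type $X_l$), $\mathring\Delta_\pm=\mathring\Delta\cap\Delta_\pm$, $\theta$ its highest root, $\delta=\alpha_0+\theta$. Then $\Delta^{re}=\{m\delta+\varepsilon\mid m\in\mathbb Z,\varepsilon\in\mathring\Delta\}$, $\Delta^{im}=\{m\delta\mid m\in\mathbb Z\setminus\{0\}\}$, $\Delta^{re}_+=\Delta^{re}\cap\Delta_+$, $\Delta^{im}_+=\Delta^{im}\cap\Delta_+$. Write $\beta<0$ for $\beta\in\Delta_-$. For $\alpha\in\Delta^{re}$, $s_\alpha$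 is the reflection in $\alpha$. One has $W=\mathring W\ltimes T$ with $T$ the normal subgroup of translations; for $x\in W$, $\overline x\in\mathring W$ is the unique element with $x\in\overline xT$. Parabolic notation. For $\mathbf K\subset\mathbf J\subset\mathring{\mathbf I}$: $\mathring\Pi_{\mathbf J}=\{\alpha_j\mid j\in\mathbf J\}$, $\mathring W_{\mathbf J}=\langle s_j\mid j\in\mathbf J\rangle$, $\mathring\Delta_{\mathbf J}=\mathring W_{\mathbf J}(\mathring\Pi_{\mathbf J})$, $\mathring\Delta^{\mathbf K}_{\mathbf J\pm}=(\mathring\Delta_{\mathbf J}\setminus\mathring\Delta_{\mathbf K})\cap\mathring\Delta_\pm$, $\mathring W^{\mathbf K}_{\mathbf J}=\{w\in\mathring W_{\mathbf J}\mid w(\alpha_k)\in\Delta_+\ \forall k\in\mathbf K\}$; each $w\in\mathring W_{\mathbf J}$ is uniquely $w=w^{\mathbf K}w_{\mathbf K}$ with $w^{\mathbf K}\in\mathring W^{\mathbf K}_{\mathbf J}$, $w_{\mathbf K}\in\mathring W_{\mathbf K}$; $\overline x^{\mathbf K}$ means $(\overline x)^{\mathbf K}$. For $P\subset\mathring\Delta$, $\langle P\rangle=\{m\delta+\varepsilon\mid m\in\mathbb Z_{\ge0},\varepsilon\in P\}\cap\Delta^{re}_+$. Put $\Delta^{re}_{\mathbf J+}=\langle\mathring\Delta_{\mathbf J}\rangle$, $\Delta_{\mathbf J+}=\Delta^{re}_{\mathbf J+}\amalg\Delta^{im}_+$, and $\Delta^{\mathbf K}_{\mathbf J}(w,\pm)=\langle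 w\mathring\Delta^{\mathbf K}_{\mathbf J\pm}\rangle$ for $w\in\mathring W_{\mathbf J}$. For $\mathbf J\neq\emptyset$ let $\mathring\Delta_{\mathbf J}=\coprod_c\mathring\Delta_{\mathbf J_c}$ be the decomposition into irreducible components, $\theta_{\mathbf J_c}$ the highest root of $\mathring\Delta_{\mathbf J_c}$ relative to $\mathring\Pi_{\mathbf J_c}$, $\Pi_{\mathbf J}=\coprod_c(\mathring\Pi_{\mathbf J_c}\amalg\{\delta-\theta_{\mathbf J_c}\})$, $S_{\mathbf J}=\{s_\alpha\mid\alpha\in\Pi_{\mathbf J}\}$, $W_{\mathbf J}=\langle S_{\mathbf J}\rangle\subset W$; $W_\emptyset=\{1\}$. $(W_{\mathbf J},S_{\mathbf J})$ is a Coxeter system with length function $\ell_{\mathbf J}$, and $\overline x\in\mathring W_{\mathbf J}$ for $x\in W_{\mathbf J}$. For $y\in W_{\mathbf J}$, $\Phi_{\mathbf J}(y)=\{\beta\in\Delta_{\mathbf J+}\mid y^{-1}(\beta)<0\}$. Biconvex sets. $B\subset\Delta_{\mathbf J+}$ is biconvex in $\Delta_{\mathbf J+}$ if both $B$ and $C=\Delta_{\mathbf J+}\setminus B$ are convex, where $B$ convex means: $\beta,\gamma\in B$, $\beta+\gamma\in\Delta_{\mathbf J+}$ imply $\beta+\gamma\in B$ (and likewise for $C$). $\mathfrak B^\infty_{\mathbf J}$ is the set of infinite biconvex sets $B$ in $\Delta_{\mathbf J+}$ with $B\subset\Delta^{re}_+$. Infinite words. For $\boldsymbol s\in S_{\mathbf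 J}^{\mathbb N}$ put $z_{\boldsymbol s}(p)=\boldsymbol s(1)\cdots\boldsymbol s(p)$. $\mathcal W_{\mathbf J}^\infty$ is the set of $\boldsymbol s$ with $\ell_{\mathbf J}(z_{\boldsymbol s}(p))=p$ for all $p\in\mathbb N$. $\boldsymbol s\sim\boldsymbol s'$ means: for each $(p,q)\in\mathbb N^2$ there are $p_0\ge p$, $q_0\ge q$ with $\ell_{\mathbf J}(z_{\boldsymbol s}(p)^{-1}z_{\boldsymbol s'}(p_0))=p_0-p$ and $\ell_{\mathbf J}(z_{\boldsymbol s'}(q)^{-1}z_{\boldsymbol s}(q_0))=q_0-q$. $W^\infty_{\mathbf J}=\mathcal W^\infty_{\mathbf J}/\!\sim$. The map $\Phi^\infty_{\mathbf J}\colon W^\infty_{\mathbf J}\to\mathfrak B^\infty_{\mathbf J}$, $[\boldsymbol s]\mapsto\widetilde\Phi^\infty_{\mathbf J}(\boldsymbol s):=\bigcup_p\Phi_{\mathbf J}(z_{\boldsymbol s}(p))$, is well defined and injective. For $x\in W_{\mathbf J}$, $\boldsymbol s\in\mathcal W^\infty_{\mathbf J}$ let $\widetilde\Phi^\infty_{\mathbf J}(x,\boldsymbol s)=\{\beta\in\Delta^{re}_{\mathbf J+}\mid\exists p_0\,\forall p\ge p_0,\ (xz_{\boldsymbol s}(p))^{-1}(\beta)<0\}$. $W_{\mathbf J}$ acts on the left on $W^\infty_{\mathbf J}$ by $x.[\boldsymbol s]=[\boldsymbol s']$ whenever $\widetilde\Phi^\infty_{\mathbf J}(x,\boldsymbol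 s)=\widetilde\Phi^\infty_{\mathbf J}(\boldsymbol s')$. The maps. For $\mathbf K\subsetneq\mathbf J$, $Z^{\mathbf K}_{\mathbf J}$ is the unique element of $W^\infty_{\mathbf J}$ with $\Phi^\infty_{\mathbf J}(Z^{\mathbf K}_{\mathbf J})=\Delta^{\mathbf K}_{\mathbf J}(1,-)$ (its existence is known: it is the class of the periodic word obtained by repeating a reduced expression in $(W_{\mathbf J},S_{\mathbf J})$ of a translation $t_\lambda$, $\mu\mapsto\mu-(\mu|\lambda)\delta$ on the span of $\Pi_{\mathbf J}$, where $\lambda\in\bigoplus_{j\in\mathbf J}\mathbb Z\frac{2\alpha_j}{(\alpha_j|\alpha_j)}$ satisfies $(\alpha_j|\lambda)>0$ for $j\in\mathbf J\setminus\mathbf K$ and $(\alpha_k|\lambda)=0$ for $k\in\mathbf K$; here $(\cdot|\cdot)$ is the standard invariant form). Put $\boldsymbol{\mathcal P}_{\mathbf J}=\{(\mathbf K,u,y)\mid\mathbf K\subsetneq\mathbf J,\ u\in\mathring W^{\mathbf K}_{\mathbf J},\ y\in W_{\mathbf K}\}$, $\nabla_{\mathbf J}(\mathbf K,u,y)=\Delta^{\mathbf K}_{\mathbf J}(u,-)\amalg u\Phi_{\mathbf K}(y)$, and $\chi_{\mathbf J}(\mathbf K,u,y)=uy.Z^{\mathbf K}_{\mathbf J}$. *)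

theory Defs
  imports "HOL-Analysis.Analysis" "HOL-Combinatorics.Permutations"
begin

datatype cartan_type = Type_A | Type_B | Type_C | Type_D | Type_E | Type_F | Type_G

fun admissible_rank :: "cartan_type \<Rightarrow> nat \<Rightarrow> bool" where
  "admissible_rank Type_A l \<longleftrightarrow> l \<ge> 1"
| "admissible_rank Type_B l \<longleftrightarrow> l \<ge> 3"
| "admissible_rank Type_C l \<longleftrightarrow> l \<ge> 2"
| "admissible_rank Type_D l \<longleftrightarrow> l \<ge> 4"
| "admissible_rank Type_E l \<longleftrightarrow> l \<in> {6, 7, 8}"
| "admissible_rank Type_F l \<longleftrightarrow> l = 4"
| "admissible_rank Type_G l \<longleftrightarrow> l = 2"

text \<open>The extended Dynkin diagrams of type \<open>X\<^sub>l\<^sup>(\<^sup>1\<^sup>)\<close>, with the vertex labels of Kac,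
  \<open>Infinite dimensional Lie algebras\<close>, Table Aff 1. Each edge is listed in one of its two
  orientations; \<open>edge_weight X l i j\<close> is \<open>\<bar>a\<^sub>i\<^sub>j\<bar>\<close> for adjacent \<open>i, j\<close>.\<close>

fun affine_edges :: "cartan_type \<Rightarrow> nat \<Rightarrow> (nat \<times> nat) set" where
  "affine_edges Type_A l = {(k, k + 1) | k. k < l} \<union> {(0, l)}"
| "affine_edges Type_B l = {(k, k + 1) | k. 1 \<le> k \<and> k < l} \<union> {(0, 2)}"
| "affine_edges Type_C l = {(k, k + 1) | k. k < l}"
| "affine_edges Type_D l = {(k, k + 1) | k. 1 \<le> k \<and> k + 1 < l} \<union> {(0, 2), (l - 2, l)}"
| "affine_edges Type_E l =
    (if l = 6 then {(1, 2), (2, 3), (3, 4), (4, 5), (3, 6), (6, 0)}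
     else if l = 7 then {(k, k + 1) | k. k < 6} \<union> {(3, 7)}
     else {(k, k + 1) | k. k < 7} \<union> {(5, 8)})"
| "affine_edges Type_F l = {(k, k + 1) | k. k < 4}"
| "affine_edges Type_G l = {(k, k + 1) | k. k < 2}"

fun edge_weight :: "cartan_type \<Rightarrow> nat \<Rightarrow> nat \<Rightarrow> nat \<Rightarrow> int" where
  "edge_weight Type_A l i j = (if l = 1 then 2 else 1)"
| "edge_weight Type_B l i j = (if (i, j) = (l, l - 1) then 2 else 1)"
| "edge_weight Type_C l i j = (if (i, j) = (1, 0) \<or> (i, j) = (l - 1, l) then 2 else 1)"
| "edge_weight Type_D l i j = 1"
| "edge_weight Type_E l i j = 1"
| "edge_weight Type_F l i j = (if (i, j) = (3, 2) then 2 else 1)"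
| "edge_weight Type_G l i j = (if (i, j) = (2, 1) then 3 else 1)"

definition affine_cartan_matrix :: "cartan_type \<Rightarrow> nat \<Rightarrow> nat \<Rightarrow> nat \<Rightarrow> int" where
  "affine_cartan_matrix X l i j =
    (if i = j then 2
     else if (i, j) \<in> affine_edges X l \<or> (j, i) \<in> affine_edges X l then - edge_weight X l i j
     else 0)"

text \<open>The numbering of \<open>{1..l}\<close> is arbitrary, but \<open>0\<close> is always the affine vertex: this is what makes
  \<open>(a\<^sub>i\<^sub>j)\<close>, \<open>1 \<le> i, j \<le> l\<close>, the Cartan matrix of finite type \<open>X\<^sub>l\<close>.\<close>

definition untwisted_affine_gcm :: "cartan_type \<Rightarrow> nat \<Rightarrow> (nat \<Rightarrow> nat \<Rightarrow> int) \<Rightarrow> bool" where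
  "untwisted_affine_gcm X l A \<longleftrightarrow> admissible_rank X l \<and>
    (\<exists>\<pi>. \<pi> permutes {1..l} \<and> (\<forall>i\<le>l. \<forall>j\<le>l. A i j = affine_cartan_matrix X l (\<pi> i) (\<pi> j)))"

text \<open>The type \<open>'v\<close> plays the role of the dual Cartan subalgebra over the reals. Since it is
  finite dimensional, the simple coroots are given as linear functionals on it.\<close>

record 'v affine_datum =
  rk :: nat
  sroot :: "nat \<Rightarrow> 'v"
  scoroot :: "nat \<Rightarrow> 'v \<Rightarrow> real"

definition realization_of :: "(nat \<Rightarrow> nat \<Rightarrow> int) \<Rightarrow> 'v::real_vector affine_datum \<Rightarrow> bool" where
  "realization_of A D \<longleftrightarrow>
    dim (UNIV :: 'v set) = rk D + 2 \<and>
    inj_on (sroot D) {0..rk D} \<and> independent (sroot D ` {0..rk D}) \<and>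
    (\<forall>i\<le>rk D. linear (scoroot D i)) \<and>
    (\<forall>c :: nat \<Rightarrow> real.
      (\<forall>v. (\<Sum>i\<le>rk D. c i * scoroot D i v) = 0) \<longrightarrow> (\<forall>i\<le>rk D. c i = 0)) \<and>
    (\<forall>i\<le>rk D. \<forall>j\<le>rk D. scoroot D i (sroot D j) = of_int (A i j))"

inductive_set generated_group :: "('v \<Rightarrow> 'v) set \<Rightarrow> ('v \<Rightarrow> 'v) set" for S where
  gg_id: "id \<in> generated_group S"
| gg_mult: "s \<in> S \<Longrightarrow> w \<in> generated_group S \<Longrightarrow> s \<circ> w \<in> generated_group S"
| gg_inv: "s \<in> S \<Longrightarrow> w \<in> generated_group S \<Longrightarrow> inv s \<circ> w \<in> generated_group S"

definition word_prod :: "('v \<Rightarrow> 'v) list \<Rightarrow> 'v \<Rightarrow> 'v" where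
  "word_prod ws = foldr (\<circ>) ws id"

definition word_length :: "('v \<Rightarrow> 'v) set \<Rightarrow> ('v \<Rightarrow> 'v) \<Rightarrow> nat" where
  "word_length S x = (LEAST n. \<exists>ws. set ws \<subseteq> S \<and> length ws = n \<and> word_prod ws = x)"

definition srefl :: "'v::real_vector affine_datum \<Rightarrow> nat \<Rightarrow> 'v \<Rightarrow> 'v" where
  "srefl D i v = v - scoroot D i v *\<^sub>R sroot D i"

definition weyl :: "'v::real_vector affine_datum \<Rightarrow> ('v \<Rightarrow> 'v) set" where
  "weyl D = generated_group (srefl D ` {0..rk D})"

definition fin_weyl :: "'v::real_vector affine_datum \<Rightarrow> nat set \<Rightarrow> ('v \<Rightarrow> 'v) set" where
  "fin_weyl D J = generated_group (srefl D ` J)"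

definition fin_roots :: "'v::real_vector affine_datum \<Rightarrow> nat set \<Rightarrow> 'v set" where
  "fin_roots D J = {w (sroot D j) | w j. w \<in> fin_weyl D J \<and> j \<in> J}"

text \<open>Only meaningful if the subdiagram on \<open>J\<close> is connected and nonempty.\<close>

definition highest_root :: "'v::real_vector affine_datum \<Rightarrow> nat set \<Rightarrow> 'v" where
  "highest_root D J = (THE \<theta>. \<theta> \<in> fin_roots D J \<and>
    (\<forall>\<beta>\<in>fin_roots D J. \<exists>c :: nat \<Rightarrow> nat. \<theta> - \<beta> = (\<Sum>j\<in>J. real (c j) *\<^sub>R sroot D j)))"

definition null_root :: "'v::real_vector affine_datum \<Rightarrow> 'v" where
  "null_root D = sroot D 0 + highest_root D {1..rk D}"

definition re_roots :: "'v::real_vector affine_datum \<Rightarrow> 'v set" where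
  "re_roots D = {w (sroot D i) | w i. w \<in> weyl D \<and> i \<le> rk D}"

definition im_roots :: "'v::real_vector affine_datum \<Rightarrow> 'v set" where
  "im_roots D = {of_int m *\<^sub>R null_root D | m. m \<noteq> 0}"

text \<open>The root system of the affine Lie algebra, described without the Lie algebra: real roots are
  the Weyl conjugates of the simple roots, imaginary roots the nonzero integral multiples of the
  null root.\<close>

definition all_roots :: "'v::real_vector affine_datum \<Rightarrow> 'v set" where
  "all_roots D = re_roots D \<union> im_roots D"

definition pos_roots :: "'v::real_vector affine_datum \<Rightarrow> 'v set" where
  "pos_roots D =
    {\<beta> \<in> all_roots D. \<exists>c :: nat \<Rightarrow> nat. \<beta> = (\<Sum>i\<le>rk D. real (c i) *\<^sub>R sroot D i)}"

definition neg_roots :: "'v::real_vector affine_datum \<Rightarrow> 'v set" where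
  "neg_roots D = {\<beta> \<in> all_roots D. - \<beta> \<in> pos_roots D}"

definition re_pos_roots :: "'v::real_vector affine_datum \<Rightarrow> 'v set" where
  "re_pos_roots D = re_roots D \<inter> pos_roots D"

definition im_pos_roots :: "'v::real_vector affine_datum \<Rightarrow> 'v set" where
  "im_pos_roots D = im_roots D \<inter> pos_roots D"

text \<open>The reflection in a real root \<open>\<beta> = w(\<alpha>\<^sub>i)\<close> is \<open>w s\<^sub>i w\<^sup>-\<^sup>1\<close>, independently of \<open>w\<close> and \<open>i\<close>.\<close>

definition refl_in :: "'v::real_vector affine_datum \<Rightarrow> 'v \<Rightarrow> 'v \<Rightarrow> 'v" where
  "refl_in D \<beta> = (THE r. \<exists>w\<in>weyl D. \<exists>i\<le>rk D. \<beta> = w (sroot D i) \<and> r = w \<circ> srefl D i \<circ> inv w)"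

text \<open>The translations: on the span of the simple roots they have the form
  \<open>\<mu> \<mapsto> \<mu> - f(\<mu>) \<delta>\<close> (with \<open>f\<close> automatically linear, hence given by pairing with some \<open>\<lambda>\<close>).\<close>

definition translation_group :: "'v::real_vector affine_datum \<Rightarrow> ('v \<Rightarrow> 'v) set" where
  "translation_group D =
    {t \<in> weyl D. \<forall>\<mu> \<in> span (sroot D ` {0..rk D}). \<exists>a::real. t \<mu> = \<mu> - a *\<^sub>R null_root D}"

definition fin_part :: "'v::real_vector affine_datum \<Rightarrow> ('v \<Rightarrow> 'v) \<Rightarrow> 'v \<Rightarrow> 'v" where
  "fin_part D x = (THE w. w \<in> fin_weyl D {1..rk D} \<and> (\<exists>t\<in>translation_group D. x = w \<circ> t))"

definition fin_diff_pos :: "'v::real_vector affine_datum \<Rightarrow> nat set \<Rightarrow> nat set \<Rightarrow> 'v set" where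
  "fin_diff_pos D J K = (fin_roots D J - fin_roots D K) \<inter> pos_roots D"

definition fin_diff_neg :: "'v::real_vector affine_datum \<Rightarrow> nat set \<Rightarrow> nat set \<Rightarrow> 'v set" where
  "fin_diff_neg D J K = (fin_roots D J - fin_roots D K) \<inter> neg_roots D"

definition min_reps :: "'v::real_vector affine_datum \<Rightarrow> nat set \<Rightarrow> nat set \<Rightarrow> ('v \<Rightarrow> 'v) set" where
  "min_reps D J K = {w \<in> fin_weyl D J. \<forall>k\<in>K. w (sroot D k) \<in> pos_roots D}"

text \<open>The factor \<open>w\<^sup>K\<close> in \<open>w = w\<^sup>K w\<^sub>K\<close>.\<close>

definition min_rep ::
  "'v::real_vector affine_datum \<Rightarrow> nat set \<Rightarrow> nat set \<Rightarrow> ('v \<Rightarrow> 'v) \<Rightarrow> 'v \<Rightarrow> 'v" where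
  "min_rep D J K w = (THE u. u \<in> min_reps D J K \<and> (\<exists>v\<in>fin_weyl D K. w = u \<circ> v))"

definition affinize :: "'v::real_vector affine_datum \<Rightarrow> 'v set \<Rightarrow> 'v set" where
  "affinize D P =
    {of_nat m *\<^sub>R null_root D + \<epsilon> | (m::nat) \<epsilon>. \<epsilon> \<in> P} \<inter> re_pos_roots D"

definition par_re_pos :: "'v::real_vector affine_datum \<Rightarrow> nat set \<Rightarrow> 'v set" where
  "par_re_pos D J = affinize D (fin_roots D J)"

definition par_pos :: "'v::real_vector affine_datum \<Rightarrow> nat set \<Rightarrow> 'v set" where
  "par_pos D J = par_re_pos D J \<union> im_pos_roots D"

definition par_diff_neg ::
  "'v::real_vector affine_datum \<Rightarrow> nat set \<Rightarrow> nat set \<Rightarrow> ('v \<Rightarrow> 'v) \<Rightarrow> 'v set" where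
  "par_diff_neg D J K w = affinize D (w ` fin_diff_neg D J K)"

text \<open>Irreducible components of the finite root system on \<open>J\<close>, given by the connected components of
  the Dynkin diagram on \<open>J\<close>. The relation is reflexive on \<open>J\<close> because diagonal entries are \<open>2\<close>.\<close>

definition dynkin_rel :: "'v::real_vector affine_datum \<Rightarrow> nat set \<Rightarrow> (nat \<times> nat) set" where
  "dynkin_rel D J = {(i, j). i \<in> J \<and> j \<in> J \<and> scoroot D i (sroot D j) \<noteq> 0}"

definition dynkin_components :: "'v::real_vector affine_datum \<Rightarrow> nat set \<Rightarrow> nat set set" where
  "dynkin_components D J = J // (dynkin_rel D J)\<^sup>+"

definition par_simple_roots :: "'v::real_vector affine_datum \<Rightarrow> nat set \<Rightarrow> 'v set" where
  "par_simple_roots D J =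
    (\<Union>C\<in>dynkin_components D J. sroot D ` C \<union> {null_root D - highest_root D C})"

definition par_gens :: "'v::real_vector affine_datum \<Rightarrow> nat set \<Rightarrow> ('v \<Rightarrow> 'v) set" where
  "par_gens D J = refl_in D ` par_simple_roots D J"

definition par_weyl :: "'v::real_vector affine_datum \<Rightarrow> nat set \<Rightarrow> ('v \<Rightarrow> 'v) set" where
  "par_weyl D J = generated_group (par_gens D J)"

definition par_length :: "'v::real_vector affine_datum \<Rightarrow> nat set \<Rightarrow> ('v \<Rightarrow> 'v) \<Rightarrow> nat" where
  "par_length D J = word_length (par_gens D J)"

definition inversion_set ::
  "'v::real_vector affine_datum \<Rightarrow> nat set \<Rightarrow> ('v \<Rightarrow> 'v) \<Rightarrow> 'v set" where
  "inversion_set D J y = {\<beta> \<in> par_pos D J. inv y \<beta> \<in> neg_roots D}"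

definition root_convex :: "'v::real_vector affine_datum \<Rightarrow> nat set \<Rightarrow> 'v set \<Rightarrow> bool" where
  "root_convex D J B \<longleftrightarrow> (\<forall>\<beta>\<in>B. \<forall>\<gamma>\<in>B. \<beta> + \<gamma> \<in> par_pos D J \<longrightarrow> \<beta> + \<gamma> \<in> B)"

definition biconvex :: "'v::real_vector affine_datum \<Rightarrow> nat set \<Rightarrow> 'v set \<Rightarrow> bool" where
  "biconvex D J B \<longleftrightarrow>
    B \<subseteq> par_pos D J \<and> root_convex D J B \<and> root_convex D J (par_pos D J - B)"

definition inf_biconvex_sets :: "'v::real_vector affine_datum \<Rightarrow> nat set \<Rightarrow> 'v set set" where
  "inf_biconvex_sets D J = {B. biconvex D J B \<and> infinite B \<and> B \<subseteq> re_pos_roots D}"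

text \<open>Words are indexed from \<open>0\<close>: the letter \<open>s n\<close> is the \<open>(n + 1)\<close>-st letter, and \<open>prefix_prod s p\<close>
  is the product of the first \<open>p\<close> letters.\<close>

definition prefix_prod :: "(nat \<Rightarrow> 'v \<Rightarrow> 'v) \<Rightarrow> nat \<Rightarrow> 'v \<Rightarrow> 'v" where
  "prefix_prod s p = word_prod (map s [0..<p])"

definition inf_words :: "'v::real_vector affine_datum \<Rightarrow> nat set \<Rightarrow> (nat \<Rightarrow> 'v \<Rightarrow> 'v) set" where
  "inf_words D J =
    {s. (\<forall>n. s n \<in> par_gens D J) \<and> (\<forall>p. par_length D J (prefix_prod s p) = p)}"

definition word_equiv ::
  "'v::real_vector affine_datum \<Rightarrow> nat set \<Rightarrow> ((nat \<Rightarrow> 'v \<Rightarrow> 'v) \<times> (nat \<Rightarrow> 'v \<Rightarrow> 'v)) set" where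
  "word_equiv D J = {(s, s'). s \<in> inf_words D J \<and> s' \<in> inf_words D J \<and>
    (\<forall>p q. \<exists>p\<^sub>0\<ge>p. \<exists>q\<^sub>0\<ge>q.
      par_length D J (inv (prefix_prod s p) \<circ> prefix_prod s' p\<^sub>0) = p\<^sub>0 - p \<and>
      par_length D J (inv (prefix_prod s' q) \<circ> prefix_prod s q\<^sub>0) = q\<^sub>0 - q)}"

definition inf_weyl :: "'v::real_vector affine_datum \<Rightarrow> nat set \<Rightarrow> (nat \<Rightarrow> 'v \<Rightarrow> 'v) set set" where
  "inf_weyl D J = inf_words D J // word_equiv D J"

definition word_inversions ::
  "'v::real_vector affine_datum \<Rightarrow> nat set \<Rightarrow> (nat \<Rightarrow> 'v \<Rightarrow> 'v) \<Rightarrow> 'v set" where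
  "word_inversions D J s = (\<Union>p. inversion_set D J (prefix_prod s p))"

text \<open>The common value of \<open>word_inversions D J\<close> on the equivalence class \<open>Y\<close>.\<close>

definition inf_inversions ::
  "'v::real_vector affine_datum \<Rightarrow> nat set \<Rightarrow> (nat \<Rightarrow> 'v \<Rightarrow> 'v) set \<Rightarrow> 'v set" where
  "inf_inversions D J Y = the_elem (word_inversions D J ` Y)"

definition shifted_inversions ::
  "'v::real_vector affine_datum \<Rightarrow> nat set \<Rightarrow> ('v \<Rightarrow> 'v) \<Rightarrow> (nat \<Rightarrow> 'v \<Rightarrow> 'v) \<Rightarrow> 'v set" where
  "shifted_inversions D J x s =
    {\<beta> \<in> par_re_pos D J. \<exists>p\<^sub>0. \<forall>p\<ge>p\<^sub>0. inv (x \<circ> prefix_prod s p) \<beta> \<in> neg_roots D}"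

definition inf_action ::
  "'v::real_vector affine_datum \<Rightarrow> nat set \<Rightarrow> ('v \<Rightarrow> 'v) \<Rightarrow>
    (nat \<Rightarrow> 'v \<Rightarrow> 'v) set \<Rightarrow> (nat \<Rightarrow> 'v \<Rightarrow> 'v) set" where
  "inf_action D J x Y = (THE Y'. Y' \<in> inf_weyl D J \<and>
    (\<exists>s\<in>Y. \<exists>s'\<in>Y'. shifted_inversions D J x s = word_inversions D J s'))"

definition Z_elem ::
  "'v::real_vector affine_datum \<Rightarrow> nat set \<Rightarrow> nat set \<Rightarrow> (nat \<Rightarrow> 'v \<Rightarrow> 'v) set" where
  "Z_elem D J K = (THE Z. Z \<in> inf_weyl D J \<and> inf_inversions D J Z = par_diff_neg D J K id)"

definition param_set ::
  "'v::real_vector affine_datum \<Rightarrow> nat set \<Rightarrow> (nat set \<times> ('v \<Rightarrow> 'v) \<times> ('v \<Rightarrow> 'v)) set" where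
  "param_set D J = {(K, u, y). K \<subset> J \<and> u \<in> min_reps D J K \<and> y \<in> par_weyl D K}"

fun nabla ::
  "'v::real_vector affine_datum \<Rightarrow> nat set \<Rightarrow> nat set \<times> ('v \<Rightarrow> 'v) \<times> ('v \<Rightarrow> 'v) \<Rightarrow> 'v set" where
  "nabla D J (K, u, y) = par_diff_neg D J K u \<union> u ` inversion_set D K y"

fun chi ::
  "'v::real_vector affine_datum \<Rightarrow> nat set \<Rightarrow> nat set \<times> ('v \<Rightarrow> 'v) \<times> ('v \<Rightarrow> 'v) \<Rightarrow>
    (nat \<Rightarrow> 'v \<Rightarrow> 'v) set" where
  "chi D J (K, u, y) = inf_action D J (u \<circ> y) (Z_elem D J K)"

definition Z_orbit ::
  "'v::real_vector affine_datum \<Rightarrow> nat set \<Rightarrow> nat set \<Rightarrow> (nat \<Rightarrow> 'v \<Rightarrow> 'v) set set" where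
  "Z_orbit D J K = {inf_action D J x (Z_elem D J K) | x. x \<in> par_weyl D J}"

end

theory Submission
  imports Defs
begin

text \<open>A set \<open>B\<close> of positive real roots that is biconvex avoids all imaginary roots, so for each finite
  root \<open>\<epsilon>\<close> the roots \<open>m\<delta> + \<epsilon>\<close> lying in \<open>B\<close> form an initial segment of the string of \<open>\<epsilon>\<close>. The finite
  roots whose string is not contained in \<open>B\<close> form a parabolic subset, hence a Weyl translate by some
  \<open>u\<close> of the positive roots together with the roots of a parabolic subsystem \<open>K\<close>. What remains of
  \<open>B\<close> is \<open>u\<close> applied to a finite biconvex set for \<open>K\<close>, that is, to the inversion set of a unique
  \<open>y\<close>. This gives \<open>B = \<nabla>(K, u, y)\<close>. Conversely \<open>\<nabla>(K, u, y)\<close> is the increasing union of the inversion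
  sets of \<open>u y t\<^sup>n\<close> for large \<open>n\<close>, where \<open>t\<close> is a translation that is dominant for \<open>J\<close> with
  stabilizer \<open>K\<close>, so it comes from an infinite reduced word.\<close>

section \<open>Marks of the affine diagrams\<close>

text \<open>Every root has nonzero height, so each sign condition becomes an inequality for a linear
  functional: \<Phi>(y) consists of the positive roots on which ht composed with the inverse of y is
  negative, and \<nabla>(K, u, y) is the lexicographic version with two functionals. Biconvexity,
  injectivity and limits of inversion sets thereby become linear algebra. The types A to G enter
  only through marks and dual marks, the signs of the matrix entries and the connectedness of the
  finite diagram; a locale abstracts these facts. One obstacle is that the components of J share a
  single null root, so the affine system of J is not a disjoint union of irreducible affine systems.
  Inductions therefore run over heights in \<open>PA J\<close>, with the simple roots \<alpha> j and
  \<delta> - \<theta> for the highest root \<theta> of each component. A second obstacle is that the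
  element attached to K and the action on infinite words are definite descriptions: they can be
  evaluated only after the inversion sets concerned have been recognised as some \<nabla> and
  realised by a word.\<close>

text \<open>\<open>a\<close> are the marks, the coefficients of the null root, and \<open>c\<close>
  the dual marks. Symmetry of \<open>c i * M i j * a j\<close> says that the ratios
  \<open>c i / a i\<close> symmetrise the matrix; they become half the squared lengths of the simple
  roots. Thus \<open>c i \<le> a i\<close> says that \<alpha> 0 is long, and with
  \<open>a 0 = c 0 = 1\<close> and integrality this is the form in which untwistedness is
  used.\<close>

definition affine_marks ::
  "nat \<Rightarrow> (nat \<Rightarrow> nat \<Rightarrow> int) \<Rightarrow> (nat \<Rightarrow> int) \<Rightarrow> (nat \<Rightarrow> int) \<Rightarrow> bool" where
  "affine_marks l M a c \<longleftrightarrow> a 0 = 1 \<and> c 0 = 1 \<and>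
    (\<forall>i\<le>l. 0 < c i \<and> c i \<le> a i \<and> (\<Sum>j\<le>l. M i j * a j) = 0) \<and>
    (\<forall>i\<le>l. \<forall>j\<le>l. c i * M i j * a j = c j * M j i * a i)"

lemma affine_cartan_matrix_diag [simp]: "affine_cartan_matrix X l i i = 2"
  by (simp add: affine_cartan_matrix_def)

lemma affine_cartan_matrix_nonpos: "i \<noteq> j \<Longrightarrow> affine_cartan_matrix X l i j \<le> 0"
proof -
  have "0 \<le> edge_weight X l i j" by (cases X) auto
  then show "i \<noteq> j \<Longrightarrow> ?thesis" by (simp add: affine_cartan_matrix_def)
qed

text \<open>A row of an affine Cartan matrix is supported on a vertex and its neighbours, so row
  sums of unbounded length reduce to a few explicit entries.\<close>

lemma row_sum_restrict:
  fixes f :: "nat \<Rightarrow> int"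
  assumes "S \<subseteq> {..l}" "\<And>j. j \<le> l \<Longrightarrow> j \<notin> S \<Longrightarrow> f j = 0"
  shows "(\<Sum>j\<le>l. f j) = sum f S"
  using assms by (intro sum.mono_neutral_right) auto

text \<open>Symmetrisability is a condition on unordered pairs that is trivial off the edges, so one
  orientation of each edge suffices.\<close>

lemma affine_marks_I:
  assumes "a 0 = 1" "c 0 = 1"
    and "\<And>i. i \<le> l \<Longrightarrow> 0 < c i \<and> c i \<le> a i"
    and "\<And>i. i \<le> l \<Longrightarrow> (\<Sum>j\<le>l. affine_cartan_matrix X l i j * a j) = 0"
    and edge: "\<And>i j. (i, j) \<in> affine_edges X l \<Longrightarrow>
      c i * edge_weight X l i j * a j = c j * edge_weight X l j i * a i"
  shows "affine_marks l (affine_cartan_matrix X l) a c"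
proof -
  have "c i * affine_cartan_matrix X l i j * a j = c j * affine_cartan_matrix X l j i * a i" for i j
    using edge[of i j] edge[of j i] unfolding affine_cartan_matrix_def by auto
  with assms show ?thesis by (simp add: affine_marks_def)
qed

lemma marks_A:
  assumes "l \<ge> 1"
  shows "affine_marks l (affine_cartan_matrix Type_A l) (\<lambda>_. 1) (\<lambda>_. 1)"
proof -
  have row: "(\<Sum>j\<le>l. affine_cartan_matrix Type_A l i j) = 0" if i: "i \<le> l" for i
  proof -
    consider "l = 1" | "l \<ge> 2" "i = 0" | "l \<ge> 2" "i = l" | "i > 0" "i < l"
      using i assms by linarith
    then show ?thesis
    proof cases
      case 1
      then have "i = 0 \<or> i = 1" using i by auto
      with 1 show ?thesis by (auto simp: affine_cartan_matrix_def)
    next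
      case 2
      then show ?thesis
        by (subst row_sum_restrict[where S = "{0, 1, l}"]) (auto simp: affine_cartan_matrix_def)
    next
      case 3
      then show ?thesis
        by (subst row_sum_restrict[where S = "{0, l - 1, l}"]) (auto simp: affine_cartan_matrix_def)
    next
      case 4
      then obtain k where "i = Suc k" by (cases i) auto
      with 4 show ?thesis using assms
        by (subst row_sum_restrict[where S = "{k, Suc k, Suc (Suc k)}"]) (auto simp: affine_cartan_matrix_def)
    qed
  qed
  then show ?thesis by (intro affine_marks_I) auto
qed

text \<open>In the types with two root lengths the dual mark is the mark divided, at short vertices,
  by the ratio of squared lengths; here only vertex \<open>l\<close> is short. The row cases
  separate the ends of the diagram from its interior, where \<open>i = Suc k\<close> avoids
  truncated subtraction.\<close>

lemma marks_B:
  assumes "l \<ge> 3"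
  shows "affine_marks l (affine_cartan_matrix Type_B l) (\<lambda>i. if i \<le> 1 then 1 else 2)
    (\<lambda>i. if i \<le> 1 \<or> i = l then 1 else 2)" (is "affine_marks l ?M ?a ?c")
proof -
  have row: "(\<Sum>j\<le>l. ?M i j * ?a j) = 0" if i: "i \<le> l" for i
  proof -
    consider "i = 0" | "i = 1" | "i = 2" "l = 3" | "i = 2" "l > 3" | "i > 2" "i < l" | "i = l"
      using i assms by linarith
    then show ?thesis
    proof cases
      case 1
      then show ?thesis using assms
        by (subst row_sum_restrict[where S = "{0, 2}"]) (auto simp: affine_cartan_matrix_def)
    next
      case 2
      then show ?thesis using assms
        by (subst row_sum_restrict[where S = "{1, 2}"]) (auto simp: affine_cartan_matrix_def)
    next
      case 3
      then show ?thesis using assms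
        by (subst row_sum_restrict[where S = "{0, 1, 2, 3}"]) (auto simp: affine_cartan_matrix_def)
    next
      case 4
      then show ?thesis using assms
        by (subst row_sum_restrict[where S = "{0, 1, 2, 3}"]) (auto simp: affine_cartan_matrix_def)
    next
      case 5
      then obtain k where "i = Suc k" by (cases i) auto
      with 5 show ?thesis using assms
        by (subst row_sum_restrict[where S = "{k, Suc k, Suc (Suc k)}"]) (auto simp: affine_cartan_matrix_def)
    next
      case 6
      then show ?thesis using assms
        by (subst row_sum_restrict[where S = "{l - 1, l}"]) (auto simp: affine_cartan_matrix_def)
    qed
  qed
  with assms show ?thesis by (intro affine_marks_I) auto
qed

text \<open>The two end vertices are the long ones, so the interior marks 2 are halved in the dual
  marks.\<close>

lemma marks_C:
  assumes "l \<ge> 2"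
  shows "affine_marks l (affine_cartan_matrix Type_C l) (\<lambda>i. if i = 0 \<or> i = l then 1 else 2)
    (\<lambda>_. 1)" (is "affine_marks l ?M ?a ?c")
proof -
  have row: "(\<Sum>j\<le>l. ?M i j * ?a j) = 0" if i: "i \<le> l" for i
  proof -
    consider "i = 0" | "i > 0" "i < l" | "i = l"
      using i assms by linarith
    then show ?thesis
    proof cases
      case 1
      then show ?thesis using assms
        by (subst row_sum_restrict[where S = "{0, 1}"]) (auto simp: affine_cartan_matrix_def)
    next
      case 2
      then obtain k where "i = Suc k" by (cases i) auto
      with 2 show ?thesis using assms
        by (subst row_sum_restrict[where S = "{k, Suc k, Suc (Suc k)}"]) (auto simp: affine_cartan_matrix_def)
    next
      case 3
      then show ?thesis using assms
        by (subst row_sum_restrict[where S = "{l - 1, l}"]) (auto simp: affine_cartan_matrix_def)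
    qed
  qed
  with assms show ?thesis by (intro affine_marks_I) auto
qed

lemma marks_D:
  assumes "l \<ge> 4"
  shows "affine_marks l (affine_cartan_matrix Type_D l) (\<lambda>i. if i \<le> 1 \<or> i \<ge> l - 1 then 1 else 2)
    (\<lambda>i. if i \<le> 1 \<or> i \<ge> l - 1 then 1 else 2)" (is "affine_marks l ?M ?a ?c")
proof -
  have row: "(\<Sum>j\<le>l. ?M i j * ?a j) = 0" if i: "i \<le> l" for i
  proof -
    consider "i = 0" | "i = 1" | "i = 2" "l = 4" | "i = 2" "l > 4" | "i = l - 2" "l > 4"
      | "i > 2" "i < l - 2" | "i = l - 1" | "i = l"
      using i assms by linarith
    then show ?thesis
    proof cases
      case 1
      then show ?thesis using assms
        by (subst row_sum_restrict[where S = "{0, 2}"]) (auto simp: affine_cartan_matrix_def)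
    next
      case 2
      then show ?thesis using assms
        by (subst row_sum_restrict[where S = "{1, 2}"]) (auto simp: affine_cartan_matrix_def)
    next
      case 3
      then show ?thesis using assms
        by (subst row_sum_restrict[where S = "{0, 1, 2, 3, 4}"]) (auto simp: affine_cartan_matrix_def)
    next
      case 4
      then show ?thesis using assms
        by (subst row_sum_restrict[where S = "{0, 1, 2, 3}"]) (auto simp: affine_cartan_matrix_def)
    next
      case 5
      \<comment> \<open>Writing \<open>l = k + 5\<close> turns the neighbours l - 3, l - 1 and l of
        the branch vertex l - 2 into sums.\<close>
      define k where "k = l - 5"
      with 5 have "l = k + 5" "i = k + 3" by auto
      then show ?thesis
        by (subst row_sum_restrict[where S = "{k + 2, k + 3, k + 4, k + 5}"]) (auto simp: affine_cartan_matrix_def)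
    next
      case 6
      then obtain k where "i = Suc k" by (cases i) auto
      with 6 show ?thesis using assms
        by (subst row_sum_restrict[where S = "{k, Suc k, Suc (Suc k)}"]) (auto simp: affine_cartan_matrix_def)
    next
      case 7
      then show ?thesis using assms
        by (subst row_sum_restrict[where S = "{l - 2, l - 1}"]) (auto simp: affine_cartan_matrix_def)
    next
      case 8
      then show ?thesis using assms
        by (subst row_sum_restrict[where S = "{l - 2, l}"]) (auto simp: affine_cartan_matrix_def)
    qed
  qed
  with assms show ?thesis by (intro affine_marks_I) auto
qed


text \<open>The matrices of type E are symmetric, so marks and dual marks coincide. The lists are
  the classical coefficients of the null root in the given labelling, and the finitely many rows are
  evaluated.\<close>

lemma marks_E6:
  "affine_marks 6 (affine_cartan_matrix Type_E 6) (\<lambda>i. [1, 1, 2, 3, 2, 1, 2] ! i) (\<lambda>i. [1, 1, 2, 3, 2, 1, 2] ! i)"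
  (is "affine_marks 6 ?M ?a ?c")
proof -
  have S: "{..6} = {0, 1, 2, 3, 4, 5, 6 :: nat}" by auto
  have row: "(\<Sum>j\<le>6. ?M i j * ?a j) = 0 \<and> 0 < ?c i \<and> ?c i \<le> ?a i" if i: "i \<le> 6" for i
  proof -
    have "i \<in> {0, 1, 2, 3, 4, 5, 6}" using i by auto
    then show ?thesis unfolding S
      by (elim insertE emptyE) (simp_all add: affine_cartan_matrix_def)
  qed
  have "?M i j = ?M j i" for i j
    by (auto simp: affine_cartan_matrix_def)
  with row show ?thesis by (simp add: affine_marks_def)
qed

lemma marks_E7:
  "affine_marks 7 (affine_cartan_matrix Type_E 7) (\<lambda>i. [1, 2, 3, 4, 3, 2, 1, 2] ! i) (\<lambda>i. [1, 2, 3, 4, 3, 2, 1, 2] ! i)"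
  (is "affine_marks 7 ?M ?a ?c")
proof -
  have S: "{..7} = {0, 1, 2, 3, 4, 5, 6, 7 :: nat}" by auto
  have row: "(\<Sum>j\<le>7. ?M i j * ?a j) = 0 \<and> 0 < ?c i \<and> ?c i \<le> ?a i" if i: "i \<le> 7" for i
  proof -
    have "i \<in> {0, 1, 2, 3, 4, 5, 6, 7}" using i by auto
    then show ?thesis unfolding S
      by (elim insertE emptyE) (simp_all add: affine_cartan_matrix_def)
  qed
  have "?M i j = ?M j i" for i j
    by (auto simp: affine_cartan_matrix_def)
  with row show ?thesis by (simp add: affine_marks_def)
qed

lemma marks_E8:
  "affine_marks 8 (affine_cartan_matrix Type_E 8) (\<lambda>i. [1, 2, 3, 4, 5, 6, 4, 2, 3] ! i) (\<lambda>i. [1, 2, 3, 4, 5, 6, 4, 2, 3] ! i)"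
  (is "affine_marks 8 ?M ?a ?c")
proof -
  have S: "{..8} = {0, 1, 2, 3, 4, 5, 6, 7, 8 :: nat}" by auto
  have row: "(\<Sum>j\<le>8. ?M i j * ?a j) = 0 \<and> 0 < ?c i \<and> ?c i \<le> ?a i" if i: "i \<le> 8" for i
  proof -
    have "i \<in> {0, 1, 2, 3, 4, 5, 6, 7, 8}" using i by auto
    then show ?thesis unfolding S
      by (elim insertE emptyE) (simp_all add: affine_cartan_matrix_def)
  qed
  have "?M i j = ?M j i" for i j
    by (auto simp: affine_cartan_matrix_def)
  with row show ?thesis by (simp add: affine_marks_def)
qed

text \<open>Vertices 3 and 4 are short with squared length ratio 2, so exactly their marks are
  halved in the second list.\<close>

lemma marks_F:
  "affine_marks 4 (affine_cartan_matrix Type_F 4) (\<lambda>i. [1, 2, 3, 4, 2] ! i) (\<lambda>i. [1, 2, 3, 2, 1] ! i)"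
  (is "affine_marks 4 ?M ?a ?c")
proof -
  have S: "{..4} = {0, 1, 2, 3, 4 :: nat}" by auto
  have row: "(\<Sum>j\<le>4. ?M i j * ?a j) = 0 \<and> 0 < ?c i \<and> ?c i \<le> ?a i" if i: "i \<le> 4" for i
  proof -
    have "i \<in> {0, 1, 2, 3, 4}" using i by auto
    then show ?thesis unfolding S
      by (elim insertE emptyE) (simp_all add: affine_cartan_matrix_def)
  qed
  have "?c i * ?M i j * ?a j = ?c j * ?M j i * ?a i" if "i \<le> 4" "j \<le> 4" for i j
    using that by (auto simp: affine_cartan_matrix_def less_Suc_eq numeral_eq_Suc)
  with row show ?thesis by (simp add: affine_marks_def)
qed

text \<open>Vertex 2 is short with squared length ratio 3, which turns its mark 3 into the dual mark
  1.\<close>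

lemma marks_G:
  "affine_marks 2 (affine_cartan_matrix Type_G 2) (\<lambda>i. [1, 2, 3] ! i) (\<lambda>i. [1, 2, 1] ! i)"
  (is "affine_marks 2 ?M ?a ?c")
proof -
  have S: "{..2} = {0, 1, 2 :: nat}" by auto
  have row: "(\<Sum>j\<le>2. ?M i j * ?a j) = 0 \<and> 0 < ?c i \<and> ?c i \<le> ?a i" if i: "i \<le> 2" for i
  proof -
    have "i \<in> {0, 1, 2}" using i by auto
    then show ?thesis unfolding S
      by (elim insertE emptyE) (simp_all add: affine_cartan_matrix_def)
  qed
  have "?c i * ?M i j * ?a j = ?c j * ?M j i * ?a i" if "i \<le> 2" "j \<le> 2" for i j
    using that by (auto simp: affine_cartan_matrix_def less_Suc_eq numeral_eq_Suc)
  with row show ?thesis by (simp add: affine_marks_def)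
qed


lemma affine_marks_exist:
  assumes "admissible_rank X l"
  shows "\<exists>a c. affine_marks l (affine_cartan_matrix X l) a c"
proof (cases X)
  case Type_A
  then show ?thesis using marks_A[of l] assms by (simp only: admissible_rank.simps) blast
next
  case Type_B
  then show ?thesis using marks_B[of l] assms by (simp only: admissible_rank.simps) blast
next
  case Type_C
  then show ?thesis using marks_C[of l] assms by (simp only: admissible_rank.simps) blast
next
  case Type_D
  then show ?thesis using marks_D[of l] assms by (simp only: admissible_rank.simps) blast
next
  case Type_E
  then have "l = 6 \<or> l = 7 \<or> l = 8" using assms by simp
  with Type_E show ?thesis using marks_E6 marks_E7 marks_E8 by blast
next
  case Type_F
  then show ?thesis using marks_F assms by (simp only: admissible_rank.simps) blast
next
  case Type_G
  then show ?thesis using marks_G assms by (simp only: admissible_rank.simps) blast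
qed

text \<open>Each finite diagram grows as a tree from vertex 1: a later vertex is attached to its
  predecessor, except possibly the last vertex in types D and E. This gives connectedness by
  induction on labels.\<close>

lemma affine_edges_parent:
  assumes "admissible_rank X l" "2 \<le> k" "k \<le> l"
  shows "\<exists>j\<ge>1. j < k \<and> (j, k) \<in> affine_edges X l"
proof -
  obtain m where m: "k = Suc m" "1 \<le> m" using assms(2) by (cases k) auto
  show ?thesis
  proof (cases "k < l \<or> X \<notin> {Type_D, Type_E}")
    case True
    then have "(m, Suc m) \<in> affine_edges X l"
      using assms m by (cases X) (simp_all, linarith)
    with m show ?thesis by blast
  next
    case False
    \<comment> \<open>The last vertex hangs on l - 2 in type D, on 5 in E8, and on 3 in E6 and
      E7.\<close>
    define j where "j = (if X = Type_D then l - 2 else if l = 8 then 5 else 3)"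
    have "1 \<le> j \<and> j < k \<and> (j, k) \<in> affine_edges X l"
    proof (cases "X = Type_D")
      case True
      then show ?thesis using False assms by (simp add: j_def)
    next
      case not_D: False
      with False have "X = Type_E" "k = l" using assms by auto
      moreover have "l = 6 \<or> l = 7 \<or> l = 8" using assms calculation by simp
      ultimately show ?thesis by (elim disjE) (simp_all add: j_def)
    qed
    then show ?thesis by blast
  qed
qed

lemma affine_cartan_matrix_neq_0:
  assumes "(i, j) \<in> affine_edges X l"
  shows "affine_cartan_matrix X l i j \<noteq> 0" "affine_cartan_matrix X l j i \<noteq> 0"
proof -
  have "edge_weight X l i j \<noteq> 0" for i j by (cases X) simp_all
  with assms show "affine_cartan_matrix X l i j \<noteq> 0" "affine_cartan_matrix X l j i \<noteq> 0"
    unfolding affine_cartan_matrix_def by simp_all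
qed

text \<open>If no edge left \<open>S\<close>, membership in \<open>S\<close> would agree along every
  edge of the tree, hence with membership of vertex 1 everywhere.\<close>

lemma affine_cartan_matrix_connected:
  assumes "admissible_rank X l" "S \<subseteq> {1..l}" "S \<noteq> {}" "S \<noteq> {1..l}"
  shows "\<exists>i\<in>{1..l} - S. \<exists>j\<in>S. affine_cartan_matrix X l i j \<noteq> 0"
proof (rule ccontr)
  assume no: "\<not> ?thesis"
  have "k \<in> S \<longleftrightarrow> 1 \<in> S" if "1 \<le> k" "k \<le> l" for k
    using that
  proof (induction k rule: less_induct)
    case (less k)
    show ?case
    proof (cases "k = 1")
      case False
      then obtain j where j: "1 \<le> j" "j < k" "(j, k) \<in> affine_edges X l"
        using affine_edges_parent[OF assms(1), of k] less.prems by auto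
      have "j \<in> S \<longleftrightarrow> 1 \<in> S" using less.IH[OF j(2) j(1)] j less.prems by linarith
      moreover have "j \<in> {1..l}" "k \<in> {1..l}" using j less.prems by auto
      then have "k \<in> S \<longleftrightarrow> j \<in> S"
        using no affine_cartan_matrix_neq_0[OF j(3)] by blast
      ultimately show ?thesis by simp
    qed simp
  qed
  then have "(\<forall>k\<in>{1..l}. k \<in> S) \<or> (\<forall>k\<in>{1..l}. k \<notin> S)" by (meson atLeastAtMost_iff)
  then show False using assms by blast
qed

section \<open>Finite root systems\<close>

lemma generated_group_base: "s \<in> S \<Longrightarrow> s \<in> generated_group S"
  using gg_mult[OF _ gg_id, of s S] by simp

lemma generated_group_comp:
  assumes "x \<in> generated_group S" "y \<in> generated_group S"
  shows "x \<circ> y \<in> generated_group S"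
  using assms
  by (induction rule: generated_group.induct) (auto simp: o_assoc[symmetric] intro: generated_group.intros)

lemma generated_group_inv:
  assumes "\<And>s. s \<in> S \<Longrightarrow> bij s" "w \<in> generated_group S"
  shows "bij w" "inv w \<in> generated_group S"
proof -
  have "bij w \<and> inv w \<in> generated_group S"
    using assms(2)
  proof induction
    case gg_id
    then show ?case by (auto intro: generated_group.gg_id simp flip: id_def)
  next
    case (gg_mult s w)
    have "inv s \<in> generated_group S"
      using generated_group.gg_inv[OF gg_mult(1) generated_group.gg_id] by simp
    moreover have "inv (s \<circ> w) = inv w \<circ> inv s"
      using gg_mult assms(1)[of s] by (intro o_inv_distrib) auto
    ultimately show ?case using gg_mult assms(1)[of s]
      by (metis bij_comp generated_group_comp)
  next
    case (gg_inv s w)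
    then have s: "bij s" "bij (inv s)" "inv (inv s) \<in> generated_group S"
      using assms(1)[of s] by (simp_all add: bij_imp_bij_inv inv_inv_eq generated_group_base)
    then have "inv (inv s \<circ> w) = inv w \<circ> inv (inv s)" using gg_inv by (intro o_inv_distrib) auto
    with s gg_inv show ?case
      by (metis bij_comp generated_group_comp)
  qed
  then show "bij w" "inv w \<in> generated_group S" by auto
qed

lemma generated_group_subset:
  assumes "\<And>s. s \<in> T \<Longrightarrow> bij s" "S \<subseteq> generated_group T"
  shows "generated_group S \<subseteq> generated_group T"
proof
  fix w assume "w \<in> generated_group S"
  then show "w \<in> generated_group T"
  proof induction
    case gg_id
    then show ?case by (rule generated_group.gg_id)
  next
    case (gg_mult s w)
    then show ?case using assms(2) by (metis generated_group_comp subsetD)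
  next
    case (gg_inv s w)
    then have "inv s \<in> generated_group T"
      using assms(2) generated_group_inv(2)[OF assms(1), of T s] by blast
    with gg_inv show ?case by (metis generated_group_comp)
  qed
qed

lemma exists_max_image:
  fixes f :: "'a \<Rightarrow> 'b::linorder"
  assumes "finite U" "U \<noteq> {}"
  shows "\<exists>x\<in>U. \<forall>y\<in>U. f y \<le> f x"
proof -
  have "Max (f ` U) \<in> f ` U" using assms by (intro Max_in) auto
  then obtain x where "x \<in> U" "f x = Max (f ` U)" by auto
  with assms show ?thesis by (metis Max_ge finite_imageI imageI)
qed

text \<open>\<open>b\<close> is an invariant form on the whole space, \<open>cf i\<close> a linear
  extension of the i-th simple root coordinate, and \<open>mk\<close> are the marks.
  \<open>b_coroot\<close> holds for every vector, so \<open>srefl\<close> is an orthogonal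
  reflection also off the root span. Positivity is confined to the finite part because the null root
  is isotropic. Untwistedness enters through \<open>mk_0\<close>, \<open>mk_dual\<close> and
  \<open>root_0_long\<close>.\<close>

locale affine_roots =
  fixes D :: "'v::real_vector affine_datum"
    and b :: "'v \<Rightarrow> 'v \<Rightarrow> real" and cf :: "nat \<Rightarrow> 'v \<Rightarrow> real" and mk :: "nat \<Rightarrow> int"
  assumes rank_pos: "1 \<le> rk D"
    and b_bilinear: "bilinear b" and b_sym: "b u v = b v u"
    and cf_linear: "i \<le> rk D \<Longrightarrow> linear (cf i)"
    and cf_root: "i \<le> rk D \<Longrightarrow> j \<le> rk D \<Longrightarrow> cf i (sroot D j) = (if i = j then 1 else 0)"
    and b_coroot: "i \<le> rk D \<Longrightarrow> 2 * b (sroot D i) v = b (sroot D i) (sroot D i) * scoroot D i v"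
    and root_norm: "i \<le> rk D \<Longrightarrow> 0 < b (sroot D i) (sroot D i)"
    and cartan_int: "i \<le> rk D \<Longrightarrow> j \<le> rk D \<Longrightarrow> scoroot D i (sroot D j) \<in> \<int>"
    and cartan_nonpos: "i \<le> rk D \<Longrightarrow> j \<le> rk D \<Longrightarrow> i \<noteq> j \<Longrightarrow> scoroot D i (sroot D j) \<le> 0"
    and pos_def: "v \<in> span (sroot D ` {1..rk D}) \<Longrightarrow> v \<noteq> 0 \<Longrightarrow> 0 < b v v"
    and mk_0: "mk 0 = 1" and mk_pos: "i \<le> rk D \<Longrightarrow> 0 < mk i"
    and mk_null: "i \<le> rk D \<Longrightarrow> b (\<Sum>j\<le>rk D. of_int (mk j) *\<^sub>R sroot D j) (sroot D i) = 0"
    and mk_dual: "i \<le> rk D \<Longrightarrow>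
      of_int (mk i) * b (sroot D i) (sroot D i) / b (sroot D 0) (sroot D 0) \<in> \<int>"
    and root_0_long: "i \<le> rk D \<Longrightarrow> b (sroot D i) (sroot D i) \<le> b (sroot D 0) (sroot D 0)"
    and diagram_connected: "S \<subseteq> {1..rk D} \<Longrightarrow> S \<noteq> {} \<Longrightarrow> S \<noteq> {1..rk D} \<Longrightarrow>
      \<exists>i\<in>{1..rk D} - S. \<exists>j\<in>S. b (sroot D i) (sroot D j) \<noteq> 0"
begin

abbreviation \<alpha> :: "nat \<Rightarrow> 'v" where "\<alpha> \<equiv> sroot D"
abbreviation I :: "nat set" where "I \<equiv> {1..rk D}"
abbreviation R :: "nat set \<Rightarrow> 'v set" where "R \<equiv> fin_roots D"

lemmas b_simps = bilinear_ladd[OF b_bilinear] bilinear_radd[OF b_bilinear]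
  bilinear_lmul[OF b_bilinear] bilinear_rmul[OF b_bilinear]
  bilinear_lneg[OF b_bilinear] bilinear_rneg[OF b_bilinear]
  bilinear_lsub[OF b_bilinear] bilinear_rsub[OF b_bilinear]
  bilinear_lzero[OF b_bilinear] bilinear_rzero[OF b_bilinear]

lemma b_sum_left: "b (\<Sum>i\<in>S. f i) v = (\<Sum>i\<in>S. b (f i) v)"
  using b_bilinear linear_sum[of "\<lambda>u. b u v" f S] by (simp add: bilinear_def)

lemma b_sum_right: "b v (\<Sum>i\<in>S. f i) = (\<Sum>i\<in>S. b v (f i))"
  using b_bilinear by (simp add: bilinear_def linear_sum)

lemma cf_simps:
  assumes "i \<le> rk D"
  shows "cf i (u + v) = cf i u + cf i v" "cf i (u - v) = cf i u - cf i v"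
    "cf i (- u) = - cf i u" "cf i (r *\<^sub>R u) = r * cf i u" "cf i 0 = 0"
    "cf i (\<Sum>x\<in>S. f x) = (\<Sum>x\<in>S. cf i (f x))"
  using cf_linear[OF assms]
  by (auto simp: linear_add linear_diff linear_neg linear_scale linear_0 linear_sum)

lemma root_norm_neq_0 [simp]: "i \<le> rk D \<Longrightarrow> b (\<alpha> i) (\<alpha> i) \<noteq> 0"
  using root_norm[of i] by simp

lemma simple_b_nonpos: "i \<le> rk D \<Longrightarrow> j \<le> rk D \<Longrightarrow> i \<noteq> j \<Longrightarrow> b (\<alpha> i) (\<alpha> j) \<le> 0"
  using b_coroot[of i "\<alpha> j"] cartan_nonpos[of i j] root_norm[of i]
  by (smt (verit) mult_nonneg_nonpos)

lemma coroot_eq: "i \<le> rk D \<Longrightarrow> scoroot D i v = 2 * b (\<alpha> i) v / b (\<alpha> i) (\<alpha> i)"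
  using b_coroot[of i v] root_norm[of i] by (simp add: field_simps)

lemma span_expand:
  assumes "v \<in> span (\<alpha> ` S)" "S \<subseteq> {..rk D}"
  shows "v = (\<Sum>j\<in>S. cf j v *\<^sub>R \<alpha> j)"
    and "\<And>i. i \<le> rk D \<Longrightarrow> i \<notin> S \<Longrightarrow> cf i v = 0"
proof -
  have fin: "finite S" using assms(2) finite_subset by blast
  have "linear (\<lambda>v. \<Sum>j\<in>S. cf j v *\<^sub>R \<alpha> j)"
    using assms(2)
    by (intro linear_compose_sum ballI linearI) (auto simp: cf_simps subset_iff scaleR_add_left)
  then show "v = (\<Sum>j\<in>S. cf j v *\<^sub>R \<alpha> j)"
  proof (rule linear_eq_on[OF linear_ident _ assms(1)])
    fix x assume "x \<in> \<alpha> ` S"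
    then obtain k where k: "k \<in> S" "x = \<alpha> k" by auto
    have "(\<Sum>j\<in>S. cf j (\<alpha> k) *\<^sub>R \<alpha> j) = (\<Sum>j\<in>S. if j = k then \<alpha> k else 0)"
      using assms(2) k by (intro sum.cong) (auto simp: cf_root subset_iff)
    with k fin show "x = (\<Sum>j\<in>S. cf j x *\<^sub>R \<alpha> j)" by simp
  qed
  show "cf i v = 0" if "i \<le> rk D" "i \<notin> S" for i
    using assms(1)
  proof (induction rule: span_induct)
    case base
    show ?case using that by (auto simp: subspace_def cf_simps)
  next
    case (step x)
    with that assms(2) show ?case by (auto simp: cf_root)
  qed
qed

lemma b_expand_left:
  assumes "v \<in> span (\<alpha> ` S)" "S \<subseteq> {..rk D}"
  shows "b v w = (\<Sum>j\<in>S. cf j v * b (\<alpha> j) w)"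
  by (subst span_expand(1)[OF assms]) (simp add: b_sum_left b_simps)

lemma span_zero_iff:
  assumes "v \<in> span (\<alpha> ` S)" "S \<subseteq> {..rk D}"
  shows "v = 0 \<longleftrightarrow> (\<forall>j\<in>S. cf j v = 0)"
proof
  show "v = 0 \<Longrightarrow> \<forall>j\<in>S. cf j v = 0" using assms by (auto simp: cf_simps)
  show "\<forall>j\<in>S. cf j v = 0 \<Longrightarrow> v = 0"
    by (subst span_expand(1)[OF assms]) simp
qed

lemma simple_in_span: "i \<in> S \<Longrightarrow> \<alpha> i \<in> span (\<alpha> ` S)"
  by (intro span_base) auto

lemma span_simple_mono: "S \<subseteq> T \<Longrightarrow> v \<in> span (\<alpha> ` S) \<Longrightarrow> v \<in> span (\<alpha> ` T)"
  using span_mono[of "\<alpha> ` S" "\<alpha> ` T"] by auto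

lemma pos_semidef: "v \<in> span (\<alpha> ` I) \<Longrightarrow> 0 \<le> b v v"
  using pos_def[of v] by (cases "v = 0") (auto simp: b_simps)

definition ht :: "'v \<Rightarrow> real" where "ht v = (\<Sum>i\<le>rk D. cf i v)"

lemma ht_simps:
  "ht (u + v) = ht u + ht v" "ht (u - v) = ht u - ht v" "ht (- u) = - ht u"
  "ht (r *\<^sub>R u) = r * ht u" "ht 0 = 0"
  by (auto simp: ht_def cf_simps sum.distrib sum_subtractf sum_negf sum_distrib_left)

lemma ht_simple [simp]: "i \<le> rk D \<Longrightarrow> ht (\<alpha> i) = 1"
  by (simp add: ht_def cf_root)

lemma ht_span:
  assumes "v \<in> span (\<alpha> ` S)" "S \<subseteq> {..rk D}"
  shows "ht v = (\<Sum>j\<in>S. cf j v)"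
  unfolding ht_def using assms span_expand(2)[OF assms]
  by (intro sum.mono_neutral_right) auto

definition refl :: "'v \<Rightarrow> 'v \<Rightarrow> 'v" where
  "refl \<gamma> v = v - (2 * b \<gamma> v / b \<gamma> \<gamma>) *\<^sub>R \<gamma>"

lemma srefl_eq: "i \<le> rk D \<Longrightarrow> srefl D i = refl (\<alpha> i)"
  by (auto simp: fun_eq_iff srefl_def refl_def coroot_eq)

lemma refl_self: "b \<gamma> \<gamma> \<noteq> 0 \<Longrightarrow> refl \<gamma> \<gamma> = - \<gamma>"
  by (simp add: refl_def scaleR_2)

lemma refl_refl: "b \<gamma> \<gamma> \<noteq> 0 \<Longrightarrow> refl \<gamma> (refl \<gamma> v) = v"
  by (simp add: refl_def b_simps field_simps)

lemma refl_minus: "refl (- \<gamma>) = refl \<gamma>"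
  by (simp add: fun_eq_iff refl_def b_simps)

lemma refl_b: "b \<gamma> \<gamma> \<noteq> 0 \<Longrightarrow> b (refl \<gamma> u) (refl \<gamma> v) = b u v"
  by (simp add: refl_def b_simps b_sym[of \<gamma> u] b_sym[of u v] field_simps)

lemma refl_linear: "linear (refl \<gamma>)"
  by (rule linearI) (simp_all add: refl_def b_simps algebra_simps add_divide_distrib)

lemma refl_span: "\<gamma> \<in> span X \<Longrightarrow> v \<in> span X \<Longrightarrow> refl \<gamma> v \<in> span X"
  unfolding refl_def by (intro span_diff span_scale)

text \<open>This arithmetic description of the finite root system makes the sign coherence of roots and
  the identification of \<open>\<delta> - \<alpha>\<^sub>0\<close> as a root independent of the type: an element of the root lattice
  whose dual \<open>2v/(v|v)\<close> lies in the coroot lattice, the two conditions on its coordinates, is a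
  Weyl conjugate of a simple root.\<close>

definition lroot :: "'v \<Rightarrow> bool" where
  "lroot v \<longleftrightarrow> v \<in> span (\<alpha> ` I) \<and> v \<noteq> 0 \<and>
    (\<forall>j\<in>I. cf j v \<in> \<int> \<and> cf j v * b (\<alpha> j) (\<alpha> j) / b v v \<in> \<int>)"

lemma I_subset: "I \<subseteq> {..rk D}" by auto

lemma lroot_norm: "lroot v \<Longrightarrow> 0 < b v v"
  unfolding lroot_def using pos_def by blast

lemma lroot_simple: "i \<in> I \<Longrightarrow> lroot (\<alpha> i)"
  using root_norm[of i] by (auto simp: lroot_def cf_root simple_in_span b_simps)

lemma lroot_minus: "lroot v \<Longrightarrow> lroot (- v)"
  by (auto simp: lroot_def cf_simps b_simps span_neg)

text \<open>The coroot of \<open>u\<close> is a combination of simple coroots whose coefficients are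
  the integers in the second clause of \<open>lroot\<close>, and simple coroots take integral values
  on the root lattice.\<close>

lemma lroot_cartan_int:
  assumes "lroot u" "lroot v"
  shows "2 * b u v / b u u \<in> \<int>"
proof -
  have u: "u \<in> span (\<alpha> ` I)" and v: "v \<in> span (\<alpha> ` I)" using assms by (auto simp: lroot_def)
  have crt: "scoroot D j v \<in> \<int>" if "j \<in> I" for j
  proof -
    have "scoroot D j v = (\<Sum>i\<in>I. cf i v * scoroot D j (\<alpha> i))"
    proof -
      have "2 * b v (\<alpha> j) / b (\<alpha> j) (\<alpha> j) = (\<Sum>i\<in>I. cf i v * (2 * b (\<alpha> i) (\<alpha> j) / b (\<alpha> j) (\<alpha> j)))"
        unfolding b_expand_left[OF v I_subset, of "\<alpha> j"] sum_distrib_left sum_divide_distrib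
        by (intro sum.cong) auto
      then show ?thesis using that by (simp add: coroot_eq b_sym)
    qed
    also have "\<dots> \<in> \<int>"
      using that assms by (intro Ints_sum Ints_mult cartan_int) (auto simp: lroot_def)
    finally show ?thesis .
  qed
  have "2 * b u v / b u u = (\<Sum>j\<in>I. (cf j u * b (\<alpha> j) (\<alpha> j) / b u u) * scoroot D j v)"
    unfolding b_expand_left[OF u I_subset, of v] sum_distrib_left sum_divide_distrib
    by (intro sum.cong) (auto simp: coroot_eq)
  also have "\<dots> \<in> \<int>"
    using crt assms by (intro Ints_sum Ints_mult) (auto simp: lroot_def)
  finally show ?thesis .
qed

text \<open>The reflection subtracts an integral multiple of \<open>u\<close> from \<open>v\<close>
  and, since the norm of \<open>v\<close> is unchanged, an integral multiple of the coroot of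
  \<open>u\<close> from the coroot of \<open>v\<close>. Both lattice conditions survive.\<close>

lemma lroot_refl:
  assumes "lroot u" "lroot v"
  shows "lroot (refl u v)"
proof -
  have u0: "b u u \<noteq> 0" and v0: "b v v \<noteq> 0" using assms lroot_norm by force+
  have "refl u v \<noteq> 0"
    using refl_b[OF u0, of v v] v0 by (auto simp: b_simps)
  moreover have "cf j (refl u v) \<in> \<int>" if "j \<in> I" for j
  proof -
    have "cf j (refl u v) = cf j v - (2 * b u v / b u u) * cf j u"
      using that by (simp add: refl_def cf_simps)
    moreover have "\<dots> \<in> \<int>"
      using that assms by (intro Ints_diff Ints_mult lroot_cartan_int) (auto simp: lroot_def)
    ultimately show ?thesis by simp
  qed
  moreover have "cf j (refl u v) * b (\<alpha> j) (\<alpha> j) / b (refl u v) (refl u v) \<in> \<int>" if "j \<in> I" for j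
  proof -
    have "cf j (refl u v) * b (\<alpha> j) (\<alpha> j) / b v v
      = cf j v * b (\<alpha> j) (\<alpha> j) / b v v
        - (2 * b v u / b v v) * (cf j u * b (\<alpha> j) (\<alpha> j) / b u u)"
      using that by (simp add: refl_def cf_simps b_sym[of u v] algebra_simps diff_divide_distrib)
    moreover have "\<dots> \<in> \<int>"
      using that assms by (intro Ints_diff Ints_mult lroot_cartan_int) (auto simp: lroot_def)
    ultimately show ?thesis using refl_b[OF u0, of v v] by simp
  qed
  ultimately show ?thesis
    using assms by (auto simp: lroot_def refl_span)
qed

text \<open>Adding one simple term changes the norm by a cross term and a square; after division by
  \<open>b v v\<close> both are built from coordinates, dual coordinates and Cartan integers. The
  integrality makes every nonzero part of \<open>v\<close> at least as long as
  \<open>v\<close>.\<close>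

lemma lroot_part_norm:
  assumes "lroot v" "S \<subseteq> I"
  shows "b (\<Sum>j\<in>S. cf j v *\<^sub>R \<alpha> j) (\<Sum>j\<in>S. cf j v *\<^sub>R \<alpha> j) / b v v \<in> \<int>"
proof -
  have "finite S" using assms(2) finite_subset by blast
  then show ?thesis using assms(2)
  proof (induction rule: finite_induct)
    case (insert i S)
    let ?w = "\<Sum>j\<in>S. cf j v *\<^sub>R \<alpha> j" and ?k = "cf i v"
    have i: "i \<in> I" using insert by auto
    have "b ?w ?w / b v v + ?k * (\<Sum>j\<in>S. (cf j v * b (\<alpha> j) (\<alpha> j) / b v v) * scoroot D j (\<alpha> i))
        + ?k * (?k * b (\<alpha> i) (\<alpha> i) / b v v) \<in> \<int>"
      using insert.prems insert.IH assms(1) i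
      by (intro Ints_add Ints_mult Ints_sum cartan_int) (auto simp: lroot_def)
    moreover have "(\<Sum>j\<in>S. (cf j v * b (\<alpha> j) (\<alpha> j) / b v v) * scoroot D j (\<alpha> i))
        = 2 * b ?w (\<alpha> i) / b v v"
    proof -
      have "(cf j v * b (\<alpha> j) (\<alpha> j) / b v v) * scoroot D j (\<alpha> i)
          = 2 * b (cf j v *\<^sub>R \<alpha> j) (\<alpha> i) / b v v" if "j \<in> S" for j
      proof -
        have "j \<le> rk D" using insert.prems that by auto
        then show ?thesis using root_norm[of j] by (simp add: coroot_eq b_simps)
      qed
      then show ?thesis
        unfolding b_sum_left sum_distrib_left sum_divide_distrib by (intro sum.cong) auto
    qed
    moreover have "(\<Sum>j\<in>insert i S. cf j v *\<^sub>R \<alpha> j) = ?w + ?k *\<^sub>R \<alpha> i"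
      using insert.hyps by simp
    moreover have "b (?w + ?k *\<^sub>R \<alpha> i) (?w + ?k *\<^sub>R \<alpha> i)
        = b ?w ?w + ?k * (2 * b ?w (\<alpha> i)) + ?k * (?k * b (\<alpha> i) (\<alpha> i))"
      by (simp add: b_simps b_sym[of "\<alpha> i" ?w] algebra_simps)
    ultimately show ?case
      by (simp add: add_divide_distrib)
  next
    case empty
    then show ?case by (simp add: b_simps)
  qed
qed

text \<open>Split \<open>v\<close> into its positive and negative parts. They pair nonnegatively,
  because distinct simple roots pair nonpositively, and each nonzero part is at least as long as
  \<open>v\<close>. Two nonzero parts would make the norm of \<open>v\<close> at least twice
  itself.\<close>

lemma lroot_sign:
  assumes "lroot v"
  shows "(\<forall>j\<in>I. 0 \<le> cf j v) \<or> (\<forall>j\<in>I. cf j v \<le> 0)"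
proof (rule ccontr)
  assume neg: "\<not> ?thesis"
  have v: "v \<in> span (\<alpha> ` I)" using assms by (auto simp: lroot_def)
  define P where "P = {j\<in>I. 0 < cf j v}"
  define N where "N = {j\<in>I. \<not> 0 < cf j v}"
  define part where "part S = (\<Sum>j\<in>S. cf j v *\<^sub>R \<alpha> j)" for S
  have part_span: "part S \<in> span (\<alpha> ` I)" if "S \<subseteq> I" for S
    unfolding part_def using that by (intro span_sum span_scale simple_in_span) auto
  have cf_part: "cf i (part S) = (if i \<in> S then cf i v else 0)" if "S \<subseteq> I" "i \<in> I" for i S
  proof -
    have "cf i (part S) = (\<Sum>j\<in>S. if j = i then cf i v else 0)"
      unfolding part_def using that by (auto simp: cf_simps cf_root subset_iff intro!: sum.cong)
    then show ?thesis using that finite_subset[of S I] by simp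
  qed
  have large: "b v v \<le> b (part S) (part S)" if S: "S \<subseteq> I" "i \<in> S" "cf i v \<noteq> 0" for i S
  proof -
    have "part S \<noteq> 0"
      using cf_part[OF S(1), of i] S by (auto simp: cf_simps)
    then have "0 < b (part S) (part S) / b v v"
      using pos_def[OF part_span[OF S(1)]] lroot_norm[OF assms] by simp
    moreover have "b (part S) (part S) / b v v \<in> \<int>"
      unfolding part_def by (rule lroot_part_norm[OF assms S(1)])
    ultimately have "1 \<le> b (part S) (part S) / b v v"
      by (auto elim!: Ints_cases)
    then show ?thesis using lroot_norm[OF assms] by (simp add: field_simps)
  qed
  have PN: "P \<subseteq> I" "N \<subseteq> I" "finite P" "finite N" "P \<inter> N = {}" "P \<union> N = I"
    by (auto simp: P_def N_def)
  have "v = part P + part N"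
    unfolding part_def using span_expand(1)[OF v I_subset] sum.union_disjoint[OF PN(3-5)] PN(6) by metis
  then have "b v v = b (part P) (part P) + b (part N) (part N) + 2 * b (part P) (part N)"
    using b_sym[of "part P" "part N"] by (simp add: b_simps)
  moreover have "0 \<le> b (part P) (part N)"
  proof -
    have "0 \<le> b (cf i v *\<^sub>R \<alpha> i) (cf j v *\<^sub>R \<alpha> j)" if "i \<in> P" "j \<in> N" for i j
    proof -
      have "b (\<alpha> i) (\<alpha> j) \<le> 0" "0 < cf i v" "cf j v \<le> 0"
        using that by (auto simp: P_def N_def intro!: simple_b_nonpos)
      then show ?thesis
        by (simp add: b_simps mult_nonpos_nonpos mult_nonneg_nonpos)
    qed
    then show ?thesis
      unfolding part_def b_sum_left b_sum_right by (intro sum_nonneg) auto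
  qed
  moreover obtain i j where "i \<in> I" "\<not> cf i v \<le> 0" "j \<in> I" "\<not> 0 \<le> cf j v"
    using neg by blast
  then have "i \<in> P" "j \<in> N" "cf i v \<noteq> 0" "cf j v \<noteq> 0"
    by (auto simp: P_def N_def)
  then have "b v v \<le> b (part P) (part P)" "b v v \<le> b (part N) (part N)"
    using large PN by blast+
  ultimately show False using lroot_norm[OF assms] by linarith
qed

lemma lroot_ht_Ints: "lroot v \<Longrightarrow> ht v \<in> \<int>"
  using ht_span[OF _ I_subset, of v] by (auto simp: lroot_def intro!: Ints_sum)

lemma lroot_ht_pos_iff:
  assumes "lroot v"
  shows "0 < ht v \<longleftrightarrow> (\<forall>j\<in>I. 0 \<le> cf j v)" "ht v < 0 \<longleftrightarrow> (\<forall>j\<in>I. cf j v \<le> 0)" "ht v \<noteq> 0"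
proof -
  have v: "v \<in> span (\<alpha> ` I)" "v \<noteq> 0" using assms by (auto simp: lroot_def)
  then obtain i where i: "i \<in> I" "cf i v \<noteq> 0"
    using span_zero_iff[OF v(1) I_subset] by blast
  have ht: "ht v = (\<Sum>j\<in>I. cf j v)" by (rule ht_span[OF v(1) I_subset])
  have "0 < ht v" if "\<forall>j\<in>I. 0 \<le> cf j v"
    unfolding ht using that i by (intro sum_pos2[of I i]) (auto simp: less_le)
  moreover have "ht v < 0" if "\<forall>j\<in>I. cf j v \<le> 0"
  proof -
    have "0 < (\<Sum>j\<in>I. - cf j v)"
      using that i by (intro sum_pos2[of I i]) (auto simp: less_le)
    then show ?thesis unfolding ht by (simp add: sum_negf)
  qed
  ultimately show "0 < ht v \<longleftrightarrow> (\<forall>j\<in>I. 0 \<le> cf j v)" "ht v < 0 \<longleftrightarrow> (\<forall>j\<in>I. cf j v \<le> 0)" "ht v \<noteq> 0"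
    using lroot_sign[OF assms] by force+
qed

text \<open>The root lattice makes \<open>k\<close> an integer and the coroot lattice makes
  \<open>1 / k\<close> one; this is reducedness of the root system.\<close>

lemma lroot_simple_multiple:
  assumes "lroot (k *\<^sub>R \<alpha> i)" "i \<in> I" "0 < k"
  shows "k = 1"
proof -
  have "k \<in> \<int>" "k * b (\<alpha> i) (\<alpha> i) / (k * (k * b (\<alpha> i) (\<alpha> i))) \<in> \<int>"
    using assms by (auto simp: lroot_def b_simps cf_simps cf_root dest!: bspec[of _ _ i])
  then have "k \<in> \<int>" "1 / k \<in> \<int>" using assms root_norm[of i] by auto
  then obtain m n :: int where "k = of_int m" "1 / k = of_int n" by (metis Ints_cases)
  then have "of_int (n * m) = (1 :: real)" using assms(3) by (simp add: field_simps)
  then have "n * m = 1" using of_int_eq_1_iff by blast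
  then show ?thesis using \<open>k = of_int m\<close> assms(3) by (auto simp: zmult_eq_1_iff)
qed

lemma exists_acute_simple:
  assumes "v \<in> span (\<alpha> ` S)" "S \<subseteq> I" "v \<noteq> 0" "\<forall>j\<in>I. 0 \<le> cf j v"
  shows "\<exists>i\<in>S. 0 < b v (\<alpha> i)"
proof (rule ccontr)
  assume no: "\<not> ?thesis"
  have "b v v = (\<Sum>j\<in>S. cf j v * b (\<alpha> j) v)"
    by (rule b_expand_left[OF assms(1) subset_trans[OF assms(2) I_subset]])
  also have "\<dots> \<le> 0"
  proof (intro sum_nonpos mult_nonneg_nonpos)
    fix j assume "j \<in> S"
    then show "0 \<le> cf j v" "b (\<alpha> j) v \<le> 0"
      using no assms(2,4) by (auto simp: b_sym[of "\<alpha> j" v] not_less)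
  qed
  finally show False using pos_def assms span_simple_mono[OF assms(2,1)] by force
qed

text \<open>Simple reflections are involutions, so inverse generators give no extra case.\<close>

lemma fin_weyl_induct [consumes 2, case_names id step]:
  assumes "w \<in> fin_weyl D J" "J \<subseteq> {..rk D}" "P id"
    and "\<And>j w. j \<in> J \<Longrightarrow> w \<in> fin_weyl D J \<Longrightarrow> P w \<Longrightarrow> P (refl (\<alpha> j) \<circ> w)"
  shows "P w"
proof -
  have j: "srefl D j = refl (\<alpha> j)" "inv (refl (\<alpha> j)) = refl (\<alpha> j)" if "j \<in> J" for j
  proof -
    have "j \<le> rk D" using that assms(2) by auto
    then have "b (\<alpha> j) (\<alpha> j) \<noteq> 0" using root_norm[of j] by simp
    then show "inv (refl (\<alpha> j)) = refl (\<alpha> j)" 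
      by (intro inv_equality refl_refl)
    show "srefl D j = refl (\<alpha> j)" using \<open>j \<le> rk D\<close> by (rule srefl_eq)
  qed
  show ?thesis using assms(1) unfolding fin_weyl_def
  proof (induction rule: generated_group.induct)
    case gg_id
    then show ?case by (rule assms(3))
  next
    case (gg_mult s w)
    then obtain i where "i \<in> J" "s = refl (\<alpha> i)" using j by auto
    with gg_mult assms(4)[of i w] show ?case by (simp only: fin_weyl_def)
  next
    case (gg_inv s w)
    then obtain i where "i \<in> J" "inv s = refl (\<alpha> i)" using j by auto
    with gg_inv assms(4)[of i w] show ?case by (simp only: fin_weyl_def)
  qed
qed

lemma refl_in_fin_weyl: "j \<in> J \<Longrightarrow> j \<le> rk D \<Longrightarrow> refl (\<alpha> j) \<in> fin_weyl D J"
  unfolding fin_weyl_def by (intro generated_group_base) (auto simp: srefl_eq intro!: rev_image_eqI)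

lemma fin_weyl_comp: "x \<in> fin_weyl D J \<Longrightarrow> y \<in> fin_weyl D J \<Longrightarrow> x \<circ> y \<in> fin_weyl D J"
  unfolding fin_weyl_def by (rule generated_group_comp)

text \<open>For the converse, a vector of positive height satisfying the criterion is acute to some
  simple root of \<open>J\<close>, and reflecting there lowers the height. The descent stops only
  when the reflected vector turns negative, and then the vector was that simple root. Roots are
  thereby described by conditions on vectors instead of orbits.\<close>

lemma fin_roots_iff:
  assumes "J \<subseteq> I"
  shows "v \<in> R J \<longleftrightarrow> lroot v \<and> v \<in> span (\<alpha> ` J)"
proof
  assume "v \<in> R J"
  then obtain w j where w: "v = w (\<alpha> j)" "w \<in> fin_weyl D J" "j \<in> J"
    by (auto simp: fin_roots_def)
  have J: "J \<subseteq> {..rk D}" using assms by auto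
  from w(2) J have "lroot (w (\<alpha> j)) \<and> w (\<alpha> j) \<in> span (\<alpha> ` J)"
  proof (induction rule: fin_weyl_induct)
    case id
    then show ?case using w(3) assms by (auto simp: lroot_simple simple_in_span)
  next
    case (step i w)
    then show ?case using assms by (auto intro!: lroot_refl lroot_simple refl_span simple_in_span)
  qed
  with w show "lroot v \<and> v \<in> span (\<alpha> ` J)" by simp
next
  assume v: "lroot v \<and> v \<in> span (\<alpha> ` J)"
  have J: "J \<subseteq> {..rk D}" using assms by auto
  have pos: "v \<in> R J" if "lroot v" "v \<in> span (\<alpha> ` J)" "0 < ht v" "ht v \<le> real n" for v n
    using that
  proof (induction n arbitrary: v)
    case (Suc n)
    have cf: "\<forall>j\<in>I. 0 \<le> cf j v" using lroot_ht_pos_iff[OF Suc.prems(1)] Suc.prems by simp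
    obtain i where i: "i \<in> J" "0 < b v (\<alpha> i)"
      using exists_acute_simple[OF Suc.prems(2) assms _ cf] Suc.prems(1) by (auto simp: lroot_def)
    then have iI: "i \<in> I" "i \<le> rk D" using assms by auto
    define c where "c = 2 * b (\<alpha> i) v / b (\<alpha> i) (\<alpha> i)"
    have "0 < c" unfolding c_def using i root_norm[OF iI(2)] by (simp add: b_sym)
    moreover have "c \<in> \<int>" unfolding c_def by (intro lroot_cartan_int lroot_simple iI Suc.prems)
    ultimately have c: "1 \<le> c" by (auto elim!: Ints_cases)
    define v' where "v' = refl (\<alpha> i) v"
    have v': "v' = v - c *\<^sub>R \<alpha> i" by (simp add: v'_def refl_def c_def)
    have l': "lroot v'" unfolding v'_def by (intro lroot_refl lroot_simple iI Suc.prems)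
    have s': "v' \<in> span (\<alpha> ` J)" unfolding v'_def by (intro refl_span simple_in_span i Suc.prems)
    have v: "v = refl (\<alpha> i) v'"
      unfolding v'_def using root_norm[OF iI(2)] by (simp add: refl_refl)
    show ?case
    proof (cases "0 < ht v'")
      case True
      have "v' \<in> R J" using Suc.IH[OF l' s' True] c Suc.prems(4) iI by (simp add: v' ht_simps)
      then obtain w j where "v' = w (\<alpha> j)" "w \<in> fin_weyl D J" "j \<in> J"
        by (auto simp: fin_roots_def)
      then have "v = (refl (\<alpha> i) \<circ> w) (\<alpha> j)" "refl (\<alpha> i) \<circ> w \<in> fin_weyl D J" "j \<in> J"
        using v i iI by (auto intro: fin_weyl_comp refl_in_fin_weyl)
      then show ?thesis unfolding fin_roots_def by blast
    next
      case False
      then have neg: "\<forall>j\<in>I. cf j v' \<le> 0" using lroot_ht_pos_iff[OF l'] by auto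
      \<comment> \<open>Reflecting in \<alpha> i alters only the i-th coordinate, so every other one
        is both nonnegative and nonpositive.\<close>
      have "cf j v = 0" if "j \<in> J" "j \<noteq> i" for j
        using neg cf that assms iI by (force simp: v' cf_simps cf_root subset_iff)
      then have "v = (\<Sum>j\<in>J. if j = i then cf i v *\<^sub>R \<alpha> i else 0)"
        by (subst span_expand(1)[OF Suc.prems(2) J]) (auto intro!: sum.cong)
      then have vi: "v = cf i v *\<^sub>R \<alpha> i" using i finite_subset[OF assms] by simp
      moreover have "0 < cf i v" using vi cf iI Suc.prems(3) by (metis ht_simple ht_simps(4) mult_1_right)
      ultimately have "cf i v = 1" using lroot_simple_multiple[of "cf i v" i] Suc.prems(1) iI by metis
      then have "v = id (\<alpha> i)" using vi by simp
      moreover have "id \<in> fin_weyl D J" unfolding fin_weyl_def by (rule gg_id)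
      ultimately show ?thesis using i unfolding fin_roots_def by blast
    qed
  qed simp
  have "v \<in> R J \<or> - v \<in> R J"
  proof (cases "0 < ht v")
    case True
    then show ?thesis using pos[of v "nat \<lceil>ht v\<rceil>"] v by (auto simp: real_nat_ceiling_ge)
  next
    case False
    then have "0 < ht (- v)" using lroot_ht_pos_iff(3)[of v] v by (simp add: ht_simps)
    then show ?thesis using pos[of "- v" "nat \<lceil>ht (- v)\<rceil>"] v 
      by (auto simp: real_nat_ceiling_ge lroot_minus span_neg)
  qed
  moreover have "- u \<in> R J" if "u \<in> R J" for u
  proof -
    obtain w j where w: "u = w (\<alpha> j)" "w \<in> fin_weyl D J" "j \<in> J"
      using \<open>u \<in> R J\<close> by (auto simp: fin_roots_def)
    have j: "j \<le> rk D" using w assms by auto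
    have "linear w" using w(2) J
      by (induction rule: fin_weyl_induct) (auto intro: refl_linear linear_ident linear_compose[unfolded comp_def] simp: comp_def id_def)
    then have "- u = (w \<circ> refl (\<alpha> j)) (\<alpha> j)"
      using w root_norm[OF j] by (simp add: refl_self linear_neg)
    with w j show ?thesis
      unfolding fin_roots_def by (auto intro!: exI[of _ "w \<circ> refl (\<alpha> j)"] fin_weyl_comp refl_in_fin_weyl)
  qed
  ultimately show "v \<in> R J" by (metis minus_minus)
qed

lemma R_D: "J \<subseteq> I \<Longrightarrow> v \<in> R J \<Longrightarrow> lroot v" "J \<subseteq> I \<Longrightarrow> v \<in> R J \<Longrightarrow> v \<in> span (\<alpha> ` J)"
  by (simp_all add: fin_roots_iff)

lemma R_minus: "J \<subseteq> I \<Longrightarrow> v \<in> R J \<Longrightarrow> - v \<in> R J"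
  by (simp add: fin_roots_iff lroot_minus span_neg)

lemma R_minus_iff: "J \<subseteq> I \<Longrightarrow> - v \<in> R J \<longleftrightarrow> v \<in> R J"
  using R_minus[of J v] R_minus[of J "- v"] by auto

lemma R_refl: "J \<subseteq> I \<Longrightarrow> u \<in> R J \<Longrightarrow> v \<in> R J \<Longrightarrow> refl u v \<in> R J"
  by (simp add: fin_roots_iff lroot_refl refl_span)

lemma R_simple: "J \<subseteq> I \<Longrightarrow> j \<in> J \<Longrightarrow> \<alpha> j \<in> R J"
  using lroot_simple[of j] simple_in_span[of j J] by (auto simp: fin_roots_iff)

lemma R_mono: "K \<subseteq> J \<Longrightarrow> J \<subseteq> I \<Longrightarrow> R K \<subseteq> R J"
  using span_simple_mono[of K J] by (auto simp: fin_roots_iff)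

lemma fin_weyl_R: "w \<in> fin_weyl D J \<Longrightarrow> v \<in> R J \<Longrightarrow> w v \<in> R J"
proof -
  assume w: "w \<in> fin_weyl D J" and "v \<in> R J"
  then obtain x j where "v = x (\<alpha> j)" "x \<in> fin_weyl D J" "j \<in> J"
    by (auto simp: fin_roots_def)
  then have "w v = (w \<circ> x) (\<alpha> j)" "w \<circ> x \<in> fin_weyl D J" "j \<in> J"
    using w by (auto intro: fin_weyl_comp)
  then show "w v \<in> R J" unfolding fin_roots_def by blast
qed

text \<open>If one of the two Cartan integers is 1, the difference is up to sign a reflected root.
  If both are at least 2, the difference has nonpositive norm, hence vanishes.\<close>

lemma lroot_diff:
  assumes "lroot u" "lroot v" "0 < b u v" "u \<noteq> v"
  shows "lroot (u - v)"
proof -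
  define p where "p = 2 * b v u / b v v"
  define q where "q = 2 * b u v / b u u"
  have pos: "0 < b u u" "0 < b v v" using assms lroot_norm by auto
  have "p \<in> \<int>" "q \<in> \<int>" "0 < p" "0 < q"
    unfolding p_def q_def using assms lroot_cartan_int[of u v] lroot_cartan_int[of v u] pos
    by (auto simp: b_sym[of v u])
  then obtain m n :: int where "p = of_int m" "q = of_int n" "0 < m" "0 < n"
    by (metis Ints_cases of_int_0_less_iff)
  then consider "p = 1" | "q = 1" | "2 \<le> p" "2 \<le> q" by fastforce
  then show ?thesis
  proof cases
    case 1
    then have "refl v u = u - v" by (simp add: refl_def p_def)
    then show ?thesis using lroot_refl[OF assms(2,1)] by simp
  next
    case 2
    then have "refl u v = - (u - v)" by (simp add: refl_def q_def)
    then show ?thesis using lroot_minus[OF lroot_refl[OF assms(1,2)]] by simp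
  next
    case 3
    then have "b v v \<le> b u v" "b u u \<le> b u v"
      using pos by (simp_all add: p_def q_def b_sym[of v u] field_simps)
    then have "b (u - v) (u - v) \<le> 0" by (simp add: b_simps b_sym[of v u])
    moreover have "u - v \<in> span (\<alpha> ` I)" using assms by (auto simp: lroot_def span_diff)
    ultimately show ?thesis using pos_def[of "u - v"] assms(4) by auto
  qed
qed

lemma R_diff: "J \<subseteq> I \<Longrightarrow> u \<in> R J \<Longrightarrow> v \<in> R J \<Longrightarrow> 0 < b u v \<Longrightarrow> u \<noteq> v \<Longrightarrow> u - v \<in> R J"
  by (simp add: fin_roots_iff lroot_diff span_diff)

text \<open>By Cauchy-Schwarz the two Cartan integers have product at most 4, and unless both vanish
  the other factor has absolute value at least 1.\<close>

lemma lroot_cartan_bound: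
  assumes "lroot u" "lroot v"
  shows "\<bar>2 * b u v / b u u\<bar> \<le> 4"
proof -
  have pos: "0 < b u u" "0 < b v v" using assms lroot_norm by auto
  define p where "p = 2 * b v u / b v v"
  define q where "q = 2 * b u v / b u u"
  have int: "p \<in> \<int>" "q \<in> \<int>" unfolding p_def q_def using assms lroot_cartan_int by auto
  have "0 \<le> b (u - (b u v / b v v) *\<^sub>R v) (u - (b u v / b v v) *\<^sub>R v)"
    using assms by (intro pos_semidef span_diff span_scale) (auto simp: lroot_def)
  also have "\<dots> = b u u - b u v * b u v / b v v"
    using pos by (simp add: b_simps b_sym[of v u] field_simps)
  finally have pq: "p * q \<le> 4"
    using pos by (simp add: p_def q_def b_sym[of v u] field_simps)
  have pq0: "p * q = 4 * (b u v)\<^sup>2 / (b v v * b u u)"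
    by (simp add: p_def q_def b_sym[of v u] power2_eq_square)
  show ?thesis
  proof (cases "b u v = 0")
    case False
    then have "p \<noteq> 0" using pos by (simp add: p_def b_sym[of v u])
    then have "1 \<le> \<bar>p\<bar>" using int by (auto elim!: Ints_cases)
    then have "\<bar>q\<bar> \<le> \<bar>p\<bar> * \<bar>q\<bar>" by (simp add: mult_le_cancel_right1)
    also have "\<dots> = p * q" using pq0 pos by (simp add: abs_mult[symmetric])
    finally show ?thesis using pq by (simp add: q_def)
  qed simp
qed

text \<open>By definiteness a root is determined by its Cartan integers against the simple roots,
  and these are bounded.\<close>

lemma finite_R: "J \<subseteq> I \<Longrightarrow> finite (R J)"
proof (rule finite_subset[OF R_mono])
  define f where "f v = (\<lambda>i\<in>I. 2 * b (\<alpha> i) v / b (\<alpha> i) (\<alpha> i))" for v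
  have "finite {x :: real. x \<in> \<int> \<and> \<bar>x\<bar> \<le> 4}"
  proof (rule finite_subset)
    show "{x :: real. x \<in> \<int> \<and> \<bar>x\<bar> \<le> 4} \<subseteq> of_int ` {-4..4}"
    proof
      fix x :: real assume "x \<in> {x. x \<in> \<int> \<and> \<bar>x\<bar> \<le> 4}"
      then obtain z where "x = of_int z" "\<bar>z\<bar> \<le> 4" by (auto elim!: Ints_cases)
      then show "x \<in> of_int ` {-4..4}" by (intro image_eqI[of _ _ z]) auto
    qed
  qed simp
  then have "finite (I \<rightarrow>\<^sub>E {x :: real. x \<in> \<int> \<and> \<bar>x\<bar> \<le> 4})" by (intro finite_PiE) auto
  moreover have "f ` R I \<subseteq> I \<rightarrow>\<^sub>E {x. x \<in> \<int> \<and> \<bar>x\<bar> \<le> 4}"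
    unfolding f_def image_subset_iff restrict_PiE_iff mem_Collect_eq
    using lroot_cartan_int lroot_cartan_bound lroot_simple by (simp add: fin_roots_iff)
  moreover have "inj_on f (R I)"
  proof (rule inj_onI)
    fix u v assume uv: "u \<in> R I" "v \<in> R I" "f u = f v"
    have "b (\<alpha> i) (u - v) = 0" if "i \<in> I" for i
    proof -
      have "f u i = f v i" using uv by simp
      then show ?thesis using that by (simp add: f_def b_simps)
    qed
    moreover have s: "u - v \<in> span (\<alpha> ` I)" using uv by (simp add: fin_roots_iff span_diff)
    ultimately have "b (u - v) (u - v) = 0"
      by (subst b_expand_left[OF s I_subset]) (auto intro!: sum.neutral)
    then show "u = v" using pos_def[OF s] by auto
  qed
  ultimately show "finite (R I)" using inj_on_finite by blast
qed auto

section \<open>Highest roots of connected diagrams\<close>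

definition connected_diagram :: "nat set \<Rightarrow> bool" where
  "connected_diagram C \<longleftrightarrow> C \<subseteq> I \<and> C \<noteq> {} \<and>
    (\<forall>S. S \<subset> C \<and> S \<noteq> {} \<longrightarrow> (\<exists>i\<in>C - S. \<exists>j\<in>S. b (\<alpha> i) (\<alpha> j) \<noteq> 0))"

lemma connected_diagram_D: "connected_diagram C \<Longrightarrow> C \<subseteq> I" "connected_diagram C \<Longrightarrow> C \<noteq> {}"
  by (simp_all add: connected_diagram_def)

lemma connected_diagram_I: "connected_diagram I"
  using diagram_connected rank_pos unfolding connected_diagram_def by auto

lemma cf_outside: "J \<subseteq> I \<Longrightarrow> v \<in> R J \<Longrightarrow> i \<le> rk D \<Longrightarrow> i \<notin> J \<Longrightarrow> cf i v = 0"
  using span_expand(2)[of v J i] subset_trans[OF _ I_subset, of J] by (auto simp: fin_roots_iff)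

lemma R_pos_iff:
  assumes "J \<subseteq> I" "v \<in> R J"
  shows "0 < ht v \<longleftrightarrow> (\<forall>j\<in>J. 0 \<le> cf j v)" "ht v < 0 \<longleftrightarrow> (\<forall>j\<in>J. cf j v \<le> 0)"
  using lroot_ht_pos_iff[of v] cf_outside[OF assms] assms by (force simp: fin_roots_iff)+

text \<open>If the height were negative, \<open>- v\<close> would have nonnegative coordinates and
  thus be acute to some simple root of \<open>J\<close>.\<close>

lemma R_dominant_pos:
  assumes "J \<subseteq> I" "v \<in> R J" "\<forall>i\<in>J. 0 \<le> b v (\<alpha> i)"
  shows "0 < ht v"
proof (rule ccontr)
  assume "\<not> 0 < ht v"
  then have "ht (- v) > 0" using lroot_ht_pos_iff(3)[of v] R_D[OF assms(1,2)] by (simp add: ht_simps)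
  moreover have nv: "- v \<in> R J" using R_minus assms by blast
  ultimately have "\<forall>j\<in>I. 0 \<le> cf j (- v)" using lroot_ht_pos_iff(1)[of "- v"] R_D[OF assms(1)] by blast
  moreover have "- v \<noteq> 0" using R_D(1)[OF assms(1) nv] by (auto simp: lroot_def)
  ultimately obtain i where "i \<in> J" "0 < b (- v) (\<alpha> i)"
    using exists_acute_simple[OF R_D(2)[OF assms(1) nv] assms(1)] by blast
  then show False using assms(3) by (force simp: b_simps)
qed

text \<open>With a negative pairing, \<open>v + \<alpha> i\<close> would be a higher root, or
  \<alpha> i itself when \<open>v = - \<alpha> i\<close>. Maximality is asked only among roots above
  \<open>v\<close>, so that the argument serves both a root of greatest height and a maximal root
  above a given one.\<close>

lemma maximal_root_dominant:
  assumes "J \<subseteq> I" "v \<in> R J" "i \<in> J"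
    and "\<And>u. u \<in> R J \<Longrightarrow> (\<forall>j\<in>J. cf j v \<le> cf j u) \<Longrightarrow> ht u \<le> ht v"
  shows "0 \<le> b v (\<alpha> i)"
proof (rule ccontr)
  assume neg: "\<not> 0 \<le> b v (\<alpha> i)"
  have i: "i \<in> I" "i \<le> rk D" using assms(1,3) by auto
  have J: "j \<le> rk D" if "j \<in> J" for j using that assms(1) by auto
  have up: "\<forall>j\<in>J. cf j v \<le> cf j (v + \<alpha> i)" using J i by (auto simp: cf_simps cf_root)
  show False
  proof (cases "v = - \<alpha> i")
    case True
    have "\<forall>j\<in>J. cf j v \<le> cf j (\<alpha> i)" using J i by (auto simp: True cf_simps cf_root)
    then have "ht (\<alpha> i) \<le> ht v" using assms(4) R_simple[OF assms(1,3)] by blast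
    then show False using i by (simp add: True ht_simps)
  next
    case False
    have "v + \<alpha> i \<in> R J"
      using R_diff[OF assms(1,2) R_minus[OF assms(1) R_simple[OF assms(1,3)]]] neg False
      by (simp add: b_simps)
    then have "ht (v + \<alpha> i) \<le> ht v" using assms(4) up by blast
    then show False using i by (simp add: ht_simps)
  qed
qed

text \<open>A root \<theta> of greatest height is dominant, and connectedness makes all its
  coordinates positive. A maximal root \<gamma> above \<beta> is dominant too, so it pairs
  positively with \<theta>. Then \<theta> - \<gamma> is zero or a root, positive by height, and
  \<theta> bounds \<beta> coordinatewise.\<close>

lemma highest_root_exists:
  assumes "connected_diagram C"
  obtains \<theta> where "\<theta> \<in> R C" "\<And>\<beta> j. \<beta> \<in> R C \<Longrightarrow> j \<in> C \<Longrightarrow> cf j \<beta> \<le> cf j \<theta>"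
    "\<And>i. i \<in> C \<Longrightarrow> 0 \<le> b \<theta> (\<alpha> i)" "\<And>j. j \<in> C \<Longrightarrow> 0 < cf j \<theta>"
proof -
  have C: "C \<subseteq> I" "C \<noteq> {}" "C \<subseteq> {..rk D}"
    using connected_diagram_D[OF assms] subset_trans[OF _ I_subset] by auto
  have Cle: "j \<le> rk D" if "j \<in> C" for j using that C by auto
  have fin: "finite (R C)" by (rule finite_R[OF C(1)])
  have "R C \<noteq> {}" using R_simple[OF C(1)] C(2) by blast
  then obtain \<theta> where \<theta>: "\<theta> \<in> R C" "\<And>\<beta>. \<beta> \<in> R C \<Longrightarrow> ht \<beta> \<le> ht \<theta>"
    using exists_max_image[OF fin, of ht] by blast
  have dom: "0 \<le> b \<theta> (\<alpha> i)" if "i \<in> C" for i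
    using maximal_root_dominant[OF C(1) \<theta>(1) that] \<theta>(2) by blast
  have \<theta>s: "\<theta> \<in> span (\<alpha> ` C)" using R_D(2)[OF C(1) \<theta>(1)] .
  have "0 < ht \<theta>" using R_dominant_pos[OF C(1) \<theta>(1)] dom by blast
  then have nonneg: "0 \<le> cf j \<theta>" if "j \<in> C" for j
    using R_pos_iff(1)[OF C(1) \<theta>(1)] that by blast
  have full: "0 < cf j \<theta>" if "j \<in> C" for j
  proof (rule ccontr)
    assume j: "\<not> 0 < cf j \<theta>"
    \<comment> \<open>\<open>S\<close> is the support of \<theta>; a vertex outside it but joined to
      it would pair negatively with \<theta>.\<close>
    define S where "S = {k\<in>C. 0 < cf k \<theta>}"
    have "S \<subset> C" using j \<open>j \<in> C\<close> by (auto simp: S_def)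
    moreover have "S \<noteq> {}"
    proof
      assume "S = {}"
      then have "\<forall>k\<in>C. cf k \<theta> = 0" using nonneg by (force simp: S_def)
      then have "\<theta> = 0" using span_zero_iff[OF \<theta>s C(3)] by blast
      then show False using R_D(1)[OF C(1) \<theta>(1)] by (simp add: lroot_def)
    qed
    ultimately obtain i k where ik: "i \<in> C - S" "k \<in> S" "b (\<alpha> i) (\<alpha> k) \<noteq> 0"
      using assms unfolding connected_diagram_def by blast
    have "0 < (\<Sum>m\<in>C. - (cf m \<theta> * b (\<alpha> m) (\<alpha> i)))"
    proof (rule sum_pos2)
      show "finite C" using C finite_subset by blast
      show "k \<in> C" using ik S_def by auto
      have "b (\<alpha> k) (\<alpha> i) < 0"
        using ik simple_b_nonpos[of k i] Cle S_def by (force simp: b_sym[of "\<alpha> k" "\<alpha> i"])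
      then show "0 < - (cf k \<theta> * b (\<alpha> k) (\<alpha> i))"
        using ik by (simp add: S_def mult_pos_neg)
      fix m assume m: "m \<in> C"
      show "0 \<le> - (cf m \<theta> * b (\<alpha> m) (\<alpha> i))"
      proof (cases "m = i")
        case True
        then have "cf m \<theta> = 0" using ik nonneg[OF m] by (auto simp: S_def)
        then show ?thesis by simp
      next
        case False
        then have "b (\<alpha> m) (\<alpha> i) \<le> 0" using simple_b_nonpos[of m i] Cle m ik by auto
        then show ?thesis using nonneg[OF m] by (simp add: mult_nonneg_nonpos)
      qed
    qed
    then have "b \<theta> (\<alpha> i) < 0" unfolding b_expand_left[OF \<theta>s C(3)] by (simp add: sum_negf)
    then show False using dom ik by force
  qed
  have high: "cf j \<beta> \<le> cf j \<theta>" if "\<beta> \<in> R C" "j \<in> C" for \<beta> j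
  proof -
    define U where "U = {u \<in> R C. \<forall>j\<in>C. cf j \<beta> \<le> cf j u}"
    have "finite U" "U \<noteq> {}" using fin that by (auto simp: U_def)
    then obtain \<gamma> where \<gamma>: "\<gamma> \<in> U" "\<And>u. u \<in> U \<Longrightarrow> ht u \<le> ht \<gamma>"
      using exists_max_image[of U ht] by blast
    then have \<gamma>R: "\<gamma> \<in> R C" by (simp add: U_def)
    have dom': "0 \<le> b \<gamma> (\<alpha> i)" if "i \<in> C" for i
    proof (rule maximal_root_dominant[OF C(1) \<gamma>R that])
      fix u assume "u \<in> R C" "\<forall>j\<in>C. cf j \<gamma> \<le> cf j u"
      then have "u \<in> U" using \<gamma>(1) unfolding U_def by force
      then show "ht u \<le> ht \<gamma>" by (rule \<gamma>(2))
    qed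
    have "0 < ht \<gamma>" using R_dominant_pos[OF C(1) \<gamma>R] dom' by blast
    then have "\<forall>j\<in>I. 0 \<le> cf j \<gamma>" "\<gamma> \<noteq> 0" using lroot_ht_pos_iff(1)[of \<gamma>] R_D(1)[OF C(1) \<gamma>R]
      by (auto simp: lroot_def)
    then obtain i where i: "i \<in> C" "0 < b \<gamma> (\<alpha> i)"
      using exists_acute_simple[OF R_D(2)[OF C(1) \<gamma>R] C(1)] by blast
    have "0 < b \<theta> \<gamma>" unfolding b_expand_left[OF \<theta>s C(3)]
    proof (rule sum_pos2)
      show "finite C" using C finite_subset by blast
      show "0 < cf i \<theta> * b (\<alpha> i) \<gamma>" using i full by (simp add: b_sym[of "\<alpha> i" \<gamma>])
      show "0 \<le> cf m \<theta> * b (\<alpha> m) \<gamma>" if "m \<in> C" for m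
        using that full[of m] dom'[of m] by (simp add: b_sym[of "\<alpha> m" \<gamma>])
    qed (rule i)
    show ?thesis
    proof (cases "\<theta> = \<gamma>")
      case True
      then show ?thesis using \<gamma>(1) that by (auto simp: U_def)
    next
      case False
      have d: "\<theta> - \<gamma> \<in> R C" using R_diff[OF C(1) \<theta>(1) \<gamma>R \<open>0 < b \<theta> \<gamma>\<close> False] .
      moreover have "ht \<gamma> \<le> ht \<theta>" by (rule \<theta>(2)[OF \<gamma>R])
      ultimately have "0 < ht (\<theta> - \<gamma>)"
        using lroot_ht_pos_iff(3)[OF R_D(1)[OF C(1) d]] by (simp add: ht_simps)
      then have "0 \<le> cf j (\<theta> - \<gamma>)" using R_pos_iff(1)[OF C(1) d] that by blast
      then show ?thesis using \<gamma>(1) that Cle by (auto simp: U_def cf_simps)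
    qed
  qed
  show thesis using that \<theta>(1) high dom full by blast
qed

lemma R_cf_Ints: "J \<subseteq> I \<Longrightarrow> v \<in> R J \<Longrightarrow> j \<in> J \<Longrightarrow> cf j v \<in> \<int>"
  by (auto simp: fin_roots_iff lroot_def)

lemma highest_root_eqI:
  assumes "C \<subseteq> I" "\<theta> \<in> R C" "\<And>\<beta> j. \<beta> \<in> R C \<Longrightarrow> j \<in> C \<Longrightarrow> cf j \<beta> \<le> cf j \<theta>"
  shows "highest_root D C = \<theta>"
proof -
  have C: "C \<subseteq> {..rk D}" "\<And>j. j \<in> C \<Longrightarrow> j \<le> rk D" using assms(1) by auto
  have le: "\<exists>c :: nat \<Rightarrow> nat. \<theta> - \<beta> = (\<Sum>j\<in>C. real (c j) *\<^sub>R \<alpha> j)" if "\<beta> \<in> R C" for \<beta>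
  proof -
    have s: "\<theta> - \<beta> \<in> span (\<alpha> ` C)" using that assms(1,2) by (simp add: R_D(2) span_diff)
    have "real (nat \<lfloor>cf j (\<theta> - \<beta>)\<rfloor>) = cf j (\<theta> - \<beta>)" if "j \<in> C" for j
    proof -
      have "cf j (\<theta> - \<beta>) \<in> \<int>" "0 \<le> cf j (\<theta> - \<beta>)"
        using that \<open>\<beta> \<in> R C\<close> assms C(2) R_cf_Ints[of C] by (auto simp: cf_simps)
      then show ?thesis by (auto elim!: Ints_cases)
    qed
    then have "\<theta> - \<beta> = (\<Sum>j\<in>C. real (nat \<lfloor>cf j (\<theta> - \<beta>)\<rfloor>) *\<^sub>R \<alpha> j)"
      by (subst span_expand(1)[OF s C(1)]) auto
    then show ?thesis by (intro exI[of _ "\<lambda>j. nat \<lfloor>cf j (\<theta> - \<beta>)\<rfloor>"])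
  qed
  show ?thesis unfolding highest_root_def
  proof (rule the_equality)
    show "\<theta> \<in> R C \<and> (\<forall>\<beta>\<in>R C. \<exists>c :: nat \<Rightarrow> nat. \<theta> - \<beta> = (\<Sum>j\<in>C. real (c j) *\<^sub>R \<alpha> j))"
      using le assms(2) by blast
    fix \<theta>' assume \<theta>': "\<theta>' \<in> R C \<and> (\<forall>\<beta>\<in>R C. \<exists>c :: nat \<Rightarrow> nat. \<theta>' - \<beta> = (\<Sum>j\<in>C. real (c j) *\<^sub>R \<alpha> j))"
    then obtain c :: "nat \<Rightarrow> nat" where c: "\<theta>' - \<theta> = (\<Sum>j\<in>C. real (c j) *\<^sub>R \<alpha> j)"
      using assms(2) by blast
    have "ht (\<theta>' - \<theta>) = (\<Sum>j\<in>C. real (c j))"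
    proof -
      have "ht (\<Sum>j\<in>S. real (c j) *\<^sub>R \<alpha> j) = (\<Sum>j\<in>S. real (c j))" if "S \<subseteq> C" "finite S" for S
        using that(2,1) C(2) by (induction S) (auto simp: ht_simps)
      then show ?thesis using c finite_subset[OF C(1)] by simp
    qed
    moreover have "ht \<theta>' \<le> ht \<theta>"
      using ht_span[OF R_D(2)[OF assms(1)] C(1)] assms(2,3) \<theta>' by (auto intro: sum_mono)
    ultimately have "(\<Sum>j\<in>C. real (c j)) \<le> 0" by (simp add: ht_simps)
    then have "(\<Sum>j\<in>C. real (c j)) = 0" by (intro antisym sum_nonneg) auto
    then have "\<forall>j\<in>C. real (c j) = 0"
      using C finite_subset[OF C(1)] by (subst (asm) sum_nonneg_eq_0_iff) auto
    then have "\<theta>' - \<theta> = 0" unfolding c by (intro sum.neutral) auto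
    then show "\<theta>' = \<theta>" by simp
  qed
qed

lemma highest_root:
  assumes "connected_diagram C"
  shows "highest_root D C \<in> R C"
    "\<beta> \<in> R C \<Longrightarrow> j \<in> C \<Longrightarrow> cf j \<beta> \<le> cf j (highest_root D C)"
    "i \<in> C \<Longrightarrow> 0 \<le> b (highest_root D C) (\<alpha> i)" "j \<in> C \<Longrightarrow> 0 < cf j (highest_root D C)"
proof -
  have "C \<subseteq> I" using assms by (simp add: connected_diagram_def)
  obtain \<theta> where \<theta>: "\<theta> \<in> R C" "\<And>\<beta> j. \<beta> \<in> R C \<Longrightarrow> j \<in> C \<Longrightarrow> cf j \<beta> \<le> cf j \<theta>"
    "\<And>i. i \<in> C \<Longrightarrow> 0 \<le> b \<theta> (\<alpha> i)" "\<And>j. j \<in> C \<Longrightarrow> 0 < cf j \<theta>"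
    using highest_root_exists[OF assms] by metis
  have "highest_root D C = \<theta>" by (rule highest_root_eqI[OF \<open>C \<subseteq> I\<close> \<theta>(1,2)])
  with \<theta> show "highest_root D C \<in> R C"
    "\<beta> \<in> R C \<Longrightarrow> j \<in> C \<Longrightarrow> cf j \<beta> \<le> cf j (highest_root D C)"
    "i \<in> C \<Longrightarrow> 0 \<le> b (highest_root D C) (\<alpha> i)" "j \<in> C \<Longrightarrow> 0 < cf j (highest_root D C)"
    by auto
qed

section \<open>The null root\<close>

definition \<delta> :: 'v where "\<delta> = (\<Sum>j\<le>rk D. of_int (mk j) *\<^sub>R \<alpha> j)"

lemma b_\<delta>_simple: "i \<le> rk D \<Longrightarrow> b \<delta> (\<alpha> i) = 0"
  unfolding \<delta>_def by (rule mk_null)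

lemma b_\<delta>: "v \<in> span (\<alpha> ` {..rk D}) \<Longrightarrow> b \<delta> v = 0" "v \<in> span (\<alpha> ` {..rk D}) \<Longrightarrow> b v \<delta> = 0"
proof -
  show *: "b v \<delta> = 0" if "v \<in> span (\<alpha> ` {..rk D})"
    by (subst b_expand_left[OF that order_refl])
       (auto intro!: sum.neutral simp: b_sym[of "\<alpha> _" \<delta>] b_\<delta>_simple)
  show "b \<delta> v = 0" if "v \<in> span (\<alpha> ` {..rk D})"
    using *[OF that] by (simp add: b_sym[of \<delta> v])
qed

lemma \<delta>_span: "\<delta> \<in> span (\<alpha> ` {..rk D})"
  unfolding \<delta>_def by (intro span_sum span_scale simple_in_span)

lemma cf_\<delta>: "i \<le> rk D \<Longrightarrow> cf i \<delta> = of_int (mk i)"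
proof -
  assume i: "i \<le> rk D"
  have "cf i \<delta> = (\<Sum>j\<le>rk D. of_int (mk j) * cf i (\<alpha> j))"
    unfolding \<delta>_def using i by (simp add: cf_simps)
  also have "\<dots> = (\<Sum>j\<le>rk D. if j = i then of_int (mk i) else 0)"
    using i by (intro sum.cong) (auto simp: cf_root)
  finally show ?thesis using i by simp
qed

text \<open>Here it is used that the affine type is untwisted: \<open>\<delta> - \<alpha>\<^sub>0\<close> satisfies the lattice criterion
  because the dual marks are integral, and it is the highest root because \<open>\<alpha>\<^sub>0\<close> is long.\<close>

lemma highest_root_I: "highest_root D I = \<delta> - \<alpha> 0"
proof -
  define \<eta> where "\<eta> = \<delta> - \<alpha> 0"
  have set: "{..rk D} = insert 0 I" by auto
  have \<eta>: "\<eta> = (\<Sum>j\<in>I. of_int (mk j) *\<^sub>R \<alpha> j)"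
    unfolding \<eta>_def \<delta>_def set by (subst sum.insert) (auto simp: mk_0)
  then have s: "\<eta> \<in> span (\<alpha> ` I)" by (auto intro!: span_sum span_scale simple_in_span)
  have cf: "cf j \<eta> = of_int (mk j)" if "j \<in> I" for j
    using that by (simp add: \<eta>_def cf_simps cf_\<delta> cf_root)
  have "cf 1 \<eta> \<noteq> 0" using cf[of 1] mk_pos[of 1] rank_pos by auto
  then have "\<eta> \<noteq> 0" using rank_pos by (auto simp: cf_simps)
  have norm: "b \<eta> \<eta> = b (\<alpha> 0) (\<alpha> 0)"
    using b_\<delta>(1)[OF \<delta>_span] b_\<delta>_simple[of 0] by (simp add: \<eta>_def b_simps b_sym[of "\<alpha> 0" \<delta>])
  have l: "lroot \<eta>"
    unfolding lroot_def using s \<open>\<eta> \<noteq> 0\<close> cf mk_dual norm by auto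
  have \<eta>R: "\<eta> \<in> R I" using l s by (simp add: fin_roots_iff)
  define \<theta> where "\<theta> = highest_root D I"
  note \<theta> = highest_root[OF connected_diagram_I, folded \<theta>_def]
  have \<theta>s: "\<theta> \<in> span (\<alpha> ` I)" using \<theta>(1) R_D by blast
  have norm_le: "b \<theta> \<theta> \<le> b \<eta> \<eta>"
  proof -
    obtain w j where w: "\<theta> = w (\<alpha> j)" "w \<in> fin_weyl D I" "j \<in> I"
      using \<theta>(1) by (auto simp: fin_roots_def)
    from w(2) I_subset have "b (w (\<alpha> j)) (w (\<alpha> j)) = b (\<alpha> j) (\<alpha> j)"
      by (induction rule: fin_weyl_induct) (auto simp: refl_b)
    then show ?thesis using w root_0_long[of j] norm by auto
  qed
  \<comment> \<open>Both roots are dominant and \<theta> - \<eta> has nonnegative coordinates. The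
    pairing of \<theta> with \<eta> is therefore at least the norm of \<eta>, which is at least the
    norm of \<theta>, and the difference has nonpositive norm.\<close>
  have "b (\<theta> - \<eta>) \<theta> \<ge> 0" "b (\<theta> - \<eta>) \<eta> \<ge> 0"
  proof -
    have d: "\<theta> - \<eta> \<in> span (\<alpha> ` I)" by (intro span_diff \<theta>s s)
    have nn: "0 \<le> cf j (\<theta> - \<eta>)" if "j \<in> I" for j
      using \<theta>(2)[OF \<eta>R that] that by (simp add: cf_simps)
    show "b (\<theta> - \<eta>) \<theta> \<ge> 0"
      unfolding b_expand_left[OF d I_subset]
      using nn \<theta>(3) by (intro sum_nonneg mult_nonneg_nonneg) (auto simp: b_sym[of "\<alpha> _" \<theta>])
    show "b (\<theta> - \<eta>) \<eta> \<ge> 0"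
      unfolding b_expand_left[OF d I_subset]
    proof (intro sum_nonneg mult_nonneg_nonneg nn)
      fix j assume j: "j \<in> I"
      then have "b \<eta> (\<alpha> j) = - b (\<alpha> 0) (\<alpha> j)" by (simp add: \<eta>_def b_simps b_\<delta>_simple)
      then show "0 \<le> b (\<alpha> j) \<eta>" using simple_b_nonpos[of 0 j] j by (simp add: b_sym[of "\<alpha> j" \<eta>])
    qed
  qed
  then have "b (\<theta> - \<eta>) (\<theta> - \<eta>) \<le> 0"
    using norm_le by (simp add: b_simps b_sym[of \<eta> \<theta>])
  then have "\<theta> - \<eta> = 0" using pos_def[of "\<theta> - \<eta>"] s \<theta>s by (meson not_le span_diff)
  then show ?thesis by (simp add: \<theta>_def \<eta>_def)
qed

lemma null_root_eq: "null_root D = \<delta>"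
  unfolding null_root_def highest_root_I by simp

section \<open>Affine root systems of parabolic type\<close>

abbreviation Q :: "'v set" where "Q \<equiv> span (\<alpha> ` {..rk D})"

text \<open>These are the properties of Weyl group elements used later, bundled so that they pass to
  products and inverses. The last clause keeps \<open>Q\<close> stable.\<close>

definition isom :: "('v \<Rightarrow> 'v) \<Rightarrow> bool" where
  "isom w \<longleftrightarrow> linear w \<and> bij w \<and> (\<forall>u v. b (w u) (w v) = b u v) \<and> w \<delta> = \<delta> \<and> (\<forall>v. w v - v \<in> Q)"

lemma isom_D:
  assumes "isom w"
  shows "linear w" "bij w" "b (w u) (w v) = b u v" "w \<delta> = \<delta>" "w v - v \<in> Q"
    "w (u + v) = w u + w v" "w (u - v) = w u - w v" "w (- v) = - w v" "w (r *\<^sub>R v) = r *\<^sub>R w v"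
    "inv w (w v) = v" "w (inv w v) = v"
  using assms unfolding isom_def
  by (auto simp: linear_add linear_diff linear_neg linear_scale bij_is_inj bij_is_surj surj_f_inv_f)

lemma isom_Q: "isom w \<Longrightarrow> v \<in> Q \<Longrightarrow> w v \<in> Q"
  using isom_D(5)[of w v] span_add[of "w v - v" "\<alpha> ` {..rk D}" v] by simp

lemma isom_id: "isom id"
  by (auto simp: isom_def linear_id id_def linear_ident span_zero bij_def inj_def)

lemma isom_comp:
  assumes "isom x" "isom y"
  shows "isom (x \<circ> y)"
  unfolding isom_def
proof (intro conjI allI)
  show "linear (x \<circ> y)" using assms isom_D(1) by (intro linear_compose) auto
  show "bij (x \<circ> y)" using assms isom_D(2) by (intro bij_comp) auto
  fix v
  have "x (y v) - v = (x (y v) - y v) + (y v - v)" by simp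
  then show "(x \<circ> y) v - v \<in> Q" using isom_D(5)[OF assms(1), of "y v"] isom_D(5)[OF assms(2), of v]
    by (metis comp_apply span_add)
qed (use assms in \<open>auto simp: isom_D\<close>)

lemma isom_inv:
  assumes "isom x"
  shows "isom (inv x)"
  unfolding isom_def
proof (intro conjI allI)
  have inv_eq: "inv x u = v" if "u = x v" for u v using that isom_D(10)[OF assms] by simp
  show "linear (inv x)"
    by (intro linearI inv_eq) (simp_all add: isom_D[OF assms])
  show "bij (inv x)" using isom_D(2)[OF assms] by (rule bij_imp_bij_inv)
  show "b (inv x u) (inv x v) = b u v" for u v
    using isom_D(3)[OF assms, of "inv x u" "inv x v"] by (simp add: isom_D(11)[OF assms])
  show "inv x \<delta> = \<delta>" by (intro inv_eq) (simp add: isom_D[OF assms])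
  show "inv x v - v \<in> Q" for v
    using span_neg[OF isom_D(5)[OF assms, of "inv x v"]] by (simp add: isom_D(11)[OF assms])
qed

lemma isom_refl:
  assumes "\<gamma> \<in> Q" "b \<gamma> \<gamma> \<noteq> 0"
  shows "isom (refl \<gamma>)"
  unfolding isom_def
proof (intro conjI allI)
  show "linear (refl \<gamma>)" by (rule refl_linear)
  show "bij (refl \<gamma>)" using assms by (intro o_bij[of "refl \<gamma>"]) (auto simp: fun_eq_iff refl_refl)
  show "refl \<gamma> \<delta> = \<delta>" using assms by (simp add: refl_def b_\<delta>)
  show "refl \<gamma> v - v \<in> Q" for v using assms by (simp add: refl_def span_scale span_neg)
qed (use assms in \<open>auto simp: refl_b\<close>)

lemma isom_generated: "(\<And>s. s \<in> S \<Longrightarrow> isom s) \<Longrightarrow> w \<in> generated_group S \<Longrightarrow> isom w"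
  by (rotate_tac 1, induction rule: generated_group.induct) (auto intro: isom_id isom_comp isom_inv)

lemma isom_refl_apply: "isom w \<Longrightarrow> w (refl \<gamma> v) = refl (w \<gamma>) (w v)"
  by (simp add: refl_def isom_D)

lemma isom_refl_conj: "isom w \<Longrightarrow> w \<circ> refl \<gamma> \<circ> inv w = refl (w \<gamma>)"
  by (auto simp: fun_eq_iff isom_refl_apply isom_D)

lemma simple_Q: "i \<le> rk D \<Longrightarrow> \<alpha> i \<in> Q"
  by (simp add: simple_in_span)

lemma R_Q: "J \<subseteq> I \<Longrightarrow> v \<in> R J \<Longrightarrow> v \<in> Q"
  using span_simple_mono[OF subset_trans[OF _ I_subset], of J v] by (simp add: fin_roots_iff)

text \<open>The \<open>\<delta>\<close>-coefficient of a real root is its \<open>\<alpha>\<^sub>0\<close>-coefficient, because \<open>\<alpha>\<^sub>0\<close> has mark \<open>1\<close>.\<close>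

definition fp :: "'v \<Rightarrow> 'v" where "fp \<beta> = \<beta> - cf 0 \<beta> *\<^sub>R \<delta>"

lemma fp_simps: "fp (u + v) = fp u + fp v" "fp (u - v) = fp u - fp v" "fp (- u) = - fp u"
  "fp (r *\<^sub>R u) = r *\<^sub>R fp u" "fp \<delta> = 0"
  by (simp_all add: fp_def cf_simps cf_\<delta> mk_0 algebra_simps)

lemma fp_decomp: "\<beta> = cf 0 \<beta> *\<^sub>R \<delta> + fp \<beta>"
  by (simp add: fp_def)

lemma b_fp: "u \<in> Q \<Longrightarrow> v \<in> Q \<Longrightarrow> b (fp u) (fp v) = b u v"
  by (simp add: fp_def b_simps b_\<delta> \<delta>_span)

lemma cf0_R: "J \<subseteq> I \<Longrightarrow> v \<in> R J \<Longrightarrow> cf 0 v = 0"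
  by (rule cf_outside) auto

lemma fp_R: "J \<subseteq> I \<Longrightarrow> v \<in> R J \<Longrightarrow> fp v = v"
  by (simp add: fp_def cf0_R)

text \<open>\<open>PR J\<close> is \<open>\<Delta>\<^sup>r\<^sup>e\<^sub>J\<^sub>+\<close> and \<open>PI\<close> is \<open>\<Delta>\<^sup>i\<^sup>m\<^sub>+\<close>. Since no root has height \<open>0\<close>, the linear functional \<open>ht\<close> decides
  the sign of every root.\<close>

definition RT :: "nat set \<Rightarrow> 'v set" where "RT J = {\<beta>. cf 0 \<beta> \<in> \<int> \<and> fp \<beta> \<in> R J}"
definition PR :: "nat set \<Rightarrow> 'v set" where "PR J = {\<beta> \<in> RT J. 0 < ht \<beta>}"
definition PI :: "'v set" where "PI = {real m *\<^sub>R \<delta> | m. 1 \<le> m}"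

lemma RT_iff: "J \<subseteq> I \<Longrightarrow> \<epsilon> \<in> R J \<Longrightarrow> m *\<^sub>R \<delta> + \<epsilon> \<in> RT J \<longleftrightarrow> m \<in> \<int>"
  by (simp add: RT_def fp_simps fp_R cf_simps cf_\<delta> mk_0 cf0_R)

lemma R_RT: "J \<subseteq> I \<Longrightarrow> \<epsilon> \<in> R J \<Longrightarrow> \<epsilon> \<in> RT J"
  using RT_iff[of J \<epsilon> 0] by simp

lemma RT_Q: "J \<subseteq> I \<Longrightarrow> \<beta> \<in> RT J \<Longrightarrow> \<beta> \<in> Q"
  using span_add[OF span_scale[OF \<delta>_span, of "cf 0 \<beta>"] R_Q[of J "fp \<beta>"]]
  by (simp add: RT_def fp_def)

lemma RT_minus: "J \<subseteq> I \<Longrightarrow> \<beta> \<in> RT J \<Longrightarrow> - \<beta> \<in> RT J"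
  by (simp add: RT_def cf_simps fp_simps R_minus)

lemma RT_mono: "K \<subseteq> J \<Longrightarrow> J \<subseteq> I \<Longrightarrow> RT K \<subseteq> RT J"
  using R_mono[of K J] by (auto simp: RT_def)

lemma RT_norm: "J \<subseteq> I \<Longrightarrow> \<beta> \<in> RT J \<Longrightarrow> 0 < b \<beta> \<beta>"
  using b_fp[of \<beta> \<beta>] RT_Q[of J \<beta>] lroot_norm[OF R_D(1), of J "fp \<beta>"] by (simp add: RT_def)

lemma fp_refl: "\<gamma> \<in> Q \<Longrightarrow> \<beta> \<in> Q \<Longrightarrow> fp (refl \<gamma> \<beta>) = refl (fp \<gamma>) (fp \<beta>)"
  by (simp add: refl_def fp_simps b_fp)

lemma RT_refl:
  assumes "J \<subseteq> I" "\<gamma> \<in> RT J" "\<beta> \<in> RT J"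
  shows "refl \<gamma> \<beta> \<in> RT J"
proof -
  have Q: "\<gamma> \<in> Q" "\<beta> \<in> Q" using assms RT_Q by auto
  have f: "fp \<gamma> \<in> R J" "fp \<beta> \<in> R J" "cf 0 \<gamma> \<in> \<int>" "cf 0 \<beta> \<in> \<int>" using assms by (auto simp: RT_def)
  have "2 * b \<gamma> \<beta> / b \<gamma> \<gamma> \<in> \<int>"
    using lroot_cartan_int[of "fp \<gamma>" "fp \<beta>"] f R_D(1)[OF assms(1)] by (simp add: b_fp Q)
  then have "cf 0 \<beta> - (2 * b \<gamma> \<beta> / b \<gamma> \<gamma>) * cf 0 \<gamma> \<in> \<int>" using f by (intro Ints_diff Ints_mult)
  moreover have "cf 0 (refl \<gamma> \<beta>) = cf 0 \<beta> - (2 * b \<gamma> \<beta> / b \<gamma> \<gamma>) * cf 0 \<gamma>"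
    by (simp add: refl_def cf_simps)
  ultimately show ?thesis
    using f assms(1) by (simp add: RT_def fp_refl Q R_refl)
qed

lemma ht_\<delta>: "ht \<delta> \<in> \<int>" "2 \<le> ht \<delta>"
proof -
  have "ht \<delta> = (\<Sum>i\<le>rk D. real_of_int (mk i))" unfolding ht_def by (simp add: cf_\<delta>)
  also have "\<dots> = of_int (\<Sum>i\<le>rk D. mk i)" by simp
  finally have h: "ht \<delta> = of_int (\<Sum>i\<le>rk D. mk i)" .
  then show "ht \<delta> \<in> \<int>" by (metis Ints_of_int)
  have "(\<Sum>i\<in>{0, 1}. mk i) \<le> (\<Sum>i\<le>rk D. mk i)"
    using rank_pos mk_pos by (intro sum_mono2) (auto simp: less_imp_le)
  then have "2 \<le> (\<Sum>i\<le>rk D. mk i)" using mk_0 mk_pos[of 1] rank_pos by simp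
  then have "2 \<le> real_of_int (\<Sum>i\<le>rk D. mk i)" by linarith
  then show "2 \<le> ht \<delta>" unfolding h .
qed

lemma cf_highest_root_I: "i \<in> I \<Longrightarrow> cf i (highest_root D I) = of_int (mk i)"
  unfolding highest_root_I by (simp add: cf_simps cf_\<delta> cf_root)

lemma R_cf_bound: "J \<subseteq> I \<Longrightarrow> \<epsilon> \<in> R J \<Longrightarrow> i \<in> I \<Longrightarrow> cf i \<epsilon> \<le> of_int (mk i)"
  using highest_root(2)[OF connected_diagram_I, of \<epsilon> i] cf_highest_root_I[of i] R_mono[of J I] by auto

text \<open>The highest root is \<delta> - \<alpha> 0, of height one less than \<delta>; a single
  multiple of \<delta> thus outweighs every finite root.\<close>

lemma R_ht_bound:
  assumes "J \<subseteq> I" "\<epsilon> \<in> R J"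
  shows "\<bar>ht \<epsilon>\<bar> < ht \<delta>"
proof -
  have "ht \<epsilon> < ht \<delta>" if "\<epsilon> \<in> R J" for \<epsilon>
  proof -
    have "\<epsilon> \<in> R I" using that R_mono[OF assms(1)] by auto
    then have "ht \<epsilon> \<le> (\<Sum>i\<in>I. of_int (mk i))"
      using ht_span[OF R_D(2)[OF order_refl] I_subset, of \<epsilon>] R_cf_bound[of I \<epsilon>] by (auto intro!: sum_mono)
    also have "\<dots> = ht (highest_root D I)"
      unfolding ht_span[OF R_D(2)[OF order_refl highest_root(1)[OF connected_diagram_I]] I_subset]
      by (intro sum.cong) (simp_all only: cf_highest_root_I)
    also have "\<dots> = ht \<delta> - 1" unfolding highest_root_I by (simp add: ht_simps)
    finally show ?thesis by simp
  qed
  from this[OF assms(2)] this[OF R_minus[OF assms]] show ?thesis by (simp add: ht_simps)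
qed

lemma ht_fp: "ht \<beta> = cf 0 \<beta> * ht \<delta> + ht (fp \<beta>)"
  by (subst fp_decomp[of \<beta>]) (simp add: ht_simps)

text \<open>The height bound makes the sign lexicographic: the \<delta>-coefficient decides, and
  where it vanishes the finite part does.\<close>

lemma RT_ht:
  assumes "J \<subseteq> I" "\<beta> \<in> RT J"
  shows "0 < ht \<beta> \<longleftrightarrow> 1 \<le> cf 0 \<beta> \<or> (cf 0 \<beta> = 0 \<and> 0 < ht (fp \<beta>))" "ht \<beta> \<noteq> 0" "ht \<beta> \<in> \<int>"
proof -
  have f: "fp \<beta> \<in> R J" "cf 0 \<beta> \<in> \<int>" using assms by (auto simp: RT_def)
  obtain m :: int where m: "cf 0 \<beta> = of_int m" using f by (auto elim: Ints_cases)
  have bd: "\<bar>ht (fp \<beta>)\<bar> < ht \<delta>" by (rule R_ht_bound[OF assms(1) f(1)])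
  have nz: "ht (fp \<beta>) \<noteq> 0" using lroot_ht_pos_iff(3) R_D(1)[OF assms(1) f(1)] by blast
  have h: "ht \<beta> = of_int m * ht \<delta> + ht (fp \<beta>)" using ht_fp[of \<beta>] m by simp
  have pos: "0 < ht \<delta>" using ht_\<delta> by simp
  have "ht \<delta> \<le> of_int m * ht \<delta>" if "1 \<le> m" using that pos by (simp add: mult_le_cancel_right1)
  moreover have "of_int m * ht \<delta> \<le> - ht \<delta>" if "m \<le> -1"
    using mult_right_mono[of "of_int m" "-1" "ht \<delta>"] that pos by simp
  moreover have "m \<le> -1 \<or> m = 0 \<or> 1 \<le> m" by linarith
  ultimately show "0 < ht \<beta> \<longleftrightarrow> 1 \<le> cf 0 \<beta> \<or> (cf 0 \<beta> = 0 \<and> 0 < ht (fp \<beta>))" "ht \<beta> \<noteq> 0"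
    using bd nz unfolding h m by (auto simp: not_less)
  show "ht \<beta> \<in> \<int>" unfolding ht_fp[of \<beta>]
    using f ht_\<delta>(1) lroot_ht_Ints[OF R_D(1)[OF assms(1) f(1)]] by (intro Ints_add Ints_mult)
qed

lemma PR_cf0: "J \<subseteq> I \<Longrightarrow> \<beta> \<in> PR J \<Longrightarrow> 0 \<le> cf 0 \<beta>"
  using RT_ht(1)[of J \<beta>] by (auto simp: PR_def)

lemma PR_mono: "K \<subseteq> J \<Longrightarrow> J \<subseteq> I \<Longrightarrow> PR K \<subseteq> PR J"
  using RT_mono[of K J] by (auto simp: PR_def)

section \<open>Irreducible components\<close>

lemma dynkin_rel_iff:
  "J \<subseteq> I \<Longrightarrow> (i, j) \<in> dynkin_rel D J \<longleftrightarrow> i \<in> J \<and> j \<in> J \<and> b (\<alpha> i) (\<alpha> j) \<noteq> 0"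
  by (auto simp: dynkin_rel_def coroot_eq subset_iff)

lemma dynkin_equiv:
  assumes "J \<subseteq> I"
  shows "equiv J ((dynkin_rel D J)\<^sup>+)"
proof -
  have sub: "dynkin_rel D J \<subseteq> J \<times> J" by (auto simp: dynkin_rel_def)
  have "(dynkin_rel D J)\<^sup>+ \<subseteq> J \<times> J" using trancl_subset_Sigma[OF sub] .
  moreover have "(j, j) \<in> (dynkin_rel D J)\<^sup>+" if "j \<in> J" for j
  proof -
    have "j \<le> rk D" using that assms by auto
    then show ?thesis using that assms by (intro r_into_trancl) (simp add: dynkin_rel_iff)
  qed
  moreover have "sym ((dynkin_rel D J)\<^sup>+)"
    using assms by (intro sym_trancl) (auto simp: sym_def dynkin_rel_iff b_sym)
  ultimately show ?thesis by (auto simp: equiv_def refl_on_def)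
qed

text \<open>A subset that no edge leaves is stable under the generating relation, hence contains the
  whole class of each of its elements.\<close>

lemma component_connected_diagram:
  assumes "J \<subseteq> I" "C \<in> dynkin_components D J"
  shows "C \<subseteq> J" "connected_diagram C"
proof -
  obtain i where i: "i \<in> J" "C = (dynkin_rel D J)\<^sup>+ `` {i}"
    using assms(2) by (auto simp: dynkin_components_def elim: quotientE)
  show CJ: "C \<subseteq> J"
    using assms(2) in_quotient_imp_subset[OF dynkin_equiv[OF assms(1)]] by (auto simp: dynkin_components_def)
  have refl: "k \<in> (dynkin_rel D J)\<^sup>+ `` {k}" if "k \<in> J" for k
    using equiv_class_self[OF dynkin_equiv[OF assms(1)] that] .
  have "\<exists>k\<in>C - S. \<exists>j\<in>S. b (\<alpha> k) (\<alpha> j) \<noteq> 0" if S: "S \<subset> C" "S \<noteq> {}" for S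
  proof (rule ccontr)
    assume no: "\<not> ?thesis"
    obtain s where s: "s \<in> S" using S by auto
    have "(i, s) \<in> (dynkin_rel D J)\<^sup>+" using s S i by auto
    then have Cs: "C = (dynkin_rel D J)\<^sup>+ `` {s}"
      using i equiv_class_eq[OF dynkin_equiv[OF assms(1)]] by blast
    have "k \<in> S" if "(s, k) \<in> (dynkin_rel D J)\<^sup>+" for k
      using that
    proof (induction rule: trancl_induct)
      case (base y)
      then have "y \<in> C" using Cs by auto
      with base no s assms(1) show ?case by (metis DiffI b_sym dynkin_rel_iff)
    next
      case (step y z)
      then have "z \<in> C" using Cs by (auto intro: trancl_into_trancl)
      with step no assms(1) show ?case by (metis DiffI b_sym dynkin_rel_iff)
    qed
    then have "C \<subseteq> S" using Cs by auto
    then show False using S by auto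
  qed
  moreover have "C \<noteq> {}" using refl i by blast
  ultimately show "connected_diagram C" using CJ assms(1) unfolding connected_diagram_def by blast
qed

lemma component_cover: "J \<subseteq> I \<Longrightarrow> j \<in> J \<Longrightarrow> \<exists>C\<in>dynkin_components D J. j \<in> C"
  using Union_quotient[OF dynkin_equiv, of J] by (auto simp: dynkin_components_def)

lemma component_closed:
  assumes "J \<subseteq> I" "C \<in> dynkin_components D J" "i \<in> C" "j \<in> J" "b (\<alpha> i) (\<alpha> j) \<noteq> 0"
  shows "j \<in> C"
proof -
  have "i \<in> J" using component_connected_diagram[OF assms(1,2)] assms(3) by auto
  then have "(i, j) \<in> (dynkin_rel D J)\<^sup>+" using assms by (intro r_into_trancl) (simp add: dynkin_rel_iff)
  then show ?thesis
    using assms(2,3) in_quotient_imp_closed[OF dynkin_equiv[OF assms(1)]]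
    by (auto simp: dynkin_components_def)
qed

lemma component_orth:
  assumes "J \<subseteq> I" "C \<in> dynkin_components D J" "i \<in> J" "i \<notin> C" "v \<in> R C"
  shows "b (\<alpha> i) v = 0"
proof -
  have C: "C \<subseteq> I" "C \<subseteq> {..rk D}" using component_connected_diagram[OF assms(1,2)] assms(1) by auto
  have "b v (\<alpha> i) = 0"
    unfolding b_expand_left[OF R_D(2)[OF C(1) assms(5)] C(2)]
  proof (intro sum.neutral ballI)
    fix j assume "j \<in> C"
    then have "b (\<alpha> j) (\<alpha> i) = 0" using component_closed[OF assms(1,2) _ assms(3)] assms(4) by blast
    then show "cf j v * b (\<alpha> j) (\<alpha> i) = 0" by simp
  qed
  then show ?thesis by (simp add: b_sym[of "\<alpha> i" v])
qed

text \<open>A simple root outside the component is orthogonal to all roots inside, so its reflection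
  fixes them and the orbit never leaves the component.\<close>

lemma R_component:
  assumes "J \<subseteq> I" "v \<in> R J"
  shows "\<exists>C\<in>dynkin_components D J. v \<in> R C"
proof -
  obtain w j where w: "v = w (\<alpha> j)" "w \<in> fin_weyl D J" "j \<in> J"
    using assms(2) by (auto simp: fin_roots_def)
  obtain C where C: "C \<in> dynkin_components D J" "j \<in> C" using component_cover[OF assms(1) w(3)] by blast
  have CI: "C \<subseteq> I" using component_connected_diagram(1)[OF assms(1) C(1)] assms(1) by blast
  have "J \<subseteq> {..rk D}" using assms(1) by auto
  from w(2) this have "w (\<alpha> j) \<in> R C"
  proof (induction rule: fin_weyl_induct)
    case id
    then show ?case using R_simple[OF CI C(2)] by simp
  next
    case (step i w)
    show ?case
    proof (cases "i \<in> C")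
      case True
      then show ?thesis using step R_refl[OF CI R_simple[OF CI True]] by simp
    next
      case False
      then have "b (\<alpha> i) (w (\<alpha> j)) = 0" using component_orth[OF assms(1) C(1)] step by blast
      then show ?thesis using step by (simp add: refl_def)
    qed
  qed
  with C w show ?thesis by blast
qed

lemma R_component_orth:
  assumes "J \<subseteq> I" "C \<in> dynkin_components D J" "u \<in> R C" "v \<in> R J" "b u v \<noteq> 0"
  shows "v \<in> R C"
proof -
  obtain C' where C': "C' \<in> dynkin_components D J" "v \<in> R C'" using R_component[OF assms(1,4)] by blast
  have CI': "C' \<subseteq> I" "C' \<subseteq> {..rk D}" "C' \<subseteq> J" using component_connected_diagram[OF assms(1) C'(1)] assms(1) by auto
  have "b v u = (\<Sum>j\<in>C'. cf j v * b (\<alpha> j) u)"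
    by (rule b_expand_left[OF R_D(2)[OF CI'(1) C'(2)] CI'(2)])
  moreover have "b v u \<noteq> 0" using assms(5) by (simp add: b_sym[of v u])
  ultimately have "\<exists>j\<in>C'. b (\<alpha> j) u \<noteq> 0" by (force intro: sum.neutral)
  then obtain j where j: "j \<in> C'" "b (\<alpha> j) u \<noteq> 0" by blast
  then have "j \<in> C" using component_orth[OF assms(1,2) _ _ assms(3)] CI' by blast
  then have "C = C'"
    using quotient_disj[OF dynkin_equiv[OF assms(1)]] assms(2) C'(1) j(1)
    by (auto simp: dynkin_components_def)
  then show ?thesis using C' by simp
qed

section \<open>Simple roots of the affine system of J\<close>

abbreviation PS :: "nat set \<Rightarrow> 'v set" where "PS \<equiv> par_simple_roots D"

lemma Pi_cases:
  assumes "J \<subseteq> I" "\<gamma> \<in> PS J"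
  obtains (fin) j where "j \<in> J" "\<gamma> = \<alpha> j"
  | (aff) C where "C \<in> dynkin_components D J" "\<gamma> = \<delta> - highest_root D C"
proof -
  obtain C where C: "C \<in> dynkin_components D J" "\<gamma> \<in> \<alpha> ` C \<union> {\<delta> - highest_root D C}"
    using assms(2) by (auto simp: par_simple_roots_def null_root_eq)
  then show thesis using fin aff component_connected_diagram(1)[OF assms(1) C(1)] by blast
qed

lemma Pi_fin: "J \<subseteq> I \<Longrightarrow> j \<in> J \<Longrightarrow> \<alpha> j \<in> PS J"
  using component_cover[of J j] by (auto simp: par_simple_roots_def)

lemma Pi_aff: "C \<in> dynkin_components D J \<Longrightarrow> \<delta> - highest_root D C \<in> PS J"
  by (auto simp: par_simple_roots_def null_root_eq)

lemma R_comp_J: "J \<subseteq> I \<Longrightarrow> C \<in> dynkin_components D J \<Longrightarrow> v \<in> R C \<Longrightarrow> v \<in> R J"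
  using R_mono[of C J] component_connected_diagram(1)[of J C] by auto

lemma Pi_PR:
  assumes "J \<subseteq> I" "\<gamma> \<in> PS J"
  shows "\<gamma> \<in> PR J"
  using assms
proof (cases rule: Pi_cases)
  case (fin j)
  then show ?thesis using assms R_RT[OF _ R_simple] by (auto simp: PR_def)
next
  case (aff C)
  have C: "connected_diagram C" by (rule component_connected_diagram(2)[OF assms(1) aff(1)])
  have hJ: "- highest_root D C \<in> R J"
    using highest_root(1)[OF C] R_comp_J[OF assms(1) aff(1)] R_minus[OF assms(1)] by blast
  then have "\<gamma> \<in> RT J" using RT_iff[OF assms(1) hJ, of 1] aff by simp
  moreover have "cf 0 \<gamma> = 1" using aff cf0_R[OF assms(1) hJ] by (simp add: cf_simps cf_\<delta> mk_0)
  ultimately show ?thesis using RT_ht(1)[OF assms(1)] by (simp add: PR_def)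
qed

lemma PR_D: "J \<subseteq> I \<Longrightarrow> \<beta> \<in> PR J \<Longrightarrow> \<beta> \<in> RT J" "J \<subseteq> I \<Longrightarrow> \<beta> \<in> PR J \<Longrightarrow> 0 < ht \<beta>"
    "J \<subseteq> I \<Longrightarrow> \<beta> \<in> PR J \<Longrightarrow> fp \<beta> \<in> R J" "J \<subseteq> I \<Longrightarrow> \<beta> \<in> PR J \<Longrightarrow> cf 0 \<beta> \<in> \<int>"
    "J \<subseteq> I \<Longrightarrow> \<beta> \<in> PR J \<Longrightarrow> \<beta> \<in> Q"
  using RT_Q[of J \<beta>] by (auto simp: PR_def RT_def)

text \<open>For \<gamma> = \<alpha> j, a root with vanishing \<delta>-coefficient other than
  \<gamma> has a further positive coordinate, which the reflection keeps. For \<gamma> = \<delta> -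
  \<theta>, the reflection adds \<open>q *\<^sub>R \<gamma>\<close> with \<open>q\<close> the Cartan
  integer of \<theta> and the finite part \<epsilon>, and the cases \<open>q = -1\<close> and
  \<open>q \<le> -2\<close> are the critical ones.\<close>

lemma simple_refl_PR:
  assumes "J \<subseteq> I" "\<gamma> \<in> PS J" "\<beta> \<in> PR J" "\<beta> \<noteq> \<gamma>"
  shows "refl \<gamma> \<beta> \<in> PR J"
proof -
  note \<beta> = PR_D[OF assms(1,3)]
  have RTr: "refl \<gamma> \<beta> \<in> RT J" using Pi_PR[OF assms(1,2)] \<beta> PR_D(1)[OF assms(1)] RT_refl[OF assms(1)] by blast
  have \<beta>0: "0 \<le> cf 0 \<beta>" by (rule PR_cf0[OF assms(1,3)])
  have "0 < ht (refl \<gamma> \<beta>)"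
    using assms(1,2)
  proof (cases rule: Pi_cases)
    case (fin j)
    then have j: "j \<in> I" "j \<le> rk D" "j \<noteq> 0" using assms(1) by auto
    define c where "c = 2 * b (\<alpha> j) \<beta> / b (\<alpha> j) (\<alpha> j)"
    have r: "refl \<gamma> \<beta> = \<beta> - c *\<^sub>R \<alpha> j" by (simp add: fin refl_def c_def)
    have c0: "cf 0 (refl \<gamma> \<beta>) = cf 0 \<beta>" using j by (simp add: r cf_simps cf_root)
    have fa: "fp (\<alpha> j) = \<alpha> j" using fp_R[OF assms(1) R_simple[OF assms(1) fin(1)]] .
    show ?thesis
    proof (cases "1 \<le> cf 0 \<beta>")
      case False
      then have z: "cf 0 \<beta> = 0" and pos: "0 < ht (fp \<beta>)" using RT_ht(1)[OF assms(1) \<beta>(1)] \<beta>(2) by auto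
      then have fb: "fp \<beta> = \<beta>" by (simp add: fp_def)
      have bR: "\<beta> \<in> R J" "lroot \<beta>" using \<beta>(3) fb R_D(1)[OF assms(1)] by auto
      have nn: "\<forall>i\<in>I. 0 \<le> cf i \<beta>" using lroot_ht_pos_iff(1)[OF bR(2)] pos fb by simp
      have "\<exists>i\<in>I. i \<noteq> j \<and> cf i \<beta> \<noteq> 0"
      proof (rule ccontr)
        assume "\<not> ?thesis"
        then have "(\<Sum>i\<in>I. cf i \<beta> *\<^sub>R \<alpha> i) = (\<Sum>i\<in>I. if i = j then cf j \<beta> *\<^sub>R \<alpha> j else 0)"
          by (intro sum.cong) auto
        moreover have "\<beta> \<in> span (\<alpha> ` I)" using bR(2) by (simp add: lroot_def)
        ultimately have "\<beta> = (\<Sum>i\<in>I. if i = j then cf j \<beta> *\<^sub>R \<alpha> j else 0)"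
          using span_expand(1)[OF _ I_subset, of \<beta>] by metis
        then have e: "\<beta> = cf j \<beta> *\<^sub>R \<alpha> j" using j by simp
        have "0 < cf j \<beta> * ht (\<alpha> j)" using e \<beta>(2) ht_simps(4) by metis
        then have "0 < cf j \<beta>" using j by simp
        then have "cf j \<beta> = 1" using lroot_simple_multiple[of "cf j \<beta>" j] e bR(2) j by metis
        then show False using e assms(4) fin by simp
      qed
      then obtain i where i: "i \<in> I" "i \<noteq> j" "0 < cf i \<beta>" using nn by (force simp: less_le)
      have fr: "fp (refl \<gamma> \<beta>) = refl \<gamma> \<beta>" using z c0 by (simp add: fp_def)
      then have "refl \<gamma> \<beta> \<in> R J" using RTr by (simp add: RT_def)
      then have l: "lroot (refl \<gamma> \<beta>)" by (rule R_D(1)[OF assms(1)])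
      have "cf i (refl \<gamma> \<beta>) = cf i \<beta>" using i j by (simp add: r cf_simps cf_root)
      then have "\<not> ht (refl \<gamma> \<beta>) < 0" using lroot_ht_pos_iff(2)[OF l] i by force
      then show ?thesis using RT_ht(2)[OF assms(1) RTr] by simp
    qed (use RT_ht(1)[OF assms(1) RTr] c0 in simp)
  next
    case (aff C)
    have C: "connected_diagram C" "C \<subseteq> J" "C \<subseteq> I" "C \<subseteq> {..rk D}"
      using component_connected_diagram[OF assms(1) aff(1)] assms(1) by auto
    define \<theta> where "\<theta> = highest_root D C"
    note \<theta> = highest_root[OF C(1), folded \<theta>_def]
    have \<theta>J: "\<theta> \<in> R J" using R_comp_J[OF assms(1) aff(1) \<theta>(1)] .
    have \<theta>Q: "\<theta> \<in> Q" using R_Q[OF assms(1) \<theta>J] .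
    have \<gamma>: "\<gamma> = \<delta> - \<theta>" using aff by (simp add: \<theta>_def)
    define \<epsilon> where "\<epsilon> = fp \<beta>"
    have \<epsilon>J: "\<epsilon> \<in> R J" "lroot \<epsilon>" using \<beta>(3) R_D(1)[OF assms(1)] by (auto simp: \<epsilon>_def)
    define q where "q = 2 * b \<theta> \<epsilon> / b \<theta> \<theta>"
    have norm: "0 < b \<theta> \<theta>" using lroot_norm R_D(1)[OF assms(1) \<theta>J] by blast
    have "q \<in> \<int>" unfolding q_def using lroot_cartan_int R_D(1)[OF assms(1)] \<theta>J \<epsilon>J by blast
    have "b \<gamma> \<beta> = - b \<theta> \<beta>" "b \<gamma> \<gamma> = b \<theta> \<theta>"
      by (simp_all add: \<gamma> b_simps b_\<delta> \<beta>(5) \<theta>Q \<delta>_span)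
    moreover have "b \<theta> \<beta> = b \<theta> \<epsilon>" using b_fp[OF \<theta>Q \<beta>(5)] fp_R[OF assms(1) \<theta>J] by (simp add: \<epsilon>_def)
    ultimately have r: "refl \<gamma> \<beta> = \<beta> + q *\<^sub>R \<gamma>" by (simp add: refl_def q_def)
    have c0: "cf 0 (refl \<gamma> \<beta>) = cf 0 \<beta> + q"
      unfolding r unfolding \<gamma> using cf0_R[OF assms(1) \<theta>J] by (simp add: cf_simps cf_\<delta> mk_0)
    have fr: "fp (refl \<gamma> \<beta>) = \<epsilon> - q *\<^sub>R \<theta>"
      unfolding r unfolding \<gamma> using fp_R[OF assms(1) \<theta>J] by (simp add: fp_simps \<epsilon>_def)
    \<comment> \<open>Only a negative \<open>q\<close> lowers the \<delta>-coefficient. Dominance of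
      \<theta> then makes \<epsilon> a negative root of the component \<open>C\<close>, so
      positivity of \<beta> forces its \<delta>-coefficient to be at least 1.\<close>
    have neg_string: "\<epsilon> \<in> R C" "1 \<le> cf 0 \<beta>" "\<epsilon> - q *\<^sub>R \<theta> \<in> R C" "\<And>j. j \<in> C \<Longrightarrow> - cf j \<theta> \<le> cf j \<epsilon>"
      if "q < 0"
    proof -
      have neg: "b \<theta> \<epsilon> < 0" using that norm by (simp add: q_def divide_less_0_iff)
      show \<epsilon>C: "\<epsilon> \<in> R C" using R_component_orth[OF assms(1) aff(1) \<theta>(1) \<epsilon>J(1)] neg by simp
      have "refl \<theta> \<epsilon> \<in> R C" by (rule R_refl[OF C(3) \<theta>(1) \<epsilon>C])
      then show "\<epsilon> - q *\<^sub>R \<theta> \<in> R C" by (simp add: refl_def q_def)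
      show "- cf j \<theta> \<le> cf j \<epsilon>" if j: "j \<in> C" for j
      proof -
        have "j \<le> rk D" using j C(4) by auto
        then show ?thesis using \<theta>(2)[OF R_minus[OF C(3) \<epsilon>C] j] by (simp add: cf_simps)
      qed
      have "\<not> 0 < ht \<epsilon>"
      proof
        assume "0 < ht \<epsilon>"
        then have nn: "\<forall>j\<in>C. 0 \<le> cf j \<epsilon>" using R_pos_iff(1)[OF C(3) \<epsilon>C] by blast
        have "0 \<le> b \<epsilon> \<theta>"
          unfolding b_expand_left[OF R_D(2)[OF C(3) \<epsilon>C] C(4)]
          using nn \<theta>(3) by (intro sum_nonneg mult_nonneg_nonneg) (auto simp: b_sym[of "\<alpha> _" \<theta>])
        then show False using neg by (simp add: b_sym[of \<epsilon> \<theta>])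
      qed
      then show "1 \<le> cf 0 \<beta>" using RT_ht(1)[OF assms(1) \<beta>(1)] \<beta>(2) by (simp add: \<epsilon>_def)
    qed
    obtain k :: int where k: "q = of_int k" using \<open>q \<in> \<int>\<close> by (rule Ints_cases)
    have "1 \<le> k \<or> k = 0 \<or> k = -1 \<or> k \<le> -2" by linarith
    then consider "1 \<le> q" | "q = 0" | "q = -1" | "q \<le> -2" using k by fastforce
    then show ?thesis
    proof cases
      case 1
      then show ?thesis using RT_ht(1)[OF assms(1) RTr] c0 \<beta>0 by simp
    next
      case 2
      then show ?thesis using r \<beta>(2) by simp
    next
      case neg: 3
      then have "q < 0" by simp
      note str = neg_string[OF this]
      have "cf 0 (refl \<gamma> \<beta>) \<ge> 0" using c0 neg str(2) by simp
      moreover have "0 < ht (fp (refl \<gamma> \<beta>))"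
      proof -
        have "cf j (\<epsilon> - q *\<^sub>R \<theta>) \<ge> 0" if "j \<in> C" for j
          using str(4)[OF that] that C(4) by (auto simp: neg cf_simps)
        then show ?thesis using R_pos_iff(1)[OF C(3) str(3)] by (simp add: fr)
      qed
      moreover have "cf 0 (refl \<gamma> \<beta>) \<in> \<int>" using RTr by (simp add: RT_def)
      ultimately show ?thesis using RT_ht(1)[OF assms(1) RTr] by (force elim!: Ints_cases)
    next
      case neg: 4
      have "q < 0" using neg by simp
      note str = neg_string[OF this]
      \<comment> \<open>The bound by \<theta>, applied both to the reflected root and to -
        \<epsilon>, squeezes \<epsilon> to - \<theta>. Then \<open>q = -2\<close>, and excluding
        \<beta> = \<gamma> leaves a \<delta>-coefficient of at least 2.\<close>
      have "cf j (\<epsilon> + \<theta>) = 0" if j: "j \<in> C" for j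
      proof -
        have jr: "j \<le> rk D" using j C(4) by auto
        have "cf j \<epsilon> - q * cf j \<theta> \<le> cf j \<theta>"
          using \<theta>(2)[OF str(3) j] jr by (simp add: cf_simps)
        moreover have "q * cf j \<theta> \<le> -2 * cf j \<theta>"
          using neg \<theta>(4)[OF j] by (intro mult_right_mono) auto
        ultimately have "cf j \<epsilon> \<le> - cf j \<theta>" by simp
        then show ?thesis using str(4)[OF j] jr by (simp add: cf_simps)
      qed
      moreover have "\<epsilon> + \<theta> \<in> span (\<alpha> ` C)" using str(1) \<theta>(1) R_D(2)[OF C(3)] by (simp add: span_add)
      ultimately have "\<epsilon> + \<theta> = 0" using span_zero_iff[OF _ C(4)] by blast
      then have \<epsilon>\<theta>: "\<epsilon> = - \<theta>" by (simp add: eq_neg_iff_add_eq_0)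
      then have "q = -2" using norm by (simp add: q_def b_simps)
      have "cf 0 \<beta> \<noteq> 1"
      proof
        assume "cf 0 \<beta> = 1"
        then have "\<beta> = \<gamma>" using fp_decomp[of \<beta>] \<epsilon>\<theta> by (simp add: \<gamma> \<epsilon>_def)
        then show False using assms(4) by simp
      qed
      then have "2 \<le> cf 0 \<beta>" using str(2) \<beta>(4) by (force elim!: Ints_cases)
      then have "cf 0 (refl \<gamma> \<beta>) \<ge> 0" using c0 \<open>q = -2\<close> by simp
      moreover have "fp (refl \<gamma> \<beta>) = \<theta>" by (simp add: fr \<epsilon>\<theta> \<open>q = -2\<close> scaleR_2)
      moreover have "0 < ht \<theta>" using R_pos_iff(1)[OF C(3) \<theta>(1)] \<theta>(4) by (auto simp: less_imp_le)
      moreover have "cf 0 (refl \<gamma> \<beta>) \<in> \<int>" using RTr by (simp add: RT_def)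
      ultimately show ?thesis using RT_ht(1)[OF assms(1) RTr] by (force elim!: Ints_cases)
    qed
  qed
  with RTr show ?thesis by (simp add: PR_def)
qed

text \<open>If no \<alpha> j in the component of the finite part is acute to it, the negative of the
  finite part is dominant. The highest root, having full support, then pairs positively with that
  negative, so \<delta> - \<theta> is acute.\<close>

lemma exists_acute_Pi:
  assumes "J \<subseteq> I" "\<beta> \<in> PR J"
  shows "\<exists>\<gamma>\<in>PS J. 0 < b \<beta> \<gamma>"
proof -
  note \<beta> = PR_D[OF assms]
  obtain C where C: "C \<in> dynkin_components D J" "fp \<beta> \<in> R C" using R_component[OF assms(1) \<beta>(3)] by blast
  have C': "connected_diagram C" "C \<subseteq> J" "C \<subseteq> I" "C \<subseteq> {..rk D}" using component_connected_diagram[OF assms(1) C(1)] assms(1) by auto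
  have b\<beta>: "b \<beta> v = b (fp \<beta>) v" if "v \<in> R J" for v
    using b_fp[OF \<beta>(5) R_Q[OF assms(1) that]] fp_R[OF assms(1) that] by simp
  show ?thesis
  proof (cases "\<exists>j\<in>C. 0 < b (fp \<beta>) (\<alpha> j)")
    case True
    then show ?thesis using b\<beta> R_simple[OF assms(1)] Pi_fin[OF assms(1)] C'(2) by (metis subsetD)
  next
    case False
    define \<theta> where "\<theta> = highest_root D C"
    note \<theta> = highest_root[OF C'(1), folded \<theta>_def]
    have \<theta>J: "\<theta> \<in> R J" by (rule R_comp_J[OF assms(1) C(1) \<theta>(1)])
    have n: "- fp \<beta> \<in> R C" by (rule R_minus[OF C'(3) C(2)])
    have dom: "\<forall>i\<in>C. 0 \<le> b (- fp \<beta>) (\<alpha> i)" using False by (auto simp: b_simps not_less)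
    have l: "lroot (- fp \<beta>)" by (rule R_D(1)[OF C'(3) n])
    have "0 < ht (- fp \<beta>)" by (rule R_dominant_pos[OF C'(3) n dom])
    then have "\<forall>j\<in>I. 0 \<le> cf j (- fp \<beta>)" using lroot_ht_pos_iff(1)[OF l] by blast
    moreover have "- fp \<beta> \<noteq> 0" using l by (auto simp: lroot_def)
    ultimately obtain i where i: "i \<in> C" "0 < b (- fp \<beta>) (\<alpha> i)"
      using exists_acute_simple[OF R_D(2)[OF C'(3) n] C'(3)] by blast
    have "0 < b \<theta> (- fp \<beta>)" unfolding b_expand_left[OF R_D(2)[OF C'(3) \<theta>(1)] C'(4)]
    proof (rule sum_pos2)
      show "finite C" using C'(3) finite_subset by blast
      show "0 < cf i \<theta> * b (\<alpha> i) (- fp \<beta>)" using i \<theta>(4) by (simp add: b_sym[of "\<alpha> i" "- fp \<beta>"])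
      show "0 \<le> cf m \<theta> * b (\<alpha> m) (- fp \<beta>)" if "m \<in> C" for m
        using that \<theta>(4)[of m] dom by (auto simp: b_sym[of "\<alpha> m" "- fp \<beta>"])
    qed (rule i)
    also have "b \<theta> (- fp \<beta>) = b \<beta> (\<delta> - \<theta>)"
      using b\<beta>[OF \<theta>J] by (simp add: b_simps b_\<delta> \<beta>(5) b_sym[of \<theta> "fp \<beta>"])
    finally show ?thesis using Pi_aff[OF C(1)] by (auto simp: \<theta>_def)
  qed
qed

text \<open>Imaginary roots arise when the two finite parts agree: \<gamma> is the lowest positive
  root of its \<delta>-string, so the difference is a positive multiple of \<delta>. Otherwise the
  difference of the finite parts is a root. This is the height descent for biconvex sets.\<close>

lemma PR_minus_Pi:
  assumes "J \<subseteq> I" "\<beta> \<in> PR J" "\<gamma> \<in> PS J" "0 < b \<beta> \<gamma>" "\<beta> \<noteq> \<gamma>"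
  shows "\<beta> - \<gamma> \<in> PR J \<union> PI"
proof -
  note \<beta> = PR_D[OF assms(1,2)] and \<gamma> = PR_D[OF assms(1) Pi_PR[OF assms(1,3)]]
  have bf: "0 < b (fp \<beta>) (fp \<gamma>)" using assms(4) b_fp[OF \<beta>(5) \<gamma>(5)] by simp
  have \<beta>0: "0 \<le> cf 0 \<beta>" by (rule PR_cf0[OF assms(1,2)])
  show ?thesis
  proof (cases "fp \<beta> = fp \<gamma>")
    case True
    define k where "k = cf 0 \<beta> - cf 0 \<gamma>"
    have e: "\<beta> - \<gamma> = k *\<^sub>R \<delta>"
      using True by (simp add: k_def fp_def algebra_simps)
    have "k \<noteq> 0" using e assms(5) by auto
    have "cf 0 \<gamma> = 0 \<or> (cf 0 \<gamma> = 1 \<and> 1 \<le> cf 0 \<beta>)"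
      using assms(1,3)
    proof (cases rule: Pi_cases)
      case (fin j)
      then show ?thesis using cf0_R[OF assms(1) R_simple[OF assms(1)]] by simp
    next
      case (aff C)
      have C': "connected_diagram C" "C \<subseteq> I" using component_connected_diagram[OF assms(1) aff(1)] assms(1) by auto
      note \<theta> = highest_root[OF C'(1)]
      have \<theta>J: "highest_root D C \<in> R J" by (rule R_comp_J[OF assms(1) aff(1) \<theta>(1)])
      have "fp \<beta> = - highest_root D C" using True fp_R[OF assms(1) \<theta>J] by (simp add: aff fp_simps)
      moreover have "0 < ht (highest_root D C)"
        using R_pos_iff(1)[OF C'(2) \<theta>(1)] \<theta>(4) by (auto simp: less_imp_le)
      ultimately have "1 \<le> cf 0 \<beta>" using RT_ht(1)[OF assms(1) \<beta>(1)] \<beta>(2) by (simp add: ht_simps)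
      then show ?thesis using cf0_R[OF assms(1) \<theta>J] by (simp add: aff cf_simps cf_\<delta> mk_0)
    qed
    then have "0 \<le> k" using \<beta>0 by (auto simp: k_def)
    moreover have "k \<in> \<int>" unfolding k_def using \<beta>(4) \<gamma>(4) by simp
    ultimately obtain m :: nat where "k = real m" "1 \<le> m"
      using \<open>k \<noteq> 0\<close> by (metis Ints_cases int_nat_eq less_one not_le of_int_0_le_iff of_int_of_nat_eq of_nat_0)
    then show ?thesis using e by (auto simp: PI_def)
  next
    case False
    have d: "fp \<beta> - fp \<gamma> \<in> R J" by (rule R_diff[OF assms(1) \<beta>(3) \<gamma>(3) bf False])
    then have RTd: "\<beta> - \<gamma> \<in> RT J" using \<beta>(4) \<gamma>(4) by (simp add: RT_def cf_simps fp_simps)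
    have "0 < ht (\<beta> - \<gamma>)"
      using assms(1,3)
    proof (cases rule: Pi_cases)
      case (fin j)
      then have "j \<le> rk D" using assms(1) by auto
      then have "ht (\<beta> - \<gamma>) = ht \<beta> - 1" by (simp add: fin ht_simps)
      moreover have "1 \<le> ht \<beta>" using \<beta>(2) RT_ht(3)[OF assms(1) \<beta>(1)] by (auto elim!: Ints_cases)
      ultimately show ?thesis using RT_ht(2)[OF assms(1) RTd] by simp
    next
      case (aff C)
      have C': "connected_diagram C" "C \<subseteq> I" "C \<subseteq> {..rk D}" using component_connected_diagram[OF assms(1) aff(1)] assms(1) by auto
      define \<theta> where "\<theta> = highest_root D C"
      note \<theta> = highest_root[OF C'(1), folded \<theta>_def]
      have \<theta>J: "\<theta> \<in> R J" by (rule R_comp_J[OF assms(1) aff(1) \<theta>(1)])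
      have f\<gamma>: "fp \<gamma> = - \<theta>" using fp_R[OF assms(1) \<theta>J] by (simp add: aff \<theta>_def fp_simps)
      have c\<gamma>: "cf 0 (\<beta> - \<gamma>) = cf 0 \<beta> - 1" using cf0_R[OF assms(1) \<theta>J] by (simp add: aff \<theta>_def cf_simps cf_\<delta> mk_0)
      have neg: "b \<theta> (fp \<beta>) < 0" using bf f\<gamma> b_sym[of \<theta> "fp \<beta>"] by (simp add: b_simps)
      have \<beta>C: "fp \<beta> \<in> R C" using R_component_orth[OF assms(1) aff(1) \<theta>(1) \<beta>(3)] neg by simp
      have dC: "fp (\<beta> - \<gamma>) \<in> R C"
        using R_diff[OF C'(2) \<beta>C R_minus[OF C'(2) \<theta>(1)]] bf False f\<gamma> by (simp add: fp_simps)
      have "\<forall>j\<in>C. 0 \<le> cf j (fp (\<beta> - \<gamma>))"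
      proof
        fix j assume j: "j \<in> C"
        then have "j \<le> rk D" using C'(3) by auto
        then show "0 \<le> cf j (fp (\<beta> - \<gamma>))"
          using \<theta>(2)[OF R_minus[OF C'(2) \<beta>C] j] by (simp add: fp_simps f\<gamma> cf_simps)
      qed
      then have pos: "0 < ht (fp (\<beta> - \<gamma>))" using R_pos_iff(1)[OF C'(2) dC] by blast
      have "\<not> 0 < ht (fp \<beta>)"
      proof
        assume "0 < ht (fp \<beta>)"
        then have nn: "\<forall>j\<in>C. 0 \<le> cf j (fp \<beta>)" using R_pos_iff(1)[OF C'(2) \<beta>C] by blast
        have "0 \<le> b (fp \<beta>) \<theta>"
          unfolding b_expand_left[OF R_D(2)[OF C'(2) \<beta>C] C'(3)]
          using nn \<theta>(3) by (intro sum_nonneg mult_nonneg_nonneg) (auto simp: b_sym[of "\<alpha> _" \<theta>])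
        then show False using neg by (simp add: b_sym[of "fp \<beta>" \<theta>])
      qed
      then have "1 \<le> cf 0 \<beta>" using RT_ht(1)[OF assms(1) \<beta>(1)] \<beta>(2) by simp
      then have "0 \<le> cf 0 (\<beta> - \<gamma>)" using c\<gamma> by simp
      moreover have "cf 0 (\<beta> - \<gamma>) \<in> \<int>" using RTd by (simp add: RT_def)
      ultimately show ?thesis using RT_ht(1)[OF assms(1) RTd] pos by (force elim!: Ints_cases)
    qed
    with RTd show ?thesis by (simp add: PR_def)
  qed
qed

section \<open>The affine Weyl group of J\<close>

definition AW :: "nat set \<Rightarrow> ('v \<Rightarrow> 'v) set" where "AW J = generated_group (refl ` PS J)"

lemma isom_refl_RT: "J \<subseteq> I \<Longrightarrow> \<gamma> \<in> RT J \<Longrightarrow> isom (refl \<gamma>)"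
  using RT_Q[of J \<gamma>] RT_norm[of J \<gamma>] by (intro isom_refl) auto

lemma isom_refl_Pi: "J \<subseteq> I \<Longrightarrow> \<gamma> \<in> PS J \<Longrightarrow> isom (refl \<gamma>)"
  using isom_refl_RT[of J \<gamma>] Pi_PR[of J \<gamma>] PR_D(1)[of J \<gamma>] by blast

lemma isom_AW: "J \<subseteq> I \<Longrightarrow> w \<in> AW J \<Longrightarrow> isom w"
  unfolding AW_def using isom_generated[of "refl ` PS J" w] isom_refl_Pi[of J] by blast

lemma AW_id: "id \<in> AW J"
  unfolding AW_def by (rule gg_id)

lemma AW_comp: "x \<in> AW J \<Longrightarrow> y \<in> AW J \<Longrightarrow> x \<circ> y \<in> AW J"
  unfolding AW_def by (rule generated_group_comp)

lemma AW_inv: "J \<subseteq> I \<Longrightarrow> x \<in> AW J \<Longrightarrow> inv x \<in> AW J"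
  unfolding AW_def using generated_group_inv(2)[of "refl ` PS J" x] isom_D(2)[OF isom_refl_Pi] by blast

lemma AW_refl: "\<gamma> \<in> PS J \<Longrightarrow> refl \<gamma> \<in> AW J"
  unfolding AW_def by (intro generated_group_base) auto

lemma inv_refl: "b \<gamma> \<gamma> \<noteq> 0 \<Longrightarrow> inv (refl \<gamma>) = refl \<gamma>"
  by (intro inv_equality refl_refl)

lemma AW_induct [consumes 2, case_names id step]:
  assumes "w \<in> AW J" "J \<subseteq> I" "P id"
    and "\<And>\<gamma> w. \<gamma> \<in> PS J \<Longrightarrow> w \<in> AW J \<Longrightarrow> P w \<Longrightarrow> P (refl \<gamma> \<circ> w)"
  shows "P w"
  using assms(1) unfolding AW_def
proof (induction rule: generated_group.induct)
  case gg_id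
  then show ?case by (rule assms(3))
next
  case (gg_mult s w)
  then show ?case using assms(4) unfolding AW_def by blast
next
  case (gg_inv s w)
  then obtain \<gamma> where \<gamma>: "\<gamma> \<in> PS J" "s = refl \<gamma>" by blast
  then have "b \<gamma> \<gamma> \<noteq> 0"
    using RT_norm[OF assms(2) PR_D(1)[OF assms(2) Pi_PR[OF assms(2) \<gamma>(1)]]] by simp
  then have inv: "inv s = refl \<gamma>" using \<gamma>(2) by (simp add: inv_refl)
  show ?case unfolding inv by (intro assms(4) \<gamma>(1) gg_inv.IH) (use gg_inv in \<open>simp add: AW_def\<close>)
qed

lemma AW_RT:
  assumes "J \<subseteq> I" "w \<in> AW J" "\<beta> \<in> RT J"
  shows "w \<beta> \<in> RT J"
  using assms(2,1)
proof (induction rule: AW_induct)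
  case (step \<gamma> w)
  then show ?case using RT_refl[OF assms(1) PR_D(1)[OF assms(1) Pi_PR[OF assms(1)]]] by simp
qed (use assms in simp)

text \<open>Reflecting in an acute simple root keeps a root positive and lowers its height, until
  the root itself is simple.\<close>

lemma PR_conj_Pi:
  assumes "J \<subseteq> I" "\<beta> \<in> PR J"
  shows "\<exists>w\<in>AW J. \<exists>\<gamma>\<in>PS J. \<beta> = w \<gamma>"
proof -
  have "\<exists>w\<in>AW J. \<exists>\<gamma>\<in>PS J. \<beta> = w \<gamma>" if "\<beta> \<in> PR J" "ht \<beta> \<le> real n" for n \<beta>
    using that
  proof (induction n arbitrary: \<beta>)
    case 0
    then show ?case using PR_D(2)[OF assms(1)] by force
  next
    case (Suc n)
    obtain \<gamma> where \<gamma>: "\<gamma> \<in> PS J" "0 < b \<beta> \<gamma>" using exists_acute_Pi[OF assms(1) Suc.prems(1)] by blast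
    note \<gamma>P = Pi_PR[OF assms(1) \<gamma>(1)]
    have norm: "0 < b \<gamma> \<gamma>" by (rule RT_norm[OF assms(1) PR_D(1)[OF assms(1) \<gamma>P]])
    show ?case
    proof (cases "\<beta> = \<gamma>")
      case True
      then show ?thesis using \<gamma> AW_id by (intro bexI[of _ id] bexI[of _ \<gamma>]) auto
    next
      case False
      define c where "c = 2 * b \<gamma> \<beta> / b \<gamma> \<gamma>"
      have "c \<in> \<int>"
        using lroot_cartan_int[OF R_D(1)[OF assms(1) PR_D(3)[OF assms(1) \<gamma>P]]
            R_D(1)[OF assms(1) PR_D(3)[OF assms(1) Suc.prems(1)]]]
        by (simp add: c_def b_fp PR_D(5)[OF assms(1)] \<gamma>P Suc.prems(1))
      moreover have "0 < c" unfolding c_def using \<gamma>(2) norm by (simp add: b_sym[of \<gamma> \<beta>])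
      ultimately have "1 \<le> c" by (auto elim!: Ints_cases)
      have "1 \<le> ht \<gamma>" using PR_D(2)[OF assms(1) \<gamma>P] RT_ht(3)[OF assms(1) PR_D(1)[OF assms(1) \<gamma>P]]
        by (auto elim!: Ints_cases)
      with \<open>1 \<le> c\<close> have "1 \<le> c * ht \<gamma>" using mult_mono[of 1 c 1 "ht \<gamma>"] by simp
      then have "ht (refl \<gamma> \<beta>) \<le> real n" using Suc.prems(2) by (simp add: refl_def ht_simps c_def)
      then obtain w \<eta> where "w \<in> AW J" "\<eta> \<in> PS J" "refl \<gamma> \<beta> = w \<eta>"
        using Suc.IH[OF simple_refl_PR[OF assms(1) \<gamma>(1) Suc.prems(1) False]] by blast
      moreover then have "\<beta> = (refl \<gamma> \<circ> w) \<eta>" using refl_refl[of \<gamma> \<beta>] norm by simp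
      ultimately show ?thesis using AW_comp[OF AW_refl[OF \<gamma>(1)]] by blast
    qed
  qed
  then show ?thesis using assms(2) real_nat_ceiling_ge[of "ht \<beta>"] by blast
qed

text \<open>Conjugating a simple reflection yields the reflection in any conjugate root, and
  opposite roots have the same reflection.\<close>

lemma refl_PR_AW:
  assumes "J \<subseteq> I" "\<beta> \<in> RT J"
  shows "refl \<beta> \<in> AW J"
proof -
  have "refl \<beta> \<in> AW J" if \<beta>: "\<beta> \<in> PR J" for \<beta>
  proof -
    obtain w \<gamma> where w: "w \<in> AW J" "\<gamma> \<in> PS J" "\<beta> = w \<gamma>" using PR_conj_Pi[OF assms(1) \<beta>] by blast
    then have "refl \<beta> = w \<circ> refl \<gamma> \<circ> inv w" using isom_refl_conj[OF isom_AW[OF assms(1)]] by simp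
    then show ?thesis using w AW_inv[OF assms(1)] by (metis AW_comp AW_refl)
  qed
  from this[of \<beta>] this[of "- \<beta>"] show ?thesis
    using RT_ht(2)[OF assms] assms RT_minus[OF assms] by (cases "0 < ht \<beta>") (auto simp: PR_def refl_minus ht_simps)
qed

section \<open>Length and inversion sets\<close>

lemma components_I: "dynkin_components D I = {I}"
proof -
  have "C = I" if C: "C \<in> dynkin_components D I" for C
  proof (rule ccontr)
    assume "C \<noteq> I"
    moreover have "C \<subseteq> I" "C \<noteq> {}" using component_connected_diagram[OF order_refl C] connected_diagram_D by auto
    ultimately obtain i j where "i \<in> I - C" "j \<in> C" "b (\<alpha> i) (\<alpha> j) \<noteq> 0"
      using diagram_connected by blast
    then show False using component_closed[OF order_refl C, of j i] by (auto simp: b_sym)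
  qed
  moreover have "\<exists>C. C \<in> dynkin_components D I"
    using component_cover[OF order_refl, of 1] rank_pos by auto
  ultimately show ?thesis by blast
qed

text \<open>On the connected diagram \<open>I\<close> the only affine simple root is \<delta> -
  \<theta> = \<alpha> 0. Hence the case J = I of all results on \<open>PS J\<close> is the full
  affine root system.\<close>

lemma PS_I: "PS I = \<alpha> ` {..rk D}"
proof -
  have "PS I = \<alpha> ` I \<union> {\<alpha> 0}"
    unfolding par_simple_roots_def null_root_eq components_I UN_insert UN_empty highest_root_I by simp
  moreover have "{..rk D} = insert 0 I" by auto
  ultimately show ?thesis by (metis Un_insert_right image_insert sup_bot_right)
qed

lemma weyl_eq: "weyl D = AW I"
proof -
  have "srefl D ` {0..rk D} = refl ` PS I"
    unfolding PS_I image_image by (intro image_cong) (auto simp: srefl_eq)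
  then show ?thesis unfolding weyl_def AW_def by metis
qed

lemma re_roots_eq: "re_roots D = RT I"
proof
  have simple: "\<alpha> i \<in> RT I" if "i \<le> rk D" for i
  proof -
    have "\<alpha> i \<in> PS I" unfolding PS_I using that by blast
    then show ?thesis using Pi_PR PR_D(1) by blast
  qed
  show "re_roots D \<subseteq> RT I"
    unfolding re_roots_def weyl_eq using simple AW_RT[OF order_refl] by blast
  have pos: "\<exists>w i. \<beta> = w (\<alpha> i) \<and> w \<in> AW I \<and> i \<le> rk D" if "\<beta> \<in> PR I" for \<beta>
    using PR_conj_Pi[OF order_refl that] unfolding PS_I by blast
  show "RT I \<subseteq> re_roots D"
  proof
    fix \<beta> assume \<beta>: "\<beta> \<in> RT I"
    show "\<beta> \<in> re_roots D"
    proof (cases "0 < ht \<beta>")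
      case True
      then show ?thesis unfolding re_roots_def weyl_eq using pos \<beta> by (auto simp: PR_def)
    next
      case False
      then have "- \<beta> \<in> PR I"
        using RT_ht(2)[OF order_refl \<beta>] RT_minus[OF order_refl \<beta>] by (auto simp: PR_def ht_simps)
      then obtain w i where w: "- \<beta> = w (\<alpha> i)" "w \<in> AW I" "i \<le> rk D" using pos by blast
      then have "\<beta> = (w \<circ> refl (\<alpha> i)) (\<alpha> i)"
        using isom_D(8)[OF isom_AW[OF order_refl w(2)]] root_norm_neq_0[OF w(3)]
        by (metis comp_apply minus_minus refl_self)
      moreover have "w \<circ> refl (\<alpha> i) \<in> AW I"
      proof (intro AW_comp AW_refl w)
        show "\<alpha> i \<in> PS I" unfolding PS_I using w(3) by blast
      qed
      ultimately show ?thesis unfolding re_roots_def weyl_eq using w(3) by blast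
    qed
  qed
qed

lemma im_roots_eq: "im_roots D = {of_int m *\<^sub>R \<delta> | m. m \<noteq> 0}"
  by (simp add: im_roots_def null_root_eq)

lemma nonneg_comb_iff:
  assumes "v \<in> Q"
  shows "(\<exists>c :: nat \<Rightarrow> nat. v = (\<Sum>i\<le>rk D. real (c i) *\<^sub>R \<alpha> i)) \<longleftrightarrow>
    (\<forall>i\<le>rk D. cf i v \<in> \<int> \<and> 0 \<le> cf i v)"
proof
  assume "\<exists>c :: nat \<Rightarrow> nat. v = (\<Sum>i\<le>rk D. real (c i) *\<^sub>R \<alpha> i)"
  then obtain c :: "nat \<Rightarrow> nat" where c: "v = (\<Sum>i\<le>rk D. real (c i) *\<^sub>R \<alpha> i)" by blast
  have "cf i v = real (c i)" if "i \<le> rk D" for i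
  proof -
    have "cf i v = (\<Sum>j\<le>rk D. real (c j) * cf i (\<alpha> j))" unfolding c using that by (simp add: cf_simps)
    also have "\<dots> = (\<Sum>j\<le>rk D. if j = i then real (c i) else 0)"
      using that by (intro sum.cong) (auto simp: cf_root)
    finally show ?thesis using that by simp
  qed
  then show "\<forall>i\<le>rk D. cf i v \<in> \<int> \<and> 0 \<le> cf i v" by simp
next
  assume nn: "\<forall>i\<le>rk D. cf i v \<in> \<int> \<and> 0 \<le> cf i v"
  have "real (nat \<lfloor>cf i v\<rfloor>) = cf i v" if "i \<le> rk D" for i
    using nn that by (auto elim!: Ints_cases dest!: spec[of _ i])
  then have "(\<Sum>i\<le>rk D. real (nat \<lfloor>cf i v\<rfloor>) *\<^sub>R \<alpha> i) = (\<Sum>i\<le>rk D. cf i v *\<^sub>R \<alpha> i)"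
    by (intro sum.cong) auto
  then have "v = (\<Sum>i\<le>rk D. real (nat \<lfloor>cf i v\<rfloor>) *\<^sub>R \<alpha> i)"
    using span_expand(1)[OF assms order_refl] by simp
  then show "\<exists>c :: nat \<Rightarrow> nat. v = (\<Sum>i\<le>rk D. real (c i) *\<^sub>R \<alpha> i)"
    by (intro exI[of _ "\<lambda>i. nat \<lfloor>cf i v\<rfloor>"])
qed

lemma nonneg_ht: "\<exists>c :: nat \<Rightarrow> nat. v = (\<Sum>i\<le>rk D. real (c i) *\<^sub>R \<alpha> i) \<Longrightarrow> 0 \<le> ht v"
proof -
  assume c: "\<exists>c :: nat \<Rightarrow> nat. v = (\<Sum>i\<le>rk D. real (c i) *\<^sub>R \<alpha> i)"
  then have "v \<in> Q" by (auto intro!: span_sum span_scale simple_Q)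
  then show "0 \<le> ht v" using nonneg_comb_iff[of v] c unfolding ht_def by (auto intro!: sum_nonneg)
qed

lemma PI_D: "\<beta> \<in> PI \<Longrightarrow> 0 < ht \<beta>" "\<beta> \<in> PI \<Longrightarrow> fp \<beta> = 0" "\<beta> \<in> PI \<Longrightarrow> \<beta> \<in> im_roots D"
proof -
  assume "\<beta> \<in> PI"
  then obtain m :: nat where m: "\<beta> = real m *\<^sub>R \<delta>" "1 \<le> m" by (auto simp: PI_def)
  then show "0 < ht \<beta>" "fp \<beta> = 0" using ht_\<delta> by (auto simp: ht_simps fp_simps)
  show "\<beta> \<in> im_roots D" unfolding im_roots_eq using m by (auto intro!: exI[of _ "int m"])
qed

lemma RT_fp_neq_0: "J \<subseteq> I \<Longrightarrow> \<beta> \<in> RT J \<Longrightarrow> fp \<beta> \<noteq> 0"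
  using R_D(1)[of J "fp \<beta>"] by (auto simp: RT_def lroot_def)

text \<open>Positive height has to be upgraded to nonnegative coordinates. Once the
  \<delta>-coefficient is at least 1, the marks outweigh the coordinates of the finite part, because
  these are bounded by the highest root; with coefficient 0 sign coherence of finite roots
  applies.\<close>

lemma pos_roots_eq: "pos_roots D = PR I \<union> PI"
proof
  show "pos_roots D \<subseteq> PR I \<union> PI"
  proof
    fix \<beta> assume "\<beta> \<in> pos_roots D"
    then have \<beta>: "\<beta> \<in> RT I \<or> \<beta> \<in> im_roots D" "0 \<le> ht \<beta>"
      using nonneg_ht unfolding pos_roots_def all_roots_def re_roots_eq by blast+
    then show "\<beta> \<in> PR I \<union> PI"
    proof (elim disjE)
      assume "\<beta> \<in> RT I"
      then show ?thesis using RT_ht(2)[OF order_refl, of \<beta>] \<beta>(2) by (auto simp: PR_def)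
    next
      assume "\<beta> \<in> im_roots D"
      then obtain m :: int where m: "m \<noteq> 0" "\<beta> = of_int m *\<^sub>R \<delta>" by (auto simp: im_roots_eq)
      then have "0 \<le> m" using \<beta>(2) ht_\<delta> by (simp add: ht_simps zero_le_mult_iff)
      then have "\<beta> = real (nat m) *\<^sub>R \<delta>" "1 \<le> nat m" using m by auto
      then show ?thesis unfolding PI_def by blast
    qed
  qed
  show "PR I \<union> PI \<subseteq> pos_roots D"
  proof
    fix \<beta> assume \<beta>: "\<beta> \<in> PR I \<union> PI"
    then have all: "\<beta> \<in> all_roots D"
      unfolding all_roots_def re_roots_eq using PI_D(3) by (auto simp: PR_def)
    have \<beta>Q: "\<beta> \<in> Q"
      using \<beta> PR_D(5)[OF order_refl] span_scale[OF \<delta>_span] by (auto simp: PI_def)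
    have "cf i \<beta> \<in> \<int> \<and> 0 \<le> cf i \<beta>" if i: "i \<le> rk D" for i
      using \<beta>
    proof
      assume "\<beta> \<in> PI"
      then show ?thesis using mk_pos[OF i] by (auto simp: PI_def cf_simps i cf_\<delta> less_imp_le)
    next
      assume b: "\<beta> \<in> PR I"
      note b' = PR_D[OF order_refl b]
      show ?thesis
      proof (cases "i = 0")
        case True
        then show ?thesis using b'(4) PR_cf0[OF order_refl b] by simp
      next
        case False
        then have iI: "i \<in> I" using i by auto
        have c: "cf i \<beta> = cf 0 \<beta> * of_int (mk i) + cf i (fp \<beta>)"
          by (subst fp_decomp[of \<beta>]) (simp add: cf_simps i cf_\<delta>)
        have "cf i (fp \<beta>) \<in> \<int>" using R_cf_Ints[OF order_refl b'(3) iI] .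
        then have "cf i \<beta> \<in> \<int>" unfolding c using b'(4) by auto
        moreover have "0 \<le> cf i \<beta>"
        proof (cases "1 \<le> cf 0 \<beta>")
          case True
          then have "of_int (mk i) \<le> cf 0 \<beta> * of_int (mk i)" using mk_pos[OF i]
            by (simp add: mult_le_cancel_right1)
          moreover have "- cf i (fp \<beta>) \<le> of_int (mk i)"
            using R_cf_bound[OF order_refl R_minus[OF order_refl b'(3)] iI] by (simp add: cf_simps i)
          ultimately show ?thesis unfolding c by simp
        next
          case False
          then have z: "cf 0 \<beta> = 0" "0 < ht (fp \<beta>)"
            using RT_ht(1)[OF order_refl b'(1)] b'(2) by auto
          then show ?thesis unfolding c
            using lroot_ht_pos_iff(1)[OF R_D(1)[OF order_refl b'(3)]] iI by simp
        qed
        ultimately show ?thesis by simp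
      qed
    qed
    then show "\<beta> \<in> pos_roots D"
      unfolding pos_roots_def using all nonneg_comb_iff[OF \<beta>Q] by blast
  qed
qed

lemma pos_roots_iff: "\<beta> \<in> all_roots D \<Longrightarrow> \<beta> \<in> pos_roots D \<longleftrightarrow> 0 < ht \<beta>"
proof
  show "\<beta> \<in> pos_roots D \<Longrightarrow> 0 < ht \<beta>" unfolding pos_roots_eq using PI_D(1) by (auto simp: PR_def)
  assume \<beta>: "\<beta> \<in> all_roots D" "0 < ht \<beta>"
  then consider "\<beta> \<in> RT I" | m where "\<beta> = of_int m *\<^sub>R \<delta>" "m \<noteq> 0"
    unfolding all_roots_def re_roots_eq im_roots_eq by blast
  then show "\<beta> \<in> pos_roots D"
  proof cases
    case 1
    then show ?thesis unfolding pos_roots_eq using \<beta> by (simp add: PR_def)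
  next
    case 2
    then have "0 < m" using \<beta>(2) ht_\<delta> by (simp add: ht_simps zero_less_mult_iff)
    then have "\<beta> = real (nat m) *\<^sub>R \<delta>" "1 \<le> nat m" using 2 by auto
    then show ?thesis unfolding pos_roots_eq PI_def by blast
  qed
qed

lemma all_roots_minus: "\<beta> \<in> all_roots D \<Longrightarrow> - \<beta> \<in> all_roots D"
proof -
  assume "\<beta> \<in> all_roots D"
  then consider "\<beta> \<in> RT I" | m where "\<beta> = of_int m *\<^sub>R \<delta>" "m \<noteq> 0"
    unfolding all_roots_def re_roots_eq im_roots_eq by blast
  then show "- \<beta> \<in> all_roots D"
  proof cases
    case 1
    then show ?thesis unfolding all_roots_def re_roots_eq using RT_minus[OF order_refl] by blast
  next
    case 2
    then have "- \<beta> = of_int (- m) *\<^sub>R \<delta>" "- m \<noteq> 0" by auto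
    then show ?thesis unfolding all_roots_def im_roots_eq by blast
  qed
qed

lemma neg_roots_iff: "\<beta> \<in> all_roots D \<Longrightarrow> \<beta> \<in> neg_roots D \<longleftrightarrow> ht \<beta> < 0"
  using pos_roots_iff[OF all_roots_minus] by (simp add: neg_roots_def ht_simps)

lemma RT_all: "J \<subseteq> I \<Longrightarrow> \<beta> \<in> RT J \<Longrightarrow> \<beta> \<in> all_roots D"
  unfolding all_roots_def re_roots_eq using RT_mono[OF _ order_refl, of J] by auto

lemma PI_all: "\<beta> \<in> PI \<Longrightarrow> \<beta> \<in> all_roots D"
  unfolding all_roots_def using PI_D(3) by simp

text \<open>The conjugate of a simple reflection by \<open>w\<close> is the orthogonal reflection in
  the image root, so the description does not depend on the choice of \<open>w\<close> and
  \<open>i\<close>.\<close>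

lemma refl_in_eq:
  assumes "\<beta> \<in> RT I"
  shows "refl_in D \<beta> = refl \<beta>"
  unfolding refl_in_def
proof (rule the_equality)
  have conj: "w \<circ> srefl D i \<circ> inv w = refl (w (\<alpha> i))" if "w \<in> AW I" "i \<le> rk D" for w i
    using isom_refl_conj[OF isom_AW[OF order_refl that(1)]] srefl_eq[OF that(2)] by simp
  obtain w i where w: "w \<in> AW I" "i \<le> rk D" "\<beta> = w (\<alpha> i)"
    using assms unfolding re_roots_eq[symmetric] re_roots_def weyl_eq by blast
  then show "\<exists>w\<in>weyl D. \<exists>i\<le>rk D. \<beta> = w (\<alpha> i) \<and> refl \<beta> = w \<circ> srefl D i \<circ> inv w"
    unfolding weyl_eq using conj by metis
  fix r assume "\<exists>w\<in>weyl D. \<exists>i\<le>rk D. \<beta> = w (\<alpha> i) \<and> r = w \<circ> srefl D i \<circ> inv w"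
  then show "r = refl \<beta>" unfolding weyl_eq using conj by metis
qed

lemma PS_RT: "J \<subseteq> I \<Longrightarrow> \<gamma> \<in> PS J \<Longrightarrow> \<gamma> \<in> RT J"
  using Pi_PR PR_D(1) by blast

lemma par_gens_eq: "J \<subseteq> I \<Longrightarrow> par_gens D J = refl ` PS J"
  unfolding par_gens_def using PS_RT[of J] RT_mono[OF _ order_refl, of J]
  by (intro image_cong refl refl_in_eq) auto

lemma par_weyl_eq: "J \<subseteq> I \<Longrightarrow> par_weyl D J = AW J"
  unfolding par_weyl_def AW_def by (simp only: par_gens_eq)

text \<open>The highest root of a component of \<open>K\<close> may differ from those of
  \<open>J\<close>, so a generator for \<open>K\<close> need not be one for \<open>J\<close>; it is
  still the reflection in a real root of \<open>J\<close>.\<close>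

lemma AW_mono: "K \<subseteq> J \<Longrightarrow> J \<subseteq> I \<Longrightarrow> AW K \<subseteq> AW J"
proof -
  assume KJ: "K \<subseteq> J" "J \<subseteq> I"
  have "refl ` PS K \<subseteq> generated_group (refl ` PS J)"
    using refl_PR_AW[OF KJ(2)] PS_RT[of K] RT_mono[OF KJ] KJ unfolding AW_def by blast
  then show "AW K \<subseteq> AW J"
    using generated_group_subset[of "refl ` PS J" "refl ` PS K"] isom_D(2)[OF isom_refl_Pi[OF KJ(2)]]
    unfolding AW_def by blast
qed

lemma fin_weyl_AW: "J \<subseteq> I \<Longrightarrow> w \<in> fin_weyl D J \<Longrightarrow> w \<in> AW J"
proof -
  assume J: "J \<subseteq> I" "w \<in> fin_weyl D J"
  have "J \<subseteq> {..rk D}" using J by auto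
  with J(2) show "w \<in> AW J"
    by (induction rule: fin_weyl_induct) (blast intro: AW_id AW_comp AW_refl Pi_fin[OF J(1)])+
qed

lemma im_pos_roots_eq: "im_pos_roots D = PI"
  unfolding im_pos_roots_def pos_roots_eq
proof -
  have "\<beta> \<notin> im_roots D" if "\<beta> \<in> PR I" for \<beta>
    using RT_fp_neq_0[OF order_refl PR_D(1)[OF order_refl that]] by (auto simp: im_roots_eq fp_simps)
  then show "im_roots D \<inter> (PR I \<union> PI) = PI" using PI_D(3) by blast
qed

lemma re_pos_roots_eq: "re_pos_roots D = PR I"
  unfolding re_pos_roots_def pos_roots_eq re_roots_eq
  using PI_D(2) RT_fp_neq_0[OF order_refl] unfolding PR_def by blast

lemma affinize_eq:
  assumes "P \<subseteq> R I"
  shows "affinize D P = {\<beta> \<in> PR I. fp \<beta> \<in> P}"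
proof -
  have "\<exists>m::nat. \<exists>\<epsilon>. \<beta> = of_nat m *\<^sub>R \<delta> + \<epsilon> \<and> \<epsilon> \<in> P" if "\<beta> \<in> PR I" "fp \<beta> \<in> P" for \<beta>
  proof -
    have "cf 0 \<beta> \<in> \<int>" "0 \<le> cf 0 \<beta>" using PR_D(4) PR_cf0 that by blast+
    then have "cf 0 \<beta> = of_nat (nat \<lfloor>cf 0 \<beta>\<rfloor>)" by (auto elim!: Ints_cases)
    then show ?thesis using fp_decomp[of \<beta>] that by metis
  qed
  moreover have "fp (of_nat m *\<^sub>R \<delta> + \<epsilon>) = \<epsilon>" if "\<epsilon> \<in> P" for m \<epsilon>
    using that assms fp_R[OF order_refl, of \<epsilon>] by (auto simp: fp_simps)
  ultimately show ?thesis
    unfolding affinize_def re_pos_roots_eq null_root_eq by auto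
qed

lemma PR_I_iff: "J \<subseteq> I \<Longrightarrow> \<beta> \<in> PR I \<and> fp \<beta> \<in> R J \<longleftrightarrow> \<beta> \<in> PR J"
  using RT_mono[OF _ order_refl, of J] by (auto simp: PR_def RT_def)

lemma par_re_pos_eq: "J \<subseteq> I \<Longrightarrow> par_re_pos D J = PR J"
  unfolding par_re_pos_def using affinize_eq[OF R_mono[of J I]] PR_I_iff[of J] by auto

lemma par_pos_eq: "J \<subseteq> I \<Longrightarrow> par_pos D J = PR J \<union> PI"
  unfolding par_pos_def by (simp only: par_re_pos_eq im_pos_roots_eq)

lemma fin_diff_neg_eq:
  assumes "J \<subseteq> I"
  shows "fin_diff_neg D J K = {\<epsilon> \<in> R J. \<epsilon> \<notin> R K \<and> ht \<epsilon> < 0}"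
proof -
  have "\<epsilon> \<in> neg_roots D \<longleftrightarrow> ht \<epsilon> < 0" if "\<epsilon> \<in> R J" for \<epsilon>
    by (rule neg_roots_iff[OF RT_all[OF assms R_RT[OF assms that]]])
  then show ?thesis unfolding fin_diff_neg_def by blast
qed

lemma min_reps_eq:
  assumes "K \<subseteq> J" "J \<subseteq> I"
  shows "min_reps D J K = {w \<in> fin_weyl D J. \<forall>k\<in>K. 0 < ht (w (\<alpha> k))}"
  unfolding min_reps_def
proof -
  have "w (\<alpha> k) \<in> pos_roots D \<longleftrightarrow> 0 < ht (w (\<alpha> k))" if "w \<in> fin_weyl D J" "k \<in> K" for w k
  proof -
    have "\<alpha> k \<in> R J" using that assms R_simple by blast
    then have "w (\<alpha> k) \<in> R J" using fin_weyl_R that by blast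
    then show ?thesis using pos_roots_iff RT_all[OF assms(2) R_RT[OF assms(2)]] by blast
  qed
  then show "{w \<in> fin_weyl D J. \<forall>k\<in>K. w (\<alpha> k) \<in> pos_roots D} =
    {w \<in> fin_weyl D J. \<forall>k\<in>K. 0 < ht (w (\<alpha> k))}" by blast
qed

text \<open>Weyl group elements fix \<delta>, so imaginary roots are never inverted and the
  inversion set can be taken inside \<open>PR J\<close>.\<close>

definition Inv :: "nat set \<Rightarrow> ('v \<Rightarrow> 'v) \<Rightarrow> 'v set" where
  "Inv J y = {\<beta> \<in> PR J. ht (inv y \<beta>) < 0}"

lemma Inv_id: "Inv J id = {}"
  by (auto simp: Inv_def PR_def)

lemma inversion_set_eq:
  assumes "J \<subseteq> I" "y \<in> AW I"
  shows "inversion_set D J y = Inv J y"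
proof -
  have isom: "isom (inv y)" using isom_inv[OF isom_AW[OF order_refl assms(2)]] .
  have "inv y \<beta> = \<beta>" if "\<beta> \<in> PI" for \<beta> using that isom_D[OF isom] by (auto simp: PI_def)
  then have "inv y \<beta> \<notin> neg_roots D" if "\<beta> \<in> PI" for \<beta>
    using that neg_roots_iff[OF PI_all[OF that]] PI_D(1)[OF that] by simp
  moreover have "inv y \<beta> \<in> neg_roots D \<longleftrightarrow> ht (inv y \<beta>) < 0" if "\<beta> \<in> PR J" for \<beta>
  proof -
    have "\<beta> \<in> RT I" using PR_D(1)[OF assms(1) that] RT_mono[OF assms(1) order_refl] by blast
    then show ?thesis using AW_RT[OF order_refl AW_inv[OF order_refl assms(2)]] neg_roots_iff RT_all by blast
  qed
  ultimately show ?thesis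
    unfolding inversion_set_def par_pos_eq[OF assms(1)] Inv_def by blast
qed

lemma word_prod_simps [simp]: "word_prod [] = id" "word_prod (s # ws) = s \<circ> word_prod ws"
  by (simp_all add: word_prod_def)

lemma word_prod_append: "word_prod (xs @ ys) = word_prod xs \<circ> word_prod ys"
  by (induction xs) (simp_all add: o_assoc)

lemma word_prod_AW: "set ws \<subseteq> refl ` PS J \<Longrightarrow> word_prod ws \<in> AW J"
  by (induction ws) (auto intro: AW_id AW_comp AW_refl simp del: comp_apply)

lemma AW_word:
  assumes "J \<subseteq> I" "w \<in> AW J"
  shows "\<exists>ws. set ws \<subseteq> refl ` PS J \<and> word_prod ws = w"
  using assms(2,1)
proof (induction rule: AW_induct)
  case id
  then show ?case by (intro exI[of _ "[]"]) simp
next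
  case (step \<gamma> w)
  then obtain ws where "set ws \<subseteq> refl ` PS J" "word_prod ws = w" by blast
  then show ?case using step(1) by (intro exI[of _ "refl \<gamma> # ws"]) simp
qed

lemma PS_norm: "J \<subseteq> I \<Longrightarrow> \<gamma> \<in> PS J \<Longrightarrow> b \<gamma> \<gamma> \<noteq> 0"
  using RT_norm[of J \<gamma>] PS_RT[of J \<gamma>] by simp

lemma inv_refl_comp:
  assumes "J \<subseteq> I" "\<gamma> \<in> PS J" "x \<in> AW J"
  shows "inv (refl \<gamma> \<circ> x) \<beta> = inv x (refl \<gamma> \<beta>)"
proof -
  have "inv (refl \<gamma> \<circ> x) = inv x \<circ> inv (refl \<gamma>)"
    using isom_D(2)[OF isom_refl_Pi[OF assms(1,2)]] isom_D(2)[OF isom_AW[OF assms(1,3)]]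
    by (intro o_inv_distrib)
  then show ?thesis using inv_refl[OF PS_norm[OF assms(1,2)]] by simp
qed

text \<open>If \<beta> is the root of the first letter, delete that letter. Otherwise its reflection
  keeps \<beta> positive, and the reflected root is inverted by the rest of the word.\<close>

lemma strong_exchange:
  assumes "J \<subseteq> I" "set ws \<subseteq> refl ` PS J" "\<beta> \<in> PR J" "ht (inv (word_prod ws) \<beta>) < 0"
  shows "\<exists>ws'. set ws' \<subseteq> refl ` PS J \<and> length ws = Suc (length ws') \<and>
    word_prod ws' = refl \<beta> \<circ> word_prod ws"
  using assms(2-4)
proof (induction ws arbitrary: \<beta>)
  case Nil
  then show ?case using PR_D(2)[OF assms(1)] by (force simp: inv_id[unfolded id_def] id_def)
next
  case (Cons s ws)
  then obtain \<gamma> where \<gamma>: "\<gamma> \<in> PS J" "s = refl \<gamma>" by auto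
  have ws: "set ws \<subseteq> refl ` PS J" using Cons.prems by simp
  have x: "word_prod ws \<in> AW J" by (rule word_prod_AW[OF ws])
  have inv: "inv (word_prod (s # ws)) \<beta> = inv (word_prod ws) (refl \<gamma> \<beta>)"
    using inv_refl_comp[OF assms(1) \<gamma>(1) x] \<gamma>(2) by simp
  have norm: "b \<gamma> \<gamma> \<noteq> 0" by (rule PS_norm[OF assms(1) \<gamma>(1)])
  show ?case
  proof (cases "\<beta> = \<gamma>")
    case True
    then have "word_prod ws = refl \<beta> \<circ> word_prod (s # ws)"
      using norm \<gamma>(2) by (simp add: fun_eq_iff refl_refl)
    with ws show ?thesis by (metis length_Cons)
  next
    case False
    have s\<beta>: "refl \<gamma> \<beta> \<in> PR J" by (rule simple_refl_PR[OF assms(1) \<gamma>(1) Cons.prems(2) False])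
    obtain ws' where ws': "set ws' \<subseteq> refl ` PS J" "length ws = Suc (length ws')"
      "word_prod ws' = refl (refl \<gamma> \<beta>) \<circ> word_prod ws"
      using Cons.IH[OF ws s\<beta>] Cons.prems(3) unfolding inv by blast
    have "refl \<gamma> (refl (refl \<gamma> \<beta>) v) = refl \<beta> (refl \<gamma> v)" for v
      using isom_refl_apply[OF isom_refl_Pi[OF assms(1) \<gamma>(1)], of "refl \<gamma> \<beta>" v]
      unfolding refl_refl[OF norm] .
    then have "word_prod (s # ws') = refl \<beta> \<circ> word_prod (s # ws)"
      using ws'(3) \<gamma>(2) by (simp add: fun_eq_iff)
    then show ?thesis using ws' \<gamma> by (intro exI[of _ "s # ws'"]) auto
  qed
qed

lemma Inv_refl_iff:
  assumes "J \<subseteq> I" "\<gamma> \<in> PS J" "x \<in> AW J" "\<beta> \<in> PR J" "\<beta> \<noteq> \<gamma>"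
  shows "\<beta> \<in> Inv J (refl \<gamma> \<circ> x) \<longleftrightarrow> refl \<gamma> \<beta> \<in> Inv J x"
  using inv_refl_comp[OF assms(1-3)] simple_refl_PR[OF assms(1,2,4,5)] assms(4) by (simp add: Inv_def)

lemma Inv_refl_self_iff:
  assumes "J \<subseteq> I" "\<gamma> \<in> PS J" "x \<in> AW J"
  shows "\<gamma> \<in> Inv J (refl \<gamma> \<circ> x) \<longleftrightarrow> \<gamma> \<notin> Inv J x"
proof -
  have "inv (refl \<gamma> \<circ> x) \<gamma> = - inv x \<gamma>"
    using inv_refl_comp[OF assms] refl_self[OF PS_norm[OF assms(1,2)]]
      isom_D(8)[OF isom_inv[OF isom_AW[OF assms(1,3)]]] by simp
  moreover have "ht (inv x \<gamma>) \<noteq> 0"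
    using RT_ht(2)[OF assms(1) AW_RT[OF assms(1) AW_inv[OF assms(1,3)] PS_RT[OF assms(1,2)]]] .
  ultimately show ?thesis using Pi_PR[OF assms(1,2)] by (auto simp: Inv_def ht_simps)
qed

text \<open>The reflection permutes the positive roots other than \<gamma> and reverses the sign of
  \<gamma>, so the inversion set is transported and \<gamma> is toggled.\<close>

lemma Inv_refl:
  assumes "J \<subseteq> I" "\<gamma> \<in> PS J" "x \<in> AW J"
  shows "Inv J (refl \<gamma> \<circ> x) = (if \<gamma> \<in> Inv J x then {} else {\<gamma>}) \<union> refl \<gamma> ` (Inv J x - {\<gamma>})"
proof -
  have norm: "b \<gamma> \<gamma> \<noteq> 0" by (rule PS_norm[OF assms(1,2)])
  have 1: "\<beta> \<in> Inv J (refl \<gamma> \<circ> x) \<longleftrightarrow> \<beta> \<in> refl \<gamma> ` (Inv J x - {\<gamma>})" if "\<beta> \<noteq> \<gamma>" for \<beta>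
  proof
    assume b: "\<beta> \<in> Inv J (refl \<gamma> \<circ> x)"
    then have \<beta>: "\<beta> \<in> PR J" by (simp add: Inv_def)
    have "refl \<gamma> \<beta> \<noteq> \<gamma>"
    proof
      assume "refl \<gamma> \<beta> = \<gamma>"
      then have "\<beta> = - \<gamma>" using refl_refl[OF norm, of \<beta>] refl_self[OF norm] by simp
      then show False using \<beta> Pi_PR[OF assms(1,2)] by (simp add: PR_def ht_simps)
    qed
    then show "\<beta> \<in> refl \<gamma> ` (Inv J x - {\<gamma>})"
      using b Inv_refl_iff[OF assms \<beta> that] refl_refl[OF norm, of \<beta>] by (metis Diff_iff image_eqI singletonD)
  next
    assume "\<beta> \<in> refl \<gamma> ` (Inv J x - {\<gamma>})"
    then obtain \<eta> where \<eta>: "\<beta> = refl \<gamma> \<eta>" "\<eta> \<in> Inv J x" "\<eta> \<noteq> \<gamma>" by auto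
    then have "\<beta> \<in> PR J" using simple_refl_PR[OF assms(1,2)] by (simp add: Inv_def)
    then show "\<beta> \<in> Inv J (refl \<gamma> \<circ> x)"
      using Inv_refl_iff[OF assms _ that] \<eta> refl_refl[OF norm, of \<eta>] by simp
  qed
  have 2: "\<gamma> \<notin> refl \<gamma> ` (Inv J x - {\<gamma>})"
  proof
    assume "\<gamma> \<in> refl \<gamma> ` (Inv J x - {\<gamma>})"
    then obtain \<eta> where \<eta>: "\<gamma> = refl \<gamma> \<eta>" "\<eta> \<in> PR J" by (auto simp: Inv_def)
    then have "\<eta> = - \<gamma>" using refl_refl[OF norm, of \<eta>] refl_self[OF norm] by simp
    then show False using \<eta>(2) Pi_PR[OF assms(1,2)] by (simp add: PR_def ht_simps)
  qed
  show ?thesis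
  proof (rule set_eqI)
    fix \<beta>
    show "\<beta> \<in> Inv J (refl \<gamma> \<circ> x) \<longleftrightarrow> \<beta> \<in> (if \<gamma> \<in> Inv J x then {} else {\<gamma>}) \<union> refl \<gamma> ` (Inv J x - {\<gamma>})"
      using 1[of \<beta>] 2 Inv_refl_self_iff[OF assms] by (cases "\<beta> = \<gamma>") auto
  qed
qed

lemma finite_Inv:
  assumes "J \<subseteq> I" "x \<in> AW J"
  shows "finite (Inv J x)"
  using assms(2,1)
proof (induction rule: AW_induct)
  case id
  show ?case unfolding Inv_id by simp
next
  case (step \<gamma> w)
  then have "finite ((if \<gamma> \<in> Inv J w then {} else {\<gamma>}) \<union> refl \<gamma> ` (Inv J w - {\<gamma>}))" by simp
  then show ?case unfolding Inv_refl[OF assms(1) step(1,2)] .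
qed

lemma card_Inv_refl:
  assumes "J \<subseteq> I" "\<gamma> \<in> PS J" "x \<in> AW J"
  shows "\<gamma> \<notin> Inv J x \<Longrightarrow> card (Inv J (refl \<gamma> \<circ> x)) = Suc (card (Inv J x))"
    and "card (Inv J (refl \<gamma> \<circ> x)) \<le> Suc (card (Inv J x))"
proof -
  have fin: "finite (Inv J x)" by (rule finite_Inv[OF assms(1,3)])
  have inj: "inj_on (refl \<gamma>) S" for S
    using isom_D(2)[OF isom_refl_Pi[OF assms(1,2)]] by (metis bij_is_inj inj_on_subset subset_UNIV)
  have le: "card (refl \<gamma> ` (Inv J x - {\<gamma>})) \<le> card (Inv J x)"
    using card_image[OF inj] card_mono[OF fin, of "Inv J x - {\<gamma>}"] by auto
  have "card (Inv J (refl \<gamma> \<circ> x)) \<le> card (if \<gamma> \<in> Inv J x then {} else {\<gamma>}) + card (refl \<gamma> ` (Inv J x - {\<gamma>}))"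
    unfolding Inv_refl[OF assms] by (rule card_Un_le)
  then show "card (Inv J (refl \<gamma> \<circ> x)) \<le> Suc (card (Inv J x))" using le by (auto split: if_splits)
  assume "\<gamma> \<notin> Inv J x"
  moreover have "\<gamma> \<notin> refl \<gamma> ` Inv J x"
  proof
    assume "\<gamma> \<in> refl \<gamma> ` Inv J x"
    then obtain \<eta> where \<eta>: "\<gamma> = refl \<gamma> \<eta>" "\<eta> \<in> PR J" by (auto simp: Inv_def)
    have norm: "b \<gamma> \<gamma> \<noteq> 0" by (rule PS_norm[OF assms(1,2)])
    have "\<eta> = - \<gamma>" using \<eta> refl_refl[OF norm, of \<eta>] refl_self[OF norm] by simp
    then show False using \<eta>(2) Pi_PR[OF assms(1,2)] by (simp add: PR_def ht_simps)
  qed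
  ultimately show "card (Inv J (refl \<gamma> \<circ> x)) = Suc (card (Inv J x))"
    using Inv_refl[OF assms] fin card_image[OF inj, of "Inv J x"] by simp
qed

lemma card_Inv_word:
  assumes "J \<subseteq> I" "set ws \<subseteq> refl ` PS J"
  shows "card (Inv J (word_prod ws)) \<le> length ws"
  using assms(2)
proof (induction ws)
  case Nil
  show ?case unfolding word_prod_simps Inv_id by simp
next
  case (Cons s ws)
  then obtain \<gamma> where \<gamma>: "\<gamma> \<in> PS J" "s = refl \<gamma>" by auto
  have "card (Inv J (refl \<gamma> \<circ> word_prod ws)) \<le> Suc (card (Inv J (word_prod ws)))"
    using Cons.prems by (intro card_Inv_refl(2)[OF assms(1) \<gamma>(1)] word_prod_AW) simp
  also have "\<dots> \<le> length (s # ws)" using Cons by simp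
  finally show ?case unfolding word_prod_simps \<gamma>(2) .
qed

text \<open>The tail of a shortest word is shortest. If the tail already inverted the root of the
  first letter, exchange would give a shorter word for the whole product; hence every letter adds
  exactly one inverted root.\<close>

lemma card_Inv_shortest:
  assumes "J \<subseteq> I" "set ws \<subseteq> refl ` PS J"
    and "\<And>ws'. set ws' \<subseteq> refl ` PS J \<Longrightarrow> word_prod ws' = word_prod ws \<Longrightarrow> length ws \<le> length ws'"
  shows "card (Inv J (word_prod ws)) = length ws"
  using assms(2,3)
proof (induction ws)
  case Nil
  show ?case unfolding word_prod_simps Inv_id by simp
next
  case (Cons s ws)
  then obtain \<gamma> where \<gamma>: "\<gamma> \<in> PS J" "s = refl \<gamma>" by auto
  have ws: "set ws \<subseteq> refl ` PS J" using Cons.prems(1) by simp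
  have IH: "card (Inv J (word_prod ws)) = length ws"
  proof (rule Cons.IH[OF ws])
    fix ws' assume "set ws' \<subseteq> refl ` PS J" "word_prod ws' = word_prod ws"
    then show "length ws \<le> length ws'" using Cons.prems(2)[of "s # ws'"] Cons.prems(1) by simp
  qed
  have "\<gamma> \<notin> Inv J (word_prod ws)"
  proof
    assume "\<gamma> \<in> Inv J (word_prod ws)"
    then obtain ws' where ws': "set ws' \<subseteq> refl ` PS J" "length ws = Suc (length ws')"
      "word_prod ws' = refl \<gamma> \<circ> word_prod ws"
      using strong_exchange[OF assms(1) ws] unfolding Inv_def by blast
    then show False using Cons.prems(2)[OF ws'(1)] \<gamma>(2) by simp
  qed
  from card_Inv_refl(1)[OF assms(1) \<gamma>(1) word_prod_AW[OF ws] this] show ?case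
    unfolding word_prod_simps \<gamma>(2) IH list.size(4) by linarith
qed

lemma reduced_word:
  assumes "J \<subseteq> I" "y \<in> AW J"
  obtains ws where "set ws \<subseteq> refl ` PS J" "word_prod ws = y" "length ws = card (Inv J y)"
proof -
  have ex: "\<exists>ws. set ws \<subseteq> refl ` PS J \<and> word_prod ws = y" by (rule AW_word[OF assms])
  then obtain ws where ws: "set ws \<subseteq> refl ` PS J \<and> word_prod ws = y"
    and min: "\<forall>ws'. set ws' \<subseteq> refl ` PS J \<and> word_prod ws' = y \<longrightarrow> length ws \<le> length ws'"
    using ex_has_least_nat[of "\<lambda>ws. set ws \<subseteq> refl ` PS J \<and> word_prod ws = y" _ length] by blast
  have "card (Inv J (word_prod ws)) = length ws"
    using ws min by (intro card_Inv_shortest[OF assms(1)]) auto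
  with ws have "length ws = card (Inv J y)" by simp
  with ws that show thesis by blast
qed

lemma par_length_eq:
  assumes "J \<subseteq> I" "y \<in> AW J"
  shows "par_length D J y = card (Inv J y)"
  unfolding par_length_def word_length_def par_gens_eq[OF assms(1)]
proof (rule Least_equality)
  show "\<exists>ws. set ws \<subseteq> refl ` PS J \<and> length ws = card (Inv J y) \<and> word_prod ws = y"
    using reduced_word[OF assms] by metis
  show "card (Inv J y) \<le> n" if "\<exists>ws. set ws \<subseteq> refl ` PS J \<and> length ws = n \<and> word_prod ws = y" for n
    using that card_Inv_word[OF assms(1)] by blast
qed

lemma Inv_empty:
  assumes "J \<subseteq> I" "y \<in> AW J" "Inv J y = {}"
  shows "y = id"
  using reduced_word[OF assms(1,2)] assms(3) by (metis card.empty length_0_conv word_prod_simps(1))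

section \<open>Biconvex sets\<close>

abbreviation PA :: "nat set \<Rightarrow> 'v set" where "PA J \<equiv> PR J \<union> PI"

lemma PR_PI_disjoint: "J \<subseteq> I \<Longrightarrow> \<beta> \<in> PR J \<Longrightarrow> \<beta> \<notin> PI"
  using RT_fp_neq_0[of J \<beta>] PI_D(2)[of \<beta>] by (auto simp: PR_def)

lemma PA_ht: "J \<subseteq> I \<Longrightarrow> \<beta> \<in> PA J \<Longrightarrow> 0 < ht \<beta>"
  using PI_D(1) by (auto simp: PR_def)

lemma isom_PI: "isom w \<Longrightarrow> \<beta> \<in> PI \<Longrightarrow> w \<beta> = \<beta>"
  by (auto simp: PI_def isom_D)

text \<open>Biconvexity for sets of real roots. Convexity of the complement is phrased as avoidance
  of \<open>B\<close>, which is equivalent because \<open>B\<close> consists of roots of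
  \<open>J\<close>.\<close>

definition real_biconvex :: "nat set \<Rightarrow> 'v set \<Rightarrow> bool" where
  "real_biconvex J B \<longleftrightarrow> B \<subseteq> PR J \<and> (\<forall>\<beta>\<in>B. \<forall>\<gamma>\<in>B. \<beta> + \<gamma> \<in> PA J \<longrightarrow> \<beta> + \<gamma> \<in> B) \<and>
    (\<forall>\<beta>\<in>PA J - B. \<forall>\<gamma>\<in>PA J - B. \<beta> + \<gamma> \<notin> B)"

lemma real_biconvex_D:
  assumes "real_biconvex J B"
  shows "B \<subseteq> PR J" "\<beta> \<in> B \<Longrightarrow> \<gamma> \<in> B \<Longrightarrow> \<beta> + \<gamma> \<in> PA J \<Longrightarrow> \<beta> + \<gamma> \<in> B"
    "\<beta> \<in> PA J \<Longrightarrow> \<beta> \<notin> B \<Longrightarrow> \<gamma> \<in> PA J \<Longrightarrow> \<gamma> \<notin> B \<Longrightarrow> \<beta> + \<gamma> \<notin> B"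
  using assms unfolding real_biconvex_def by blast+

lemma real_biconvex_iff:
  assumes "J \<subseteq> I"
  shows "biconvex D J B \<and> B \<subseteq> re_pos_roots D \<longleftrightarrow> real_biconvex J B"
proof -
  have "B \<subseteq> PA J \<and> B \<subseteq> PR I \<longleftrightarrow> B \<subseteq> PR J"
    using PR_mono[OF assms order_refl] PR_PI_disjoint[OF order_refl] by blast
  then show ?thesis
    unfolding biconvex_def root_convex_def par_pos_eq[OF assms] re_pos_roots_eq real_biconvex_def by blast
qed

text \<open>The inversion set and its complement are separated by a single linear functional, the
  height after applying the inverse of \<open>y\<close>.\<close>

lemma real_biconvex_Inv:
  assumes "J \<subseteq> I" "y \<in> AW J"
  shows "real_biconvex J (Inv J y)"
proof -
  have iso: "isom (inv y)" by (rule isom_inv[OF isom_AW[OF assms]])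
  have pi: "0 < ht (inv y \<beta>)" if "\<beta> \<in> PI" for \<beta>
    using isom_PI[OF iso that] PI_D(1)[OF that] by simp
  have add: "ht (inv y (\<beta> + \<gamma>)) = ht (inv y \<beta>) + ht (inv y \<gamma>)" for \<beta> \<gamma>
    by (simp add: isom_D(6)[OF iso] ht_simps)
  show ?thesis unfolding real_biconvex_def
  proof (intro conjI ballI impI)
    show "Inv J y \<subseteq> PR J" by (auto simp: Inv_def)
    fix \<beta> \<gamma> assume "\<beta> \<in> Inv J y" "\<gamma> \<in> Inv J y" and s: "\<beta> + \<gamma> \<in> PA J"
    then have "ht (inv y (\<beta> + \<gamma>)) < 0" by (simp add: add Inv_def)
    with s pi[of "\<beta> + \<gamma>"] show "\<beta> + \<gamma> \<in> Inv J y" by (auto simp: Inv_def)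
  next
    fix \<beta> \<gamma> assume b: "\<beta> \<in> PA J - Inv J y" and c: "\<gamma> \<in> PA J - Inv J y"
    have "0 \<le> ht (inv y \<eta>)" if "\<eta> \<in> PA J - Inv J y" for \<eta>
      using that pi[of \<eta>] by (force simp: Inv_def)
    from this[OF b] this[OF c] show "\<beta> + \<gamma> \<notin> Inv J y" by (simp add: add Inv_def)
  qed
qed

text \<open>Otherwise the complement contains all simple and all imaginary roots. Subtracting an
  acute simple root and inducting on height then puts every positive real root into the
  complement.\<close>

lemma real_biconvex_has_simple:
  assumes "J \<subseteq> I" "real_biconvex J B" "B \<noteq> {}"
  shows "\<exists>\<gamma>\<in>PS J. \<gamma> \<in> B"
proof (rule ccontr)
  assume no: "\<not> ?thesis"
  have "\<beta> \<notin> B" if "\<beta> \<in> PR J" "ht \<beta> \<le> real n" for n \<beta>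
    using that
  proof (induction n arbitrary: \<beta>)
    case 0
    then show ?case using PR_D(2)[OF assms(1)] by force
  next
    case (Suc n)
    obtain \<gamma> where \<gamma>: "\<gamma> \<in> PS J" "0 < b \<beta> \<gamma>" using exists_acute_Pi[OF assms(1) Suc.prems(1)] by blast
    have \<gamma>P: "\<gamma> \<in> PR J" by (rule Pi_PR[OF assms(1) \<gamma>(1)])
    show ?case
    proof (cases "\<beta> = \<gamma>")
      case True
      then show ?thesis using no \<gamma> by blast
    next
      case False
      have d: "\<beta> - \<gamma> \<in> PA J" by (rule PR_minus_Pi[OF assms(1) Suc.prems(1) \<gamma> False])
      have "1 \<le> ht \<gamma>"
        using PR_D(2)[OF assms(1) \<gamma>P] RT_ht(3)[OF assms(1) PR_D(1)[OF assms(1) \<gamma>P]] by (auto elim!: Ints_cases)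
      then have "ht (\<beta> - \<gamma>) \<le> real n" using Suc.prems(2) by (simp add: ht_simps)
      then have "\<beta> - \<gamma> \<notin> B"
        using d Suc.IH[of "\<beta> - \<gamma>"] real_biconvex_D(1)[OF assms(2)] PR_PI_disjoint[OF assms(1)] by blast
      then have "\<gamma> + (\<beta> - \<gamma>) \<notin> B"
        using d \<gamma> \<gamma>P no by (intro real_biconvex_D(3)[OF assms(2)]) auto
      then show ?thesis by simp
    qed
  qed
  then have "\<beta> \<notin> B" if "\<beta> \<in> PR J" for \<beta>
    using that real_nat_ceiling_ge[of "ht \<beta>"] by blast
  then show False using assms(3) real_biconvex_D(1)[OF assms(2)] by blast
qed

text \<open>The reflection maps the positive roots other than \<gamma> to themselves, so convexity
  transports; only sums involving \<gamma> call for a separate argument.\<close>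

lemma real_biconvex_shift:
  assumes "J \<subseteq> I" "real_biconvex J B" "\<gamma> \<in> PS J" "\<gamma> \<in> B"
  shows "real_biconvex J (refl \<gamma> ` (B - {\<gamma>}))"
proof -
  define s where "s = refl \<gamma>"
  have norm: "b \<gamma> \<gamma> \<noteq> 0" by (rule PS_norm[OF assms(1,3)])
  have iso: "isom s" unfolding s_def by (rule isom_refl_Pi[OF assms(1,3)])
  have ss: "s (s v) = v" for v unfolding s_def by (rule refl_refl[OF norm])
  have s\<gamma>: "s \<gamma> = - \<gamma>" unfolding s_def by (rule refl_self[OF norm])
  have \<gamma>P: "\<gamma> \<in> PR J" by (rule Pi_PR[OF assms(1,3)])
  have sPR: "s \<beta> \<in> PR J" if "\<beta> \<in> PR J" "\<beta> \<noteq> \<gamma>" for \<beta>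
    unfolding s_def by (rule simple_refl_PR[OF assms(1,3) that])
  have not_neg: "\<beta> \<noteq> - \<gamma>" if "\<beta> \<in> PA J" for \<beta>
    using PA_ht[OF assms(1) that] PR_D(2)[OF assms(1) \<gamma>P] by (auto simp: ht_simps)
  have sPA: "s \<beta> \<in> PA J" if "\<beta> \<in> PA J" "\<beta> \<noteq> \<gamma>" for \<beta>
    using that sPR[of \<beta>] isom_PI[OF iso, of \<beta>] by auto
  have BP: "B \<subseteq> PR J" by (rule real_biconvex_D(1)[OF assms(2)])
  have mem: "v \<in> s ` (B - {\<gamma>}) \<longleftrightarrow> s v \<in> B - {\<gamma>}" for v
    using ss by (metis imageE imageI)
  show ?thesis unfolding real_biconvex_def s_def[symmetric]
  proof (intro conjI ballI impI)
    show "s ` (B - {\<gamma>}) \<subseteq> PR J" using sPR BP by blast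
    fix x x' assume x: "x \<in> s ` (B - {\<gamma>})" "x' \<in> s ` (B - {\<gamma>})" and sum: "x + x' \<in> PA J"
    have "s x \<in> B" "s x' \<in> B" using x mem by auto
    have add: "s (x + x') = s x + s x'" by (rule isom_D(6)[OF iso])
    have pos: "0 < ht (s (x + x'))" using \<open>s x \<in> B\<close> \<open>s x' \<in> B\<close> BP PR_D(2)[OF assms(1)]
      by (simp add: add ht_simps) (meson add_pos_pos subsetD)
    have "x + x' \<noteq> \<gamma>" using pos s\<gamma> PR_D(2)[OF assms(1) \<gamma>P] by (auto simp: ht_simps)
    then have "s (x + x') \<in> PA J" by (rule sPA[OF sum])
    then have "s (x + x') \<in> B" using real_biconvex_D(2)[OF assms(2) \<open>s x \<in> B\<close> \<open>s x' \<in> B\<close>] add by simp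
    moreover have "s (x + x') \<noteq> \<gamma>" using ss[of "x + x'"] s\<gamma> not_neg[OF sum] by metis
    ultimately show "x + x' \<in> s ` (B - {\<gamma>})" using mem by blast
  next
    fix x x' assume x: "x \<in> PA J - s ` (B - {\<gamma>})" "x' \<in> PA J - s ` (B - {\<gamma>})"
    have out: "s v \<in> PA J \<and> s v \<notin> B" if "v \<in> PA J - s ` (B - {\<gamma>})" "v \<noteq> \<gamma>" for v
    proof -
      have "s v \<noteq> \<gamma>" using ss[of v] s\<gamma> not_neg[of v] that by auto
      then show ?thesis using that sPA[of v] mem[of v] by auto
    qed
    have add: "s (v + v') = s v + s v'" for v v' by (rule isom_D(6)[OF iso])
    \<comment> \<open>A counterexample would give - \<gamma> + s v in \<open>B\<close>. Adding
      \<gamma> itself, also in \<open>B\<close>, would put s v into \<open>B\<close>; for v =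
      \<gamma> the element would be - 2 \<gamma>, which is negative.\<close>
    have half: "\<gamma> + v \<notin> s ` (B - {\<gamma>})" if v: "v \<in> PA J - s ` (B - {\<gamma>})" for v
    proof
      assume "\<gamma> + v \<in> s ` (B - {\<gamma>})"
      then have sv: "- \<gamma> + s v \<in> B" using mem add s\<gamma> by (metis DiffD1)
      show False
      proof (cases "v = \<gamma>")
        case True
        then have "0 < ht (- \<gamma> - \<gamma>)" using sv s\<gamma> BP PR_D(2)[OF assms(1)] by auto
        then show False using PR_D(2)[OF assms(1) \<gamma>P] by (simp add: ht_simps)
      next
        case False
        have e: "\<gamma> + (- \<gamma> + s v) = s v" by simp
        have "\<gamma> + (- \<gamma> + s v) \<in> B"
          using out[OF v False] by (intro real_biconvex_D(2)[OF assms(2) assms(4) sv]) (simp only: e)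
        then show False using out[OF v False] by simp
      qed
    qed
    show "x + x' \<notin> s ` (B - {\<gamma>})"
    proof (cases "x = \<gamma> \<or> x' = \<gamma>")
      case True
      then show ?thesis using half[OF x(1)] half[OF x(2)] by (auto simp: add.commute)
    next
      case False
      then have "s x + s x' \<notin> B" using out[OF x(1)] out[OF x(2)] by (intro real_biconvex_D(3)[OF assms(2)]) auto
      then show ?thesis using mem add by auto
    qed
  qed
qed

text \<open>Peeling off a simple root and reflecting lowers the cardinality by one and prepends one
  letter to \<open>y\<close>.\<close>

lemma finite_real_biconvex:
  assumes "J \<subseteq> I" "finite B" "real_biconvex J B"
  shows "\<exists>y\<in>AW J. Inv J y = B"
  using assms(2,3)
proof (induction "card B" arbitrary: B)
  case 0
  then show ?case using AW_id Inv_id by fastforce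
next
  case (Suc n)
  then have "B \<noteq> {}" by auto
  then obtain \<gamma> where \<gamma>: "\<gamma> \<in> PS J" "\<gamma> \<in> B" using real_biconvex_has_simple[OF assms(1) Suc.prems(2)] by blast
  have norm: "b \<gamma> \<gamma> \<noteq> 0" by (rule PS_norm[OF assms(1) \<gamma>(1)])
  define B' where "B' = refl \<gamma> ` (B - {\<gamma>})"
  have inj: "inj_on (refl \<gamma>) (B - {\<gamma>})" using refl_refl[OF norm] by (metis inj_on_inverseI)
  have "card B' = n" using Suc.hyps(2) Suc.prems(1) \<gamma>(2) by (simp add: B'_def card_image[OF inj])
  moreover have "finite B'" using Suc.prems(1) by (simp add: B'_def)
  moreover have "real_biconvex J B'" unfolding B'_def by (rule real_biconvex_shift[OF assms(1) Suc.prems(2) \<gamma>])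
  ultimately obtain y where y: "y \<in> AW J" "Inv J y = B'" using Suc.hyps(1)[of B'] by blast
  have "\<gamma> \<notin> B'"
  proof
    assume "\<gamma> \<in> B'"
    then obtain \<beta> where \<beta>: "\<gamma> = refl \<gamma> \<beta>" "\<beta> \<in> B" by (auto simp: B'_def)
    then have "\<beta> = - \<gamma>" using refl_refl[OF norm, of \<beta>] refl_self[OF norm] by simp
    moreover have "0 < ht \<beta>" using \<beta>(2) real_biconvex_D(1)[OF Suc.prems(2)] PR_D(2)[OF assms(1)] by blast
    ultimately show False using PR_D(2)[OF assms(1) Pi_PR[OF assms(1) \<gamma>(1)]] by (simp add: ht_simps)
  qed
  then have "Inv J (refl \<gamma> \<circ> y) = {\<gamma>} \<union> refl \<gamma> ` B'"
    using Inv_refl[OF assms(1) \<gamma>(1) y(1)] y(2) by simp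
  also have "refl \<gamma> ` B' = B - {\<gamma>}"
    unfolding B'_def image_image refl_refl[OF norm] by simp
  also have "{\<gamma>} \<union> (B - {\<gamma>}) = B" using \<gamma>(2) by blast
  finally show ?case using AW_comp[OF AW_refl[OF \<gamma>(1)] y(1)] by blast
qed

text \<open>A positive root \<gamma> is inverted by the quotient either when x \<gamma> is a
  positive root inverted by \<open>y\<close> only, or when - x \<gamma> is a positive root inverted
  by \<open>x\<close> only. The length of a quotient is thus the size of a symmetric
  difference.\<close>

lemma Inv_symdiff:
  assumes "J \<subseteq> I" "x \<in> AW J" "y \<in> AW J"
  shows "card (Inv J (inv x \<circ> y)) = card (Inv J y - Inv J x) + card (Inv J x - Inv J y)"
proof -
  have ix: "isom x" and iy: "isom y" using isom_AW[OF assms(1)] assms(2,3) by auto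
  note iix = isom_inv[OF ix]
  have ix': "inv x \<in> AW J" by (rule AW_inv[OF assms(1,2)])
  have inv: "inv (inv x \<circ> y) v = inv y (x v)" for v
  proof -
    have "inv (inv x \<circ> y) = inv y \<circ> inv (inv x)"
      using isom_D(2)[OF iix] isom_D(2)[OF iy] by (intro o_inv_distrib)
    then show ?thesis using inv_inv_eq[OF isom_D(2)[OF ix]] by simp
  qed
  define A where "A = inv x ` (Inv J y - Inv J x)"
  define C where "C = (\<lambda>v. - inv x v) ` (Inv J x - Inv J y)"
  have nz: "ht (w \<beta>) \<noteq> 0" if "w \<in> AW J" "\<beta> \<in> PR J" for w \<beta>
    using RT_ht(2)[OF assms(1) AW_RT[OF assms(1) that(1) PR_D(1)[OF assms(1) that(2)]]] .
  have xPR: "x \<gamma> \<in> PR J \<or> - x \<gamma> \<in> PR J" if "\<gamma> \<in> PR J" for \<gamma>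
    using nz[OF assms(2) that] AW_RT[OF assms(1,2) PR_D(1)[OF assms(1) that]] RT_minus[OF assms(1)]
    by (auto simp: PR_def ht_simps)
  have "Inv J (inv x \<circ> y) = A \<union> C"
  proof
    show "Inv J (inv x \<circ> y) \<subseteq> A \<union> C"
    proof
      fix \<gamma> assume g: "\<gamma> \<in> Inv J (inv x \<circ> y)"
      then have \<gamma>: "\<gamma> \<in> PR J" "ht (inv y (x \<gamma>)) < 0" "0 < ht \<gamma>" by (auto simp: Inv_def inv PR_def)
      show "\<gamma> \<in> A \<union> C"
        using xPR[OF \<gamma>(1)]
      proof
        assume "x \<gamma> \<in> PR J"
        then have "x \<gamma> \<in> Inv J y - Inv J x" using \<gamma> by (simp add: Inv_def isom_D(10)[OF ix])
        then show ?thesis unfolding A_def by (metis UnI1 image_eqI isom_D(10)[OF ix])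
      next
        assume "- x \<gamma> \<in> PR J"
        then have "- x \<gamma> \<in> Inv J x - Inv J y"
          using \<gamma> by (simp add: Inv_def isom_D(8)[OF isom_inv[OF iy]] isom_D(8)[OF iix] isom_D(10)[OF ix] ht_simps)
        moreover have "\<gamma> = - inv x (- x \<gamma>)" by (simp add: isom_D(8)[OF iix] isom_D(10)[OF ix])
        ultimately show ?thesis unfolding C_def by blast
      qed
    qed
    show "A \<union> C \<subseteq> Inv J (inv x \<circ> y)"
    proof
      fix \<gamma> assume "\<gamma> \<in> A \<union> C"
      then show "\<gamma> \<in> Inv J (inv x \<circ> y)"
      proof
        assume "\<gamma> \<in> A"
        then obtain \<beta> where \<beta>: "\<gamma> = inv x \<beta>" "\<beta> \<in> PR J" "ht (inv y \<beta>) < 0" "\<not> ht (inv x \<beta>) < 0"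
          by (auto simp: A_def Inv_def)
        then show ?thesis
          using nz[OF ix' \<beta>(2)] AW_RT[OF assms(1) ix' PR_D(1)[OF assms(1) \<beta>(2)]]
          by (simp add: Inv_def PR_def inv isom_D(11)[OF ix])
      next
        assume "\<gamma> \<in> C"
        then obtain \<beta> where \<beta>: "\<gamma> = - inv x \<beta>" "\<beta> \<in> PR J" "\<not> ht (inv y \<beta>) < 0" "ht (inv x \<beta>) < 0"
          by (auto simp: C_def Inv_def)
        then show ?thesis
          using nz[OF AW_inv[OF assms(1,3)] \<beta>(2)] RT_minus[OF assms(1) AW_RT[OF assms(1) ix' PR_D(1)[OF assms(1) \<beta>(2)]]]
          by (simp add: Inv_def PR_def inv isom_D(8)[OF ix] isom_D(8)[OF isom_inv[OF iy]] isom_D(11)[OF ix] ht_simps)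
      qed
    qed
  qed
  moreover have "A \<inter> C = {}"
  proof -
    have False if "\<beta> \<in> PR J" "\<beta>' \<in> PR J" "inv x \<beta> = - inv x \<beta>'" for \<beta> \<beta>'
    proof -
      have "\<beta> = - \<beta>'" using that(3) isom_D(11)[OF ix] isom_D(8)[OF ix] by metis
      then show False
        using PR_D(2)[OF assms(1) that(1)] PR_D(2)[OF assms(1) that(2)] by (simp add: ht_simps)
    qed
    then show ?thesis by (force simp: A_def C_def Inv_def)
  qed
  moreover have "card A = card (Inv J y - Inv J x)"
    unfolding A_def using isom_D(11)[OF ix] by (intro card_image inj_on_inverseI)
  moreover have "card C = card (Inv J x - Inv J y)"
    unfolding C_def
    by (intro card_image inj_on_inverseI[where g = "\<lambda>v. x (- v)"]) (simp add: isom_D(11)[OF ix])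
  moreover have "finite A" "finite C" unfolding A_def C_def using finite_Inv[OF assms(1)] assms by auto
  ultimately show ?thesis by (simp add: card_Un_disjoint)
qed

lemma Inv_inj:
  assumes "J \<subseteq> I" "x \<in> AW J" "y \<in> AW J" "Inv J x = Inv J y"
  shows "x = y"
proof -
  have xy: "inv x \<circ> y \<in> AW J" using AW_inv[OF assms(1,2)] assms(3) by (rule AW_comp)
  have "card (Inv J (inv x \<circ> y)) = 0" using Inv_symdiff[OF assms(1-3)] assms(4) by simp
  then have "inv x \<circ> y = id" using Inv_empty[OF assms(1) xy] finite_Inv[OF assms(1) xy] by simp
  then have "x \<circ> (inv x \<circ> y) = x" by simp
  then show ?thesis
    using isom_D(11)[OF isom_AW[OF assms(1,2)]] by (metis comp_apply ext)
qed

text \<open>This turns the length conditions in the equivalence of infinite words into inclusions of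
  inversion sets.\<close>

lemma length_diff_iff:
  assumes "J \<subseteq> I" "x \<in> AW J" "y \<in> AW J" "card (Inv J x) \<le> card (Inv J y)"
  shows "par_length D J (inv x \<circ> y) = card (Inv J y) - card (Inv J x) \<longleftrightarrow> Inv J x \<subseteq> Inv J y"
proof -
  have fin: "finite (Inv J x)" "finite (Inv J y)" using finite_Inv[OF assms(1)] assms by auto
  have "par_length D J (inv x \<circ> y) = card (Inv J y - Inv J x) + card (Inv J x - Inv J y)"
    using par_length_eq[OF assms(1) AW_comp[OF AW_inv[OF assms(1,2)] assms(3)]] Inv_symdiff[OF assms(1-3)] by simp
  moreover have "card (Inv J y - Inv J x) + card (Inv J y \<inter> Inv J x) = card (Inv J y)"
    using card_Diff_subset_Int[of "Inv J y" "Inv J x"] fin card_mono[of "Inv J y" "Inv J y \<inter> Inv J x"] by auto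
  moreover have "card (Inv J x - Inv J y) + card (Inv J y \<inter> Inv J x) = card (Inv J x)"
    using card_Diff_subset_Int[of "Inv J x" "Inv J y"] fin card_mono[of "Inv J x" "Inv J x \<inter> Inv J y"]
    by (auto simp: Int_commute)
  ultimately have "par_length D J (inv x \<circ> y) = card (Inv J y) - card (Inv J x) \<longleftrightarrow> card (Inv J x - Inv J y) = 0"
    using assms(4) by linarith
  then show ?thesis using fin by simp
qed

section \<open>Chambers and minimal coset representatives\<close>

lemma refl_positive_R:
  assumes "J \<subseteq> I" "j \<in> J" "\<epsilon> \<in> R J" "0 < ht \<epsilon>" "\<epsilon> \<noteq> \<alpha> j"
  shows "refl (\<alpha> j) \<epsilon> \<in> R J" "0 < ht (refl (\<alpha> j) \<epsilon>)" "refl (\<alpha> j) \<epsilon> \<noteq> \<alpha> j"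
proof -
  have jr: "j \<le> rk D" using assms by auto
  have norm: "b (\<alpha> j) (\<alpha> j) \<noteq> 0" using jr by simp
  show "refl (\<alpha> j) \<epsilon> \<in> R J" by (rule R_refl[OF assms(1) R_simple[OF assms(1,2)] assms(3)])
  have "\<epsilon> \<in> PR J" using assms R_RT by (simp add: PR_def)
  then show "0 < ht (refl (\<alpha> j) \<epsilon>)"
    using simple_refl_PR[OF assms(1) Pi_fin[OF assms(1,2)] _ assms(5)] by (simp add: PR_def)
  show "refl (\<alpha> j) \<epsilon> \<noteq> \<alpha> j"
  proof
    assume "refl (\<alpha> j) \<epsilon> = \<alpha> j"
    then have "\<epsilon> = - \<alpha> j" using refl_refl[OF norm, of \<epsilon>] refl_self[OF norm] by simp
    then show False using assms(4) jr by (simp add: ht_simps)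
  qed
qed

text \<open>Choose \<open>w\<close> so that as many positive roots as possible satisfy
  \<open>P\<close> after applying \<open>w\<close>. If \<open>P\<close> failed at w(\<alpha> j),
  composing with the j-th reflection would permute the other positive roots and gain one. The
  predicate is arbitrary so that it can express positivity as well as membership in a parabolic
  set.\<close>

lemma max_chamber:
  assumes "J \<subseteq> I" "\<And>\<epsilon>. \<epsilon> \<in> R J \<Longrightarrow> P \<epsilon> \<or> P (- \<epsilon>)"
  shows "\<exists>w\<in>fin_weyl D J. \<forall>j\<in>J. P (w (\<alpha> j))"
proof -
  define Pos where "Pos = {\<epsilon> \<in> R J. 0 < ht \<epsilon>}"
  have finP: "finite Pos" using finite_R[OF assms(1)] by (simp add: Pos_def)
  define n where "n w = card {\<epsilon> \<in> Pos. P (w \<epsilon>)}" for w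
  have id: "id \<in> fin_weyl D J" unfolding fin_weyl_def by (rule gg_id)
  have "n w < Suc (card Pos)" for w unfolding n_def using card_mono[OF finP] by (simp add: less_Suc_eq_le)
  then obtain w where w: "w \<in> fin_weyl D J" "\<And>v. v \<in> fin_weyl D J \<Longrightarrow> n v \<le> n w"
    using ex_has_greatest_nat[of "\<lambda>w. w \<in> fin_weyl D J" id n "Suc (card Pos)"] id by blast
  have "P (w (\<alpha> j))" if j: "j \<in> J" for j
  proof (rule ccontr)
    assume no: "\<not> P (w (\<alpha> j))"
    have jr: "j \<le> rk D" using j assms(1) by auto
    define s where "s = refl (\<alpha> j)"
    have norm: "b (\<alpha> j) (\<alpha> j) \<noteq> 0" using jr by simp
    have sw: "w \<circ> s \<in> fin_weyl D J" unfolding s_def using w(1) by (intro fin_weyl_comp refl_in_fin_weyl j jr)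
    have ss: "s (s v) = v" for v unfolding s_def by (rule refl_refl[OF norm])
    have sPos: "s \<epsilon> \<in> Pos - {\<alpha> j}" if "\<epsilon> \<in> Pos - {\<alpha> j}" for \<epsilon>
      using that refl_positive_R[OF assms(1) j] by (auto simp: Pos_def s_def)
    define A where "A = {\<epsilon> \<in> Pos - {\<alpha> j}. P (w \<epsilon>)}"
    have "w (- \<alpha> j) = - w (\<alpha> j)"
      using isom_D(8)[OF isom_AW[OF assms(1) fin_weyl_AW[OF assms(1) w(1)]]] .
    moreover have "P (- w (\<alpha> j))" using no assms(2)[OF fin_weyl_R[OF w(1) R_simple[OF assms(1) j]]] by blast
    ultimately have Pj: "P (w (s (\<alpha> j)))" unfolding s_def refl_self[OF norm] by simp
    have "\<alpha> j \<in> Pos" using R_simple[OF assms(1) j] jr by (simp add: Pos_def)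
    then have "{\<epsilon> \<in> Pos. P ((w \<circ> s) \<epsilon>)} = insert (\<alpha> j) (s ` A)"
      using Pj sPos ss by (auto simp: A_def image_iff) (metis DiffE Diff_iff singletonD)+
    moreover have "{\<epsilon> \<in> Pos. P (w \<epsilon>)} = A" using no by (auto simp: A_def)
    moreover have "finite A" using finP by (simp add: A_def)
    moreover have "\<alpha> j \<notin> s ` A" using sPos by (force simp: A_def)
    moreover have "card (s ` A) = card A" by (intro card_image inj_on_inverseI[of A s s] ss)
    ultimately have "n (w \<circ> s) = Suc (n w)" by (simp add: n_def)
    then show False using w(2)[OF sw] by simp
  qed
  then show ?thesis using w(1) by blast
qed

lemma fin_weyl_isom: "J \<subseteq> I \<Longrightarrow> w \<in> fin_weyl D J \<Longrightarrow> isom w"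
  using isom_AW fin_weyl_AW by blast

lemma fin_weyl_inv: "J \<subseteq> I \<Longrightarrow> w \<in> fin_weyl D J \<Longrightarrow> inv w \<in> fin_weyl D J"
proof -
  assume J: "J \<subseteq> I" "w \<in> fin_weyl D J"
  have "bij s" if s: "s \<in> srefl D ` J" for s
  proof -
    obtain j where j: "j \<in> J" "s = srefl D j" using s by blast
    then have "s = refl (\<alpha> j)" using J(1) by (auto simp: srefl_eq)
    then show ?thesis using isom_D(2)[OF isom_refl_Pi[OF J(1) Pi_fin[OF J(1) j(1)]]] by simp
  qed
  then show ?thesis using generated_group_inv(2)[of "srefl D ` J" w] J(2) unfolding fin_weyl_def by blast
qed

lemma fin_weyl_id: "id \<in> fin_weyl D J"
  unfolding fin_weyl_def by (rule gg_id)

lemma fin_weyl_mono: "K \<subseteq> J \<Longrightarrow> J \<subseteq> I \<Longrightarrow> fin_weyl D K \<subseteq> fin_weyl D J"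
proof
  fix w assume K: "K \<subseteq> J" "J \<subseteq> I" and w: "w \<in> fin_weyl D K"
  have "K \<subseteq> {..rk D}" using K by auto
  with w show "w \<in> fin_weyl D J"
  proof (induction rule: fin_weyl_induct)
    case (step j w)
    then show ?case using K by (intro fin_weyl_comp refl_in_fin_weyl) auto
  qed (rule fin_weyl_id)
qed

lemma fin_weyl_fp:
  assumes "J \<subseteq> I" "u \<in> fin_weyl D J" "\<beta> \<in> RT J"
  shows "fp (u \<beta>) = u (fp \<beta>)" "cf 0 (u \<beta>) = cf 0 \<beta>"
proof -
  have iso: "isom u" by (rule fin_weyl_isom[OF assms(1,2)])
  have uR: "u (fp \<beta>) \<in> R J" using assms(3) fin_weyl_R[OF assms(2)] by (simp add: RT_def)
  have "u \<beta> = cf 0 \<beta> *\<^sub>R \<delta> + u (fp \<beta>)"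
    by (subst fp_decomp[of \<beta>]) (simp only: isom_D[OF iso])
  then show "fp (u \<beta>) = u (fp \<beta>)" "cf 0 (u \<beta>) = cf 0 \<beta>"
    using fp_R[OF assms(1) uR] cf0_R[OF assms(1) uR]
    by (simp_all add: fp_simps cf_simps cf_\<delta> mk_0)
qed

lemma fin_weyl_RT: "J \<subseteq> I \<Longrightarrow> u \<in> fin_weyl D J \<Longrightarrow> \<beta> \<in> RT J \<Longrightarrow> u \<beta> \<in> RT J"
  using AW_RT fin_weyl_AW by blast

text \<open>A linear functional that vanishes on the roots of \<open>K\<close> and whose sign on the
  remaining roots of \<open>J\<close> is that of the height; it is pairing with a coweight dominant
  for \<open>J\<close> with stabilizer \<open>K\<close>.\<close>

definition outer_ht :: "nat set \<Rightarrow> nat set \<Rightarrow> 'v \<Rightarrow> real" where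
  "outer_ht J K \<eta> = (\<Sum>j\<in>J - K. cf j \<eta>)"

lemma outer_ht_sign:
  assumes "K \<subseteq> J" "J \<subseteq> I" "\<eta> \<in> R J"
  shows "outer_ht J K \<eta> = 0 \<longleftrightarrow> \<eta> \<in> R K" "outer_ht J K \<eta> < 0 \<longleftrightarrow> \<eta> \<notin> R K \<and> ht \<eta> < 0"
proof -
  have J: "J \<subseteq> {..rk D}" "finite J" using assms(2) finite_subset by auto
  have minus: "outer_ht J K (- \<eta>) = - outer_ht J K \<eta>" for \<eta>
    using J(1) by (auto simp: outer_ht_def cf_simps sum_negf[symmetric] intro!: sum.cong)
  have mem: "\<eta> \<in> R K \<longleftrightarrow> (\<forall>j\<in>J - K. cf j \<eta> = 0)" if "\<eta> \<in> R J" for \<eta>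
  proof
    show "\<eta> \<in> R K \<Longrightarrow> \<forall>j\<in>J - K. cf j \<eta> = 0" using cf_outside[of K \<eta>] assms J by auto
    assume z: "\<forall>j\<in>J - K. cf j \<eta> = 0"
    have "\<eta> = (\<Sum>j\<in>J. cf j \<eta> *\<^sub>R \<alpha> j)" by (rule span_expand(1)[OF R_D(2)[OF assms(2) that] J(1)])
    also have "\<dots> = (\<Sum>j\<in>K. cf j \<eta> *\<^sub>R \<alpha> j)" using z assms(1) J by (intro sum.mono_neutral_right) auto
    finally have "\<eta> \<in> span (\<alpha> ` K)" by (metis (no_types, lifting) simple_in_span span_scale span_sum)
    then show "\<eta> \<in> R K" using R_D(1)[OF assms(2) that] assms by (simp add: fin_roots_iff)
  qed
  have pos: "0 \<le> outer_ht J K \<eta> \<and> (outer_ht J K \<eta> = 0 \<longleftrightarrow> \<eta> \<in> R K)" if "\<eta> \<in> R J" "0 < ht \<eta>" for \<eta>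
  proof -
    have nn: "\<forall>j\<in>J. 0 \<le> cf j \<eta>" using R_pos_iff(1)[OF assms(2) that(1)] that(2) by blast
    have "outer_ht J K \<eta> = 0 \<longleftrightarrow> (\<forall>j\<in>J - K. cf j \<eta> = 0)"
      unfolding outer_ht_def using nn J by (intro sum_nonneg_eq_0_iff) auto
    moreover have "0 \<le> outer_ht J K \<eta>" unfolding outer_ht_def using nn by (intro sum_nonneg) auto
    ultimately show ?thesis using mem[OF that(1)] by simp
  qed
  have KI: "K \<subseteq> I" using assms by blast
  have "ht \<eta> \<noteq> 0" using lroot_ht_pos_iff(3) R_D(1)[OF assms(2,3)] by blast
  then consider "0 < ht \<eta>" | "0 < ht (- \<eta>)" "ht \<eta> < 0" by (force simp: ht_simps)
  then have "(outer_ht J K \<eta> = 0 \<longleftrightarrow> \<eta> \<in> R K) \<and> (outer_ht J K \<eta> < 0 \<longleftrightarrow> \<eta> \<notin> R K \<and> ht \<eta> < 0)"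
  proof cases
    case 1
    then show ?thesis using pos[OF assms(3)] by auto
  next
    case 2
    then show ?thesis using pos[OF R_minus[OF assms(2,3)]] R_minus_iff[OF KI, of \<eta>] by (auto simp: minus)
  qed
  then show "outer_ht J K \<eta> = 0 \<longleftrightarrow> \<eta> \<in> R K" "outer_ht J K \<eta> < 0 \<longleftrightarrow> \<eta> \<notin> R K \<and> ht \<eta> < 0" by auto
qed

abbreviation MR :: "nat set \<Rightarrow> nat set \<Rightarrow> ('v \<Rightarrow> 'v) set" where "MR \<equiv> min_reps D"

lemma MR_D: "u \<in> MR J K \<Longrightarrow> u \<in> fin_weyl D J"
  by (simp add: min_reps_def)

lemma MR_pos:
  assumes "K \<subseteq> J" "J \<subseteq> I" "u \<in> MR J K" "\<epsilon> \<in> R K" "0 < ht \<epsilon>"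
  shows "0 < ht (u \<epsilon>)"
proof -
  have KI: "K \<subseteq> I" and Kr: "K \<subseteq> {..rk D}" using assms by auto
  have u: "u \<in> fin_weyl D J" and uk: "\<forall>k\<in>K. 0 < ht (u (\<alpha> k))"
    using assms(3) by (auto simp: min_reps_eq[OF assms(1,2)])
  have iso: "isom u" by (rule fin_weyl_isom[OF assms(2) u])
  have "u \<epsilon> = u (\<Sum>k\<in>K. cf k \<epsilon> *\<^sub>R \<alpha> k)"
    by (rule arg_cong[OF span_expand(1)[OF R_D(2)[OF KI assms(4)] Kr]])
  also have "\<dots> = (\<Sum>k\<in>K. cf k \<epsilon> *\<^sub>R u (\<alpha> k))"
    by (simp only: linear_sum[OF isom_D(1)[OF iso]] isom_D(9)[OF iso])
  finally have "u \<epsilon> = (\<Sum>k\<in>K. cf k \<epsilon> *\<^sub>R u (\<alpha> k))" .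
  moreover have "ht (\<Sum>k\<in>S. cf k \<epsilon> *\<^sub>R u (\<alpha> k)) = (\<Sum>k\<in>S. cf k \<epsilon> * ht (u (\<alpha> k)))" if "finite S" for S
    using that by (induction S) (auto simp: ht_simps)
  ultimately have "ht (u \<epsilon>) = (\<Sum>k\<in>K. cf k \<epsilon> * ht (u (\<alpha> k)))"
    using finite_subset[OF KI] by simp
  also have "\<dots> \<ge> 0"
    using R_pos_iff(1)[OF KI assms(4)] assms(5) uk by (intro sum_nonneg mult_nonneg_nonneg) auto
  moreover have "u \<epsilon> \<in> R J" using fin_weyl_R[OF u] R_mono[OF assms(1,2)] assms(4) by blast
  then have "ht (u \<epsilon>) \<noteq> 0" using lroot_ht_pos_iff(3) R_D(1)[OF assms(2)] by blast
  ultimately show ?thesis by simp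
qed

lemma MR_pos_iff:
  assumes "K \<subseteq> J" "J \<subseteq> I" "u \<in> MR J K" "\<beta> \<in> RT K"
  shows "0 < ht (u \<beta>) \<longleftrightarrow> 0 < ht \<beta>"
proof -
  have KI: "K \<subseteq> I" using assms by blast
  have pos: "0 < ht (u \<beta>)" if \<beta>: "\<beta> \<in> RT K" "0 < ht \<beta>" for \<beta>
  proof -
    have RJ: "\<beta> \<in> RT J" using RT_mono[OF assms(1,2)] \<beta> by blast
    note f = fin_weyl_fp[OF assms(2) MR_D[OF assms(3)] RJ]
    have "0 < ht (u (fp \<beta>))" if "0 < ht (fp \<beta>)"
      using that MR_pos[OF assms(1-3)] \<beta>(1) by (simp add: RT_def)
    then show ?thesis
      using RT_ht(1)[OF KI \<beta>(1)] \<beta>(2) f RT_ht(1)[OF assms(2) fin_weyl_RT[OF assms(2) MR_D[OF assms(3)] RJ]]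
      by auto
  qed
  have "ht \<beta> \<noteq> 0" by (rule RT_ht(2)[OF KI assms(4)])
  then show ?thesis
    using pos[OF assms(4)] pos[OF RT_minus[OF KI assms(4)]]
      isom_D(8)[OF fin_weyl_isom[OF assms(2) MR_D[OF assms(3)]]] by (force simp: ht_simps)
qed

lemma fin_weyl_pos_id:
  assumes "J \<subseteq> I" "x \<in> fin_weyl D J" "\<And>\<epsilon>. \<epsilon> \<in> R J \<Longrightarrow> 0 < ht \<epsilon> \<Longrightarrow> 0 < ht (x \<epsilon>)"
  shows "x = id"
proof -
  have x: "x \<in> AW J" by (rule fin_weyl_AW[OF assms(1,2)])
  have mr: "x \<in> MR J J"
    using assms(1,2) R_simple[OF assms(1)] assms(3) by (auto simp: min_reps_eq[OF order_refl assms(1)])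
  have "Inv J (inv x) = {}"
    using MR_pos_iff[OF order_refl assms(1) mr] inv_inv_eq[OF isom_D(2)[OF isom_AW[OF assms(1) x]]]
    by (force simp: Inv_def PR_def)
  then have "inv x = id" by (rule Inv_empty[OF assms(1) AW_inv[OF assms(1) x]])
  then show ?thesis using inv_inv_eq[OF isom_D(2)[OF isom_AW[OF assms(1) x]]] by (metis inv_id)
qed

text \<open>The only positive root made negative by the reflection at k is \<alpha> k, a root of
  \<open>K\<close>. So the Weyl group of \<open>K\<close> permutes the positive roots of
  \<open>J\<close> outside \<open>K\<close>.\<close>

lemma fin_weyl_parabolic_pos:
  assumes "K \<subseteq> J" "J \<subseteq> I" "v \<in> fin_weyl D K" "\<epsilon> \<in> R J" "\<epsilon> \<notin> R K" "0 < ht \<epsilon>"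
  shows "v \<epsilon> \<in> R J" "v \<epsilon> \<notin> R K" "0 < ht (v \<epsilon>)"
proof -
  have K: "K \<subseteq> {..rk D}" "K \<subseteq> I" using assms by auto
  from assms(3) K(1) have "v \<epsilon> \<in> R J \<and> v \<epsilon> \<notin> R K \<and> 0 < ht (v \<epsilon>)"
  proof (induction rule: fin_weyl_induct)
    case id
    then show ?case using assms by simp
  next
    case (step k w)
    have k: "k \<in> J" "k \<le> rk D" using step(1) assms(1) K by auto
    have norm: "b (\<alpha> k) (\<alpha> k) \<noteq> 0" using k by simp
    have w: "w \<epsilon> \<in> R J" "w \<epsilon> \<notin> R K" "0 < ht (w \<epsilon>)" using step.IH by auto
    have "w \<epsilon> \<noteq> \<alpha> k" using w(2) R_simple[OF K(2) step(1)] by auto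
    moreover have "w \<epsilon> \<in> PR J" using w R_RT[OF assms(2)] by (simp add: PR_def)
    ultimately have "refl (\<alpha> k) (w \<epsilon>) \<in> PR J"
      by (intro simple_refl_PR[OF assms(2) Pi_fin[OF assms(2) k(1)]])
    moreover have "refl (\<alpha> k) (w \<epsilon>) \<in> R J" by (rule R_refl[OF assms(2) R_simple[OF assms(2) k(1)] w(1)])
    moreover have "refl (\<alpha> k) (w \<epsilon>) \<notin> R K"
      using w(2) R_refl[OF K(2) R_simple[OF K(2) step(1)], of "refl (\<alpha> k) (w \<epsilon>)"] refl_refl[OF norm] by auto
    ultimately show ?case by (simp add: PR_def)
  qed
  then show "v \<epsilon> \<in> R J" "v \<epsilon> \<notin> R K" "0 < ht (v \<epsilon>)" by auto
qed

text \<open>The chamber argument inside \<open>K\<close>, applied to positivity after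
  \<open>w\<close>, finds \<open>v\<close> such that w v is minimal; its inverse supplies the second
  factor.\<close>

lemma min_rep_exists:
  assumes "K \<subseteq> J" "J \<subseteq> I" "w \<in> fin_weyl D J"
  obtains u v where "u \<in> MR J K" "v \<in> fin_weyl D K" "w = u \<circ> v"
proof -
  have KI: "K \<subseteq> I" using assms by blast
  have iso: "isom w" by (rule fin_weyl_isom[OF assms(2,3)])
  have "0 < ht (w \<epsilon>) \<or> 0 < ht (w (- \<epsilon>))" if "\<epsilon> \<in> R K" for \<epsilon>
  proof -
    have "w \<epsilon> \<in> R J" using fin_weyl_R[OF assms(3)] R_mono[OF assms(1,2)] that by blast
    then have "ht (w \<epsilon>) \<noteq> 0" using lroot_ht_pos_iff(3) R_D(1)[OF assms(2)] by blast
    then show ?thesis by (auto simp: isom_D(8)[OF iso] ht_simps)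
  qed
  then obtain v where v: "v \<in> fin_weyl D K" "\<forall>k\<in>K. 0 < ht (w (v (\<alpha> k)))"
    using max_chamber[OF KI, of "\<lambda>\<epsilon>. 0 < ht (w \<epsilon>)"] by blast
  have "w \<circ> v \<in> MR J K"
    unfolding min_reps_eq[OF assms(1,2)]
    using v fin_weyl_comp[OF assms(3), of v] fin_weyl_mono[OF assms(1,2)] by auto
  moreover have "inv v \<in> fin_weyl D K" by (rule fin_weyl_inv[OF KI v(1)])
  moreover have "w = (w \<circ> v) \<circ> inv v"
    using isom_D(11)[OF fin_weyl_isom[OF KI v(1)]] by (simp add: fun_eq_iff)
  ultimately show thesis using that by blast
qed

text \<open>The quotient of the two factors in the Weyl group of \<open>K\<close> preserves the
  positive roots of \<open>K\<close>, because both minimal representatives preserve and reflect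
  positivity there.\<close>

lemma min_rep_unique:
  assumes "K \<subseteq> J" "J \<subseteq> I" "u \<in> MR J K" "u' \<in> MR J K" "v \<in> fin_weyl D K" "v' \<in> fin_weyl D K"
    "u \<circ> v = u' \<circ> v'"
  shows "u = u'"
proof -
  have KI: "K \<subseteq> I" using assms by blast
  have iu': "isom u'" and iv: "isom v"
    using fin_weyl_isom[OF assms(2)] fin_weyl_isom[OF KI] MR_D assms by blast+
  define x where "x = v' \<circ> inv v"
  have x: "x \<in> fin_weyl D K" unfolding x_def by (intro fin_weyl_comp assms fin_weyl_inv[OF KI])
  have ux: "u e = u' (x e)" for e
    using fun_cong[OF assms(7), of "inv v e"] isom_D(11)[OF iv] by (simp add: x_def)
  have "x = id"
  proof (rule fin_weyl_pos_id[OF KI x])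
    fix \<epsilon> assume \<epsilon>: "\<epsilon> \<in> R K" "0 < ht \<epsilon>"
    have "0 < ht (u' (x \<epsilon>))" using MR_pos[OF assms(1-3) \<epsilon>] by (simp add: ux)
    then show "0 < ht (x \<epsilon>)"
      using MR_pos_iff[OF assms(1,2,4) R_RT[OF KI fin_weyl_R[OF x \<epsilon>(1)]]] by simp
  qed
  then show ?thesis using ux by (simp add: fun_eq_iff)
qed

lemma min_rep_eq:
  assumes "K \<subseteq> J" "J \<subseteq> I" "u \<in> MR J K" "v \<in> fin_weyl D K"
  shows "min_rep D J K (u \<circ> v) = u"
  unfolding min_rep_def
proof (rule the_equality)
  show "u \<in> MR J K \<and> (\<exists>v'\<in>fin_weyl D K. u \<circ> v = u \<circ> v')" using assms by blast
  show "u' = u" if "u' \<in> MR J K \<and> (\<exists>v'\<in>fin_weyl D K. u \<circ> v = u' \<circ> v')" for u'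
    using that min_rep_unique[OF assms(1,2,3) _ assms(4)] by blast
qed

text \<open>\<open>\<nabla>(K, u, y)\<close> in lexicographic form: it is cut out by the two linear functionals \<open>lex_ht J K u\<close> and
  \<open>ht \<circ> y\<^sup>-\<^sup>1 \<circ> u\<^sup>-\<^sup>1\<close>.\<close>

definition lex_ht :: "nat set \<Rightarrow> nat set \<Rightarrow> ('v \<Rightarrow> 'v) \<Rightarrow> 'v \<Rightarrow> real" where
  "lex_ht J K u \<beta> = outer_ht J K (inv u (fp \<beta>))"

definition nabla_set :: "nat set \<Rightarrow> nat set \<Rightarrow> ('v \<Rightarrow> 'v) \<Rightarrow> ('v \<Rightarrow> 'v) \<Rightarrow> 'v set" where
  "nabla_set J K u y = {\<beta> \<in> PR J. lex_ht J K u \<beta> < 0 \<or> (lex_ht J K u \<beta> = 0 \<and> ht (inv y (inv u \<beta>)) < 0)}"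

lemma lex_ht_minus:
  assumes "J \<subseteq> I" "isom u"
  shows "lex_ht J K u (- \<beta>) = - lex_ht J K u \<beta>"
proof -
  have "j \<le> rk D" if "j \<in> J" for j using that assms(1) by auto
  then show ?thesis
    by (auto simp: lex_ht_def outer_ht_def fp_simps isom_D(8)[OF isom_inv[OF assms(2)]] cf_simps sum_negf[symmetric]
        intro!: sum.cong)
qed

lemma inv_fp_R:
  assumes "J \<subseteq> I" "u \<in> fin_weyl D J" "\<beta> \<in> RT J"
  shows "inv u (fp \<beta>) \<in> R J"
  using fin_weyl_R[OF fin_weyl_inv[OF assms(1,2)]] assms(3) by (simp add: RT_def)

text \<open>Together with \<open>u_PR_K\<close> this identifies the level set of lexicographic
  height 0 with the translate by \<open>u\<close> of the positive real roots of
  \<open>K\<close>.\<close>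

lemma inv_u_RT_K:
  assumes "K \<subseteq> J" "J \<subseteq> I" "u \<in> MR J K" "\<beta> \<in> PR J" "lex_ht J K u \<beta> = 0"
  shows "inv u \<beta> \<in> PR K"
proof -
  have KI: "K \<subseteq> I" using assms by blast
  have \<beta>: "\<beta> \<in> RT J" "0 < ht \<beta>" using assms(4) by (auto simp: PR_def)
  have u: "u \<in> fin_weyl D J" using MR_D assms(3) .
  have "fp (inv u \<beta>) = inv u (fp \<beta>)" "cf 0 (inv u \<beta>) = cf 0 \<beta>"
    using fin_weyl_fp[OF assms(2) fin_weyl_inv[OF assms(2) u] \<beta>(1)] by auto
  moreover have "inv u (fp \<beta>) \<in> R K"
    using outer_ht_sign(1)[OF assms(1,2) inv_fp_R[OF assms(2) u \<beta>(1)]] assms(5) by (simp add: lex_ht_def)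
  ultimately have RTK: "inv u \<beta> \<in> RT K" using \<beta>(1) by (simp add: RT_def)
  then have "0 < ht (inv u \<beta>)"
    using MR_pos_iff[OF assms(1-3) RTK] \<beta>(2) isom_D(11)[OF fin_weyl_isom[OF assms(2) u]] by simp
  with RTK show ?thesis by (simp add: PR_def)
qed

lemma u_PR_K:
  assumes "K \<subseteq> J" "J \<subseteq> I" "u \<in> MR J K" "\<gamma> \<in> PR K"
  shows "u \<gamma> \<in> PR J" "lex_ht J K u (u \<gamma>) = 0"
proof -
  have u: "u \<in> fin_weyl D J" using MR_D assms(3) .
  have g: "\<gamma> \<in> RT K" "\<gamma> \<in> RT J" "0 < ht \<gamma>" "fp \<gamma> \<in> R K" "fp \<gamma> \<in> R J"
    using assms RT_mono[OF assms(1,2)] R_mono[OF assms(1,2)] by (auto simp: PR_def RT_def)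
  show "u \<gamma> \<in> PR J"
    using MR_pos_iff[OF assms(1-3) g(1)] g(3) fin_weyl_RT[OF assms(2) u g(2)] by (simp add: PR_def)
  show "lex_ht J K u (u \<gamma>) = 0"
    using outer_ht_sign(1)[OF assms(1,2) g(5)] g(4) fin_weyl_fp(1)[OF assms(2) u g(2)]
      isom_D(10)[OF fin_weyl_isom[OF assms(2) u]] by (simp add: lex_ht_def)
qed

lemma par_diff_neg_eq:
  assumes "K \<subseteq> J" "J \<subseteq> I" "u \<in> fin_weyl D J"
  shows "par_diff_neg D J K u = {\<beta> \<in> PR J. lex_ht J K u \<beta> < 0}"
proof -
  have iso: "isom u" by (rule fin_weyl_isom[OF assms(2,3)])
  have sub: "u ` fin_diff_neg D J K \<subseteq> R J"
    unfolding fin_diff_neg_eq[OF assms(2)] using fin_weyl_R[OF assms(3)] by auto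
  then have subI: "u ` fin_diff_neg D J K \<subseteq> R I" using R_mono[OF assms(2) order_refl] by blast
  have "fp \<beta> \<in> u ` fin_diff_neg D J K \<longleftrightarrow> lex_ht J K u \<beta> < 0" if "\<beta> \<in> PR J" for \<beta>
  proof -
    have r: "inv u (fp \<beta>) \<in> R J" using inv_fp_R[OF assms(2,3)] that by (simp add: PR_def)
    have "fp \<beta> \<in> u ` fin_diff_neg D J K \<longleftrightarrow> inv u (fp \<beta>) \<in> fin_diff_neg D J K"
      using isom_D(10,11)[OF iso] by (metis (no_types, lifting) imageE imageI)
    then show ?thesis
      using outer_ht_sign(2)[OF assms(1,2) r] r unfolding fin_diff_neg_eq[OF assms(2)] by (simp add: lex_ht_def)
  qed
  moreover have "\<beta> \<in> PR J" if "\<beta> \<in> PR I" "fp \<beta> \<in> u ` fin_diff_neg D J K" for \<beta>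
    using that sub PR_I_iff[OF assms(2)] by blast
  ultimately show ?thesis
    unfolding par_diff_neg_def affinize_eq[OF subI] using PR_mono[OF assms(2) order_refl] by blast
qed

lemma nabla_eq:
  assumes "K \<subseteq> J" "J \<subseteq> I" "u \<in> MR J K" "y \<in> AW K"
  shows "nabla D J (K, u, y) = nabla_set J K u y"
proof -
  have KI: "K \<subseteq> I" using assms by blast
  have u: "u \<in> fin_weyl D J" using MR_D assms(3) .
  have iso: "isom u" by (rule fin_weyl_isom[OF assms(2) u])
  have inv: "inversion_set D K y = Inv K y"
    using inversion_set_eq[OF KI] AW_mono[OF KI order_refl] assms(4) by blast
  have "u ` Inv K y = {\<beta> \<in> PR J. lex_ht J K u \<beta> = 0 \<and> ht (inv y (inv u \<beta>)) < 0}"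
  proof
    show "u ` Inv K y \<subseteq> {\<beta> \<in> PR J. lex_ht J K u \<beta> = 0 \<and> ht (inv y (inv u \<beta>)) < 0}"
      using u_PR_K[OF assms(1-3)] isom_D(10)[OF iso] by (auto simp: Inv_def)
    show "{\<beta> \<in> PR J. lex_ht J K u \<beta> = 0 \<and> ht (inv y (inv u \<beta>)) < 0} \<subseteq> u ` Inv K y"
    proof
      fix \<beta> assume "\<beta> \<in> {\<beta> \<in> PR J. lex_ht J K u \<beta> = 0 \<and> ht (inv y (inv u \<beta>)) < 0}"
      then have "inv u \<beta> \<in> Inv K y" using inv_u_RT_K[OF assms(1-3)] by (simp add: Inv_def)
      then show "\<beta> \<in> u ` Inv K y" using isom_D(11)[OF iso] by (metis imageI)
    qed
  qed
  then show ?thesis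
    unfolding nabla.simps inv par_diff_neg_eq[OF assms(1,2) u] nabla_set_def by blast
qed

section \<open>Classification of infinite biconvex sets\<close>

lemma PI_I: "1 \<le> m \<Longrightarrow> real m *\<^sub>R \<delta> \<in> PI"
  unfolding PI_def by blast

lemma string_PR:
  assumes "J \<subseteq> I" "\<epsilon> \<in> R J" "1 \<le> m"
  shows "real m *\<^sub>R \<delta> + \<epsilon> \<in> PR J" "fp (real m *\<^sub>R \<delta> + \<epsilon>) = \<epsilon>" "cf 0 (real m *\<^sub>R \<delta> + \<epsilon>) = real m"
proof -
  show c: "cf 0 (real m *\<^sub>R \<delta> + \<epsilon>) = real m"
    using cf0_R[OF assms(1,2)] by (simp add: cf_simps cf_\<delta> mk_0)
  show "fp (real m *\<^sub>R \<delta> + \<epsilon>) = \<epsilon>" using fp_R[OF assms(1,2)] by (simp add: fp_simps)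
  show "real m *\<^sub>R \<delta> + \<epsilon> \<in> PR J"
    using RT_iff[OF assms(1,2), of "real m"] RT_ht(1)[OF assms(1), of "real m *\<^sub>R \<delta> + \<epsilon>"] c assms(3)
    by (simp add: PR_def)
qed

lemma same_string:
  assumes "J \<subseteq> I" "\<beta> \<in> PR J" "\<beta>' \<in> PR J" "fp \<beta> = fp \<beta>'" "cf 0 \<beta> \<le> cf 0 \<beta>'"
  obtains m :: nat where "\<beta>' = \<beta> + real m *\<^sub>R \<delta>"
proof -
  have "cf 0 \<beta>' - cf 0 \<beta> \<in> \<int>" using assms PR_D(4)[OF assms(1)] by simp
  then obtain k :: int where k: "cf 0 \<beta>' - cf 0 \<beta> = of_int k" by (rule Ints_cases)
  have "\<beta>' = \<beta> + (cf 0 \<beta>' - cf 0 \<beta>) *\<^sub>R \<delta>"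
    using assms(4) by (simp add: fp_def algebra_simps)
  moreover have "of_int k = real (nat k)" using k assms(5) by simp
  ultimately have "\<beta>' = \<beta> + real (nat k) *\<^sub>R \<delta>" unfolding k by metis
  then show thesis by (rule that)
qed

lemma lex_ht_string:
  assumes "J \<subseteq> I" "u \<in> fin_weyl D J" "\<eta> \<in> R J" "1 \<le> m"
  shows "lex_ht J K u (real m *\<^sub>R \<delta> + u \<eta>) = outer_ht J K \<eta>" "real m *\<^sub>R \<delta> + u \<eta> \<in> PR J"
  using string_PR[OF assms(1) fin_weyl_R[OF assms(2,3)] assms(4)]
    isom_D(10)[OF fin_weyl_isom[OF assms(1,2)]] by (simp_all add: lex_ht_def)

text \<open>For j in \<open>J\<close> outside \<open>K\<close>, the whole string of the image of -
  \<alpha> j under \<open>u\<close> lies in the set.\<close>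

lemma nabla_set_infinite:
  assumes "K \<subset> J" "J \<subseteq> I" "u \<in> MR J K"
  shows "infinite (nabla_set J K u y)"
proof
  assume fin: "finite (nabla_set J K u y)"
  obtain j where j: "j \<in> J" "j \<notin> K" using assms(1) by blast
  have jr: "j \<le> rk D" using j assms(2) by auto
  have u: "u \<in> fin_weyl D J" using MR_D assms(3) .
  have \<eta>: "- \<alpha> j \<in> R J" by (rule R_minus[OF assms(2) R_simple[OF assms(2) j(1)]])
  have KI: "K \<subseteq> I" "K \<subseteq> J" using assms by auto
  have "cf j (- \<alpha> j) \<noteq> 0" using jr by (simp add: cf_simps cf_root)
  then have "- \<alpha> j \<notin> R K" using cf_outside[OF KI(1) _ jr j(2)] by blast
  then have "outer_ht J K (- \<alpha> j) < 0" using outer_ht_sign(2)[OF KI(2) assms(2) \<eta>] jr by (simp add: ht_simps)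
  then have "(\<lambda>m. real (Suc m) *\<^sub>R \<delta> + u (- \<alpha> j)) ` UNIV \<subseteq> nabla_set J K u y"
    using lex_ht_string(1)[OF assms(2) u \<eta>, where K = K] lex_ht_string(2)[OF assms(2) u \<eta>] by (auto simp: nabla_set_def simp del: of_nat_Suc)
  then have "finite (range (\<lambda>m. real (Suc m) *\<^sub>R \<delta> + u (- \<alpha> j)))" using fin finite_subset by blast
  moreover have "inj (\<lambda>m. real (Suc m) *\<^sub>R \<delta> + u (- \<alpha> j))"
    using ht_\<delta>(2) by (auto simp: inj_def dest!: arg_cong[where f = ht] simp: ht_simps)
  ultimately show False using finite_imageD by blast
qed

text \<open>Subtracting an acute simple root from a positive root that is not simple gives a
  positive root again.\<close>

lemma R_pos_induct [consumes 3, case_names simple add]: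
  assumes "J \<subseteq> I" "\<eta> \<in> R J" "0 < ht \<eta>"
    and simple: "\<And>j. j \<in> J \<Longrightarrow> P (\<alpha> j)"
    and add: "\<And>\<eta> j. \<eta> \<in> R J \<Longrightarrow> 0 < ht \<eta> \<Longrightarrow> j \<in> J \<Longrightarrow> \<eta> + \<alpha> j \<in> R J \<Longrightarrow> P \<eta> \<Longrightarrow> P (\<eta> + \<alpha> j)"
  shows "P \<eta>"
proof -
  have "P \<eta>" if "\<eta> \<in> R J" "0 < ht \<eta>" "ht \<eta> \<le> real n" for n \<eta>
    using that
  proof (induction n arbitrary: \<eta>)
    case (Suc n)
    have l: "lroot \<eta>" by (rule R_D(1)[OF assms(1) Suc.prems(1)])
    have "\<forall>j\<in>I. 0 \<le> cf j \<eta>" "\<eta> \<noteq> 0"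
      using lroot_ht_pos_iff(1)[OF l] Suc.prems(2) by (auto simp: ht_simps)
    then obtain j where j: "j \<in> J" "0 < b \<eta> (\<alpha> j)"
      using exists_acute_simple[OF R_D(2)[OF assms(1) Suc.prems(1)] assms(1)] by blast
    have jr: "j \<le> rk D" using j assms(1) by auto
    show ?case
    proof (cases "\<eta> = \<alpha> j")
      case True
      then show ?thesis using simple j by simp
    next
      case False
      have d: "\<eta> - \<alpha> j \<in> R J" by (rule R_diff[OF assms(1) Suc.prems(1) R_simple[OF assms(1) j(1)] j(2) False])
      have "1 \<le> ht \<eta>" using Suc.prems(2) lroot_ht_Ints[OF l] by (auto elim!: Ints_cases)
      then have "0 < ht (\<eta> - \<alpha> j)"
        using lroot_ht_pos_iff(3)[OF R_D(1)[OF assms(1) d]] jr by (simp add: ht_simps)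
      moreover have "ht (\<eta> - \<alpha> j) \<le> real n" using Suc.prems(3) jr by (simp add: ht_simps)
      ultimately have "P (\<eta> - \<alpha> j)" using Suc.IH[OF d] by blast
      then have "P ((\<eta> - \<alpha> j) + \<alpha> j)"
        using add[OF d \<open>0 < ht (\<eta> - \<alpha> j)\<close> j(1)] Suc.prems(1) by simp
      then show ?thesis by simp
    qed
  qed simp
  then show ?thesis using assms(2,3) real_nat_ceiling_ge[of "ht \<eta>"] by blast
qed

text \<open>Choose \<open>w\<close> carrying all simple roots into \<open>M\<close>; closure then
  carries all positive roots there. With \<open>K\<close> the simple roots whose negatives are also
  carried into \<open>M\<close>, the set pulled back by \<open>w\<close> consists of the positive
  roots and the roots of \<open>K\<close>.\<close>

lemma parabolic_set:
  assumes "J \<subseteq> I" "\<And>\<epsilon>. \<epsilon> \<in> R J \<Longrightarrow> \<epsilon> \<in> M \<or> - \<epsilon> \<in> M"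
    and closed: "\<And>\<epsilon> \<eta>. \<epsilon> \<in> M \<Longrightarrow> \<eta> \<in> M \<Longrightarrow> \<epsilon> \<in> R J \<Longrightarrow> \<eta> \<in> R J \<Longrightarrow> \<epsilon> + \<eta> \<in> R J \<Longrightarrow> \<epsilon> + \<eta> \<in> M"
  obtains K u where "K \<subseteq> J" "u \<in> MR J K" "\<And>\<epsilon>. \<epsilon> \<in> R J \<Longrightarrow> \<epsilon> \<in> M \<longleftrightarrow> \<not> outer_ht J K (inv u \<epsilon>) < 0"
proof -
  obtain w where w: "w \<in> fin_weyl D J" "\<And>j. j \<in> J \<Longrightarrow> w (\<alpha> j) \<in> M"
    using max_chamber[OF assms(1), of "\<lambda>\<epsilon>. \<epsilon> \<in> M"] assms(2) by blast
  have iw: "isom w" by (rule fin_weyl_isom[OF assms(1) w(1)])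
  have wR: "w \<epsilon> \<in> R J" if "\<epsilon> \<in> R J" for \<epsilon> using fin_weyl_R[OF w(1) that] .
  have clw: "w (\<epsilon> + \<eta>) \<in> M"
    if "w \<epsilon> \<in> M" "w \<eta> \<in> M" "\<epsilon> \<in> R J" "\<eta> \<in> R J" "\<epsilon> + \<eta> \<in> R J" for \<epsilon> \<eta>
    using closed[OF that(1,2) wR[OF that(3)] wR[OF that(4)]] wR[OF that(5)] by (simp add: isom_D(6)[OF iw])
  note sR = R_simple[OF assms(1)]
  have pos: "w \<epsilon> \<in> M" if "\<epsilon> \<in> R J" "0 < ht \<epsilon>" for \<epsilon>
    using assms(1) that
  proof (induction rule: R_pos_induct)
    case (simple j)
    then show ?case by (rule w(2))
  next
    case (add \<eta> j)
    then show ?case using clw w(2) sR by blast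
  qed
  define K where "K = {j \<in> J. w (- \<alpha> j) \<in> M}"
  have K: "K \<subseteq> J" "K \<subseteq> I" using assms(1) by (auto simp: K_def)
  have neg1: "w (- \<eta>) \<in> M" if "\<eta> \<in> R K" "0 < ht \<eta>" for \<eta>
    using K(2) that
  proof (induction rule: R_pos_induct)
    case (simple j)
    then show ?case by (simp add: K_def)
  next
    case (add \<eta> j)
    have RJ: "\<eta> \<in> R J" "\<alpha> j \<in> R J" "\<eta> + \<alpha> j \<in> R J" using add R_mono[OF K(1) assms(1)] sR K(1) by auto
    have "w (- \<eta> + - \<alpha> j) \<in> M"
    proof (rule clw)
      show "w (- \<alpha> j) \<in> M" using add(3) by (simp add: K_def)
      show "- \<eta> + - \<alpha> j \<in> R J" using R_minus[OF assms(1) RJ(3)] by simp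
    qed (use add RJ R_minus[OF assms(1)] in auto)
    then show ?case by (simp add: add.commute)
  qed
  \<comment> \<open>Adding \<eta> to - (\<eta> + \<alpha> j) shows that j lies in \<open>K\<close>,
    and adding \<alpha> j reduces to \<eta>; both summands are carried into \<open>M\<close>, so
    closure applies.\<close>
  have neg2: "w (- \<eta>) \<in> M \<longrightarrow> \<eta> \<in> R K" if "\<eta> \<in> R J" "0 < ht \<eta>" for \<eta>
    using assms(1) that
  proof (induction rule: R_pos_induct)
    case (simple j)
    then show ?case using R_simple[OF K(2), of j] by (auto simp: K_def)
  next
    case (add \<eta> j)
    show ?case
    proof
      assume m: "w (- (\<eta> + \<alpha> j)) \<in> M"
      have nR: "- (\<eta> + \<alpha> j) \<in> R J" "- \<alpha> j \<in> R J" "- \<eta> \<in> R J" using add(1) sR[OF add(3)] R_minus[OF assms(1) add(4)] R_minus[OF assms(1)] by blast+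
      have "w (- (\<eta> + \<alpha> j) + \<eta>) \<in> M"
        using m pos[OF add(1,2)] nR add by (intro clw) auto
      then have jK: "j \<in> K" using add(3) by (simp add: K_def)
      have "w (- (\<eta> + \<alpha> j) + \<alpha> j) \<in> M"
        using m w(2)[OF add(3)] nR sR[OF add(3)] by (intro clw) auto
      then have "\<eta> \<in> R K" using add(5) by simp
      then show "\<eta> + \<alpha> j \<in> R K"
        using R_D(1)[OF assms(1) add(4)] R_D(2)[OF K(2)] simple_in_span[OF jK]
        by (simp add: fin_roots_iff[OF K(2)] span_add)
    qed
  qed
  have memw: "w \<zeta> \<in> M \<longleftrightarrow> 0 < ht \<zeta> \<or> \<zeta> \<in> R K" if "\<zeta> \<in> R J" for \<zeta>
  proof (cases "0 < ht \<zeta>")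
    case True
    then show ?thesis using pos that by simp
  next
    case False
    then have "0 < ht (- \<zeta>)" using lroot_ht_pos_iff(3)[OF R_D(1)[OF assms(1) that]] by (simp add: ht_simps)
    then show ?thesis
      using neg1[of "- \<zeta>"] neg2[of "- \<zeta>"] R_minus[OF assms(1) that] R_minus_iff[OF K(2), of \<zeta>] False by auto
  qed
  \<comment> \<open>Passing to the minimal representative keeps the set, since the factor in the
    Weyl group of \<open>K\<close> permutes both the roots of \<open>K\<close> and the positive
    roots outside \<open>K\<close>.\<close>
  obtain u v where uv: "u \<in> MR J K" "v \<in> fin_weyl D K" "w = u \<circ> v"
    using min_rep_exists[OF K(1) assms(1) w(1)] by blast
  have iu: "isom u" by (rule fin_weyl_isom[OF assms(1) MR_D[OF uv(1)]])
  have iv: "isom v" by (rule fin_weyl_isom[OF K(2) uv(2)])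
  have "\<epsilon> \<in> M \<longleftrightarrow> \<not> outer_ht J K (inv u \<epsilon>) < 0" if \<epsilon>: "\<epsilon> \<in> R J" for \<epsilon>
  proof -
    define \<zeta> where "\<zeta> = inv w \<epsilon>"
    have \<zeta>: "\<zeta> \<in> R J" unfolding \<zeta>_def by (rule fin_weyl_R[OF fin_weyl_inv[OF assms(1) w(1)] \<epsilon>])
    have w\<zeta>: "w \<zeta> = \<epsilon>" unfolding \<zeta>_def by (rule isom_D(11)[OF iw])
    have v\<zeta>: "inv u \<epsilon> = v \<zeta>" using w\<zeta> uv(3) isom_D(10)[OF iu] by auto
    have vR: "v \<zeta> \<in> R J" using fin_weyl_R[OF _ \<zeta>] fin_weyl_mono[OF K(1) assms(1)] uv(2) by blast
    have RKiff: "v \<zeta> \<in> R K \<longleftrightarrow> \<zeta> \<in> R K"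
      using fin_weyl_R[OF uv(2), of \<zeta>] fin_weyl_R[OF fin_weyl_inv[OF K(2) uv(2)], of "v \<zeta>"]
      by (auto simp: isom_D(10)[OF iv])
    have "\<epsilon> \<in> M \<longleftrightarrow> 0 < ht \<zeta> \<or> \<zeta> \<in> R K" using memw[OF \<zeta>] w\<zeta> by simp
    moreover have "ht (v \<zeta>) < 0 \<longleftrightarrow> \<not> 0 < ht \<zeta>" if "\<zeta> \<notin> R K"
    proof (cases "0 < ht \<zeta>")
      case True
      then show ?thesis using fin_weyl_parabolic_pos(3)[OF K(1) assms(1) uv(2) \<zeta> that] by simp
    next
      case False
      then have "0 < ht (- \<zeta>)" using lroot_ht_pos_iff(3)[OF R_D(1)[OF assms(1) \<zeta>]] by (simp add: ht_simps)
      then have "0 < ht (v (- \<zeta>))"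
        using fin_weyl_parabolic_pos(3)[OF K(1) assms(1) uv(2) R_minus[OF assms(1) \<zeta>]] that
          R_minus_iff[OF K(2), of \<zeta>] by simp
      then show ?thesis using False by (simp add: isom_D(8)[OF iv] ht_simps)
    qed
    ultimately show ?thesis using outer_ht_sign(2)[OF K(1) assms(1) vR] RKiff v\<zeta> by auto
  qed
  then show thesis using that K(1) uv(1) by blast
qed

lemma infinite_real_biconvex_nabla_set:
  assumes "J \<subseteq> I" "real_biconvex J B" "infinite B"
  obtains K u y where "K \<subset> J" "u \<in> MR J K" "y \<in> AW K" "B = nabla_set J K u y"
proof -
  have BP: "B \<subseteq> PR J" by (rule real_biconvex_D(1)[OF assms(2)])
  \<comment> \<open>Once a string has left \<open>B\<close> it stays outside: adding imaginary
    roots, which avoid \<open>B\<close>, keeps within the complement.\<close>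
  have up: "\<beta>' \<notin> B" if h: "\<beta> \<in> PR J" "\<beta> \<notin> B" "\<beta>' \<in> PR J" "fp \<beta> = fp \<beta>'" "cf 0 \<beta> \<le> cf 0 \<beta>'" for \<beta> \<beta>'
  proof -
    obtain m where m: "\<beta>' = \<beta> + real m *\<^sub>R \<delta>" using same_string[OF assms(1) h(1,3,4,5)] by blast
    show ?thesis
    proof (cases "m = 0")
      case False
      then have "real m *\<^sub>R \<delta> \<in> PI" by (intro PI_I) simp
      then show ?thesis unfolding m
        using that BP PR_PI_disjoint[OF assms(1)] by (intro real_biconvex_D(3)[OF assms(2)]) auto
    qed (use m that in simp)
  qed
  \<comment> \<open>Two roots of \<open>B\<close> with opposite finite parts would have an imaginary
    sum in \<open>B\<close>.\<close>
  have opp: False if "\<beta> \<in> B" "\<beta>' \<in> B" "fp \<beta>' = - fp \<beta>" for \<beta> \<beta>'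
  proof -
    have P: "\<beta> \<in> PR J" "\<beta>' \<in> PR J" using that BP by auto
    have e: "\<beta> + \<beta>' = (cf 0 \<beta> + cf 0 \<beta>') *\<^sub>R \<delta>"
      using that(3) by (simp add: fp_def algebra_simps)
    have "0 < ht (\<beta> + \<beta>')"
      using PR_D(2)[OF assms(1) P(1)] PR_D(2)[OF assms(1) P(2)] by (simp add: ht_simps)
    then have "0 < (cf 0 \<beta> + cf 0 \<beta>') * ht \<delta>" unfolding e ht_simps .
    then have "0 < cf 0 \<beta> + cf 0 \<beta>'" using ht_\<delta>(2) by (simp add: zero_less_mult_iff)
    moreover obtain k :: int where k: "cf 0 \<beta> + cf 0 \<beta>' = of_int k"
      using PR_D(4)[OF assms(1)] P Ints_add Ints_cases by metis
    ultimately have "cf 0 \<beta> + cf 0 \<beta>' = real (nat k)" "1 \<le> nat k" by auto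
    then have pi: "\<beta> + \<beta>' \<in> PI" unfolding e using PI_I by metis
    then have "\<beta> + \<beta>' \<in> B" using real_biconvex_D(2)[OF assms(2) that(1,2)] by blast
    then show False using pi BP PR_PI_disjoint[OF assms(1)] by blast
  qed
  define N where "N = {\<epsilon> \<in> R J. \<forall>\<beta>\<in>PR J. fp \<beta> = \<epsilon> \<longrightarrow> \<beta> \<in> B}"
  have N1: "real 1 *\<^sub>R \<delta> + \<epsilon> \<in> B" "fp (real 1 *\<^sub>R \<delta> + \<epsilon>) = \<epsilon>" if "\<epsilon> \<in> N" for \<epsilon>
    using that string_PR[OF assms(1), of \<epsilon> 1] by (auto simp: N_def)
  have N2: "\<exists>\<beta>\<in>PR J. fp \<beta> = \<epsilon> \<and> \<beta> \<notin> B" if "\<epsilon> \<in> R J" "\<epsilon> \<notin> N" for \<epsilon>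
    using that by (auto simp: N_def)
  \<comment> \<open>Here \<open>- N\<close> is the set complement. If \<epsilon> and - \<epsilon>
    both had their full string in \<open>B\<close>, the two roots with \<delta>-coefficient 1 would
    be opposite in the sense just excluded.\<close>
  have tot: "\<epsilon> \<in> - N \<or> - \<epsilon> \<in> - N" if "\<epsilon> \<in> R J" for \<epsilon>
    using N1[of \<epsilon>] N1[of "- \<epsilon>"] opp[of "real 1 *\<^sub>R \<delta> + \<epsilon>" "real 1 *\<^sub>R \<delta> + - \<epsilon>"] by auto
  have closed: "\<epsilon> + \<eta> \<in> - N" if h: "\<epsilon> \<in> - N" "\<eta> \<in> - N" "\<epsilon> \<in> R J" "\<eta> \<in> R J" "\<epsilon> + \<eta> \<in> R J" for \<epsilon> \<eta>
  proof -
    obtain \<beta> \<gamma> where b: "\<beta> \<in> PR J" "fp \<beta> = \<epsilon>" "\<beta> \<notin> B" and c: "\<gamma> \<in> PR J" "fp \<gamma> = \<eta>" "\<gamma> \<notin> B"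
      using N2[of \<epsilon>] N2[of \<eta>] h by blast
    have "\<beta> + \<gamma> \<in> PR J"
      using h(5) b(2) c(2) PR_D(2,4)[OF assms(1) b(1)] PR_D(2,4)[OF assms(1) c(1)]
      by (simp add: PR_def RT_def fp_simps cf_simps ht_simps)
    moreover have "\<beta> + \<gamma> \<notin> B" using b c by (intro real_biconvex_D(3)[OF assms(2)]) auto
    moreover have "fp (\<beta> + \<gamma>) = \<epsilon> + \<eta>" using b c by (simp add: fp_simps)
    ultimately show ?thesis by (auto simp: N_def)
  qed
  obtain K u where K: "K \<subseteq> J" and u: "u \<in> MR J K"
    and memN: "\<And>\<epsilon>. \<epsilon> \<in> R J \<Longrightarrow> \<epsilon> \<in> - N \<longleftrightarrow> \<not> outer_ht J K (inv u \<epsilon>) < 0"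
    using parabolic_set[OF assms(1) tot closed] by blast
  have KI: "K \<subseteq> I" using K assms(1) by blast
  have uw: "u \<in> fin_weyl D J" by (rule MR_D[OF u])
  have iu: "isom u" by (rule fin_weyl_isom[OF assms(1) uw])
  have lxN: "fp \<beta> \<in> N \<longleftrightarrow> lex_ht J K u \<beta> < 0" if "\<beta> \<in> PR J" for \<beta>
    using memN[OF PR_D(3)[OF assms(1) that]] by (auto simp: lex_ht_def)
  have lex_ht_neg: "\<beta> \<in> B" if "\<beta> \<in> PR J" "lex_ht J K u \<beta> < 0" for \<beta>
    using lxN[OF that(1)] that by (auto simp: N_def)
  \<comment> \<open>The opposite string lies entirely in \<open>B\<close>, so this root
    cannot.\<close>
  have lex_ht_pos: "\<beta> \<notin> B" if "\<beta> \<in> PR J" "0 < lex_ht J K u \<beta>" for \<beta>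
  proof
    assume "\<beta> \<in> B"
    have r: "- fp \<beta> \<in> R J" by (rule R_minus[OF assms(1) PR_D(3)[OF assms(1) that(1)]])
    have "lex_ht J K u (- \<beta>) < 0" using that(2) lex_ht_minus[OF assms(1) iu] by simp
    then have "outer_ht J K (inv u (- fp \<beta>)) < 0" by (simp add: lex_ht_def fp_simps)
    then have "- fp \<beta> \<in> N" using memN[OF r] by blast
    then show False using N1[of "- fp \<beta>"] opp[OF \<open>\<beta> \<in> B\<close>] by blast
  qed
  define F where "F = {\<gamma> \<in> PR K. u \<gamma> \<in> B}"
  have uPR: "u \<gamma> \<in> PR J" "lex_ht J K u (u \<gamma>) = 0" if "\<gamma> \<in> PR K" for \<gamma>
    using u_PR_K[OF K assms(1) u that] by auto
  \<comment> \<open>For a root \<epsilon> of \<open>K\<close> the string of u \<epsilon> leaves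
    \<open>B\<close> at some point and stays outside, which bounds the \<delta>-coefficients in
    \<open>F\<close>; and \<open>K\<close> has only finitely many roots.\<close>
  have finF: "finite F"
  proof -
    have "\<exists>c. \<forall>\<gamma>\<in>F. fp \<gamma> = \<epsilon> \<longrightarrow> cf 0 \<gamma> < c" if e: "\<epsilon> \<in> R K" for \<epsilon>
    proof -
      have eJ: "\<epsilon> \<in> R J" using e R_mono[OF K assms(1)] by blast
      have "outer_ht J K (inv u (u \<epsilon>)) = 0" using outer_ht_sign(1)[OF K assms(1) eJ] e isom_D(10)[OF iu] by simp
      then have "u \<epsilon> \<notin> N" using memN[OF fin_weyl_R[OF uw eJ]] by auto
      then obtain \<beta> where \<beta>: "\<beta> \<in> PR J" "fp \<beta> = u \<epsilon>" "\<beta> \<notin> B" using N2 fin_weyl_R[OF uw eJ] by blast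
      have "cf 0 \<gamma> < cf 0 \<beta>" if "\<gamma> \<in> F" "fp \<gamma> = \<epsilon>" for \<gamma>
      proof -
        have g: "\<gamma> \<in> PR K" "u \<gamma> \<in> B" "\<gamma> \<in> RT J" using that RT_mono[OF K assms(1)] by (auto simp: F_def PR_def)
        show ?thesis
          using up[OF \<beta>(1,3) uPR(1)[OF g(1)]] g \<beta>(2) that(2) fin_weyl_fp[OF assms(1) uw g(3)] by force
      qed
      then show ?thesis by blast
    qed
    then obtain c where c: "\<And>\<epsilon> \<gamma>. \<epsilon> \<in> R K \<Longrightarrow> \<gamma> \<in> F \<Longrightarrow> fp \<gamma> = \<epsilon> \<Longrightarrow> cf 0 \<gamma> < c \<epsilon>" by metis
    have "F \<subseteq> (\<Union>\<epsilon>\<in>R K. (\<lambda>m::int. of_int m *\<^sub>R \<delta> + \<epsilon>) ` {0..\<lceil>c \<epsilon>\<rceil>})"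
    proof
      fix \<gamma> assume g: "\<gamma> \<in> F"
      then have gP: "\<gamma> \<in> PR K" by (simp add: F_def)
      obtain m :: int where m: "cf 0 \<gamma> = of_int m" using PR_D(4)[OF KI gP] by (rule Ints_cases)
      have "0 \<le> m" using PR_cf0[OF KI gP] m by simp
      moreover have "m \<le> \<lceil>c (fp \<gamma>)\<rceil>" using c[OF PR_D(3)[OF KI gP] g refl] m by linarith
      ultimately show "\<gamma> \<in> (\<Union>\<epsilon>\<in>R K. (\<lambda>m::int. of_int m *\<^sub>R \<delta> + \<epsilon>) ` {0..\<lceil>c \<epsilon>\<rceil>})"
        using PR_D(3)[OF KI gP] fp_decomp[of \<gamma>] m by (metis (no_types, lifting) UN_I atLeastAtMost_iff image_eqI)
    qed
    then show ?thesis using finite_R[OF KI] by (meson finite_UN_I finite_atLeastAtMost_int finite_imageI finite_subset)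
  qed
  have uPA: "u \<gamma> \<in> PA J" if "\<gamma> \<in> PA K" for \<gamma>
    using that uPR(1) isom_PI[OF iu] by auto
  have uB: "\<gamma> \<in> F" if "\<gamma> \<in> PA K" "u \<gamma> \<in> B" for \<gamma>
    using that isom_PI[OF iu, of \<gamma>] BP PR_PI_disjoint[OF assms(1), of \<gamma>] by (auto simp: F_def)
  have "real_biconvex K F" unfolding real_biconvex_def
  proof (intro conjI ballI impI)
    show "F \<subseteq> PR K" by (auto simp: F_def)
    fix \<beta> \<gamma> assume "\<beta> \<in> F" "\<gamma> \<in> F" and s: "\<beta> + \<gamma> \<in> PA K"
    then have "u \<beta> + u \<gamma> \<in> B"
      using uPA[OF s] isom_D(6)[OF iu] by (intro real_biconvex_D(2)[OF assms(2)]) (auto simp: F_def)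
    then show "\<beta> + \<gamma> \<in> F" using uB[OF s] isom_D(6)[OF iu] by simp
  next
    fix \<beta> \<gamma> assume b: "\<beta> \<in> PA K - F" and c: "\<gamma> \<in> PA K - F"
    have "u \<beta> + u \<gamma> \<notin> B" using b c uPA uB by (intro real_biconvex_D(3)[OF assms(2)]) auto
    then show "\<beta> + \<gamma> \<notin> F" by (auto simp: F_def isom_D(6)[OF iu])
  qed
  then obtain y where y: "y \<in> AW K" "Inv K y = F" using finite_real_biconvex[OF KI finF] by blast
  have zero: "\<beta> \<in> B \<longleftrightarrow> ht (inv y (inv u \<beta>)) < 0" if "\<beta> \<in> PR J" "lex_ht J K u \<beta> = 0" for \<beta>
  proof -
    have "inv u \<beta> \<in> PR K" by (rule inv_u_RT_K[OF K assms(1) u that])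
    moreover then have "\<beta> \<in> B \<longleftrightarrow> inv u \<beta> \<in> F" by (simp add: F_def isom_D(11)[OF iu])
    ultimately show ?thesis unfolding y(2)[symmetric] by (simp add: Inv_def)
  qed
  have B: "B = nabla_set J K u y"
  proof (intro set_eqI)
    fix \<beta>
    consider "\<beta> \<notin> PR J" | "\<beta> \<in> PR J" "lex_ht J K u \<beta> < 0" | "\<beta> \<in> PR J" "lex_ht J K u \<beta> = 0"
      | "\<beta> \<in> PR J" "0 < lex_ht J K u \<beta>" by linarith
    then show "\<beta> \<in> B \<longleftrightarrow> \<beta> \<in> nabla_set J K u y"
      by cases (use BP lex_ht_neg lex_ht_pos zero in \<open>auto simp: nabla_set_def\<close>)
  qed
  \<comment> \<open>For \<open>K = J\<close> the lexicographic height vanishes identically and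
    \<open>B\<close> would be contained in the finite set u(F).\<close>
  have "K \<noteq> J"
  proof
    assume "K = J"
    then have "lex_ht J K u \<beta> = 0" for \<beta> by (simp add: lex_ht_def outer_ht_def)
    then have "inv u \<beta> \<in> F" if "\<beta> \<in> B" for \<beta>
      using inv_u_RT_K[OF K assms(1) u, of \<beta>] that BP isom_D(11)[OF iu, of \<beta>] by (auto simp: F_def)
    then have "B \<subseteq> u ` F" using isom_D(11)[OF iu] by (metis imageI subsetI)
    then show False using finF assms(3) finite_subset by blast
  qed
  then show thesis using that K u y(1) B by blast
qed

text \<open>A string of lexicographic height 0 cannot lie wholly in the set, since its translate
  would be an infinite subset of the finite inversion set of \<open>y\<close>. So the negative locus
  of \<open>outer_ht\<close>, from which \<open>K\<close> and \<open>u\<close> are recovered, is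
  visible in the set.\<close>

lemma nabla_set_string_iff:
  assumes "K \<subseteq> J" "J \<subseteq> I" "u \<in> MR J K" "y \<in> AW K" "\<epsilon> \<in> R J"
  shows "(\<forall>\<beta>\<in>PR J. fp \<beta> = \<epsilon> \<longrightarrow> \<beta> \<in> nabla_set J K u y) \<longleftrightarrow> outer_ht J K (inv u \<epsilon>) < 0"
proof
  show "outer_ht J K (inv u \<epsilon>) < 0 \<Longrightarrow> \<forall>\<beta>\<in>PR J. fp \<beta> = \<epsilon> \<longrightarrow> \<beta> \<in> nabla_set J K u y"
    by (auto simp: nabla_set_def lex_ht_def)
  assume all: "\<forall>\<beta>\<in>PR J. fp \<beta> = \<epsilon> \<longrightarrow> \<beta> \<in> nabla_set J K u y"
  have KI: "K \<subseteq> I" using assms by blast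
  have uw: "u \<in> fin_weyl D J" by (rule MR_D[OF assms(3)])
  have iu: "isom u" by (rule fin_weyl_isom[OF assms(2) uw])
  have str: "real (Suc m) *\<^sub>R \<delta> + \<epsilon> \<in> nabla_set J K u y" "lex_ht J K u (real (Suc m) *\<^sub>R \<delta> + \<epsilon>) = outer_ht J K (inv u \<epsilon>)" for m
  proof -
    show "real (Suc m) *\<^sub>R \<delta> + \<epsilon> \<in> nabla_set J K u y"
      using all string_PR(1,2)[OF assms(2,5), of "Suc m"] by (simp del: of_nat_Suc)
    show "lex_ht J K u (real (Suc m) *\<^sub>R \<delta> + \<epsilon>) = outer_ht J K (inv u \<epsilon>)"
      using string_PR(2)[OF assms(2,5), of "Suc m"] by (simp add: lex_ht_def del: of_nat_Suc)
  qed
  have le: "outer_ht J K (inv u \<epsilon>) \<le> 0" using str[of 0] by (auto simp: nabla_set_def)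
  moreover have "outer_ht J K (inv u \<epsilon>) \<noteq> 0"
  proof
    assume z: "outer_ht J K (inv u \<epsilon>) = 0"
    have "real (Suc m) *\<^sub>R \<delta> + inv u \<epsilon> \<in> Inv K y" for m
    proof -
      have "inv u (real (Suc m) *\<^sub>R \<delta> + \<epsilon>) = real (Suc m) *\<^sub>R \<delta> + inv u \<epsilon>"
        by (simp only: isom_D[OF isom_inv[OF iu]])
      moreover have "real (Suc m) *\<^sub>R \<delta> + \<epsilon> \<in> PR J" using str(1)[of m] by (simp add: nabla_set_def)
      ultimately show ?thesis
        using str[of m] z inv_u_RT_K[OF assms(1-3), of "real (Suc m) *\<^sub>R \<delta> + \<epsilon>"]
        by (simp add: nabla_set_def Inv_def del: of_nat_Suc)
    qed
    then have "range (\<lambda>m. real (Suc m) *\<^sub>R \<delta> + inv u \<epsilon>) \<subseteq> Inv K y" by blast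
    then have "finite (range (\<lambda>m. real (Suc m) *\<^sub>R \<delta> + inv u \<epsilon>))"
      using finite_Inv[OF KI assms(4)] finite_subset by blast
    moreover have "inj (\<lambda>m. real (Suc m) *\<^sub>R \<delta> + inv u \<epsilon>)"
      using ht_\<delta>(2) by (auto simp: inj_def dest!: arg_cong[where f = ht] simp: ht_simps)
    ultimately show False using finite_imageD by blast
  qed
  ultimately show "outer_ht J K (inv u \<epsilon>) < 0" by simp
qed

lemma nabla_set_inj:
  assumes "J \<subseteq> I" "K \<subseteq> J" "u \<in> MR J K" "y \<in> AW K" "K' \<subseteq> J" "u' \<in> MR J K'" "y' \<in> AW K'"
    and eq: "nabla_set J K u y = nabla_set J K' u' y'"
  shows "K = K'" "u = u'" "y = y'"
proof -
  have uw: "u \<in> fin_weyl D J" "u' \<in> fin_weyl D J" using MR_D assms by blast+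
  have iu: "isom u" and iu': "isom u'" using fin_weyl_isom[OF assms(1)] uw by auto
  have KI: "K \<subseteq> I" "K' \<subseteq> I" using assms by auto
  have J: "j \<le> rk D" if "j \<in> J" for j using that assms(1) by auto
  have outer_ht_minus: "outer_ht J L (- v) = - outer_ht J L v" for L v
    using J by (auto simp: outer_ht_def cf_simps sum_negf[symmetric] intro!: sum.cong)
  \<comment> \<open>\<open>x\<close> intertwines the two functionals in their negative and zero
    loci. Minimality of \<open>u\<close> and \<open>u'\<close> settles the roots of
    \<open>K\<close>, so \<open>x\<close> preserves all positive roots of \<open>J\<close> and is
    the identity.\<close>
  define x where "x = inv u' \<circ> u"
  have xw: "x \<in> fin_weyl D J" unfolding x_def by (intro fin_weyl_comp fin_weyl_inv assms(1) uw)
  have lt: "outer_ht J K \<epsilon> < 0 \<longleftrightarrow> outer_ht J K' (x \<epsilon>) < 0" if "\<epsilon> \<in> R J" for \<epsilon>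
    using nabla_set_string_iff[OF assms(2,1,3,4) fin_weyl_R[OF uw(1) that]]
      nabla_set_string_iff[OF assms(5,1,6,7) fin_weyl_R[OF uw(1) that]] eq
    by (simp add: isom_D(10)[OF iu] x_def)
  have x_minus: "x (- \<epsilon>) = - x \<epsilon>" for \<epsilon> using isom_D(8)[OF fin_weyl_isom[OF assms(1) xw]] .
  have ze: "outer_ht J K \<epsilon> = 0 \<longleftrightarrow> outer_ht J K' (x \<epsilon>) = 0" if "\<epsilon> \<in> R J" for \<epsilon>
    using lt[OF that] lt[OF R_minus[OF assms(1) that]] by (auto simp: outer_ht_minus x_minus)
  have "x = id"
  proof (rule fin_weyl_pos_id[OF assms(1) xw])
    fix \<epsilon> assume \<epsilon>: "\<epsilon> \<in> R J" "0 < ht \<epsilon>"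
    have xR: "x \<epsilon> \<in> R J" by (rule fin_weyl_R[OF xw \<epsilon>(1)])
    show "0 < ht (x \<epsilon>)"
    proof (cases "\<epsilon> \<in> R K")
      case True
      then have "x \<epsilon> \<in> R K'"
        using outer_ht_sign(1)[OF assms(2,1) \<epsilon>(1)] outer_ht_sign(1)[OF assms(5,1) xR] ze[OF \<epsilon>(1)] by simp
      moreover have "0 < ht (u' (x \<epsilon>))"
        using MR_pos[OF assms(2,1,3) True \<epsilon>(2)] isom_D(11)[OF iu'] by (simp add: x_def)
      ultimately show ?thesis using MR_pos_iff[OF assms(5,1,6) R_RT[OF KI(2)]] by blast
    next
      case False
      then have "outer_ht J K (- \<epsilon>) < 0"
        using outer_ht_sign(2)[OF assms(2,1) R_minus[OF assms(1) \<epsilon>(1)]] R_minus_iff[OF KI(1), of \<epsilon>] \<epsilon>(2)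
        by (simp add: ht_simps)
      then have "outer_ht J K' (- x \<epsilon>) < 0" using lt[OF R_minus[OF assms(1) \<epsilon>(1)]] by (simp add: x_minus)
      then show ?thesis using outer_ht_sign(2)[OF assms(5,1) R_minus[OF assms(1) xR]] by (simp add: ht_simps)
    qed
  qed
  then have "u' (inv u' (u v)) = u' v" for v by (metis comp_apply id_apply x_def)
  then show uu: "u = u'" using isom_D(11)[OF iu'] by (simp add: fun_eq_iff)
  have RK: "\<epsilon> \<in> R K \<longleftrightarrow> \<epsilon> \<in> R K'" if "\<epsilon> \<in> R J" for \<epsilon>
    using ze[OF that] outer_ht_sign(1)[OF assms(2,1) that] outer_ht_sign(1)[OF assms(5,1) that] \<open>x = id\<close> by simp
  have simple_mem: "j \<in> L" if "\<alpha> j \<in> R L" "j \<in> J" "L \<subseteq> I" for j L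
    using cf_outside[OF that(3,1) J[OF that(2)]] cf_root[of j j] J[OF that(2)] by auto
  show KK: "K = K'"
  proof
    show "K \<subseteq> K'" using R_simple[OF KI(1)] RK[OF R_simple[OF assms(1)]] simple_mem KI assms(2) by blast
    show "K' \<subseteq> K" using R_simple[OF KI(2)] RK[OF R_simple[OF assms(1)]] simple_mem KI assms(5) by blast
  qed
  have InvK: "Inv K z = {\<gamma> \<in> PR K. u \<gamma> \<in> nabla_set J K u z}" for z
    using u_PR_K[OF assms(2,1,3)] by (auto simp: Inv_def nabla_set_def isom_D(10)[OF iu])
  have "Inv K y = Inv K y'" using InvK[of y] InvK[of y'] eq uu KK by simp
  then show "y = y'" using Inv_inj[OF KI(1) assms(4)] assms(7) KK by simp
qed

section \<open>Translations and infinite words\<close>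

text \<open>Pairing with the sum of the coroots of \<open>S\<close>; this sum is the vector of the
  translation. Being a sum of coroots, it lies in the coroot lattice by construction.\<close>

definition coroot_sum :: "'v set \<Rightarrow> 'v \<Rightarrow> real" where
  "coroot_sum S v = (\<Sum>\<beta>\<in>S. 2 * b \<beta> v / b \<beta> \<beta>)"

lemma coroot_sum_simps: "coroot_sum S (u + v) = coroot_sum S u + coroot_sum S v" "coroot_sum S (- v) = - coroot_sum S v" "coroot_sum S (r *\<^sub>R v) = r * coroot_sum S v"
    "coroot_sum S (u - v) = coroot_sum S u - coroot_sum S v" "coroot_sum S 0 = 0"
  by (simp_all add: coroot_sum_def b_simps sum.distrib[symmetric] sum_negf[symmetric] sum_distrib_left
      sum_subtractf[symmetric] add_divide_distrib diff_divide_distrib algebra_simps)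

lemma coroot_sum_\<delta>: "J \<subseteq> I \<Longrightarrow> S \<subseteq> R J \<Longrightarrow> coroot_sum S \<delta> = 0"
  using R_Q[of J] by (auto simp: coroot_sum_def b_\<delta> intro!: sum.neutral)

text \<open>The product \<open>s\<^bsub>\<delta> - \<beta>\<^esub> s\<^bsub>\<beta>\<^esub>\<close> is the translation by the coroot of \<open>\<beta>\<close>.\<close>

lemma translation_exists:
  assumes "J \<subseteq> I" "finite S" "S \<subseteq> R J"
  shows "\<exists>t\<in>AW J. \<forall>v\<in>Q. t v = v - coroot_sum S v *\<^sub>R \<delta>"
  using assms(2,3)
proof (induction S rule: finite_induct)
  case empty
  then show ?case by (intro bexI[of _ id] AW_id) (simp add: coroot_sum_def)
next
  case (insert \<beta> S)
  then obtain t where t: "t \<in> AW J" "\<forall>v\<in>Q. t v = v - coroot_sum S v *\<^sub>R \<delta>" by blast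
  have \<beta>: "\<beta> \<in> R J" "\<beta> \<in> Q" using insert R_Q[OF assms(1)] by auto
  have norm: "b \<beta> \<beta> \<noteq> 0" using lroot_norm R_D(1)[OF assms(1) \<beta>(1)] by force
  have \<gamma>: "\<delta> - \<beta> \<in> RT J" using RT_iff[OF assms(1) R_minus[OF assms(1) \<beta>(1)], of 1] by simp
  define \<tau> where "\<tau> = refl (\<delta> - \<beta>) \<circ> refl \<beta>"
  have \<tau>W: "\<tau> \<in> AW J"
    unfolding \<tau>_def using \<gamma> R_RT[OF assms(1) \<beta>(1)] by (intro AW_comp refl_PR_AW assms(1))
  have \<tau>: "\<tau> v = v - (2 * b \<beta> v / b \<beta> \<beta>) *\<^sub>R \<delta>" if "v \<in> Q" for v
  proof -
    define c where "c = 2 * b \<beta> v / b \<beta> \<beta>"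
    have r: "refl \<beta> v = v - c *\<^sub>R \<beta>" by (simp add: refl_def c_def)
    have "b (\<delta> - \<beta>) (\<delta> - \<beta>) = b \<beta> \<beta>" by (simp add: b_simps b_\<delta> \<beta>(2) \<delta>_span)
    moreover have "b (\<delta> - \<beta>) (v - c *\<^sub>R \<beta>) = b \<beta> v"
      using norm by (simp add: b_simps b_\<delta> \<beta>(2) that c_def)
    ultimately have "refl (\<delta> - \<beta>) (v - c *\<^sub>R \<beta>) = v - c *\<^sub>R \<beta> - c *\<^sub>R (\<delta> - \<beta>)"
      by (simp add: refl_def c_def)
    then show ?thesis by (simp add: \<tau>_def r c_def[symmetric] algebra_simps)
  qed
  have "(\<tau> \<circ> t) v = v - coroot_sum (insert \<beta> S) v *\<^sub>R \<delta>" if v: "v \<in> Q" for v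
  proof -
    have "t v = v - coroot_sum S v *\<^sub>R \<delta>" "t v \<in> Q" using t v by (auto intro: span_diff span_scale \<delta>_span)
    moreover have "coroot_sum (insert \<beta> S) v = 2 * b \<beta> v / b \<beta> \<beta> + coroot_sum S v" using insert by (simp add: coroot_sum_def)
    ultimately show ?thesis
      using \<tau>[of "t v"] by (simp add: b_simps b_\<delta> \<beta>(2) scaleR_add_left)
  qed
  then show ?case using AW_comp[OF \<tau>W t(1)] by blast
qed

lemma translation_power:
  assumes "J \<subseteq> I" "S \<subseteq> R J" "t \<in> AW J" "\<forall>v\<in>Q. t v = v - coroot_sum S v *\<^sub>R \<delta>"
  shows "t ^^ n \<in> AW J" "v \<in> Q \<Longrightarrow> inv (t ^^ n) v = v + (real n * coroot_sum S v) *\<^sub>R \<delta>"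
proof -
  show W: "t ^^ n \<in> AW J" by (induction n) (use AW_id AW_comp[OF assms(3)] in \<open>auto simp: id_def comp_def\<close>)
  have iso: "isom (t ^^ n)" by (rule isom_AW[OF assms(1) W])
  have "(t ^^ n) v = v - (real n * coroot_sum S v) *\<^sub>R \<delta>" if "v \<in> Q" for v
    using that
  proof (induction n)
    case (Suc n)
    define a where "a = v - (real n * coroot_sum S v) *\<^sub>R \<delta>"
    have "a \<in> Q" unfolding a_def using Suc.prems by (intro span_diff span_scale \<delta>_span)
    then have "t a = a - coroot_sum S a *\<^sub>R \<delta>" using assms(4) by blast
    moreover have "coroot_sum S a = coroot_sum S v" using coroot_sum_\<delta>[OF assms(1,2)] by (simp add: a_def coroot_sum_simps)
    moreover have "(t ^^ Suc n) v = t a" using Suc by (simp add: a_def)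
    ultimately show ?case by (simp add: a_def algebra_simps)
  qed simp
  then show "inv (t ^^ n) v = v + (real n * coroot_sum S v) *\<^sub>R \<delta>" if v: "v \<in> Q"
  proof -
    have w: "v + (real n * coroot_sum S v) *\<^sub>R \<delta> \<in> Q" using v by (intro span_add span_scale \<delta>_span)
    have "(t ^^ n) (v + (real n * coroot_sum S v) *\<^sub>R \<delta>) = v"
      using \<open>\<And>v. v \<in> Q \<Longrightarrow> (t ^^ n) v = v - (real n * coroot_sum S v) *\<^sub>R \<delta>\<close>[OF w] coroot_sum_\<delta>[OF assms(1,2)]
      by (simp add: coroot_sum_simps)
    then show ?thesis using isom_D(10)[OF iso] by metis
  qed
qed

text \<open>Reindexing the sum by the reflection moves it onto \<alpha> i and changes its
  sign.\<close>

lemma coroot_sum_refl_invariant: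
  assumes "i \<le> rk D" "finite S" "\<And>\<beta>. \<beta> \<in> S \<Longrightarrow> refl (\<alpha> i) \<beta> \<in> S"
  shows "coroot_sum S (\<alpha> i) = 0"
proof -
  have norm: "b (\<alpha> i) (\<alpha> i) \<noteq> 0" using assms(1) by simp
  have rr: "refl (\<alpha> i) (refl (\<alpha> i) v) = v" for v by (rule refl_refl[OF norm])
  have "coroot_sum S (\<alpha> i) = (\<Sum>\<beta>\<in>S. 2 * b (refl (\<alpha> i) \<beta>) (\<alpha> i) / b (refl (\<alpha> i) \<beta>) (refl (\<alpha> i) \<beta>))"
    unfolding coroot_sum_def
    by (rule sum.reindex_bij_witness[of _ "refl (\<alpha> i)" "refl (\<alpha> i)"]) (use assms(3) rr in auto)
  also have "\<dots> = (\<Sum>\<beta>\<in>S. 2 * b \<beta> (refl (\<alpha> i) (\<alpha> i)) / b \<beta> \<beta>)"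
  proof (rule sum.cong[OF refl])
    fix \<beta>
    have "b (refl (\<alpha> i) \<beta>) (\<alpha> i) = b \<beta> (refl (\<alpha> i) (\<alpha> i))"
      using refl_b[OF norm, of \<beta> "refl (\<alpha> i) (\<alpha> i)"] by (simp only: rr)
    then show "2 * b (refl (\<alpha> i) \<beta>) (\<alpha> i) / b (refl (\<alpha> i) \<beta>) (refl (\<alpha> i) \<beta>) =
      2 * b \<beta> (refl (\<alpha> i) (\<alpha> i)) / b \<beta> \<beta>"
      by (simp only: refl_b[OF norm])
  qed
  also have "\<dots> = - coroot_sum S (\<alpha> i)" unfolding refl_self[OF norm] by (simp add: coroot_sum_def b_simps sum_negf)
  finally show ?thesis by simp
qed

text \<open>The sum of the coroots of this set is the difference of the sums of positive coroots for
  \<open>J\<close> and for \<open>K\<close>, an explicit coweight dominant for \<open>J\<close> with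
  stabilizer \<open>K\<close>.\<close>

definition pos_diff :: "nat set \<Rightarrow> nat set \<Rightarrow> 'v set" where
  "pos_diff J K = {\<epsilon> \<in> R J. \<epsilon> \<notin> R K \<and> 0 < ht \<epsilon>}"

text \<open>For k in \<open>K\<close> the set is stable under the k-th reflection. For j outside
  \<open>K\<close>, all positive coroots of \<open>J\<close> together give 2 on \<alpha> j, because
  the j-th reflection permutes those other than the coroot of \<alpha> j, while the part from
  \<open>K\<close> contributes at most 0.\<close>

lemma coroot_sum_pos_diff_simple:
  assumes "K \<subseteq> J" "J \<subseteq> I"
  shows "k \<in> K \<Longrightarrow> coroot_sum (pos_diff J K) (\<alpha> k) = 0" "j \<in> J \<Longrightarrow> j \<notin> K \<Longrightarrow> 0 < coroot_sum (pos_diff J K) (\<alpha> j)"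
proof -
  have KI: "K \<subseteq> I" "K \<subseteq> {..rk D}" using assms by auto
  have fin: "finite (pos_diff J K)" using finite_R[OF assms(2)] by (simp add: pos_diff_def)
  show "coroot_sum (pos_diff J K) (\<alpha> k) = 0" if k: "k \<in> K"
  proof (rule coroot_sum_refl_invariant[OF _ fin])
    show "k \<le> rk D" using k KI by auto
    then have "refl (\<alpha> k) \<in> fin_weyl D K" by (rule refl_in_fin_weyl[OF k])
    then show "refl (\<alpha> k) \<beta> \<in> pos_diff J K" if "\<beta> \<in> pos_diff J K" for \<beta>
      using that fin_weyl_parabolic_pos[OF assms, of "refl (\<alpha> k)" \<beta>] by (simp add: pos_diff_def)
  qed
  assume j: "j \<in> J" "j \<notin> K"
  have jr: "j \<le> rk D" using j assms by auto
  define P where "P = {\<epsilon> \<in> R J. 0 < ht \<epsilon>}"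
  define PK where "PK = {\<epsilon> \<in> R K. 0 < ht \<epsilon>}"
  have finP: "finite P" "finite PK" using finite_R[OF assms(2)] finite_R[OF KI(1)] by (auto simp: P_def PK_def)
  have "P = pos_diff J K \<union> PK" "pos_diff J K \<inter> PK = {}"
    using R_mono[OF assms] by (auto simp: P_def PK_def pos_diff_def)
  then have "coroot_sum P (\<alpha> j) = coroot_sum (pos_diff J K) (\<alpha> j) + coroot_sum PK (\<alpha> j)"
    unfolding coroot_sum_def using fin finP by (simp add: sum.union_disjoint)
  moreover have "coroot_sum PK (\<alpha> j) \<le> 0"
    unfolding coroot_sum_def
  proof (rule sum_nonpos)
    fix \<epsilon> assume "\<epsilon> \<in> PK"
    then have e: "\<epsilon> \<in> R K" "0 < ht \<epsilon>" by (auto simp: PK_def)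
    have "b \<epsilon> (\<alpha> j) \<le> 0" unfolding b_expand_left[OF R_D(2)[OF KI(1) e(1)] KI(2)]
    proof (intro sum_nonpos mult_nonneg_nonpos)
      fix k assume k: "k \<in> K"
      show "0 \<le> cf k \<epsilon>" using R_pos_iff(1)[OF KI(1) e(1)] e(2) k by blast
      show "b (\<alpha> k) (\<alpha> j) \<le> 0" using k KI j jr by (intro simple_b_nonpos) auto
    qed
    then show "2 * b \<epsilon> (\<alpha> j) / b \<epsilon> \<epsilon> \<le> 0"
      using lroot_norm[OF R_D(1)[OF KI(1) e(1)]] by (simp add: divide_nonpos_pos)
  qed
  moreover have "coroot_sum P (\<alpha> j) = 2"
  proof -
    have "\<alpha> j \<in> P" using R_simple[OF assms(2) j(1)] jr by (simp add: P_def)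
    then have "coroot_sum P (\<alpha> j) = 2 * b (\<alpha> j) (\<alpha> j) / b (\<alpha> j) (\<alpha> j) + coroot_sum (P - {\<alpha> j}) (\<alpha> j)"
      unfolding coroot_sum_def using finP by (simp add: sum.remove)
    moreover have "coroot_sum (P - {\<alpha> j}) (\<alpha> j) = 0"
      using refl_positive_R[OF assms(2) j(1)] finP by (intro coroot_sum_refl_invariant jr) (auto simp: P_def)
    ultimately show ?thesis using jr by simp
  qed
  ultimately show "0 < coroot_sum (pos_diff J K) (\<alpha> j)" by simp
qed

text \<open>Only coordinates outside \<open>K\<close> contribute, with positive weights, and all
  coordinates of a root have one sign; so the sign is that of \<open>outer_ht\<close>.\<close>

lemma coroot_sum_pos_diff_R:
  assumes "K \<subseteq> J" "J \<subseteq> I" "\<eta> \<in> R J"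
  shows "outer_ht J K \<eta> = 0 \<Longrightarrow> coroot_sum (pos_diff J K) \<eta> = 0" "outer_ht J K \<eta> < 0 \<Longrightarrow> coroot_sum (pos_diff J K) \<eta> < 0"
    "0 < outer_ht J K \<eta> \<Longrightarrow> 0 < coroot_sum (pos_diff J K) \<eta>"
proof -
  have J: "J \<subseteq> {..rk D}" "finite J" using assms(2) finite_subset by auto
  have lin: "coroot_sum S (\<Sum>j\<in>L. f j *\<^sub>R \<alpha> j) = (\<Sum>j\<in>L. f j * coroot_sum S (\<alpha> j))" if "finite L" for S L f
    using that by (induction L) (auto simp: coroot_sum_simps)
  have sum: "coroot_sum (pos_diff J K) \<eta> = (\<Sum>j\<in>J - K. cf j \<eta> * coroot_sum (pos_diff J K) (\<alpha> j))" if "\<eta> \<in> R J" for \<eta>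
  proof -
    have "coroot_sum (pos_diff J K) \<eta> = coroot_sum (pos_diff J K) (\<Sum>j\<in>J. cf j \<eta> *\<^sub>R \<alpha> j)"
      by (rule arg_cong[OF span_expand(1)[OF R_D(2)[OF assms(2) that] J(1)]])
    also have "\<dots> = (\<Sum>j\<in>J. cf j \<eta> * coroot_sum (pos_diff J K) (\<alpha> j))" by (rule lin[OF J(2)])
    also have "\<dots> = (\<Sum>j\<in>J - K. cf j \<eta> * coroot_sum (pos_diff J K) (\<alpha> j))"
      using coroot_sum_pos_diff_simple(1)[OF assms(1,2)] J by (intro sum.mono_neutral_right) auto
    finally show ?thesis .
  qed
  have pos: "0 < coroot_sum (pos_diff J K) \<eta>" if "\<eta> \<in> R J" "\<eta> \<notin> R K" "0 < ht \<eta>" for \<eta>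
  proof -
    have nn: "\<forall>j\<in>J. 0 \<le> cf j \<eta>" using R_pos_iff(1)[OF assms(2) that(1)] that(3) by blast
    have "outer_ht J K \<eta> \<noteq> 0" using outer_ht_sign(1)[OF assms(1,2) that(1)] that(2) by simp
    then obtain j where j: "j \<in> J - K" "cf j \<eta> \<noteq> 0" unfolding outer_ht_def by (meson sum.neutral)
    show ?thesis unfolding sum[OF that(1)]
    proof (rule sum_pos2[OF _ j(1)])
      show "0 < cf j \<eta> * coroot_sum (pos_diff J K) (\<alpha> j)"
        using j nn coroot_sum_pos_diff_simple(2)[OF assms(1,2), of j] by (auto simp: less_le)
      show "0 \<le> cf i \<eta> * coroot_sum (pos_diff J K) (\<alpha> i)" if "i \<in> J - K" for i
        using that nn coroot_sum_pos_diff_simple(2)[OF assms(1,2), of i] by auto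
    qed (use J in auto)
  qed
  have KI: "K \<subseteq> I" using assms by blast
  show "outer_ht J K \<eta> = 0 \<Longrightarrow> coroot_sum (pos_diff J K) \<eta> = 0"
  proof -
    assume "outer_ht J K \<eta> = 0"
    then have "\<eta> \<in> R K" using outer_ht_sign(1)[OF assms] by blast
    then have "\<forall>j\<in>J - K. cf j \<eta> = 0" using cf_outside[OF KI] J by auto
    then show ?thesis using sum[OF assms(3)] by (simp add: sum.neutral)
  qed
  have nz: "ht \<eta> \<noteq> 0" using lroot_ht_pos_iff(3)[OF R_D(1)[OF assms(2,3)]] .
  show "outer_ht J K \<eta> < 0 \<Longrightarrow> coroot_sum (pos_diff J K) \<eta> < 0"
  proof -
    assume "outer_ht J K \<eta> < 0"
    then have "\<eta> \<notin> R K" "ht \<eta> < 0" using outer_ht_sign(2)[OF assms] by auto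
    then show ?thesis
      using pos[OF R_minus[OF assms(2,3)]] R_minus_iff[OF KI, of \<eta>] by (simp add: ht_simps coroot_sum_simps)
  qed
  show "0 < outer_ht J K \<eta> \<Longrightarrow> 0 < coroot_sum (pos_diff J K) \<eta>"
  proof -
    assume "0 < outer_ht J K \<eta>"
    then have "\<eta> \<notin> R K" "\<not> ht \<eta> < 0" using outer_ht_sign[OF assms] by auto
    then show ?thesis using pos[OF assms(3)] nz by simp
  qed
qed

text \<open>Multiplying \<open>uy\<close> by powers of a translation that is dominant for \<open>J\<close> and whose stabilizer is
  \<open>K\<close> exhausts \<open>\<nabla>(K, u, y)\<close>.\<close>

lemma nabla_set_chain:
  assumes "K \<subseteq> J" "J \<subseteq> I" "u \<in> MR J K" "y \<in> AW K"
  obtains X where "\<And>n. X n \<in> AW J" "\<And>n. Inv J (X n) \<subseteq> Inv J (X (Suc n))"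
    "(\<Union>n. Inv J (X n)) = nabla_set J K u y"
proof -
  have KI: "K \<subseteq> I" using assms by blast
  define S where "S = pos_diff J K"
  have S: "finite S" "S \<subseteq> R J" using finite_R[OF assms(2)] by (auto simp: S_def pos_diff_def)
  obtain t where t: "t \<in> AW J" "\<forall>v\<in>Q. t v = v - coroot_sum S v *\<^sub>R \<delta>"
    using translation_exists[OF assms(2) S] by blast
  note tn = translation_power[OF assms(2) S(2) t]
  have uw: "u \<in> fin_weyl D J" by (rule MR_D[OF assms(3)])
  have uA: "u \<in> AW J" by (rule fin_weyl_AW[OF assms(2) uw])
  have yA: "y \<in> AW J" using AW_mono[OF assms(1,2)] assms(4) by blast
  have iu: "isom u" and iy: "isom y" using isom_AW[OF assms(2)] uA yA by auto
  define x where "x n = (u \<circ> y) \<circ> (t ^^ n)" for n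
  have xA: "x n \<in> AW J" for n unfolding x_def by (intro AW_comp uA yA tn(1))
  define h0 where "h0 \<beta> = ht (inv y (inv u \<beta>))" for \<beta>
  define C where "C \<beta> = coroot_sum S (inv u (fp \<beta>))" for \<beta>
  have csK: "coroot_sum S \<gamma> = 0" if "\<gamma> \<in> RT K" for \<gamma>
  proof -
    have r: "fp \<gamma> \<in> R K" using that by (simp add: RT_def)
    then have rJ: "fp \<gamma> \<in> R J" using R_mono[OF assms(1,2)] by blast
    have "coroot_sum S (fp \<gamma>) = 0"
      unfolding S_def using coroot_sum_pos_diff_R(1)[OF assms(1,2) rJ] outer_ht_sign(1)[OF assms(1,2) rJ] r by simp
    then show ?thesis
      using fp_decomp[of \<gamma>] coroot_sum_\<delta>[OF assms(2) S(2)] coroot_sum_simps by (metis add.right_neutral mult_zero_right)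
  qed
  \<comment> \<open>Roots of \<open>K\<close> pair to 0 with the translation vector, so reflections
    in them leave the functional unchanged.\<close>
  have csy: "coroot_sum S (w v) = coroot_sum S v" if "w \<in> AW K" for w v
    using that KI
  proof (induction arbitrary: v rule: AW_induct)
    case (step \<gamma> w)
    have "coroot_sum S (refl \<gamma> (w v)) = coroot_sum S (w v)"
      using csK[OF PS_RT[OF KI step(1)]] by (simp add: refl_def coroot_sum_simps)
    then show ?case using step by simp
  qed simp
  have csu: "coroot_sum S (inv u \<beta>) = C \<beta>" for \<beta>
  proof -
    have "inv u \<beta> = cf 0 \<beta> *\<^sub>R \<delta> + inv u (fp \<beta>)"
      by (subst fp_decomp[of \<beta>]) (simp only: isom_D[OF isom_inv[OF iu]])
    then show ?thesis using coroot_sum_\<delta>[OF assms(2) S(2)] by (simp add: C_def coroot_sum_simps)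
  qed
  \<comment> \<open>Along the powers of \<open>t\<close> the height is affine in \<open>n\<close>:
    the slope \<open>C \<beta> * ht \<delta>\<close> carries the sign of the lexicographic height,
    and the constant \<open>h0 \<beta>\<close> decides where the slope vanishes.\<close>
  have inv_x: "ht (inv (x n) \<beta>) = h0 \<beta> + real n * C \<beta> * ht \<delta>" if "\<beta> \<in> PR J" for n \<beta>
  proof -
    have b: "bij u" "bij y" "bij (t ^^ n)" using isom_D(2) iu iy isom_AW[OF assms(2) tn(1)] by auto
    have "inv (x n) = inv (t ^^ n) \<circ> inv (u \<circ> y)"
      unfolding x_def using b by (intro o_inv_distrib bij_comp)
    also have "inv (u \<circ> y) = inv y \<circ> inv u" using b by (intro o_inv_distrib)
    finally have e: "inv (x n) \<beta> = inv (t ^^ n) (inv y (inv u \<beta>))" by simp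
    have q: "inv y (inv u \<beta>) \<in> Q"
      using isom_Q[OF isom_inv[OF iy]] isom_Q[OF isom_inv[OF iu]] PR_D(5)[OF assms(2) that] by blast
    have "coroot_sum S (inv y (inv u \<beta>)) = C \<beta>" using csy[OF AW_inv[OF KI assms(4)]] csu by simp
    then show ?thesis unfolding e tn(2)[OF q] by (simp add: ht_simps h0_def)
  qed
  have \<delta>pos: "0 < ht \<delta>" using ht_\<delta>(2) by simp
  have Cz: "lex_ht J K u \<beta> = 0 \<Longrightarrow> C \<beta> = 0" "lex_ht J K u \<beta> < 0 \<Longrightarrow> C \<beta> < 0" "0 < lex_ht J K u \<beta> \<Longrightarrow> 0 < C \<beta>"
    if "\<beta> \<in> PR J" for \<beta>
    using coroot_sum_pos_diff_R[OF assms(1,2) inv_fp_R[OF assms(2) uw PR_D(1)[OF assms(2) that]]]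
    unfolding lex_ht_def C_def S_def by auto
  have nabC: "\<beta> \<in> nabla_set J K u y \<longleftrightarrow> C \<beta> < 0 \<or> (C \<beta> = 0 \<and> h0 \<beta> < 0)" if "\<beta> \<in> PR J" for \<beta>
  proof -
    consider "lex_ht J K u \<beta> < 0" | "lex_ht J K u \<beta> = 0" | "0 < lex_ht J K u \<beta>" by linarith
    then show ?thesis by cases (use Cz[OF that] that in \<open>simp_all add: nabla_set_def h0_def\<close>)
  qed
  \<comment> \<open>These finitely many roots are inverted by u y although their height grows with
    \<open>n\<close>. From some \<open>n0\<close> on none of them is inverted, and the chain
    increases only from there; hence the shift in \<open>X\<close>.\<close>
  define G where "G = {\<beta> \<in> PR J. 0 < C \<beta> \<and> h0 \<beta> < 0}"
  have large: "\<exists>n. \<forall>m\<ge>n. 0 \<le> h0 \<beta> + real m * c" if "0 < c" for c \<beta>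
  proof -
    obtain n where n: "- h0 \<beta> / c < real n" using reals_Archimedean2 by blast
    have "0 \<le> h0 \<beta> + real m * c" if "n \<le> m" for m
    proof -
      have "- h0 \<beta> / c < real m" using n that by linarith
      then show ?thesis using \<open>0 < c\<close> by (simp add: field_simps)
    qed
    then show ?thesis by blast
  qed
  have "finite G"
  proof (rule finite_subset)
    have "inv (x 0) \<beta> = inv (u \<circ> y) \<beta>" for \<beta> by (simp add: x_def)
    then show "G \<subseteq> Inv J (x 0)" using inv_x[of _ 0] by (auto simp: G_def Inv_def)
    show "finite (Inv J (x 0))" by (rule finite_Inv[OF assms(2) xA])
  qed
  moreover have "\<forall>\<beta>\<in>G. eventually (\<lambda>n. 0 \<le> h0 \<beta> + real n * (C \<beta> * ht \<delta>)) sequentially"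
    using large \<delta>pos by (auto simp: G_def eventually_sequentially)
  ultimately have "eventually (\<lambda>n. \<forall>\<beta>\<in>G. 0 \<le> h0 \<beta> + real n * (C \<beta> * ht \<delta>)) sequentially"
    by (simp add: eventually_ball_finite)
  then obtain n0 where n0: "\<And>n \<beta>. n0 \<le> n \<Longrightarrow> \<beta> \<in> G \<Longrightarrow> 0 \<le> h0 \<beta> + real n * (C \<beta> * ht \<delta>)"
    by (auto simp: eventually_sequentially)
  define X where "X n = x (n0 + n)" for n
  have memX: "\<beta> \<in> Inv J (X n) \<longleftrightarrow> h0 \<beta> + real (n0 + n) * (C \<beta> * ht \<delta>) < 0" if "\<beta> \<in> PR J" for \<beta> n
    using that inv_x[OF that, of "n0 + n"] by (simp add: X_def Inv_def mult.assoc)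
  have not_pos: "C \<beta> \<le> 0" if "\<beta> \<in> Inv J (X n)" for \<beta> n
  proof (rule ccontr)
    assume c: "\<not> C \<beta> \<le> 0"
    have \<beta>: "\<beta> \<in> PR J" using that by (simp add: Inv_def)
    have lt: "h0 \<beta> + real (n0 + n) * (C \<beta> * ht \<delta>) < 0" using memX[OF \<beta>] that by blast
    have "0 \<le> real (n0 + n) * (C \<beta> * ht \<delta>)" using c \<delta>pos by (intro mult_nonneg_nonneg) auto
    then have "\<beta> \<in> G" using lt c \<beta> by (simp add: G_def)
    then show False using n0[of "n0 + n" \<beta>] lt by simp
  qed
  have step: "Inv J (X n) \<subseteq> Inv J (X (Suc n))" for n
  proof
    fix \<beta> assume b: "\<beta> \<in> Inv J (X n)"
    then have \<beta>: "\<beta> \<in> PR J" by (simp add: Inv_def)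
    have "real (n0 + Suc n) * (C \<beta> * ht \<delta>) \<le> real (n0 + n) * (C \<beta> * ht \<delta>)"
      using not_pos[OF b] \<delta>pos by (intro mult_right_mono_neg) (auto simp: mult_nonpos_nonneg)
    moreover have "h0 \<beta> + real (n0 + n) * (C \<beta> * ht \<delta>) < 0" using memX[OF \<beta>] b by blast
    ultimately have "h0 \<beta> + real (n0 + Suc n) * (C \<beta> * ht \<delta>) < 0" by linarith
    then show "\<beta> \<in> Inv J (X (Suc n))" using memX[OF \<beta>] by blast
  qed
  have "(\<Union>n. Inv J (X n)) = nabla_set J K u y"
  proof
    show "(\<Union>n. Inv J (X n)) \<subseteq> nabla_set J K u y"
    proof
      fix \<beta> assume "\<beta> \<in> (\<Union>n. Inv J (X n))"
      then obtain n where b: "\<beta> \<in> Inv J (X n)" by blast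
      then have \<beta>: "\<beta> \<in> PR J" by (simp add: Inv_def)
      show "\<beta> \<in> nabla_set J K u y"
        unfolding nabC[OF \<beta>] using not_pos[OF b] memX[OF \<beta>] b by (cases "C \<beta> = 0") auto
    qed
    show "nabla_set J K u y \<subseteq> (\<Union>n. Inv J (X n))"
    proof
      fix \<beta> assume b: "\<beta> \<in> nabla_set J K u y"
      then have \<beta>: "\<beta> \<in> PR J" by (simp add: nabla_set_def)
      show "\<beta> \<in> (\<Union>n. Inv J (X n))"
      proof (cases "C \<beta> = 0")
        case True
        then show ?thesis using b memX[OF \<beta>, of 0] unfolding nabC[OF \<beta>] by auto
      next
        case False
        then have c: "0 < - (C \<beta> * ht \<delta>)" using b \<delta>pos unfolding nabC[OF \<beta>] by (auto simp: mult_less_0_iff)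
        obtain n where n: "h0 \<beta> / - (C \<beta> * ht \<delta>) < real n" using reals_Archimedean2 by blast
        then have "h0 \<beta> / - (C \<beta> * ht \<delta>) < real (n0 + n)" by simp
        then have "h0 \<beta> + real (n0 + n) * (C \<beta> * ht \<delta>) < 0"
          using c pos_divide_less_eq[OF c, of "h0 \<beta>" "real (n0 + n)"] by simp
        then show ?thesis using memX[OF \<beta>] by blast
      qed
    qed
  qed
  then show thesis using that[of X] step xA unfolding X_def by blast
qed

section \<open>Infinite reduced words\<close>

lemma prefix_AW:
  assumes "J \<subseteq> I" "\<And>n. s n \<in> refl ` PS J"
  shows "prefix_prod s p \<in> AW J"
  unfolding prefix_prod_def using assms(2) by (intro word_prod_AW) auto

lemma inf_words_iff:
  assumes "J \<subseteq> I"
  shows "s \<in> inf_words D J \<longleftrightarrow> (\<forall>n. s n \<in> refl ` PS J) \<and> (\<forall>p. card (Inv J (prefix_prod s p)) = p)"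
  unfolding inf_words_def par_gens_eq[OF assms] using par_length_eq[OF assms prefix_AW[OF assms]] by auto

lemma inf_words_D:
  assumes "J \<subseteq> I" "s \<in> inf_words D J"
  shows "prefix_prod s p \<in> AW J" "card (Inv J (prefix_prod s p)) = p"
  using assms prefix_AW[OF assms(1)] by (auto simp: inf_words_iff[OF assms(1)])

text \<open>The quotient of two prefixes has length at most \<open>q - p\<close>, while already the
  roots inverted only by the longer prefix number at least \<open>q - p\<close>. Nothing is left for
  the other half of the symmetric difference.\<close>

lemma prefix_mono:
  assumes "J \<subseteq> I" "s \<in> inf_words D J" "p \<le> q"
  shows "Inv J (prefix_prod s p) \<subseteq> Inv J (prefix_prod s q)"
proof -
  let ?x = "prefix_prod s p" and ?y = "prefix_prod s q"
  have W: "?x \<in> AW J" "?y \<in> AW J" using inf_words_D[OF assms(1,2)] by auto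
  have fin: "finite (Inv J ?x)" "finite (Inv J ?y)" using finite_Inv[OF assms(1)] W by auto
  have gens: "set (map s [p..<q]) \<subseteq> refl ` PS J" using assms(2) by (auto simp: inf_words_iff[OF assms(1)])
  have "map s [0..<q] = map s [0..<p] @ map s [p..<q]"
    using upt_add_eq_append[of 0 p "q - p"] assms(3) by simp
  then have "?y = ?x \<circ> word_prod (map s [p..<q])"
    unfolding prefix_prod_def by (simp only: word_prod_append)
  then have "inv ?x \<circ> ?y = word_prod (map s [p..<q])"
    using isom_D(10)[OF isom_AW[OF assms(1) W(1)]] by (simp add: fun_eq_iff)
  then have "card (Inv J (inv ?x \<circ> ?y)) \<le> q - p" using card_Inv_word[OF assms(1) gens] by simp
  then have le: "card (Inv J ?y - Inv J ?x) + card (Inv J ?x - Inv J ?y) \<le> q - p"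
    using Inv_symdiff[OF assms(1) W] by simp
  have "card (Inv J ?y) - card (Inv J ?x) \<le> card (Inv J ?y - Inv J ?x)" by (rule diff_card_le_card_Diff[OF fin(1)])
  then have "card (Inv J ?x - Inv J ?y) = 0" using le by (simp add: inf_words_D[OF assms(1,2)])
  then show ?thesis using fin by simp
qed

lemma word_inversions_eq:
  assumes "J \<subseteq> I" "s \<in> inf_words D J"
  shows "word_inversions D J s = (\<Union>p. Inv J (prefix_prod s p))"
proof -
  have "inversion_set D J (prefix_prod s p) = Inv J (prefix_prod s p)" for p
    using inversion_set_eq[OF assms(1)] inf_words_D(1)[OF assms] AW_mono[OF assms(1) order_refl] by blast
  then show ?thesis by (simp add: word_inversions_def)
qed

lemma finite_subset_chain:
  fixes A :: "nat \<Rightarrow> 'a set"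
  assumes "finite F" "F \<subseteq> (\<Union>n. A n)" "\<And>m n. m \<le> n \<Longrightarrow> A m \<subseteq> A n"
  obtains n where "F \<subseteq> A n"
proof -
  have "\<exists>n. F \<subseteq> A n"
    using assms(1,2)
  proof (induction F rule: finite_induct)
    case (insert x F)
    then obtain m n where "F \<subseteq> A m" "x \<in> A n" by auto
    then have "insert x F \<subseteq> A (max m n)" using assms(3)[of m "max m n"] assms(3)[of n "max m n"] by auto
    then show ?case by blast
  qed auto
  then show thesis using that by blast
qed

lemma word_inversions_real_biconvex:
  assumes "J \<subseteq> I" "s \<in> inf_words D J"
  shows "real_biconvex J (word_inversions D J s)" "infinite (word_inversions D J s)"
proof -
  let ?A = "\<lambda>p. Inv J (prefix_prod s p)"
  note mono = prefix_mono[OF assms]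
  have b: "real_biconvex J (?A p)" for p by (rule real_biconvex_Inv[OF assms(1) inf_words_D(1)[OF assms]])
  show "real_biconvex J (word_inversions D J s)"
    unfolding word_inversions_eq[OF assms] real_biconvex_def
  proof (intro conjI ballI impI)
    show "(\<Union>p. ?A p) \<subseteq> PR J" by (auto simp: Inv_def)
    fix \<beta> \<gamma> assume "\<beta> \<in> (\<Union>p. ?A p)" "\<gamma> \<in> (\<Union>p. ?A p)" and sum: "\<beta> + \<gamma> \<in> PA J"
    then obtain p q where "\<beta> \<in> ?A p" "\<gamma> \<in> ?A q" by blast
    then have "\<beta> \<in> ?A (max p q)" "\<gamma> \<in> ?A (max p q)"
      using mono[of p "max p q"] mono[of q "max p q"] by auto
    then show "\<beta> + \<gamma> \<in> (\<Union>p. ?A p)" using real_biconvex_D(2)[OF b _ _ sum] by blast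
  next
    fix \<beta> \<gamma> assume "\<beta> \<in> PA J - (\<Union>p. ?A p)" "\<gamma> \<in> PA J - (\<Union>p. ?A p)"
    then have "\<beta> + \<gamma> \<notin> ?A p" for p by (intro real_biconvex_D(3)[OF b]) auto
    then show "\<beta> + \<gamma> \<notin> (\<Union>p. ?A p)" by blast
  qed
  show "infinite (word_inversions D J s)"
  proof
    assume fin: "finite (word_inversions D J s)"
    then have "card (?A p) \<le> card (word_inversions D J s)" for p
      unfolding word_inversions_eq[OF assms] by (intro card_mono) auto
    then show False using inf_words_D(2)[OF assms] by (metis Suc_n_not_le_n)
  qed
qed

text \<open>Each length condition says that a prefix inversion set is contained in that of a later
  prefix of the other word. Since these sets are finite and increase, it suffices that they lie in
  the union.\<close>

lemma word_equiv_iff: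
  assumes "J \<subseteq> I" "s \<in> inf_words D J" "s' \<in> inf_words D J"
  shows "(s, s') \<in> word_equiv D J \<longleftrightarrow> word_inversions D J s = word_inversions D J s'"
proof -
  have sub: "par_length D J (inv (prefix_prod r p) \<circ> prefix_prod r' q) = q - p \<longleftrightarrow>
      Inv J (prefix_prod r p) \<subseteq> Inv J (prefix_prod r' q)"
    if "r \<in> inf_words D J" "r' \<in> inf_words D J" "p \<le> q" for r r' p q
    using length_diff_iff[OF assms(1) inf_words_D(1)[OF assms(1) that(1)] inf_words_D(1)[OF assms(1) that(2)],
        of p q] that(3) inf_words_D(2)[OF assms(1)] that by simp
  have ex: "(\<exists>q\<ge>p. par_length D J (inv (prefix_prod r p) \<circ> prefix_prod r' q) = q - p) \<longleftrightarrow>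
      Inv J (prefix_prod r p) \<subseteq> word_inversions D J r'"
    if r: "r \<in> inf_words D J" "r' \<in> inf_words D J" for r r' p
  proof
    show "\<exists>q\<ge>p. par_length D J (inv (prefix_prod r p) \<circ> prefix_prod r' q) = q - p \<Longrightarrow>
        Inv J (prefix_prod r p) \<subseteq> word_inversions D J r'"
      using sub[OF r] unfolding word_inversions_eq[OF assms(1) r(2)] by blast
    assume "Inv J (prefix_prod r p) \<subseteq> word_inversions D J r'"
    then have sub': "Inv J (prefix_prod r p) \<subseteq> (\<Union>n. Inv J (prefix_prod r' n))"
      unfolding word_inversions_eq[OF assms(1) r(2)] .
    have "finite (Inv J (prefix_prod r p))" by (rule finite_Inv[OF assms(1) inf_words_D(1)[OF assms(1) r(1)]])
    then obtain n where "Inv J (prefix_prod r p) \<subseteq> Inv J (prefix_prod r' n)"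
      using finite_subset_chain[where A = "\<lambda>n. Inv J (prefix_prod r' n)", OF _ sub' prefix_mono[OF assms(1) r(2)]]
      by blast
    then have "Inv J (prefix_prod r p) \<subseteq> Inv J (prefix_prod r' (max n p))"
      using prefix_mono[OF assms(1) r(2), of n "max n p"] by auto
    then show "\<exists>q\<ge>p. par_length D J (inv (prefix_prod r p) \<circ> prefix_prod r' q) = q - p"
      using sub[OF r, of p "max n p"] by (intro exI[of _ "max n p"]) auto
  qed
  have "(s, s') \<in> word_equiv D J \<longleftrightarrow>
    (\<forall>p. Inv J (prefix_prod s p) \<subseteq> word_inversions D J s') \<and>
    (\<forall>q. Inv J (prefix_prod s' q) \<subseteq> word_inversions D J s)"
    unfolding ex[OF assms(2,3), symmetric] ex[OF assms(3,2), symmetric] word_equiv_def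
      mem_Collect_eq case_prod_conv
    using assms(2,3) by blast
  also have "\<dots> \<longleftrightarrow> word_inversions D J s = word_inversions D J s'"
    using word_inversions_eq[OF assms(1,2)] word_inversions_eq[OF assms(1,3)] by blast
  finally show ?thesis .
qed

lemma card_Inv_comp_le:
  assumes "J \<subseteq> I" "x \<in> AW J" "set ws \<subseteq> refl ` PS J"
  shows "card (Inv J (x \<circ> word_prod ws)) \<le> card (Inv J x) + length ws"
proof -
  obtain vs where vs: "set vs \<subseteq> refl ` PS J" "word_prod vs = x" "length vs = card (Inv J x)"
    using reduced_word[OF assms(1,2)] by blast
  have "card (Inv J (word_prod (vs @ ws))) \<le> length (vs @ ws)"
    using vs(1) assms(3) by (intro card_Inv_word[OF assms(1)]) auto
  then show ?thesis using vs by (simp add: word_prod_append)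
qed

text \<open>Nested inversion sets make lengths additive, so a reduced word for each element extends
  to one for the next by a reduced word of the quotient. The infinite word reads off the
  limit.\<close>

lemma chain_word:
  assumes "J \<subseteq> I" "\<And>n. X n \<in> AW J" "\<And>n. Inv J (X n) \<subseteq> Inv J (X (Suc n))"
    and inf: "infinite (\<Union>n. Inv J (X n))"
  obtains s where "s \<in> inf_words D J" "word_inversions D J s = (\<Union>n. Inv J (X n))"
proof -
  define good where "good n w \<longleftrightarrow> set w \<subseteq> refl ` PS J \<and> word_prod w = X n \<and> length w = card (Inv J (X n))"
    for n w
  have "\<exists>W. \<forall>n. good n (W n) \<and> (\<exists>r. W (Suc n) = W n @ r)"
  proof (rule dependent_nat_choice)
    show "\<exists>w. good 0 w" unfolding good_def using reduced_word[OF assms(1) assms(2)[of 0]] by metis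
    fix w n assume g: "good n w"
    have fin: "finite (Inv J (X n))" "finite (Inv J (X (Suc n)))" using finite_Inv[OF assms(1,2)] by auto
    have d: "inv (X n) \<circ> X (Suc n) \<in> AW J" by (intro AW_comp AW_inv assms(1,2))
    obtain r where r: "set r \<subseteq> refl ` PS J" "word_prod r = inv (X n) \<circ> X (Suc n)"
      "length r = card (Inv J (inv (X n) \<circ> X (Suc n)))"
      using reduced_word[OF assms(1) d] by blast
    have e: "Inv J (X n) - Inv J (X (Suc n)) = {}" using assms(3) by blast
    have "length r = card (Inv J (X (Suc n)) - Inv J (X n))"
      unfolding r(3) Inv_symdiff[OF assms(1,2,2)] e by simp
    also have "\<dots> = card (Inv J (X (Suc n))) - card (Inv J (X n))"
      by (rule card_Diff_subset[OF fin(1) assms(3)])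
    finally have "length (w @ r) = card (Inv J (X (Suc n)))"
      using g card_mono[OF fin(2) assms(3)] by (simp add: good_def)
    moreover have "X n \<circ> (inv (X n) \<circ> X (Suc n)) = X (Suc n)"
      using isom_D(11)[OF isom_AW[OF assms(1,2)]] by (simp add: fun_eq_iff)
    ultimately have "good (Suc n) (w @ r)"
      using g r by (simp add: good_def word_prod_append)
    then show "\<exists>v. good (Suc n) v \<and> (\<exists>r. v = w @ r)" by blast
  qed
  then obtain W where W: "\<And>n. good n (W n)" "\<And>n. \<exists>r. W (Suc n) = W n @ r" by blast
  have pre: "\<exists>r. W n = W m @ r" if "m \<le> n" for m n
    using that
  proof (induction n rule: dec_induct)
    case (step n)
    then show ?case using W(2)[of n] by (metis append.assoc)
  qed simp
  have Invmono: "Inv J (X m) \<subseteq> Inv J (X n)" if "m \<le> n" for m n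
    by (rule lift_Suc_mono_le[of "\<lambda>n. Inv J (X n)", OF assms(3) that])
  have unbounded: "\<exists>m. k < length (W m)" for k
  proof -
    obtain F where F: "F \<subseteq> (\<Union>n. Inv J (X n))" "finite F" "card F = Suc k"
      using infinite_arbitrarily_large[OF inf] by blast
    obtain m where "F \<subseteq> Inv J (X m)" using finite_subset_chain[OF F(2,1) Invmono] by blast
    then have "Suc k \<le> card (Inv J (X m))" using card_mono[OF finite_Inv[OF assms(1,2)]] F(3) by metis
    then show ?thesis using W(1)[of m] by (auto simp: good_def intro!: exI[of _ m])
  qed
  \<comment> \<open>Any sufficiently long \<open>W m\<close> gives the same letter, because these
    words extend one another.\<close>
  define s where "s k = W (SOME m. k < length (W m)) ! k" for k
  have s_nth: "s k = W m ! k" if "k < length (W m)" for k m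
  proof -
    define m' where "m' = (SOME m. k < length (W m))"
    have "k < length (W m')" unfolding m'_def using unbounded by (rule someI_ex)
    moreover have "(\<exists>r. W m = W m' @ r) \<or> (\<exists>r. W m' = W m @ r)" using pre by (meson nat_le_linear)
    ultimately show ?thesis using that by (auto simp: s_def m'_def[symmetric] nth_append)
  qed
  have take: "map s [0..<p] = take p (W m)" if "p \<le> length (W m)" for p m
    using that s_nth[of _ m] by (intro nth_equalityI) auto
  have gens: "s k \<in> refl ` PS J" for k
  proof -
    obtain m where m: "k < length (W m)" using unbounded by blast
    have "W m ! k \<in> refl ` PS J" using nth_mem[OF m] W(1)[of m] unfolding good_def by blast
    then show ?thesis by (simp only: s_nth[OF m])
  qed
  \<comment> \<open>Prefixes of reduced words are reduced: a shorter prefix product, completed by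
    the remaining letters, would make \<open>X m\<close> shorter than \<open>W m\<close>.\<close>
  have len: "card (Inv J (prefix_prod s p)) = p" for p
  proof -
    obtain m where m: "p < length (W m)" using unbounded by blast
    have e: "prefix_prod s p = word_prod (take p (W m))" unfolding prefix_prod_def using take[of p m] m by simp
    have sets: "set (take p (W m)) \<subseteq> refl ` PS J" "set (drop p (W m)) \<subseteq> refl ` PS J"
      using W(1)[of m] set_take_subset[of p "W m"] set_drop_subset[of p "W m"] by (auto simp: good_def)
    have le: "card (Inv J (prefix_prod s p)) \<le> p" unfolding e using card_Inv_word[OF assms(1) sets(1)] m by simp
    have "X m = prefix_prod s p \<circ> word_prod (drop p (W m))"
      unfolding e word_prod_append[symmetric] append_take_drop_id using W(1)[of m] by (simp add: good_def)
    then have "card (Inv J (X m)) \<le> card (Inv J (prefix_prod s p)) + (length (W m) - p)"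
      using card_Inv_comp_le[OF assms(1) prefix_AW[OF assms(1) gens, where p = p] sets(2)] by simp
    then show ?thesis using le W(1)[of m] m by (simp add: good_def)
  qed
  have s: "s \<in> inf_words D J" using gens len by (simp add: inf_words_iff[OF assms(1)])
  have full: "prefix_prod s (length (W m)) = X m" for m
    unfolding prefix_prod_def using take[of "length (W m)" m] W(1)[of m] by (simp add: good_def)
  have "word_inversions D J s = (\<Union>n. Inv J (X n))"
    unfolding word_inversions_eq[OF assms(1) s]
  proof
    show "(\<Union>n. Inv J (X n)) \<subseteq> (\<Union>p. Inv J (prefix_prod s p))" unfolding full[symmetric] by blast
    have "Inv J (prefix_prod s p) \<subseteq> (\<Union>n. Inv J (X n))" for p
    proof -
      obtain m where "p < length (W m)" using unbounded by blast
      then have "Inv J (prefix_prod s p) \<subseteq> Inv J (X m)"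
        using prefix_mono[OF assms(1) s, of p "length (W m)"] full[of m] by simp
      then show ?thesis by blast
    qed
    then show "(\<Union>p. Inv J (prefix_prod s p)) \<subseteq> (\<Union>n. Inv J (X n))" by blast
  qed
  then show thesis using that s by blast
qed

lemma nabla_set_word:
  assumes "K \<subset> J" "J \<subseteq> I" "u \<in> MR J K" "y \<in> AW K"
  obtains s where "s \<in> inf_words D J" "word_inversions D J s = nabla_set J K u y"
proof -
  have KJ: "K \<subseteq> J" using assms by blast
  obtain X where X: "\<And>n. X n \<in> AW J" "\<And>n. Inv J (X n) \<subseteq> Inv J (X (Suc n))"
    "(\<Union>n. Inv J (X n)) = nabla_set J K u y"
    using nabla_set_chain[OF KJ assms(2-4)] by blast
  show thesis
    using chain_word[where X = X, OF assms(2) X(1,2)] nabla_set_infinite[OF assms(1-3)] that unfolding X(3) by blast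
qed

section \<open>The action on infinite words\<close>

lemma word_equiv_equiv:
  assumes "J \<subseteq> I"
  shows "equiv (inf_words D J) (word_equiv D J)"
proof -
  have sub: "word_equiv D J \<subseteq> inf_words D J \<times> inf_words D J" by (auto simp: word_equiv_def)
  have iff: "(s, s') \<in> word_equiv D J \<longleftrightarrow> s \<in> inf_words D J \<and> s' \<in> inf_words D J \<and>
    word_inversions D J s = word_inversions D J s'" for s s'
    using word_equiv_iff[OF assms, of s s'] sub by blast
  show ?thesis
    unfolding equiv_def refl_on_def sym_def trans_def iff using sub by blast
qed

lemma inf_weyl_D:
  assumes "J \<subseteq> I" "Y \<in> inf_weyl D J" "s \<in> Y"
  shows "s \<in> inf_words D J" "inf_inversions D J Y = word_inversions D J s"
    "s' \<in> inf_words D J \<Longrightarrow> word_inversions D J s' = word_inversions D J s \<Longrightarrow> s' \<in> Y"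
proof -
  note eq = word_equiv_equiv[OF assms(1)]
  obtain r where r: "r \<in> inf_words D J" "Y = word_equiv D J `` {r}"
    using assms(2) by (auto simp: inf_weyl_def elim: quotientE)
  have YD: "v \<in> Y \<longleftrightarrow> v \<in> inf_words D J \<and> word_inversions D J v = word_inversions D J r" for v
    using r word_equiv_iff[OF assms(1) r(1), of v] by (auto simp: word_equiv_def)
  show "s \<in> inf_words D J" using YD assms(3) by blast
  have "word_inversions D J ` Y = {word_inversions D J s}"
    using YD assms(3) by (auto simp: image_iff)
  then show "inf_inversions D J Y = word_inversions D J s" by (simp add: inf_inversions_def)
  show "s' \<in> Y" if "s' \<in> inf_words D J" "word_inversions D J s' = word_inversions D J s"
    using YD assms(3) that by simp
qed

lemma inf_weyl_nonempty: "J \<subseteq> I \<Longrightarrow> Y \<in> inf_weyl D J \<Longrightarrow> \<exists>s. s \<in> Y"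
  using in_quotient_imp_non_empty[OF word_equiv_equiv, of J Y] unfolding inf_weyl_def by blast

lemma inf_weyl_class:
  assumes "J \<subseteq> I" "s \<in> inf_words D J"
  obtains Y where "Y \<in> inf_weyl D J" "s \<in> Y"
  using quotientI[OF assms(2)] equiv_class_self[OF word_equiv_equiv[OF assms(1)] assms(2)]
  unfolding inf_weyl_def by blast

lemma inf_inversions_inj: "J \<subseteq> I \<Longrightarrow> inj_on (inf_inversions D J) (inf_weyl D J)"
proof (rule inj_onI)
  fix Y Y' assume J: "J \<subseteq> I" and Y: "Y \<in> inf_weyl D J" "Y' \<in> inf_weyl D J"
    and eq: "inf_inversions D J Y = inf_inversions D J Y'"
  obtain s s' where s: "s \<in> Y" "s' \<in> Y'" using inf_weyl_nonempty[OF J] Y by blast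
  have "s' \<in> Y"
    using inf_weyl_D[OF J Y(1) s(1)] inf_weyl_D[OF J Y(2) s(2)] eq by metis
  then show "Y = Y'"
    using quotient_disj[OF word_equiv_equiv[OF J], of Y Y'] Y s(2) unfolding inf_weyl_def by blast
qed

lemma inf_biconvex_sets_eq:
  "J \<subseteq> I \<Longrightarrow> inf_biconvex_sets D J = {B. real_biconvex J B \<and> infinite B}"
  unfolding inf_biconvex_sets_def using real_biconvex_iff[of J] by blast

lemma nabla_set_class:
  assumes "K \<subset> J" "J \<subseteq> I" "u \<in> MR J K" "y \<in> AW K"
  obtains Y where "Y \<in> inf_weyl D J" "inf_inversions D J Y = nabla_set J K u y"
proof -
  obtain s where s: "s \<in> inf_words D J" "word_inversions D J s = nabla_set J K u y"
    using nabla_set_word[OF assms] by blast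
  obtain Y where "Y \<in> inf_weyl D J" "s \<in> Y" using inf_weyl_class[OF assms(2) s(1)] by blast
  then show thesis using that inf_weyl_D(2)[OF assms(2)] s(2) by metis
qed

lemma inf_inversions_mem:
  assumes "J \<subseteq> I" "Y \<in> inf_weyl D J"
  shows "inf_inversions D J Y \<in> inf_biconvex_sets D J"
proof -
  obtain s where s: "s \<in> Y" using inf_weyl_nonempty[OF assms] by blast
  then show ?thesis
    using inf_weyl_D[OF assms s] word_inversions_real_biconvex[OF assms(1)] by (simp add: inf_biconvex_sets_eq[OF assms(1)])
qed

lemma inf_inversions_bij:
  assumes "J \<subseteq> I"
  shows "bij_betw (inf_inversions D J) (inf_weyl D J) (inf_biconvex_sets D J)"
  unfolding bij_betw_def
proof
  show "inj_on (inf_inversions D J) (inf_weyl D J)" by (rule inf_inversions_inj[OF assms])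
  show "inf_inversions D J ` inf_weyl D J = inf_biconvex_sets D J"
  proof
    show "inf_inversions D J ` inf_weyl D J \<subseteq> inf_biconvex_sets D J" using inf_inversions_mem[OF assms] by blast
    show "inf_biconvex_sets D J \<subseteq> inf_inversions D J ` inf_weyl D J"
    proof
      fix B assume "B \<in> inf_biconvex_sets D J"
      then have B: "real_biconvex J B" "infinite B" by (auto simp: inf_biconvex_sets_eq[OF assms])
      obtain K u y where K: "K \<subset> J" "u \<in> MR J K" "y \<in> AW K" "B = nabla_set J K u y"
        using infinite_real_biconvex_nabla_set[OF assms B] by blast
      obtain Y where "Y \<in> inf_weyl D J" "inf_inversions D J Y = B"
        using nabla_set_class[OF K(1) assms K(2,3)] K(4) by blast
      then show "B \<in> inf_inversions D J ` inf_weyl D J" by blast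
    qed
  qed
qed

lemma id_MR: "K \<subseteq> J \<Longrightarrow> J \<subseteq> I \<Longrightarrow> id \<in> MR J K"
  unfolding min_reps_eq using fin_weyl_id[of J] by auto

lemma par_diff_neg_id:
  assumes "K \<subseteq> J" "J \<subseteq> I"
  shows "par_diff_neg D J K id = nabla_set J K id id"
  unfolding par_diff_neg_eq[OF assms fin_weyl_id] nabla_set_def by (auto simp: PR_def)

text \<open>This is the value \<nabla>(K, 1, 1). Existence comes from its realisation by a word,
  uniqueness from the injectivity of \<Phi> on classes.\<close>

lemma Z_elem:
  assumes "K \<subset> J" "J \<subseteq> I"
  shows "Z_elem D J K \<in> inf_weyl D J" "inf_inversions D J (Z_elem D J K) = nabla_set J K id id"
proof -
  have KJ: "K \<subseteq> J" using assms by blast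
  obtain Y where Y: "Y \<in> inf_weyl D J" "inf_inversions D J Y = nabla_set J K id id"
    using nabla_set_class[OF assms id_MR[OF KJ assms(2)] AW_id] by blast
  have "Z_elem D J K = Y"
    unfolding Z_elem_def par_diff_neg_id[OF KJ assms(2)]
    using Y inf_inversions_inj[OF assms(2)] by (intro the_equality) (auto dest: inj_onD)
  with Y show "Z_elem D J K \<in> inf_weyl D J" "inf_inversions D J (Z_elem D J K) = nabla_set J K id id" by auto
qed

section \<open>Finite parts of affine Weyl group elements\<close>

lemma refl_R_fin_weyl:
  assumes "J \<subseteq> I" "\<epsilon> \<in> R J"
  shows "refl \<epsilon> \<in> fin_weyl D J"
proof -
  obtain w j where w: "\<epsilon> = w (\<alpha> j)" "w \<in> fin_weyl D J" "j \<in> J"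
    using assms(2) by (auto simp: fin_roots_def)
  have "refl \<epsilon> = w \<circ> refl (\<alpha> j) \<circ> inv w"
    using isom_refl_conj[OF fin_weyl_isom[OF assms(1) w(2)]] w(1) by simp
  moreover have "j \<le> rk D" using w(3) assms(1) by auto
  ultimately show ?thesis using w fin_weyl_inv[OF assms(1) w(2)] by (metis fin_weyl_comp refl_in_fin_weyl)
qed

text \<open>Modulo \<delta>, the reflection in an affine root acts as the reflection in its finite
  part.\<close>

lemma AW_fin_decomp:
  assumes "J \<subseteq> I" "x \<in> AW J"
  obtains w where "w \<in> fin_weyl D J" "\<And>v. v \<in> Q \<Longrightarrow> \<exists>a. x v = w v + a *\<^sub>R \<delta>"
proof -
  have "\<exists>w\<in>fin_weyl D J. \<forall>v\<in>Q. \<exists>a. x v = w v + a *\<^sub>R \<delta>"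
    using assms(2,1)
  proof (induction rule: AW_induct)
    case id
    show ?case by (intro bexI[of _ id] fin_weyl_id ballI exI[of _ 0]) simp
  next
    case (step \<gamma> x)
    then obtain w where w: "w \<in> fin_weyl D J" "\<forall>v\<in>Q. \<exists>a. x v = w v + a *\<^sub>R \<delta>" by blast
    have f: "fp \<gamma> \<in> R J" "\<gamma> \<in> Q" using PR_D(3,5)[OF assms(1) Pi_PR[OF assms(1) step(1)]] by auto
    have r: "refl (fp \<gamma>) \<in> fin_weyl D J" by (rule refl_R_fin_weyl[OF assms(1) f(1)])
    have rw: "refl (fp \<gamma>) \<circ> w \<in> fin_weyl D J" by (rule fin_weyl_comp[OF r w(1)])
    have "\<exists>a. (refl \<gamma> \<circ> x) v = (refl (fp \<gamma>) \<circ> w) v + a *\<^sub>R \<delta>" if v: "v \<in> Q" for v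
    proof -
      obtain a where a: "x v = w v + a *\<^sub>R \<delta>" using w(2) v by blast
      define v' where "v' = w v"
      have v'Q: "v' \<in> Q" unfolding v'_def by (rule isom_Q[OF fin_weyl_isom[OF assms(1) w(1)] v])
      define c where "c = 2 * b \<gamma> v' / b \<gamma> \<gamma>"
      have n: "b (fp \<gamma>) (fp \<gamma>) = b \<gamma> \<gamma>" by (rule b_fp[OF f(2) f(2)])
      have "b (fp \<gamma>) v' = b \<gamma> v'" by (simp add: fp_def b_simps b_\<delta> v'Q)
      then have r1: "refl (fp \<gamma>) v' = v' - c *\<^sub>R fp \<gamma>" by (simp add: refl_def n c_def)
      have r2: "refl \<gamma> (v' + a *\<^sub>R \<delta>) = v' + a *\<^sub>R \<delta> - c *\<^sub>R \<gamma>"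
        by (simp add: refl_def b_simps b_\<delta> f(2) c_def)
      have "refl \<gamma> (v' + a *\<^sub>R \<delta>) = refl (fp \<gamma>) v' + (a - c * cf 0 \<gamma>) *\<^sub>R \<delta>"
        unfolding r1 r2 by (simp add: fp_def algebra_simps)
      then show ?thesis using a by (auto simp: v'_def)
    qed
    then show ?case using rw by blast
  qed
  then show thesis using that by blast
qed

lemma fin_part_eq:
  assumes "J \<subseteq> I" "x \<in> AW J" "w \<in> fin_weyl D J" "\<And>v. v \<in> Q \<Longrightarrow> \<exists>a. x v = w v + a *\<^sub>R \<delta>"
  shows "fin_part D x = w"
  unfolding fin_part_def
proof (rule the_equality)
  have wI: "w \<in> fin_weyl D I" using fin_weyl_mono[OF assms(1) order_refl] assms(3) by blast
  have iw: "isom w" by (rule fin_weyl_isom[OF order_refl wI])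
  have trans: "translation_group D = {t \<in> AW I. \<forall>\<mu>\<in>Q. \<exists>a. t \<mu> = \<mu> - a *\<^sub>R \<delta>}"
    unfolding translation_group_def weyl_eq null_root_eq atLeast0AtMost ..
  define t where "t = inv w \<circ> x"
  have "t \<in> AW I"
    unfolding t_def
    using AW_comp[OF AW_inv[OF order_refl fin_weyl_AW[OF order_refl wI]]] AW_mono[OF assms(1) order_refl] assms(2)
    by blast
  moreover have "\<exists>a. t \<mu> = \<mu> - a *\<^sub>R \<delta>" if m: "\<mu> \<in> Q" for \<mu>
  proof -
    obtain a where "x \<mu> = w \<mu> + a *\<^sub>R \<delta>" using assms(4)[OF m] by blast
    then have "t \<mu> = \<mu> - (- a) *\<^sub>R \<delta>"
      by (simp add: t_def isom_D[OF isom_inv[OF iw]] isom_D(10)[OF iw])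
    then show ?thesis by blast
  qed
  ultimately have "t \<in> translation_group D" by (simp add: trans)
  moreover have "x = w \<circ> t" using isom_D(11)[OF iw] by (simp add: t_def fun_eq_iff)
  ultimately show "w \<in> fin_weyl D {1..rk D} \<and> (\<exists>t\<in>translation_group D. x = w \<circ> t)" using wI by blast
  fix w' assume "w' \<in> fin_weyl D {1..rk D} \<and> (\<exists>t\<in>translation_group D. x = w' \<circ> t)"
  then obtain t' where w': "w' \<in> fin_weyl D I" "t' \<in> translation_group D" "x = w' \<circ> t'" by blast
  have iw': "isom w'" by (rule fin_weyl_isom[OF order_refl w'(1)])
  define e where "e = inv w' \<circ> w"
  have eI: "e \<in> fin_weyl D I" unfolding e_def by (intro fin_weyl_comp fin_weyl_inv wI w'(1) order_refl)
  \<comment> \<open>Both candidates agree with \<open>x\<close> modulo \<delta>, and finite roots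
    have \<delta>-coefficient 0, so the multiple of \<delta> vanishes.\<close>
  have "e \<epsilon> = \<epsilon>" if \<epsilon>: "\<epsilon> \<in> R I" for \<epsilon>
  proof -
    have \<epsilon>Q: "\<epsilon> \<in> Q" by (rule R_Q[OF order_refl \<epsilon>])
    obtain a where a: "x \<epsilon> = w \<epsilon> + a *\<^sub>R \<delta>" using assms(4)[OF \<epsilon>Q] by blast
    obtain a' where a': "t' \<epsilon> = \<epsilon> - a' *\<^sub>R \<delta>" using w'(2) \<epsilon>Q by (auto simp: trans)
    have "w \<epsilon> = w' \<epsilon> - (a' + a) *\<^sub>R \<delta>"
      using a a' w'(3) by (simp add: isom_D[OF iw'] algebra_simps)
    then have e: "e \<epsilon> = \<epsilon> - (a' + a) *\<^sub>R \<delta>"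
      by (simp add: e_def isom_D[OF isom_inv[OF iw']] isom_D(10)[OF iw'])
    moreover have "cf 0 (e \<epsilon>) = 0" "cf 0 \<epsilon> = 0"
      using cf0_R[OF order_refl] fin_weyl_R[OF eI \<epsilon>] \<epsilon> by auto
    ultimately have "a' + a = 0" by (simp add: cf_simps cf_\<delta> mk_0)
    then show ?thesis using e by simp
  qed
  then have "e = id" by (intro fin_weyl_pos_id[OF order_refl eI]) simp
  then have "w' (inv w' (w v)) = w' v" for v by (metis comp_apply e_def id_apply)
  then show "w' = w" using isom_D(11)[OF iw'] by (simp add: fun_eq_iff)
qed

lemma outer_ht_fin_weyl:
  assumes "K \<subseteq> J" "J \<subseteq> I" "v \<in> fin_weyl D K"
  shows "outer_ht J K (v \<eta>) = outer_ht J K \<eta>"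
proof -
  have K: "K \<subseteq> {..rk D}" using assms by auto
  have J: "j \<le> rk D" if "j \<in> J" for j using that assms(2) by auto
  from assms(3) K show ?thesis
  proof (induction rule: fin_weyl_induct)
    case (step k w)
    have "cf j (refl (\<alpha> k) (w \<eta>)) = cf j (w \<eta>)" if "j \<in> J - K" for j
      using that J step(1) K by (auto simp: refl_def cf_simps cf_root)
    then have "outer_ht J K (refl (\<alpha> k) (w \<eta>)) = outer_ht J K (w \<eta>)" unfolding outer_ht_def by (intro sum.cong) auto
    then show ?case using step by simp
  qed simp
qed

lemma real_biconvex_restrict:
  assumes "K \<subseteq> J" "J \<subseteq> I" "real_biconvex J B"
  shows "real_biconvex K (B \<inter> PR K)"
proof -
  have KI: "K \<subseteq> I" using assms by blast
  have sub: "PA K \<subseteq> PA J" using PR_mono[OF assms(1,2)] by blast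
  have BP: "B \<subseteq> PR J" by (rule real_biconvex_D(1)[OF assms(3)])
  have out: "\<beta> \<notin> B" if "\<beta> \<in> PA K - B \<inter> PR K" for \<beta>
    using that BP PR_PI_disjoint[OF assms(2)] by blast
  show ?thesis unfolding real_biconvex_def
  proof (intro conjI ballI impI)
    fix \<beta> \<gamma> assume "\<beta> \<in> B \<inter> PR K" "\<gamma> \<in> B \<inter> PR K" and s: "\<beta> + \<gamma> \<in> PA K"
    then have "\<beta> + \<gamma> \<in> B" using sub by (intro real_biconvex_D(2)[OF assms(3)]) auto
    then show "\<beta> + \<gamma> \<in> B \<inter> PR K" using s BP PR_PI_disjoint[OF assms(2)] by blast
  next
    fix \<beta> \<gamma> assume b: "\<beta> \<in> PA K - B \<inter> PR K" and c: "\<gamma> \<in> PA K - B \<inter> PR K"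
    have "\<beta> + \<gamma> \<notin> B" using out[OF b] out[OF c] b c sub by (intro real_biconvex_D(3)[OF assms(3)]) auto
    then show "\<beta> + \<gamma> \<notin> B \<inter> PR K" by blast
  qed auto
qed

text \<open>Restricting an inversion set to the roots of \<open>K\<close> leaves a finite biconvex
  set, which is again an inversion set.\<close>

lemma fin_factor_exists:
  assumes "K \<subseteq> J" "J \<subseteq> I" "x \<in> AW J"
  shows "\<exists>z\<in>AW K. Inv K z = Inv J x \<inter> PR K"
  using finite_real_biconvex[OF subset_trans[OF assms(1,2)]] real_biconvex_restrict[OF assms(1,2) real_biconvex_Inv[OF assms(2,3)]]
    finite_Inv[OF assms(2,3)] by blast

text \<open>A root \<open>\<beta>\<close> with \<open>\<gamma> = x\<^sup>-\<^sup>1 \<beta>\<close> is eventually inverted along \<open>x s\<close> iff \<open>\<gamma>\<close> is a positive root in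
  \<open>\<Phi>(s)\<close>, or \<open>\<gamma>\<close> is negative and \<open>- \<gamma> \<notin> \<Phi>(s)\<close>.\<close>

lemma shifted_inversions_eq:
  assumes "K \<subset> J" "J \<subseteq> I" "x \<in> AW J" "w \<in> fin_weyl D J"
    and xw: "\<And>v. v \<in> Q \<Longrightarrow> \<exists>a. x v = w v + a *\<^sub>R \<delta>"
    and "u \<in> MR J K" "v \<in> fin_weyl D K" "w = u \<circ> v"
    and "z \<in> AW K" "Inv K z = Inv J (inv u \<circ> x) \<inter> PR K"
    and s: "s \<in> inf_words D J" "word_inversions D J s = nabla_set J K id id"
  shows "shifted_inversions D J x s = nabla_set J K u z"
proof -
  have KJ: "K \<subseteq> J" and KI: "K \<subseteq> I" using assms(1,2) by auto
  have uw: "u \<in> fin_weyl D J" by (rule MR_D[OF assms(6)])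
  have ix: "isom x" by (rule isom_AW[OF assms(2,3)])
  have iw: "isom w" and iu: "isom u" using fin_weyl_isom[OF assms(2)] assms(4) uw by auto
  have iv: "isom v" by (rule fin_weyl_isom[OF KI assms(7)])
  \<comment> \<open>Modulo \<delta> the inverse of \<open>x\<close> acts as the inverse of u v, and
    \<open>v\<close> leaves \<open>outer_ht\<close> unchanged.\<close>
  have lex_ht: "outer_ht J K (fp (inv x \<beta>)) = lex_ht J K u \<beta>" if \<beta>: "\<beta> \<in> RT J" for \<beta>
  proof -
    have \<gamma>: "inv x \<beta> \<in> RT J" by (rule AW_RT[OF assms(2) AW_inv[OF assms(2,3)] \<beta>])
    obtain a where a: "x (inv x \<beta>) = w (inv x \<beta>) + a *\<^sub>R \<delta>" using xw RT_Q[OF assms(2) \<gamma>] by blast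
    then have "w (inv x \<beta>) = \<beta> - a *\<^sub>R \<delta>" using isom_D(11)[OF ix] by (metis add_diff_cancel_right')
    then have "fp (w (inv x \<beta>)) = fp \<beta>" by (simp add: fp_simps)
    then have "w (fp (inv x \<beta>)) = fp \<beta>" using fin_weyl_fp(1)[OF assms(2,4) \<gamma>] by simp
    then have "v (fp (inv x \<beta>)) = inv u (fp \<beta>)"
      using assms(8) isom_D(10)[OF iu] by (metis comp_apply)
    then show ?thesis using outer_ht_fin_weyl[OF KJ assms(2,7), of "fp (inv x \<beta>)"] by (simp add: lex_ht_def)
  qed
  let ?z = "prefix_prod s"
  have zA: "?z p \<in> AW J" for p by (rule inf_words_D(1)[OF assms(2) s(1)])
  have B: "\<gamma> \<in> (\<Union>p. Inv J (?z p)) \<longleftrightarrow> outer_ht J K (fp \<gamma>) < 0" if "\<gamma> \<in> PR J" for \<gamma>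
    using s(2) that PR_D(2)[OF assms(2) that]
    unfolding word_inversions_eq[OF assms(2) s(1)] by (simp add: nabla_set_def lex_ht_def)
  have mono: "Inv J (?z p) \<subseteq> Inv J (?z q)" if "p \<le> q" for p q by (rule prefix_mono[OF assms(2) s(1) that])
  have ev_pos: "(\<exists>p0. \<forall>p\<ge>p0. ht (inv (?z p) \<gamma>) < 0) \<longleftrightarrow> outer_ht J K (fp \<gamma>) < 0" if \<gamma>: "\<gamma> \<in> PR J" for \<gamma>
  proof -
    have "ht (inv (?z p) \<gamma>) < 0 \<longleftrightarrow> \<gamma> \<in> Inv J (?z p)" for p using \<gamma> by (simp add: Inv_def)
    moreover have "(\<exists>p0. \<forall>p\<ge>p0. \<gamma> \<in> Inv J (?z p)) \<longleftrightarrow> \<gamma> \<in> (\<Union>p. Inv J (?z p))"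
      using mono by blast
    ultimately show ?thesis unfolding B[OF \<gamma>, symmetric] by simp
  qed
  \<comment> \<open>The inversion sets of the prefixes increase, so being eventually outside them is
    the same as never entering.\<close>
  have ev_neg: "(\<exists>p0. \<forall>p\<ge>p0. ht (inv (?z p) \<gamma>) < 0) \<longleftrightarrow> \<not> outer_ht J K (fp (- \<gamma>)) < 0"
    if \<gamma>: "- \<gamma> \<in> PR J" for \<gamma>
  proof -
    have iff: "ht (inv (?z p) \<gamma>) < 0 \<longleftrightarrow> - \<gamma> \<notin> Inv J (?z p)" for p
    proof -
      have "ht (inv (?z p) (- \<gamma>)) \<noteq> 0"
        by (rule RT_ht(2)[OF assms(2) AW_RT[OF assms(2) AW_inv[OF assms(2) zA] PR_D(1)[OF assms(2) \<gamma>]]])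
      then show ?thesis
        using \<gamma> by (auto simp: Inv_def isom_D(8)[OF isom_inv[OF isom_AW[OF assms(2) zA]]] ht_simps)
    qed
    have "(\<exists>p0. \<forall>p\<ge>p0. - \<gamma> \<notin> Inv J (?z p)) \<longleftrightarrow> - \<gamma> \<notin> (\<Union>p. Inv J (?z p))"
    proof
      assume "\<exists>p0. \<forall>p\<ge>p0. - \<gamma> \<notin> Inv J (?z p)"
      then obtain p0 where p0: "\<forall>p\<ge>p0. - \<gamma> \<notin> Inv J (?z p)" by blast
      have "- \<gamma> \<notin> Inv J (?z p)" for p
        using p0 mono[of p "max p p0"] by (meson max.cobounded1 max.cobounded2 subsetD)
      then show "- \<gamma> \<notin> (\<Union>p. Inv J (?z p))" by blast
    qed blast
    then show ?thesis unfolding B[OF \<gamma>] iff .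
  qed
  have mem: "\<beta> \<in> shifted_inversions D J x s \<longleftrightarrow>
      lex_ht J K u \<beta> < 0 \<or> (lex_ht J K u \<beta> = 0 \<and> ht (inv x \<beta>) < 0)" if \<beta>: "\<beta> \<in> PR J" for \<beta>
  proof -
    have \<beta>R: "\<beta> \<in> RT J" by (rule PR_D(1)[OF assms(2) \<beta>])
    have \<gamma>: "inv x \<beta> \<in> RT J" by (rule AW_RT[OF assms(2) AW_inv[OF assms(2,3)] \<beta>R])
    have inv: "inv (x \<circ> ?z p) \<beta> = inv (?z p) (inv x \<beta>)" for p
      using o_inv_distrib[OF isom_D(2)[OF ix] isom_D(2)[OF isom_AW[OF assms(2) zA]]] by simp
    have "inv (?z p) (inv x \<beta>) \<in> RT J" for p by (rule AW_RT[OF assms(2) AW_inv[OF assms(2) zA] \<gamma>])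
    then have neg: "inv (x \<circ> ?z p) \<beta> \<in> neg_roots D \<longleftrightarrow> ht (inv (?z p) (inv x \<beta>)) < 0" for p
      unfolding inv using neg_roots_iff[OF RT_all[OF assms(2)]] by blast
    have sh: "\<beta> \<in> shifted_inversions D J x s \<longleftrightarrow> (\<exists>p0. \<forall>p\<ge>p0. ht (inv (?z p) (inv x \<beta>)) < 0)"
      using \<beta> by (simp add: shifted_inversions_def par_re_pos_eq[OF assms(2)] neg)
    have lm: "outer_ht J K (fp (- inv x \<beta>)) = - lex_ht J K u \<beta>"
      using lex_ht[OF RT_minus[OF assms(2) \<beta>R]] lex_ht_minus[OF assms(2) iu]
      by (simp add: isom_D(8)[OF isom_inv[OF ix]])
    show ?thesis
    proof (cases "0 < ht (inv x \<beta>)")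
      case True
      then have "inv x \<beta> \<in> PR J" using \<gamma> by (simp add: PR_def)
      then show ?thesis using ev_pos sh lex_ht[OF \<beta>R] True by simp
    next
      case False
      then have n: "ht (inv x \<beta>) < 0" using RT_ht(2)[OF assms(2) \<gamma>] by simp
      then have "- inv x \<beta> \<in> PR J" using RT_minus[OF assms(2) \<gamma>] by (simp add: PR_def ht_simps)
      then show ?thesis using ev_neg[of "inv x \<beta>"] sh lm n by auto
    qed
  qed
  \<comment> \<open>On this level set the inverse of \<open>u\<close> lands in the positive roots of
    \<open>K\<close>, where the defining property of \<open>z\<close> compares the two
    signs.\<close>
  have zero: "ht (inv x \<beta>) < 0 \<longleftrightarrow> ht (inv z (inv u \<beta>)) < 0" if \<beta>: "\<beta> \<in> PR J" "lex_ht J K u \<beta> = 0" for \<beta>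
  proof -
    have \<rho>: "inv u \<beta> \<in> PR K" by (rule inv_u_RT_K[OF KJ assms(2,6) \<beta>])
    then have "inv u \<beta> \<in> PR J" using PR_mono[OF KJ assms(2)] by blast
    have "inv (inv u \<circ> x) = inv x \<circ> inv (inv u)"
      using isom_D(2)[OF ix] isom_D(2)[OF isom_inv[OF iu]] by (intro o_inv_distrib)
    then have e: "inv (inv u \<circ> x) (inv u \<beta>) = inv x \<beta>"
      by (simp add: inv_inv_eq[OF isom_D(2)[OF iu]] isom_D(11)[OF iu])
    have "inv u \<beta> \<in> Inv K z \<longleftrightarrow> ht (inv x \<beta>) < 0"
      unfolding assms(10) using \<rho> \<open>inv u \<beta> \<in> PR J\<close> e by (simp add: Inv_def)
    then show ?thesis using \<rho> by (simp add: Inv_def)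
  qed
  show ?thesis
  proof (intro set_eqI)
    fix \<beta>
    show "\<beta> \<in> shifted_inversions D J x s \<longleftrightarrow> \<beta> \<in> nabla_set J K u z"
    proof (cases "\<beta> \<in> PR J")
      case True
      then show ?thesis using mem[OF True] zero[OF True] by (auto simp: nabla_set_def)
    next
      case False
      then show ?thesis by (simp add: nabla_set_def shifted_inversions_def par_re_pos_eq[OF assms(2)])
    qed
  qed
qed

text \<open>The description of the action has a value because the shifted inversion set is a
  \<nabla>, hence realised by a class, and the class is determined by its inversions.\<close>

lemma inf_action_Z:
  assumes "K \<subset> J" "J \<subseteq> I" "x \<in> AW J" "w \<in> fin_weyl D J"
    and xw: "\<And>v. v \<in> Q \<Longrightarrow> \<exists>a. x v = w v + a *\<^sub>R \<delta>"
    and "u \<in> MR J K" "v \<in> fin_weyl D K" "w = u \<circ> v"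
    and "z \<in> AW K" "Inv K z = Inv J (inv u \<circ> x) \<inter> PR K"
  shows "inf_action D J x (Z_elem D J K) \<in> inf_weyl D J"
    "inf_inversions D J (inf_action D J x (Z_elem D J K)) = nabla_set J K u z"
proof -
  have Z: "Z_elem D J K \<in> inf_weyl D J" "inf_inversions D J (Z_elem D J K) = nabla_set J K id id"
    using Z_elem[OF assms(1,2)] by auto
  have sh: "shifted_inversions D J x s = nabla_set J K u z" if "s \<in> Z_elem D J K" for s
    using inf_weyl_D(1,2)[OF assms(2) Z(1) that] Z(2)
    by (intro shifted_inversions_eq[OF assms]) auto
  obtain Y where Y: "Y \<in> inf_weyl D J" "inf_inversions D J Y = nabla_set J K u z"
    using nabla_set_class[OF assms(1,2,6,9)] by blast
  have "inf_action D J x (Z_elem D J K) = Y"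
    unfolding inf_action_def
  proof (rule the_equality)
    obtain s r where sr: "s \<in> Z_elem D J K" "r \<in> Y" using inf_weyl_nonempty[OF assms(2)] Z(1) Y(1) by blast
    then show "Y \<in> inf_weyl D J \<and> (\<exists>s\<in>Z_elem D J K. \<exists>s'\<in>Y. shifted_inversions D J x s = word_inversions D J s')"
      using Y sh inf_weyl_D(2)[OF assms(2) Y(1) sr(2)] by auto
    fix Y' assume Y': "Y' \<in> inf_weyl D J \<and> (\<exists>s\<in>Z_elem D J K. \<exists>s'\<in>Y'. shifted_inversions D J x s = word_inversions D J s')"
    then obtain s s' where "s \<in> Z_elem D J K" "s' \<in> Y'" "shifted_inversions D J x s = word_inversions D J s'" by blast
    then have "inf_inversions D J Y' = nabla_set J K u z" using sh inf_weyl_D(2)[OF assms(2)] Y' by metis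
    then show "Y' = Y" using Y Y' inf_inversions_inj[OF assms(2)] by (metis inj_onD)
  qed
  with Y show "inf_action D J x (Z_elem D J K) \<in> inf_weyl D J"
    "inf_inversions D J (inf_action D J x (Z_elem D J K)) = nabla_set J K u z" by auto
qed

lemma inversion_set_inter:
  assumes "K \<subseteq> J" "J \<subseteq> I" "x \<in> AW J"
  shows "inversion_set D J x \<inter> par_pos D K = Inv J x \<inter> PR K"
proof -
  have "x \<in> AW I" using AW_mono[OF assms(2) order_refl] assms(3) by blast
  moreover have "\<beta> \<notin> PI" if "\<beta> \<in> Inv J x" for \<beta> using that PR_PI_disjoint[OF assms(2)] by (auto simp: Inv_def)
  ultimately show ?thesis
    unfolding inversion_set_eq[OF assms(2) \<open>x \<in> AW I\<close>] par_pos_eq[OF subset_trans[OF assms(1,2)]] by blast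
qed

lemma inversion_set_K: "K \<subseteq> I \<Longrightarrow> z \<in> AW K \<Longrightarrow> inversion_set D K z = Inv K z"
  using inversion_set_eq[of K z] AW_mono[OF _ order_refl, of K] by blast

lemma action_Z_nabla:
  assumes "J \<subseteq> I" "x \<in> AW J" "K \<subset> J"
  defines "u \<equiv> min_rep D J K (fin_part D x)"
  shows "\<exists>!z. z \<in> AW K \<and> inversion_set D J (inv u \<circ> x) \<inter> par_pos D K = inversion_set D K z" (is "\<exists>!z. ?z z")
    and "z \<in> AW K \<Longrightarrow> inversion_set D J (inv u \<circ> x) \<inter> par_pos D K = inversion_set D K z \<Longrightarrow>
      inf_action D J x (Z_elem D J K) \<in> inf_weyl D J \<and> u \<in> MR J K \<and>
      inf_inversions D J (inf_action D J x (Z_elem D J K)) = nabla D J (K, u, z)"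
proof -
  have KJ: "K \<subseteq> J" and KI: "K \<subseteq> I" using assms(1,3) by auto
  obtain w where w: "w \<in> fin_weyl D J" "\<And>v. v \<in> Q \<Longrightarrow> \<exists>a. x v = w v + a *\<^sub>R \<delta>"
    using AW_fin_decomp[OF assms(1,2)] by blast
  obtain u' v where uv: "u' \<in> MR J K" "v \<in> fin_weyl D K" "w = u' \<circ> v"
    using min_rep_exists[OF KJ assms(1) w(1)] by blast
  have "fin_part D x = u' \<circ> v" unfolding uv(3)[symmetric] by (rule fin_part_eq[OF assms(1,2) w])
  then have u: "u = u'" using min_rep_eq[OF KJ assms(1) uv(1,2)] unfolding u_def by metis
  have uA: "u \<in> AW J" using fin_weyl_AW[OF assms(1) MR_D[OF uv(1)]] u by simp
  have ux: "inv u \<circ> x \<in> AW J" by (intro AW_comp AW_inv assms(1,2) uA)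
  have eq: "inversion_set D J (inv u \<circ> x) \<inter> par_pos D K = inversion_set D K z \<longleftrightarrow>
      Inv K z = Inv J (inv u \<circ> x) \<inter> PR K" if "z \<in> AW K" for z
    unfolding inversion_set_inter[OF KJ assms(1) ux] inversion_set_K[OF KI that] by blast
  obtain z0 where "z0 \<in> AW K" "Inv K z0 = Inv J (inv u \<circ> x) \<inter> PR K"
    using fin_factor_exists[OF KJ assms(1) ux] by blast
  then show "\<exists>!z. ?z z" using eq Inv_inj[OF KI] by metis
  assume z: "z \<in> AW K" "inversion_set D J (inv u \<circ> x) \<inter> par_pos D K = inversion_set D K z"
  then have Iz: "Inv K z = Inv J (inv u' \<circ> x) \<inter> PR K" using eq u by blast
  show "inf_action D J x (Z_elem D J K) \<in> inf_weyl D J \<and> u \<in> MR J K \<and>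
      inf_inversions D J (inf_action D J x (Z_elem D J K)) = nabla D J (K, u, z)"
    using inf_action_Z[OF assms(3,1,2) w uv z(1) Iz] nabla_eq[OF KJ assms(1) uv(1) z(1)] uv(1) u by simp
qed

text \<open>For x = u y the finite part is u v with \<open>v\<close> in the Weyl group of
  \<open>K\<close>, so the minimal representative is \<open>u\<close>; and the roots of
  \<open>K\<close> inverted by \<open>y\<close> are those in its inversion set for \<open>K\<close>,
  so the second factor is \<open>y\<close>.\<close>

lemma chi_eq:
  assumes "J \<subseteq> I" "K \<subset> J" "u \<in> MR J K" "y \<in> AW K"
  shows "chi D J (K, u, y) \<in> inf_weyl D J" "inf_inversions D J (chi D J (K, u, y)) = nabla_set J K u y"
proof -
  have KJ: "K \<subseteq> J" and KI: "K \<subseteq> I" using assms(1,2) by auto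
  have uw: "u \<in> fin_weyl D J" by (rule MR_D[OF assms(3)])
  have iu: "isom u" by (rule fin_weyl_isom[OF assms(1) uw])
  have yJ: "y \<in> AW J" using AW_mono[OF KJ assms(1)] assms(4) by blast
  have x: "u \<circ> y \<in> AW J" by (intro AW_comp fin_weyl_AW assms(1) uw yJ)
  obtain v where v: "v \<in> fin_weyl D K" "\<And>e. e \<in> Q \<Longrightarrow> \<exists>a. y e = v e + a *\<^sub>R \<delta>"
    using AW_fin_decomp[OF KI assms(4)] by blast
  have w: "u \<circ> v \<in> fin_weyl D J" using fin_weyl_comp[OF uw] fin_weyl_mono[OF KJ assms(1)] v(1) by blast
  have xw: "\<exists>a. (u \<circ> y) e = (u \<circ> v) e + a *\<^sub>R \<delta>" if "e \<in> Q" for e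
  proof -
    obtain a where "y e = v e + a *\<^sub>R \<delta>" using v(2) \<open>e \<in> Q\<close> by blast
    then have "(u \<circ> y) e = (u \<circ> v) e + a *\<^sub>R \<delta>" by (simp add: isom_D[OF iu])
    then show ?thesis by blast
  qed
  have "inv u \<circ> (u \<circ> y) = y" using isom_D(10)[OF iu] by (simp add: fun_eq_iff)
  moreover have "Inv J y \<inter> PR K = Inv K y" using PR_mono[OF KJ assms(1)] by (auto simp: Inv_def)
  ultimately have z: "Inv K y = Inv J (inv u \<circ> (u \<circ> y)) \<inter> PR K" by simp
  show "chi D J (K, u, y) \<in> inf_weyl D J" "inf_inversions D J (chi D J (K, u, y)) = nabla_set J K u y"
    using inf_action_Z[OF assms(2,1) x w xw assms(3) v(1) refl assms(4) z] by simp_all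
qed

section \<open>Bijectivity and orbits\<close>

lemma param_set_iff:
  "J \<subseteq> I \<Longrightarrow> (K, u, y) \<in> param_set D J \<longleftrightarrow> K \<subset> J \<and> u \<in> MR J K \<and> y \<in> AW K"
  using par_weyl_eq[of K] by (auto simp: param_set_def)

text \<open>Composed with the injective \<Phi> on classes, the map becomes \<nabla>, so injectivity
  and surjectivity are inherited from the injectivity and the classification for \<nabla>.\<close>

lemma chi_bij:
  assumes "J \<subseteq> I"
  shows "bij_betw (chi D J) (param_set D J) (inf_weyl D J)"
  unfolding bij_betw_def
proof
  note p = param_set_iff[OF assms]
  show "inj_on (chi D J) (param_set D J)"
  proof (rule inj_onI)
    fix P P' assume P: "P \<in> param_set D J" "P' \<in> param_set D J" "chi D J P = chi D J P'"
    obtain K u y K' u' y' where e: "P = (K, u, y)" "P' = (K', u', y')" by (metis prod_cases3)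
    have k: "K \<subset> J" "u \<in> MR J K" "y \<in> AW K" and k': "K' \<subset> J" "u' \<in> MR J K'" "y' \<in> AW K'"
      using P(1,2) unfolding e p by auto
    have "nabla_set J K u y = nabla_set J K' u' y'"
      using chi_eq(2)[OF assms k] chi_eq(2)[OF assms k'] P(3) unfolding e by metis
    then show "P = P'"
      unfolding e using nabla_set_inj[OF assms psubset_imp_subset[OF k(1)] k(2,3) psubset_imp_subset[OF k'(1)] k'(2,3)]
      by metis
  qed
  show "chi D J ` param_set D J = inf_weyl D J"
  proof
    show "chi D J ` param_set D J \<subseteq> inf_weyl D J" using chi_eq(1)[OF assms] p by auto
    show "inf_weyl D J \<subseteq> chi D J ` param_set D J"
    proof
      fix Y assume Y: "Y \<in> inf_weyl D J"
      then have "real_biconvex J (inf_inversions D J Y)" "infinite (inf_inversions D J Y)"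
        using inf_inversions_mem[OF assms] by (auto simp: inf_biconvex_sets_eq[OF assms])
      then obtain K u y where k: "K \<subset> J" "u \<in> MR J K" "y \<in> AW K" "inf_inversions D J Y = nabla_set J K u y"
        using infinite_real_biconvex_nabla_set[OF assms] by metis
      then have "Y = chi D J (K, u, y)"
        using chi_eq[OF assms k(1-3)] Y inf_inversions_inj[OF assms] by (metis inj_onD)
      then show "Y \<in> chi D J ` param_set D J" using k p by blast
    qed
  qed
qed

lemma action_Z_params:
  assumes "J \<subseteq> I" "K \<subset> J" "x \<in> AW J"
  obtains u z where "u \<in> MR J K" "z \<in> AW K" "inf_action D J x (Z_elem D J K) \<in> inf_weyl D J"
    "inf_inversions D J (inf_action D J x (Z_elem D J K)) = nabla_set J K u z"
  using action_Z_nabla[OF assms(1,3,2)] nabla_eq[OF psubset_imp_subset[OF assms(2)] assms(1)] by metis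

text \<open>Every value of \<open>chi\<close> lies in an orbit, so its surjectivity gives the union;
  the orbits are disjoint because a set \<nabla>(K, u, z) determines \<open>K\<close>.\<close>

lemma orbit_decomposition:
  assumes "J \<subseteq> I"
  shows "inf_weyl D J = (\<Union>K\<in>{K. K \<subset> J}. Z_orbit D J K)"
    "disjoint_family_on (Z_orbit D J) {K. K \<subset> J}"
proof -
  have orb: "Z_orbit D J K = {inf_action D J x (Z_elem D J K) | x. x \<in> AW J}" for K
    unfolding Z_orbit_def par_weyl_eq[OF assms] ..
  show "inf_weyl D J = (\<Union>K\<in>{K. K \<subset> J}. Z_orbit D J K)"
  proof
    show "(\<Union>K\<in>{K. K \<subset> J}. Z_orbit D J K) \<subseteq> inf_weyl D J"
    proof
      fix Y assume "Y \<in> (\<Union>K\<in>{K. K \<subset> J}. Z_orbit D J K)"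
      then obtain K x where "K \<subset> J" "x \<in> AW J" "Y = inf_action D J x (Z_elem D J K)" unfolding orb by blast
      then show "Y \<in> inf_weyl D J" using action_Z_params[OF assms] by metis
    qed
    show "inf_weyl D J \<subseteq> (\<Union>K\<in>{K. K \<subset> J}. Z_orbit D J K)"
    proof
      fix Y assume "Y \<in> inf_weyl D J"
      then obtain P where "P \<in> param_set D J" "Y = chi D J P"
        using bij_betw_imp_surj_on[OF chi_bij[OF assms]] by blast
      then obtain K u y where k: "K \<subset> J" "u \<in> MR J K" "y \<in> AW K" "Y = chi D J (K, u, y)"
        using param_set_iff[OF assms] by (metis prod_cases3)
      have "u \<circ> y \<in> AW J"
        using AW_comp fin_weyl_AW[OF assms MR_D[OF k(2)]] AW_mono[OF psubset_imp_subset[OF k(1)] assms] k(3) by blast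
      then show "Y \<in> (\<Union>K\<in>{K. K \<subset> J}. Z_orbit D J K)" using k unfolding orb by auto
    qed
  qed
  show "disjoint_family_on (Z_orbit D J) {K. K \<subset> J}"
    unfolding disjoint_family_on_def
  proof (intro ballI impI)
    fix K K' assume K: "K \<in> {K. K \<subset> J}" "K' \<in> {K. K \<subset> J}" "K \<noteq> K'"
    show "Z_orbit D J K \<inter> Z_orbit D J K' = {}"
    proof (rule ccontr)
      assume "\<not> ?thesis"
      then obtain x x' where x: "x \<in> AW J" "x' \<in> AW J"
        and e: "inf_action D J x (Z_elem D J K) = inf_action D J x' (Z_elem D J K')"
        unfolding orb by blast
      have k: "K \<subset> J" "K' \<subset> J" using K by auto
      obtain u z where uz: "u \<in> MR J K" "z \<in> AW K"
        "inf_inversions D J (inf_action D J x (Z_elem D J K)) = nabla_set J K u z"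
        using action_Z_params[OF assms k(1) x(1)] by metis
      obtain u' z' where uz': "u' \<in> MR J K'" "z' \<in> AW K'"
        "inf_inversions D J (inf_action D J x' (Z_elem D J K')) = nabla_set J K' u' z'"
        using action_Z_params[OF assms k(2) x(2)] by metis
      have "nabla_set J K u z = nabla_set J K' u' z'" using uz(3) uz'(3) e by simp
      then show False
        using nabla_set_inj(1)[OF assms psubset_imp_subset[OF k(1)] uz(1,2) psubset_imp_subset[OF k(2)] uz'(1,2)] K(3)
        by blast
    qed
  qed
qed

end

section \<open>The realization\<close>

text \<open>Writing \<open>x = (a\<^sub>i y\<^sub>i)\<close> for a positive vector \<open>a\<close> in the kernel turns the quadratic form into the
  sum of the nonnegative terms \<open>- B\<^sub>i\<^sub>j a\<^sub>i a\<^sub>j (y\<^sub>i - y\<^sub>j)\<^sup>2 / 2\<close>.\<close>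

lemma kernel_sum_of_squares:
  fixes B :: "'i \<Rightarrow> 'i \<Rightarrow> real"
  assumes sym: "\<And>i j. i \<in> S \<Longrightarrow> j \<in> S \<Longrightarrow> B i j = B j i"
    and ker: "\<And>i. i \<in> S \<Longrightarrow> (\<Sum>j\<in>S. B i j * a j) = 0"
  shows "2 * (\<Sum>i\<in>S. \<Sum>j\<in>S. B i j * (a i * y i) * (a j * y j)) =
    (\<Sum>i\<in>S. \<Sum>j\<in>S. - (B i j * a i * a j * (y i - y j)\<^sup>2))"
proof -
  have row: "(\<Sum>j\<in>S. B i j * a i * a j * (y i)\<^sup>2) = 0" if "i \<in> S" for i
  proof -
    have "(\<Sum>j\<in>S. B i j * a i * a j * (y i)\<^sup>2) = a i * (y i)\<^sup>2 * (\<Sum>j\<in>S. B i j * a j)"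
      by (simp add: sum_distrib_left algebra_simps)
    then show ?thesis using ker[OF that] by simp
  qed
  have rows: "(\<Sum>i\<in>S. \<Sum>j\<in>S. B i j * a i * a j * (y i)\<^sup>2) = 0"
    using row by (simp add: sum.neutral)
  have "(\<Sum>i\<in>S. \<Sum>j\<in>S. B i j * a i * a j * (y j)\<^sup>2) = (\<Sum>j\<in>S. \<Sum>i\<in>S. B i j * a i * a j * (y j)\<^sup>2)"
    by (rule sum.swap)
  also have "\<dots> = (\<Sum>j\<in>S. \<Sum>i\<in>S. B j i * a j * a i * (y j)\<^sup>2)"
    by (intro sum.cong refl) (simp add: sym mult.commute mult.left_commute)
  finally have cols: "(\<Sum>i\<in>S. \<Sum>j\<in>S. B i j * a i * a j * (y j)\<^sup>2) = 0" using rows by simp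
  have "(\<Sum>i\<in>S. \<Sum>j\<in>S. - (B i j * a i * a j * (y i - y j)\<^sup>2)) =
    (\<Sum>i\<in>S. \<Sum>j\<in>S. 2 * (B i j * (a i * y i) * (a j * y j)) - B i j * a i * a j * (y i)\<^sup>2 - B i j * a i * a j * (y j)\<^sup>2)"
    by (intro sum.cong refl) (simp add: power2_eq_square algebra_simps)
  also have "\<dots> = 2 * (\<Sum>i\<in>S. \<Sum>j\<in>S. B i j * (a i * y i) * (a j * y j)) - 0 - 0"
    unfolding sum_subtractf rows cols sum_distrib_left ..
  finally show ?thesis by simp
qed

lemma realization_affine_roots:
  fixes D :: "'v::real_vector affine_datum"
  assumes gcm: "untwisted_affine_gcm X (rk D) A" and real: "realization_of A D"
  shows "\<exists>b cf mk. affine_roots D b cf mk"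
proof -
  define l where "l = rk D"
  define \<alpha> where "\<alpha> = sroot D"
  define sc where "sc = scoroot D"
  let ?M = "affine_cartan_matrix X l"
  obtain \<pi> where adm: "admissible_rank X l" and \<pi>: "\<pi> permutes {1..l}"
    and A: "\<And>i j. i \<le> l \<Longrightarrow> j \<le> l \<Longrightarrow> A i j = ?M (\<pi> i) (\<pi> j)"
    using gcm unfolding untwisted_affine_gcm_def l_def by blast
  have l1: "1 \<le> l" using adm by (cases X) auto
  have \<pi>0: "\<pi> 0 = 0" using permutes_not_in[OF \<pi>] by simp
  have \<pi>le: "\<pi> permutes {..l}" using permutes_subset[OF \<pi>] by (simp add: subset_iff)
  have \<pi>l: "\<pi> i \<le> l" if "i \<le> l" for i using permutes_in_image[OF \<pi>le, of i] that by simp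
  obtain a c where "affine_marks l ?M a c" using affine_marks_exist[OF adm] by blast
  then have ac: "a 0 = 1" "c 0 = 1" "\<And>i. i \<le> l \<Longrightarrow> 0 < c i" "\<And>i. i \<le> l \<Longrightarrow> c i \<le> a i"
    "\<And>i. i \<le> l \<Longrightarrow> (\<Sum>j\<le>l. ?M i j * a j) = 0"
    "\<And>i j. i \<le> l \<Longrightarrow> j \<le> l \<Longrightarrow> c i * ?M i j * a j = c j * ?M j i * a i"
    by (auto simp: affine_marks_def)
  define mk where "mk i = a (\<pi> i)" for i
  define ck where "ck i = c (\<pi> i)" for i
  define d where "d i = real_of_int (ck i) / real_of_int (mk i)" for i
  define B where "B i j = d i * real_of_int (A i j)" for i j
  have mk: "0 < mk i" "0 < ck i" "ck i \<le> mk i" if "i \<le> l" for i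
    using ac(3,4)[OF \<pi>l[OF that]] by (auto simp: mk_def ck_def)
  have d: "0 < d i" "d i \<le> 1" if "i \<le> l" for i using mk[OF that] by (auto simp: d_def)
  have d0: "d 0 = 1" "mk 0 = 1" using ac(1,2) by (auto simp: d_def mk_def ck_def \<pi>0)
  have A_diag: "A i i = 2" if "i \<le> l" for i using A[OF that that] by simp
  have A_nonpos: "A i j \<le> 0" if "i \<le> l" "j \<le> l" "i \<noteq> j" for i j
    using A[OF that(1,2)] affine_cartan_matrix_nonpos[of "\<pi> i" "\<pi> j" X l] that(3)
      permutes_inj[OF \<pi>] by (auto dest: injD)
  have A_row: "(\<Sum>j\<le>l. A i j * mk j) = 0" if "i \<le> l" for i
  proof -
    have "(\<Sum>j\<le>l. A i j * mk j) = (\<Sum>j\<le>l. ?M (\<pi> i) (\<pi> j) * a (\<pi> j))"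
      using that by (intro sum.cong) (auto simp: A mk_def)
    also have "\<dots> = (\<Sum>j\<le>l. ?M (\<pi> i) j * a j)"
      by (rule sum.permute[OF \<pi>le, of "\<lambda>j. ?M (\<pi> i) j * a j", symmetric, unfolded comp_def])
    finally show ?thesis using ac(5)[OF \<pi>l[OF that]] by simp
  qed
  have B_sym: "B i j = B j i" if "i \<le> l" "j \<le> l" for i j
  proof -
    have "ck i * A i j * mk j = ck j * A j i * mk i"
      using ac(6)[OF \<pi>l[OF that(1)] \<pi>l[OF that(2)]] that by (simp add: A mk_def ck_def)
    then have "real_of_int (ck i * A i j * mk j) = real_of_int (ck j * A j i * mk i)" by simp
    then show ?thesis using mk(1)[OF that(1)] mk(1)[OF that(2)] by (simp add: B_def d_def field_simps)
  qed
  have B_row: "(\<Sum>j\<le>l. B i j * real_of_int (mk j)) = 0" if "i \<le> l" for i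
  proof -
    have "(\<Sum>j\<le>l. B i j * real_of_int (mk j)) = d i * real_of_int (\<Sum>j\<le>l. A i j * mk j)"
      by (simp add: B_def sum_distrib_left mult.assoc)
    then show ?thesis using A_row[OF that] by simp
  qed
  have B_nonpos: "B i j \<le> 0" if "i \<le> l" "j \<le> l" "i \<noteq> j" for i j
    using d(1)[OF that(1)] A_nonpos[OF that] by (simp add: B_def mult_nonneg_nonpos)
  have inj: "inj_on \<alpha> {..l}" and ind: "independent (\<alpha> ` {..l})"
    and sc_lin: "\<And>i. i \<le> l \<Longrightarrow> linear (sc i)"
    and sc: "\<And>i j. i \<le> l \<Longrightarrow> j \<le> l \<Longrightarrow> sc i (\<alpha> j) = real_of_int (A i j)"
    using real unfolding realization_of_def l_def \<alpha>_def sc_def atLeast0AtMost by auto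
  have "\<exists>f. linear f \<and> (\<forall>j\<le>l. f (\<alpha> j) = (if i = j then 1 else 0 :: real))" if "i \<le> l" for i
  proof -
    obtain f :: "'v \<Rightarrow> real" where "linear f" "\<forall>v\<in>\<alpha> ` {..l}. f v = (if v = \<alpha> i then 1 else 0)"
      using linear_independent_extend[OF ind, of "\<lambda>v. if v = \<alpha> i then 1 else 0"] by blast
    then show ?thesis using inj that by (intro exI[of _ f]) (auto dest: inj_onD)
  qed
  then obtain cf where cf: "\<And>i. i \<le> l \<Longrightarrow> linear (cf i)"
    "\<And>i j. i \<le> l \<Longrightarrow> j \<le> l \<Longrightarrow> cf i (\<alpha> j) = (if i = j then 1 else 0 :: real)"
    by metis
  \<comment> \<open>On the root span each of the two halves of the first sum is already the intended
    form, so the second sum removes one copy. The correction makes pairing with \<alpha> k equal to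
    the rescaled coroot \<open>d k * sc k w\<close> on the whole space, whichever extension
    \<open>cf\<close> was chosen.\<close>
  define b where "b v w = (\<Sum>i\<le>l. d i * (cf i v * sc i w + cf i w * sc i v))
    - (\<Sum>i\<le>l. \<Sum>j\<le>l. B i j * cf i v * cf j w)" for v w
  have b_sym: "b v w = b w v" for v w
  proof -
    have "(\<Sum>i\<le>l. \<Sum>j\<le>l. B i j * cf i v * cf j w) = (\<Sum>j\<le>l. \<Sum>i\<le>l. B i j * cf i v * cf j w)"
      by (rule sum.swap)
    also have "\<dots> = (\<Sum>j\<le>l. \<Sum>i\<le>l. B j i * cf j w * cf i v)"
      by (intro sum.cong refl) (simp add: B_sym)
    finally show ?thesis by (simp add: b_def add.commute)
  qed
  have b_lin: "linear (b v)" for v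
  proof (rule linearI)
    have "linear (sc i)" "linear (cf i)" if "i \<le> l" for i using that sc_lin cf by auto
    then have s: "sc i (w + w') = sc i w + sc i w'" "cf i (w + w') = cf i w + cf i w'"
      "sc i (r *\<^sub>R w) = r * sc i w" "cf i (r *\<^sub>R w) = r * cf i w" if "i \<le> l" for i w w' r
      using that by (auto simp: linear_add linear_scale)
    fix w w' r
    have "b v (w + w') = (\<Sum>i\<le>l. d i * (cf i v * sc i w + cf i w * sc i v) + d i * (cf i v * sc i w' + cf i w' * sc i v))
      - (\<Sum>i\<le>l. \<Sum>j\<le>l. B i j * cf i v * cf j w + B i j * cf i v * cf j w')"
      unfolding b_def using s by (intro arg_cong2[where f = minus] sum.cong refl) (auto simp: algebra_simps)
    then show "b v (w + w') = b v w + b v w'" by (simp add: b_def sum.distrib)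
    have "b v (r *\<^sub>R w) = (\<Sum>i\<le>l. r * (d i * (cf i v * sc i w + cf i w * sc i v)))
      - (\<Sum>i\<le>l. \<Sum>j\<le>l. r * (B i j * cf i v * cf j w))"
      unfolding b_def using s by (intro arg_cong2[where f = minus] sum.cong refl) (auto simp: algebra_simps)
    then show "b v (r *\<^sub>R w) = r *\<^sub>R b v w" by (simp add: b_def sum_distrib_left right_diff_distrib)
  qed
  have b_root: "b (\<alpha> k) w = d k * sc k w" if k: "k \<le> l" for k w
  proof -
    have 1: "(\<Sum>i\<le>l. d i * (cf i (\<alpha> k) * sc i w + cf i w * sc i (\<alpha> k))) =
      (\<Sum>i\<le>l. (if i = k then d k * sc k w else 0) + B i k * cf i w)"
      using k by (intro sum.cong refl) (auto simp: cf sc B_def algebra_simps)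
    have 2: "(\<Sum>i\<le>l. \<Sum>j\<le>l. B i j * cf i (\<alpha> k) * cf j w) = (\<Sum>i\<le>l. if i = k then (\<Sum>j\<le>l. B k j * cf j w) else 0)"
      using k by (intro sum.cong refl) (auto simp: cf)
    have 3: "(\<Sum>i\<le>l. B i k * cf i w) = (\<Sum>j\<le>l. B k j * cf j w)"
      using k by (intro sum.cong refl) (simp add: B_sym)
    show ?thesis unfolding b_def 1 2 using k 3 by (simp add: sum.distrib)
  qed
  have b_roots: "b (\<alpha> i) (\<alpha> j) = B i j" if "i \<le> l" "j \<le> l" for i j
    using that by (simp add: b_root sc B_def)
  have norm: "b (\<alpha> i) (\<alpha> i) = 2 * d i" if "i \<le> l" for i
    using that by (simp add: b_roots B_def A_diag)
  have connected_diagram: "\<exists>i\<in>{1..l} - S. \<exists>j\<in>S. B i j \<noteq> 0" if S: "S \<subseteq> {1..l}" "S \<noteq> {}" "S \<noteq> {1..l}" for S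
  proof -
    have "\<pi> ` S \<subseteq> {1..l}" using S(1) permutes_image[OF \<pi>] by blast
    moreover have "\<pi> ` S \<noteq> {}" using S(2) by blast
    moreover have "\<pi> ` S \<noteq> {1..l}"
      using S(1,3) permutes_image[OF \<pi>] permutes_inj[OF \<pi>] by (metis inj_image_eq_iff)
    ultimately have "\<exists>i'\<in>{1..l} - \<pi> ` S. \<exists>j'\<in>\<pi> ` S. ?M i' j' \<noteq> 0"
      by (rule affine_cartan_matrix_connected[OF adm])
    then obtain i' j' where ij: "i' \<in> {1..l} - \<pi> ` S" "j' \<in> \<pi> ` S" "?M i' j' \<noteq> 0" by blast
    obtain i where i: "i' = \<pi> i" "i \<in> {1..l}" using ij(1) permutes_image[OF \<pi>] by (metis DiffD1 imageE)
    obtain j where j: "j' = \<pi> j" "j \<in> S" using ij(2) by blast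
    have le: "i \<le> l" "j \<le> l" using i j S(1) by auto
    then have "B i j \<noteq> 0" using ij(3) i j d(1)[OF le(1)] by (simp add: B_def A)
    then show ?thesis using i j ij(1) by blast
  qed
  have pos_def: "0 < b v v" if v: "v \<in> span (\<alpha> ` {1..l})" "v \<noteq> 0" for v
  proof -
    obtain r where "v = (\<Sum>u\<in>\<alpha> ` {1..l}. r u *\<^sub>R u)" using v(1) by (auto simp: span_finite)
    moreover have "inj_on \<alpha> {1..l}" using inj by (rule inj_on_subset) auto
    ultimately have vr: "v = (\<Sum>i\<in>{1..l}. r (\<alpha> i) *\<^sub>R \<alpha> i)" by (simp add: sum.reindex)
    \<comment> \<open>The vector is placed on the affine diagram with value 0 at vertex 0. A
      vanishing norm makes \<open>y\<close> constant along edges, and connectedness spreads the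
      value 0 to all vertices.\<close>
    define y where "y i = (if i = 0 then 0 else r (\<alpha> i) / real_of_int (mk i))" for i
    have my: "real_of_int (mk i) * y i = (if i = 0 then 0 else r (\<alpha> i))" if "i \<le> l" for i
      using mk(1)[OF that] by (simp add: y_def)
    have vy: "v = (\<Sum>i\<le>l. (real_of_int (mk i) * y i) *\<^sub>R \<alpha> i)"
    proof -
      have "(\<Sum>i\<le>l. (real_of_int (mk i) * y i) *\<^sub>R \<alpha> i) = (\<Sum>i\<in>{1..l}. (real_of_int (mk i) * y i) *\<^sub>R \<alpha> i)"
        using my[of 0] by (intro sum.mono_neutral_right) (auto simp: not_less_eq_eq Suc_le_eq)
      also have "\<dots> = v" unfolding vr using my by (intro sum.cong) auto
      finally show ?thesis by simp
    qed
    have lin1: "linear (\<lambda>u. b u w)" for w using b_lin[of w] b_sym[of _ w] by (simp add: linear_iff)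
    have "b v v = (\<Sum>i\<le>l. \<Sum>j\<le>l. b ((real_of_int (mk i) * y i) *\<^sub>R \<alpha> i) ((real_of_int (mk j) * y j) *\<^sub>R \<alpha> j))"
      unfolding vy linear_sum[OF lin1] linear_sum[OF b_lin] by (rule sum.swap)
    also have "\<dots> = (\<Sum>i\<le>l. \<Sum>j\<le>l. B i j * (real_of_int (mk i) * y i) * (real_of_int (mk j) * y j))"
      by (intro sum.cong refl) (simp add: linear_scale[OF lin1] linear_scale[OF b_lin] b_roots)
    finally have bvv: "2 * b v v = (\<Sum>i\<le>l. \<Sum>j\<le>l. - (B i j * real_of_int (mk i) * real_of_int (mk j) * (y i - y j)\<^sup>2))"
      using kernel_sum_of_squares[of "{..l}" B "\<lambda>i. real_of_int (mk i)" y] B_sym B_row by simp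
    have summand: "0 \<le> - (B i j * real_of_int (mk i) * real_of_int (mk j) * (y i - y j)\<^sup>2)" if "i \<le> l" "j \<le> l" for i j
    proof (cases "i = j")
      case False
      have "0 \<le> real_of_int (mk i) * real_of_int (mk j) * (y i - y j)\<^sup>2"
        using mk(1)[OF that(1)] mk(1)[OF that(2)] by (intro mult_nonneg_nonneg) auto
      then have "B i j * (real_of_int (mk i) * real_of_int (mk j) * (y i - y j)\<^sup>2) \<le> 0"
        using B_nonpos[OF that False] by (rule mult_nonpos_nonneg[rotated])
      then show ?thesis by (simp add: mult.assoc)
    qed simp
    have nonneg: "0 \<le> 2 * b v v" unfolding bvv using summand by (intro sum_nonneg) auto
    moreover have "b v v \<noteq> 0"
    proof
      assume "b v v = 0"
      then have z0: "(\<Sum>i\<le>l. \<Sum>j\<le>l. - (B i j * real_of_int (mk i) * real_of_int (mk j) * (y i - y j)\<^sup>2)) = 0"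
        using bvv by simp
      have z: "- (B i j * real_of_int (mk i) * real_of_int (mk j) * (y i - y j)\<^sup>2) = 0" if ij: "i \<le> l" "j \<le> l" for i j
      proof -
        have "(\<Sum>j\<le>l. - (B i j * real_of_int (mk i) * real_of_int (mk j) * (y i - y j)\<^sup>2)) = 0"
          using z0 ij summand by (subst (asm) sum_nonneg_eq_0_iff) (auto intro!: sum_nonneg)
        then show ?thesis using ij summand by (subst (asm) sum_nonneg_eq_0_iff) auto
      qed
      have adj: "y i = y j" if "i \<le> l" "j \<le> l" "B i j \<noteq> 0" for i j
        using z[OF that(1,2)] that mk(1)[OF that(1)] mk(1)[OF that(2)] by auto
      define T where "T = {i \<in> {1..l}. y i = 0}"
      have "\<exists>j\<in>{1..l}. B 0 j \<noteq> 0"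
      proof (rule ccontr)
        assume "\<not> ?thesis"
        then have "(\<Sum>j\<le>l. B 0 j * real_of_int (mk j)) = (\<Sum>j\<in>{0}. B 0 j * real_of_int (mk j))"
          by (intro sum.mono_neutral_right) (auto simp: not_less_eq_eq Suc_le_eq)
        then show False using B_row[of 0] d0 by (simp add: B_def A_diag)
      qed
      then obtain j where j: "j \<in> {1..l}" "B 0 j \<noteq> 0" by blast
      have "y 0 = 0" by (simp add: y_def)
      then have "j \<in> T" using adj[of 0 j] j by (simp add: T_def)
      moreover have "T \<subseteq> {1..l}" by (auto simp: T_def)
      moreover have "False" if ik: "i \<in> {1..l} - T" "k \<in> T" "B i k \<noteq> 0" for i k
        using adj[of i k] ik by (auto simp: T_def)
      ultimately have "T = {1..l}" using connected_diagram[of T] by blast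
      then have T: "i \<in> T" if "i \<in> {1..l}" for i using that by blast
      have "y i = 0" if "i \<le> l" for i
      proof (cases "i = 0")
        case False
        then have "i \<in> T" using T[of i] that by simp
        then show ?thesis by (simp add: T_def)
      qed (simp add: \<open>y 0 = 0\<close>)
      then have "v = 0" unfolding vy by (intro sum.neutral) auto
      then show False using v(2) by simp
    qed
    ultimately show ?thesis by simp
  qed
  have "affine_roots D b cf mk"
  proof (rule affine_roots.intro, fold l_def \<alpha>_def sc_def)
    show "1 \<le> l" by (rule l1)
    show "bilinear b" unfolding bilinear_def using b_lin b_sym by (auto simp: linear_iff)
    show "b u v = b v u" for u v by (rule b_sym)
    show "linear (cf i)" if "i \<le> l" for i using cf that by blast
    show "cf i (\<alpha> j) = (if i = j then 1 else 0)" if "i \<le> l" "j \<le> l" for i j using cf that by blast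
    show "2 * b (\<alpha> i) v = b (\<alpha> i) (\<alpha> i) * sc i v" if "i \<le> l" for i v
      using norm[OF that] b_root[OF that, of v] by simp
    show "0 < b (\<alpha> i) (\<alpha> i)" if "i \<le> l" for i using norm[OF that] d(1)[OF that] by simp
    show "sc i (\<alpha> j) \<in> \<int>" if "i \<le> l" "j \<le> l" for i j using sc that by simp
    show "sc i (\<alpha> j) \<le> 0" if "i \<le> l" "j \<le> l" "i \<noteq> j" for i j using sc that A_nonpos[OF that] by simp
    show "0 < b v v" if "v \<in> span (\<alpha> ` {1..l})" "v \<noteq> 0" for v using pos_def that by blast
    show "mk 0 = 1" by (rule d0)
    show "0 < mk i" if "i \<le> l" for i using mk that by blast
    show "b (\<Sum>j\<le>l. of_int (mk j) *\<^sub>R \<alpha> j) (\<alpha> i) = 0" if "i \<le> l" for i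
    proof -
      have "b (\<alpha> i) (\<Sum>j\<le>l. of_int (mk j) *\<^sub>R \<alpha> j) = (\<Sum>j\<le>l. B i j * real_of_int (mk j))"
        unfolding linear_sum[OF b_lin] using that
        by (intro sum.cong refl) (simp add: linear_scale[OF b_lin] b_roots)
      then show ?thesis using B_row[OF that] b_sym by simp
    qed
    show "of_int (mk i) * b (\<alpha> i) (\<alpha> i) / b (\<alpha> 0) (\<alpha> 0) \<in> \<int>" if "i \<le> l" for i
    proof -
      have "of_int (mk i) * b (\<alpha> i) (\<alpha> i) / b (\<alpha> 0) (\<alpha> 0) = real_of_int (ck i)"
        using norm[OF that] norm[of 0] d0 mk(1)[OF that] by (simp add: d_def)
      then show ?thesis by simp
    qed
    show "b (\<alpha> i) (\<alpha> i) \<le> b (\<alpha> 0) (\<alpha> 0)" if "i \<le> l" for i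
      using norm[OF that] norm[of 0] d0 d(2)[OF that] by simp
    show "\<exists>i\<in>{1..l} - S. \<exists>j\<in>S. b (\<alpha> i) (\<alpha> j) \<noteq> 0" if S: "S \<subseteq> {1..l}" "S \<noteq> {}" "S \<noteq> {1..l}" for S
    proof -
      obtain i j where ij: "i \<in> {1..l} - S" "j \<in> S" "B i j \<noteq> 0" using connected_diagram[OF S] by blast
      then have "i \<le> l" "j \<le> l" using S(1) by auto
      then have "b (\<alpha> i) (\<alpha> j) \<noteq> 0" using ij(3) b_roots by simp
      then show ?thesis using ij by blast
    qed
  qed
  then show ?thesis by blast
qed

theorem theorem7p4:
  fixes X :: cartan_type
    and A :: "nat \<Rightarrow> nat \<Rightarrow> int"
    and D :: "'v::real_vector affine_datum"
    and J :: "nat set"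
  assumes "untwisted_affine_gcm X (rk D) A"
    and "realization_of A D"
    and "J \<subseteq> {1..rk D}"
    and "J \<noteq> {}"
  shows
    "(\<forall>x\<in>par_weyl D J. \<forall>K. K \<subset> J \<longrightarrow>
       (let u = min_rep D J K (fin_part D x);
            is_z = (\<lambda>z. z \<in> par_weyl D K \<and>
                     inversion_set D J (inv u \<circ> x) \<inter> par_pos D K = inversion_set D K z)
        in (\<exists>!z. is_z z) \<and>
           (\<forall>z. is_z z \<longrightarrow>
              inf_inversions D J (inf_action D J x (Z_elem D J K)) = nabla D J (K, u, z)))) \<and>
     (bij_betw (inf_inversions D J) (inf_weyl D J) (inf_biconvex_sets D J) \<and>
      bij_betw (chi D J) (param_set D J) (inf_weyl D J) \<and>
      (\<forall>P\<in>param_set D J. inf_inversions D J (chi D J P) = nabla D J P)) \<and>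
     (inf_weyl D J = (\<Union>K\<in>{K. K \<subset> J}. Z_orbit D J K) \<and>
      disjoint_family_on (Z_orbit D J) {K. K \<subset> J})"
proof -
  obtain b cf mk where "affine_roots D b cf mk"
    using realization_affine_roots[OF assms(1,2)] by blast
  then interpret affine_roots D b cf mk .
  note J = assms(3)
  have chi: "inf_inversions D J (chi D J P) = nabla D J P" if P: "P \<in> param_set D J" for P
  proof -
    obtain K u y where e: "P = (K, u, y)" by (metis prod_cases3)
    have k: "K \<subset> J" "u \<in> min_reps D J K" "y \<in> AW K"
      using P param_set_iff[OF J] unfolding e by auto
    show ?thesis
      unfolding e chi_eq(2)[OF J k] nabla_eq[OF psubset_imp_subset[OF k(1)] J k(2,3)] ..
  qed
  have 1: "let u = min_rep D J K (fin_part D x);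
            is_z = (\<lambda>z. z \<in> par_weyl D K \<and>
                     inversion_set D J (inv u \<circ> x) \<inter> par_pos D K = inversion_set D K z)
        in (\<exists>!z. is_z z) \<and>
           (\<forall>z. is_z z \<longrightarrow>
              inf_inversions D J (inf_action D J x (Z_elem D J K)) = nabla D J (K, u, z))"
    if x: "x \<in> par_weyl D J" and K: "K \<subset> J" for x K
  proof -
    have KI: "K \<subseteq> {1..rk D}" using K J by blast
    have xA: "x \<in> AW J" using x unfolding par_weyl_eq[OF J] .
    show ?thesis
      unfolding Let_def par_weyl_eq[OF KI] using action_Z_nabla[OF J xA K] by blast
  qed
  show ?thesis
    using 1 chi inf_inversions_bij[OF J] chi_bij[OF J] orbit_decomposition[OF J] by blast
qed

end
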